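(* Let $L/K$ be a finite Galois extension of number fields and let $G=\mathrm{Gal}(L/K)$. Let $\mathcal{H}$ be a set of subgroups of $G$ and $a_H\in\mathbb{Q}$ ($H\in\mathcal{H}$) such that $0=\sum_{H\in\mathcal{H}}a_H\,\mathrm{Ind}_H^G\mathbf{1}_H$ as class functions on $G$ (a Brauer relation). Then $\sum_{H\in\mathcal{H}}a_H\,\delta(L^H,p)=0$ for every prime number $p$.
   Context: $\mathbf{1}_H$ is the trivial character of $H$ and $\mathrm{Ind}_H^G$ denotes induction of characters; $L^H$ is the subfield of $L$ fixed by $H$. For a number field $F$ and prime $p$, with $S_p(F)$ the places above $p$ and $U^1_{F_w}$ the principal units of $F_w$, the diagonal embedding of units induces $\lambda_{F,p}:\mathbb{Z}_p\otimes_{\mathbb{Z}}\mathcal{O}_F^\times\to\prod_{w\in S_p(F)}U^1_{F_w}$; the Leopoldt defect $\delta(F,p)$ is the $\mathbb{Q}_p$-dimension of the kernel of $\mathbb{Q}_p\otimes_{\mathbb{Z}_p}\lambda_{F,p}$. *)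

theory Defs
  imports
    "HOL-Algebra.Algebra"
    "HOL-Algebra.Algebraic_Closure_Type"
    "Jordan_Normal_Form.Missing_VectorSpace"
begin

section \<open>Number fields and Galois groups\<close>

text \<open>
  Fields are subfields of an arbitrary ambient type of class \<^class>\<open>field_char_0\<close>; in this way
  the intermediate fields of \<open>L/K\<close> live on an equal footing with \<open>K\<close> and \<open>L\<close>.
  The type is not required to be algebraically closed, nor to be bigger than \<open>L\<close>.
\<close>

abbreviation ring_on :: "'a::field_char_0 set \<Rightarrow> 'a ring" where
  "ring_on F \<equiv> ring_of_type_algebra\<lparr>carrier := F\<rparr>"

abbreviation finite_extension :: "'a::field_char_0 set \<Rightarrow> 'a set \<Rightarrow> bool" where
  "finite_extension K L \<equiv> K \<subseteq> L \<and> ring.finite_dimension ring_of_type_algebra K L"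

definition number_field :: "'a::field_char_0 set \<Rightarrow> bool" where
  "number_field F \<longleftrightarrow> subfield F ring_of_type_algebra \<and> finite_extension \<rat> F"

definition galois_group :: "'a::field_char_0 set \<Rightarrow> 'a set \<Rightarrow> ('a \<Rightarrow> 'a) monoid" where
  "galois_group K L = (BijGroup L)
     \<lparr>carrier := {\<sigma> \<in> Bij L. \<sigma> \<in> ring_iso (ring_on L) (ring_on L) \<and> (\<forall>x\<in>K. \<sigma> x = x)}\<rparr>"

definition fixed_field :: "'a set \<Rightarrow> ('a \<Rightarrow> 'a) set \<Rightarrow> 'a set" where
  "fixed_field L H = {x \<in> L. \<forall>\<sigma>\<in>H. \<sigma> x = x}"

definition finite_galois_extension :: "'a::field_char_0 set \<Rightarrow> 'a set \<Rightarrow> bool" where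
  "finite_galois_extension K L \<longleftrightarrow>
     subfield K ring_of_type_algebra \<and> subfield L ring_of_type_algebra \<and>
     finite_extension K L \<and> fixed_field L (carrier (galois_group K L)) = K"

definition induced_character ::
    "('g, 'm) monoid_scheme \<Rightarrow> 'g set \<Rightarrow> ('g \<Rightarrow> complex) \<Rightarrow> 'g \<Rightarrow> complex" where
  "induced_character G H \<phi> g =
     (\<Sum>x \<in> {x \<in> carrier G. inv\<^bsub>G\<^esub> x \<otimes>\<^bsub>G\<^esub> g \<otimes>\<^bsub>G\<^esub> x \<in> H}. \<phi> (inv\<^bsub>G\<^esub> x \<otimes>\<^bsub>G\<^esub> g \<otimes>\<^bsub>G\<^esub> x)) / of_nat (card H)"

abbreviation trivial_character :: "'g \<Rightarrow> complex" where
  "trivial_character \<equiv> \<lambda>_. 1"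


section \<open>Places above a prime and completions\<close>

definition absolute_value_on :: "'a::field set \<Rightarrow> ('a \<Rightarrow> real) \<Rightarrow> bool" where
  "absolute_value_on F w \<longleftrightarrow>
     (\<forall>x\<in>F. 0 \<le> w x \<and> (w x = 0 \<longleftrightarrow> x = 0)) \<and>
     (\<forall>x\<in>F. \<forall>y\<in>F. w (x * y) = w x * w y \<and> w (x + y) \<le> w x + w y)"

definition padic_abs :: "nat \<Rightarrow> rat \<Rightarrow> real" where
  "padic_abs p q = (if q = 0 then 0 else
     real p powi (int (multiplicity (int p) (snd (quotient_of q)))
                - int (multiplicity (int p) (fst (quotient_of q)))))"

text \<open>
  A place of \<open>F\<close> above \<open>p\<close> is an equivalence class of absolute values restricting to the class of
  the \<open>p\<close>-adic one on the rationals. Every such class contains exactly one absolute value whose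
  restriction is the \<open>p\<close>-adic absolute value itself, and it is used to represent the class.
\<close>

definition places_above :: "nat \<Rightarrow> 'a::field_char_0 set \<Rightarrow> ('a \<Rightarrow> real) set" where
  "places_above p F =
     {w \<in> extensional F. absolute_value_on F w \<and> (\<forall>q. w (of_rat q) = padic_abs p q)}"

text \<open>The completion: Cauchy sequences modulo null sequences.\<close>

definition cauchy_seqs :: "'a::field set \<Rightarrow> ('a \<Rightarrow> real) \<Rightarrow> (nat \<Rightarrow> 'a) set" where
  "cauchy_seqs F w = {s. range s \<subseteq> F \<and> (\<forall>e>0. \<exists>N. \<forall>m\<ge>N. \<forall>n\<ge>N. w (s m - s n) < e)}"

definition null_seqs :: "'a::field set \<Rightarrow> ('a \<Rightarrow> real) \<Rightarrow> (nat \<Rightarrow> 'a) set" where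
  "null_seqs F w = {s. range s \<subseteq> F \<and> (\<lambda>n. w (s n)) \<longlonglongrightarrow> 0}"

definition cauchy_ring :: "'a::field set \<Rightarrow> ('a \<Rightarrow> real) \<Rightarrow> (nat \<Rightarrow> 'a) ring" where
  "cauchy_ring F w = \<lparr>carrier = cauchy_seqs F w, monoid.mult = (\<lambda>s t n. s n * t n), one = (\<lambda>_. 1),
     ring.zero = (\<lambda>_. 0), add = (\<lambda>s t n. s n + t n)\<rparr>"

definition completion :: "'a::field set \<Rightarrow> ('a \<Rightarrow> real) \<Rightarrow> (nat \<Rightarrow> 'a) set ring" where
  "completion F w = cauchy_ring F w Quot null_seqs F w"

definition completion_emb :: "'a::field set \<Rightarrow> ('a \<Rightarrow> real) \<Rightarrow> 'a \<Rightarrow> (nat \<Rightarrow> 'a) set" where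
  "completion_emb F w x = null_seqs F w +>\<^bsub>cauchy_ring F w\<^esub> (\<lambda>_. x)"

definition completion_abs :: "('a \<Rightarrow> real) \<Rightarrow> (nat \<Rightarrow> 'a) set \<Rightarrow> real" where
  "completion_abs w A = (THE r. \<forall>s\<in>A. (\<lambda>n. w (s n)) \<longlonglongrightarrow> r)"

type_synonym padic = "(nat \<Rightarrow> rat) set"

definition Qp :: "nat \<Rightarrow> padic ring" where
  "Qp p = completion UNIV (padic_abs p)"

definition Zp :: "nat \<Rightarrow> padic ring" where
  "Zp p = (Qp p)\<lparr>carrier := {x \<in> carrier (Qp p). completion_abs (padic_abs p) x \<le> 1}\<rparr>"

abbreviation rat_to_Qp :: "nat \<Rightarrow> rat \<Rightarrow> padic" where
  "rat_to_Qp p \<equiv> completion_emb UNIV (padic_abs p)"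


section \<open>Extension of scalars\<close>

text \<open>
  For a ring homomorphism \<open>\<phi> : R \<rightarrow> S\<close> and an \<open>R\<close>-module \<open>M\<close>, the \<open>S\<close>-module
  \<open>S \<otimes>\<^sub>R M\<close> is the free abelian group on \<open>S \<times> M\<close> modulo the bilinearity relations, with \<open>S\<close> acting
  on the left factor. The fields \<open>mult\<close> and \<open>one\<close> of a module record carry no meaning.
\<close>

definition tensor_relations ::
    "('r, 'x) ring_scheme \<Rightarrow> ('s, 'y) ring_scheme \<Rightarrow> ('r \<Rightarrow> 's) \<Rightarrow> ('r, 'm, 'z) module_scheme
     \<Rightarrow> ('s \<times> 'm \<Rightarrow>\<^sub>0 int) set" where
  "tensor_relations R S \<phi> M = generate (free_Abelian_group (carrier S \<times> carrier M))
     ({frag_of (s \<oplus>\<^bsub>S\<^esub> t, m) - frag_of (s, m) - frag_of (t, m) | s t m.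
         s \<in> carrier S \<and> t \<in> carrier S \<and> m \<in> carrier M} \<union>
      {frag_of (s, m \<oplus>\<^bsub>M\<^esub> n) - frag_of (s, m) - frag_of (s, n) | s m n.
         s \<in> carrier S \<and> m \<in> carrier M \<and> n \<in> carrier M} \<union>
      {frag_of (s \<otimes>\<^bsub>S\<^esub> \<phi> r, m) - frag_of (s, r \<odot>\<^bsub>M\<^esub> m) | s r m.
         s \<in> carrier S \<and> r \<in> carrier R \<and> m \<in> carrier M})"

definition base_change ::
    "('r, 'x) ring_scheme \<Rightarrow> ('s, 'y) ring_scheme \<Rightarrow> ('r \<Rightarrow> 's) \<Rightarrow> ('r, 'm, 'z) module_scheme
     \<Rightarrow> ('s, ('s \<times> 'm \<Rightarrow>\<^sub>0 int) set) module" where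
  "base_change R S \<phi> M =
     (let A = free_Abelian_group (carrier S \<times> carrier M); N = tensor_relations R S \<phi> M in
      \<lparr>carrier = carrier (A Mod N), monoid.mult = undefined, one = undefined,
       ring.zero = \<one>\<^bsub>A Mod N\<^esub>, add = (\<lambda>B C. B \<otimes>\<^bsub>A Mod N\<^esub> C),
       module.smult = (\<lambda>s B. (frag_extend (\<lambda>(t, m). frag_of (s \<otimes>\<^bsub>S\<^esub> t, m)) ` B) <#>\<^bsub>A\<^esub> N)\<rparr>)"

definition pure_tensor ::
    "('r, 'x) ring_scheme \<Rightarrow> ('s, 'y) ring_scheme \<Rightarrow> ('r \<Rightarrow> 's) \<Rightarrow> ('r, 'm, 'z) module_scheme
     \<Rightarrow> 's \<Rightarrow> 'm \<Rightarrow> ('s \<times> 'm \<Rightarrow>\<^sub>0 int) set" where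
  "pure_tensor R S \<phi> M s m =
     tensor_relations R S \<phi> M #>\<^bsub>free_Abelian_group (carrier S \<times> carrier M)\<^esub> frag_of (s, m)"

text \<open>The \<open>S\<close>-linear map \<open>S \<otimes>\<^sub>R M \<rightarrow> P\<close> induced by an \<open>R\<close>-linear map \<open>g : M \<rightarrow> P\<close>.\<close>

definition base_change_lift ::
    "('r, 'x) ring_scheme \<Rightarrow> ('s, 'y) ring_scheme \<Rightarrow> ('r \<Rightarrow> 's) \<Rightarrow> ('r, 'm, 'z) module_scheme
     \<Rightarrow> ('s, 'p, 'u) module_scheme \<Rightarrow> ('m \<Rightarrow> 'p) \<Rightarrow> ('s \<times> 'm \<Rightarrow>\<^sub>0 int) set \<Rightarrow> 'p" where
  "base_change_lift R S \<phi> M P g =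
     (THE f. f \<in> extensional (carrier (base_change R S \<phi> M)) \<and>
             f \<in> module_hom S (base_change R S \<phi> M) P \<and>
             (\<forall>m\<in>carrier M. f (pure_tensor R S \<phi> M \<one>\<^bsub>S\<^esub> m) = g m))"

text \<open>The map \<open>S \<otimes>\<^sub>R g : S \<otimes>\<^sub>R M \<rightarrow> S \<otimes>\<^sub>R P\<close> for an \<open>R\<close>-linear map \<open>g : M \<rightarrow> P\<close>.\<close>

definition base_change_map ::
    "('r, 'x) ring_scheme \<Rightarrow> ('s, 'y) ring_scheme \<Rightarrow> ('r \<Rightarrow> 's) \<Rightarrow> ('r, 'm, 'z) module_scheme
     \<Rightarrow> ('r, 'p, 'u) module_scheme \<Rightarrow> ('m \<Rightarrow> 'p)
     \<Rightarrow> ('s \<times> 'm \<Rightarrow>\<^sub>0 int) set \<Rightarrow> ('s \<times> 'p \<Rightarrow>\<^sub>0 int) set" where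
  "base_change_map R S \<phi> M P g =
     base_change_lift R S \<phi> M (base_change R S \<phi> P) (\<lambda>m. pure_tensor R S \<phi> P \<one>\<^bsub>S\<^esub> (g m))"


section \<open>Global and local units\<close>

text \<open>Both unit groups are written multiplicatively, so the module operations \<open>add\<close>, \<open>zero\<close> and
  \<open>smult\<close> are multiplication, \<open>1\<close> and exponentiation.\<close>

definition global_units :: "'a::field_char_0 set \<Rightarrow> (int, 'a) module" where
  "global_units F =
     \<lparr>carrier = {u \<in> F. u \<noteq> 0 \<and> algebraic_int u \<and> algebraic_int (inverse u)},
      monoid.mult = undefined, one = undefined, ring.zero = 1, add = (*), module.smult = (\<lambda>k u. u powi k)\<rparr>"

definition principal_units :: "'a::field set \<Rightarrow> ('a \<Rightarrow> real) \<Rightarrow> (nat \<Rightarrow> 'a) set set" where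
  "principal_units F w =
     {x \<in> carrier (completion F w). completion_abs w (x \<ominus>\<^bsub>completion F w\<^esub> \<one>\<^bsub>completion F w\<^esub>) < 1}"

text \<open>For \<open>a\<close> in \<^term>\<open>Zp p\<close> and a principal unit \<open>x\<close>, the power \<open>x\<^sup>a\<close> is the limit of the powers
  \<open>x\<^sup>k\<close> as the natural number \<open>k\<close> tends \<open>p\<close>-adically to \<open>a\<close>.\<close>

definition padic_power ::
    "nat \<Rightarrow> 'a::field set \<Rightarrow> ('a \<Rightarrow> real) \<Rightarrow> padic \<Rightarrow> (nat \<Rightarrow> 'a) set \<Rightarrow> (nat \<Rightarrow> 'a) set" where
  "padic_power p F w a x =
     (THE y. y \<in> principal_units F w \<and>
        (\<forall>e>0. \<exists>d>0. \<forall>k::nat.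
           completion_abs (padic_abs p) (rat_to_Qp p (of_nat k) \<ominus>\<^bsub>Qp p\<^esub> a) < d \<longrightarrow>
           completion_abs w (x [^]\<^bsub>completion F w\<^esub> k \<ominus>\<^bsub>completion F w\<^esub> y) < e))"

definition local_units :: "nat \<Rightarrow> 'a::field_char_0 set \<Rightarrow> (padic, ('a \<Rightarrow> real) \<Rightarrow> (nat \<Rightarrow> 'a) set) module" where
  "local_units p F =
     \<lparr>carrier = (\<Pi>\<^sub>E w\<in>places_above p F. principal_units F w),
      monoid.mult = undefined, one = undefined,
      ring.zero = (\<lambda>w\<in>places_above p F. \<one>\<^bsub>completion F w\<^esub>),
      add = (\<lambda>x y. \<lambda>w\<in>places_above p F. x w \<otimes>\<^bsub>completion F w\<^esub> y w),
      module.smult = (\<lambda>a x. \<lambda>w\<in>places_above p F. padic_power p F w a (x w))\<rparr>"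

text \<open>
  The unit group of the valuation ring of the completion at \<open>w\<close> is the direct product of its roots
  of unity of order prime to \<open>p\<close> and its principal units. A global unit need not be a principal
  unit locally; the diagonal map to the principal units takes its component there.
\<close>

definition principal_part :: "nat \<Rightarrow> 'a::field set \<Rightarrow> ('a \<Rightarrow> real) \<Rightarrow> 'a \<Rightarrow> (nat \<Rightarrow> 'a) set" where
  "principal_part p F w u =
     (THE y. y \<in> principal_units F w \<and>
        (\<exists>\<zeta>\<in>carrier (completion F w).
           (\<exists>n::nat. n > 0 \<and> coprime n p \<and> \<zeta> [^]\<^bsub>completion F w\<^esub> n = \<one>\<^bsub>completion F w\<^esub>) \<and>
           completion_emb F w u = \<zeta> \<otimes>\<^bsub>completion F w\<^esub> y))"

definition diagonal_embedding ::
    "nat \<Rightarrow> 'a::field_char_0 set \<Rightarrow> 'a \<Rightarrow> ('a \<Rightarrow> real) \<Rightarrow> (nat \<Rightarrow> 'a) set" where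
  "diagonal_embedding p F u = (\<lambda>w\<in>places_above p F. principal_part p F w u)"


section \<open>The Leopoldt defect\<close>

abbreviation int_to_Zp :: "nat \<Rightarrow> int \<Rightarrow> padic" where
  "int_to_Zp p k \<equiv> rat_to_Qp p (of_int k)"

definition Zp_units ::
    "nat \<Rightarrow> 'a::field_char_0 set \<Rightarrow> (padic, (padic \<times> 'a \<Rightarrow>\<^sub>0 int) set) module" where
  "Zp_units p F = base_change int_ring (Zp p) (int_to_Zp p) (global_units F)"

definition leopoldt_map ::
    "nat \<Rightarrow> 'a::field_char_0 set
     \<Rightarrow> (padic \<times> 'a \<Rightarrow>\<^sub>0 int) set \<Rightarrow> ('a \<Rightarrow> real) \<Rightarrow> (nat \<Rightarrow> 'a) set" where
  "leopoldt_map p F =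
     base_change_lift int_ring (Zp p) (int_to_Zp p) (global_units F) (local_units p F)
       (diagonal_embedding p F)"

definition leopoldt_kernel ::
    "nat \<Rightarrow> 'a::field_char_0 set
     \<Rightarrow> (padic, (padic \<times> (padic \<times> 'a \<Rightarrow>\<^sub>0 int) set \<Rightarrow>\<^sub>0 int) set) module" where
  "leopoldt_kernel p F =
     (let V = base_change (Zp p) (Qp p) id (Zp_units p F);
          W = base_change (Zp p) (Qp p) id (local_units p F)
      in V\<lparr>carrier := mod_hom.ker V W
             (base_change_map (Zp p) (Qp p) id (Zp_units p F) (local_units p F) (leopoldt_map p F))\<rparr>)"

definition leopoldt_defect :: "'a::field_char_0 set \<Rightarrow> nat \<Rightarrow> nat" where
  "leopoldt_defect F p = vectorspace.dim (Qp p) (leopoldt_kernel p F)"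

end

theory Submission
  imports Defs "Jordan_Normal_Form.Char_Poly" "HOL-Computational_Algebra.Fundamental_Theorem_Algebra"
begin

text \<open>
  Write \<open>V\<close> for the Leopoldt kernel of \<open>L\<close>, a finite-dimensional representation of \<open>G\<close> over the
  p-adic numbers. For a subgroup \<open>H\<close> with fixed field \<open>F\<close>, the inclusion \<open>F \<rightarrow> L\<close> and the norm
  \<open>u \<mapsto> \<Prod>\<^sub>h h u\<close> induce maps \<open>i\<close> and \<open>n\<close> between the kernels of \<open>F\<close> and \<open>L\<close> with \<open>i n = \<Sum>\<^sub>h h\<close> and
  \<open>n i = |H|\<close>. Hence the defect of \<open>F\<close> is \<open>1/|H|\<close> times the sum over \<open>H\<close> of the character of \<open>V\<close>,
  that is, the pairing of this character with the induced character of \<open>H\<close>, and a Brauer relation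
  kills the weighted sum of the defects.

  That \<open>n\<close> maps into the kernel of \<open>F\<close> uses that every place of \<open>F\<close> extends to \<open>L\<close>: the extension
  is a minimal submultiplicative norm, which is multiplicative by the arguments of Berkovich.
  Finite dimensionality needs only the upper bound of Dirichlet's unit theorem, which follows from
  the pigeonhole principle in the logarithmic embedding.
\<close>

subsection \<open>Traces on finite-dimensional vector spaces\<close>

text \<open>The norm is not induced by a homomorphism of fields, so it comes with no map of local
  units, and its compatibility with the kernels is not formal. It is obtained through the inclusion:
  \<open>i n v\<close> is a sum of conjugates of \<open>v\<close> and so lies in the kernel of
  \<open>L\<close>, and the kernel of \<open>F\<close> is the preimage of the kernel of
  \<open>L\<close> once the local units of \<open>F\<close> inject into those of \<open>L\<close>,
  also after tensoring with the p-adic numbers. Injectivity itself comes from the extension of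
  places, its survival from the flatness of a fraction field. The extended absolute value is built
  on \<open>L\<close> itself by minimality, so no factorization over a completion enters. Complex
  embeddings are built by adjoining one element at a time, because the ambient type of the fields
  need not be algebraically closed. Conjugate embeddings are kept apart: the repeated coordinates do
  no harm when only finiteness of the rank is wanted. The coefficients are rational while traces are
  p-adic. The relation is therefore evaluated inside the p-adic numbers and pulled back along the
  injective map from the rationals.\<close>

lemma (in abelian_monoid) finsum_swap:
  assumes "finite A" "finite B" "\<And>x y. x \<in> A \<Longrightarrow> y \<in> B \<Longrightarrow> f x y \<in> carrier G"
  shows "(\<Oplus>x\<in>A. \<Oplus>y\<in>B. f x y) = (\<Oplus>y\<in>B. \<Oplus>x\<in>A. f x y)"
  using assms(1,3)
proof (induction A rule: finite_induct)
  case empty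
  then show ?case by simp
next
  case (insert a A)
  have "(\<Oplus>x\<in>insert a A. \<Oplus>y\<in>B. f x y) = (\<Oplus>y\<in>B. f a y) \<oplus> (\<Oplus>x\<in>A. \<Oplus>y\<in>B. f x y)"
    using insert.hyps insert.prems by (intro finsum_insert) (auto intro!: finsum_closed)
  also have "\<dots> = (\<Oplus>y\<in>B. f a y) \<oplus> (\<Oplus>y\<in>B. \<Oplus>x\<in>A. f x y)"
    using insert by simp
  also have "\<dots> = (\<Oplus>y\<in>B. f a y \<oplus> (\<Oplus>x\<in>A. f x y))"
    using insert.prems by (intro finsum_addf [symmetric]) (auto intro!: finsum_closed)
  also have "\<dots> = (\<Oplus>y\<in>B. \<Oplus>x\<in>insert a A. f x y)"
    using insert.hyps insert.prems
    by (intro finsum_cong' refl) (auto intro!: finsum_closed finsum_insert [symmetric])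
  finally show ?case .
qed

lemma module_hom_zero:
  assumes "Module.module R M" "Module.module R N" "f \<in> module_hom R M N"
  shows "f \<zero>\<^bsub>M\<^esub> = \<zero>\<^bsub>N\<^esub>"
proof -
  interpret mod_hom R M N f
    using assms by (auto simp: mod_hom_def mod_hom_axioms_def)
  show ?thesis by simp
qed

lemma module_hom_finsum:
  assumes "Module.module R M" "Module.module R N" "f \<in> module_hom R M N"
    and "finite A" "g \<in> A \<rightarrow> carrier M"
  shows "f (finsum M g A) = finsum N (\<lambda>a. f (g a)) A"
  using assms(4,5)
proof (induction A rule: finite_induct)
  interpret mod_hom R M N f
    using assms by (auto simp: mod_hom_def mod_hom_axioms_def)
  {
    case empty
    then show ?case by simp
  next
    case (insert a A)
    then show ?case
      by (simp add: Pi_iff)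
  }
qed

text \<open>A basis is carried together with its coordinate functionals, so that traces can be
  computed from sums alone, without matrices or an ordering of the basis.\<close>

definition dual_basis ::
    "('k, 'x) ring_scheme \<Rightarrow> ('k, 'v, 'y) module_scheme \<Rightarrow> 'v set \<Rightarrow> ('v \<Rightarrow> 'v \<Rightarrow> 'k) \<Rightarrow> bool" where
  "dual_basis K V B c \<longleftrightarrow> finite B \<and> B \<subseteq> carrier V \<and>
     (\<forall>b\<in>B. (\<forall>v\<in>carrier V. c b v \<in> carrier K) \<and>
        (\<forall>v\<in>carrier V. \<forall>w\<in>carrier V. c b (v \<oplus>\<^bsub>V\<^esub> w) = c b v \<oplus>\<^bsub>K\<^esub> c b w) \<and>
        (\<forall>r\<in>carrier K. \<forall>v\<in>carrier V. c b (r \<odot>\<^bsub>V\<^esub> v) = r \<otimes>\<^bsub>K\<^esub> c b v)) \<and>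
     (\<forall>v\<in>carrier V. (\<Oplus>\<^bsub>V\<^esub>b\<in>B. c b v \<odot>\<^bsub>V\<^esub> b) = v) \<and>
     (\<forall>b\<in>B. c b b = \<one>\<^bsub>K\<^esub>)"

lemma dual_basisD:
  assumes "dual_basis K V B c"
  shows "finite B" "B \<subseteq> carrier V"
    and "\<And>b v. b \<in> B \<Longrightarrow> v \<in> carrier V \<Longrightarrow> c b v \<in> carrier K"
    and "\<And>b v w. b \<in> B \<Longrightarrow> v \<in> carrier V \<Longrightarrow> w \<in> carrier V \<Longrightarrow> c b (v \<oplus>\<^bsub>V\<^esub> w) = c b v \<oplus>\<^bsub>K\<^esub> c b w"
    and "\<And>b v r. b \<in> B \<Longrightarrow> v \<in> carrier V \<Longrightarrow> r \<in> carrier K \<Longrightarrow> c b (r \<odot>\<^bsub>V\<^esub> v) = r \<otimes>\<^bsub>K\<^esub> c b v"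
    and "\<And>v. v \<in> carrier V \<Longrightarrow> (\<Oplus>\<^bsub>V\<^esub>b\<in>B. c b v \<odot>\<^bsub>V\<^esub> b) = v"
    and "\<And>b. b \<in> B \<Longrightarrow> c b b = \<one>\<^bsub>K\<^esub>"
  using assms unfolding dual_basis_def by simp_all

text \<open>Linearity of the coordinates comes from their uniqueness: the sum or multiple of
  coordinate vectors represents the sum or multiple of the vectors, so it must be the coordinate
  vector.\<close>

lemma (in vectorspace) dual_basis_exists:
  assumes fin_dim
  obtains B c where "dual_basis K V B c" "card B = dim"
proof -
  obtain B where B: "finite B" "basis B"
    using assms finite_basis_exists by blast
  have BV: "B \<subseteq> carrier V"
    using B unfolding basis_def by blast
  define P where "P = (\<lambda>v a. a \<in> B \<rightarrow>\<^sub>E carrier K \<and> lincomb a B = v)"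
  have ex1: "\<exists>!a. P v a" if "v \<in> carrier V" for v
    using B(2) that basis_criterion [OF B(1) BV] unfolding P_def by blast
  define cc where "cc v = (THE a. P v a)" for v
  have ccP: "P v (cc v)" if "v \<in> carrier V" for v
    unfolding cc_def using ex1 [OF that] by (rule theI')
  have eq: "cc v = a" if "P v a" "v \<in> carrier V" for v a
    using ex1 ccP that by blast
  have car: "cc v b \<in> carrier K" if "v \<in> carrier V" "b \<in> B" for v b
    using ccP [OF that(1)] that(2) unfolding P_def by blast
  have sum: "(\<Oplus>\<^bsub>V\<^esub>b\<in>B. cc v b \<odot>\<^bsub>V\<^esub> b) = v" if "v \<in> carrier V" for v
    using ccP [OF that] unfolding P_def lincomb_def by blast
  have cV: "b \<in> carrier V" if "b \<in> B" for b using that BV by blast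
  have add: "cc (v \<oplus>\<^bsub>V\<^esub> w) b = cc v b \<oplus>\<^bsub>K\<^esub> cc w b"
    if "v \<in> carrier V" "w \<in> carrier V" "b \<in> B" for v w b
  proof -
    have "P (v \<oplus>\<^bsub>V\<^esub> w) (\<lambda>b\<in>B. cc v b \<oplus>\<^bsub>K\<^esub> cc w b)"
      unfolding P_def lincomb_def
    proof safe
      have "(\<Oplus>\<^bsub>V\<^esub>u\<in>B. (\<lambda>b\<in>B. cc v b \<oplus>\<^bsub>K\<^esub> cc w b) u \<odot>\<^bsub>V\<^esub> u)
          = (\<Oplus>\<^bsub>V\<^esub>u\<in>B. cc v u \<odot>\<^bsub>V\<^esub> u \<oplus>\<^bsub>V\<^esub> cc w u \<odot>\<^bsub>V\<^esub> u)"
        using that by (intro M.finsum_cong' refl) (auto simp: car cV smult_l_distr)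
      also have "\<dots> = v \<oplus>\<^bsub>V\<^esub> w"
        using that by (subst M.finsum_addf) (auto simp: sum car cV)
      finally show "(\<Oplus>\<^bsub>V\<^esub>u\<in>B. (\<lambda>b\<in>B. cc v b \<oplus>\<^bsub>K\<^esub> cc w b) u \<odot>\<^bsub>V\<^esub> u) = v \<oplus>\<^bsub>V\<^esub> w" .
    qed (use that car in auto)
    from eq [OF this] that show ?thesis by simp
  qed
  have sm: "cc (r \<odot>\<^bsub>V\<^esub> v) b = r \<otimes>\<^bsub>K\<^esub> cc v b"
    if "v \<in> carrier V" "r \<in> carrier K" "b \<in> B" for v r b
  proof -
    have "P (r \<odot>\<^bsub>V\<^esub> v) (\<lambda>b\<in>B. r \<otimes>\<^bsub>K\<^esub> cc v b)"
      unfolding P_def lincomb_def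
    proof safe
      have "(\<Oplus>\<^bsub>V\<^esub>u\<in>B. (\<lambda>b\<in>B. r \<otimes>\<^bsub>K\<^esub> cc v b) u \<odot>\<^bsub>V\<^esub> u)
          = (\<Oplus>\<^bsub>V\<^esub>u\<in>B. r \<odot>\<^bsub>V\<^esub> (cc v u \<odot>\<^bsub>V\<^esub> u))"
        using that by (intro M.finsum_cong' refl) (auto simp: car cV smult_assoc1)
      also have "\<dots> = r \<odot>\<^bsub>V\<^esub> v"
        using that by (subst finsum_smult [symmetric]) (auto simp: sum car cV)
      finally show "(\<Oplus>\<^bsub>V\<^esub>u\<in>B. (\<lambda>b\<in>B. r \<otimes>\<^bsub>K\<^esub> cc v b) u \<odot>\<^bsub>V\<^esub> u) = r \<odot>\<^bsub>V\<^esub> v" .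
    qed (use that car in auto)
    from eq [OF this] that show ?thesis by simp
  qed
  have one: "cc b b = \<one>\<^bsub>K\<^esub>" if "b \<in> B" for b
  proof -
    have "P b (\<lambda>x\<in>B. if x = b then \<one>\<^bsub>K\<^esub> else \<zero>\<^bsub>K\<^esub>)"
      unfolding P_def lincomb_def
    proof safe
      have "(\<Oplus>\<^bsub>V\<^esub>u\<in>B. (\<lambda>x\<in>B. if x = b then \<one>\<^bsub>K\<^esub> else \<zero>\<^bsub>K\<^esub>) u \<odot>\<^bsub>V\<^esub> u)
          = (\<Oplus>\<^bsub>V\<^esub>u\<in>B. if b = u then u else \<zero>\<^bsub>V\<^esub>)"
        using that by (intro M.finsum_cong' refl) (auto simp: car cV)
      also have "\<dots> = b"
        using that B(1) by (subst M.add.finprod_singleton) (auto simp: cV)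
      finally show "(\<Oplus>\<^bsub>V\<^esub>u\<in>B. (\<lambda>x\<in>B. if x = b then \<one>\<^bsub>K\<^esub> else \<zero>\<^bsub>K\<^esub>) u \<odot>\<^bsub>V\<^esub> u) = b" .
    qed (use that car in auto)
    from eq [OF this] that cV show ?thesis by simp
  qed
  have "dual_basis K V B (\<lambda>b v. cc v b)"
    unfolding dual_basis_def by (simp add: B(1) BV car sum add sm one)
  moreover have "card B = dim"
    using B dim_basis by simp
  ultimately show ?thesis by (rule that)
qed

definition mtrace ::
    "('k, 'x) ring_scheme \<Rightarrow> 'v set \<Rightarrow> ('v \<Rightarrow> 'v \<Rightarrow> 'k) \<Rightarrow> ('v \<Rightarrow> 'v) \<Rightarrow> 'k" where
  "mtrace K B c f = (\<Oplus>\<^bsub>K\<^esub>b\<in>B. c b (f b))"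

lemma dual_basis_finsum:
  assumes "vectorspace K V" "dual_basis K V B c" "b \<in> B" "finite A" "g \<in> A \<rightarrow> carrier V"
  shows "c b (finsum V g A) = (\<Oplus>\<^bsub>K\<^esub>a\<in>A. c b (g a))"
  using assms(4,5)
proof (induction A rule: finite_induct)
  interpret vectorspace K V by fact
  {
    case empty
    show ?case
      using dual_basisD(3,5) [OF assms(2,3) M.zero_closed] R.zero_closed by fastforce
  next
    case (insert a A)
    have c: "\<And>v. v \<in> carrier V \<Longrightarrow> c b v \<in> carrier K"
      using dual_basisD(3) [OF assms(2,3)] .
    have "finsum V g (insert a A) = g a \<oplus>\<^bsub>V\<^esub> finsum V g A"
      using insert by (intro M.finsum_insert) auto
    moreover have "c b (g a \<oplus>\<^bsub>V\<^esub> finsum V g A) = c b (g a) \<oplus>\<^bsub>K\<^esub> c b (finsum V g A)"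
      using insert by (intro dual_basisD(4) [OF assms(2,3)]) (auto simp: Pi_iff)
    moreover have "(\<Oplus>\<^bsub>K\<^esub>a\<in>insert a A. c b (g a)) = c b (g a) \<oplus>\<^bsub>K\<^esub> (\<Oplus>\<^bsub>K\<^esub>a\<in>A. c b (g a))"
      using insert c by (intro R.finsum_insert) (auto simp: Pi_iff)
    ultimately show ?case
      using insert by (simp add: Pi_iff)
  }
qed

text \<open>Both sides expand to the double sum of \<open>d e (f b)\<close> times
  \<open>c b (g e)\<close>. The two spaces may differ, which is what transports a trace from the
  kernel of a fixed field to that of \<open>L\<close>; with equal spaces it also gives independence
  under conjugation.\<close>

lemma mtrace_comm:
  assumes V: "vectorspace K V" "dual_basis K V B c"
    and W: "vectorspace K W" "dual_basis K W C d"
    and f: "f \<in> module_hom K V W" and g: "g \<in> module_hom K W V"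
  shows "mtrace K B c (\<lambda>v. g (f v)) = mtrace K C d (\<lambda>w. f (g w))"
proof -
  interpret V: vectorspace K V by fact
  interpret W: vectorspace K W by fact
  note B = dual_basisD(1) [OF V(2)] subsetD [OF dual_basisD(2) [OF V(2)]]
    and C = dual_basisD(1) [OF W(2)] subsetD [OF dual_basisD(2) [OF W(2)]]
  note cc = dual_basisD(3) [OF V(2)] and cs = dual_basisD(5) [OF V(2)] and ce = dual_basisD(6) [OF V(2)]
  note dc = dual_basisD(3) [OF W(2)] and ds = dual_basisD(5) [OF W(2)] and de = dual_basisD(6) [OF W(2)]
  have fc: "\<And>v. v \<in> carrier V \<Longrightarrow> f v \<in> carrier W" and gc: "\<And>v. v \<in> carrier W \<Longrightarrow> g v \<in> carrier V"
    using f g unfolding module_hom_def by auto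
  have 1: "c b (g (f b)) = (\<Oplus>\<^bsub>K\<^esub>e\<in>C. d e (f b) \<otimes>\<^bsub>K\<^esub> c b (g e))" if b: "b \<in> B" for b
  proof -
    have "g (f b) = g (\<Oplus>\<^bsub>W\<^esub>e\<in>C. d e (f b) \<odot>\<^bsub>W\<^esub> e)"
      using b B fc by (simp add: de)
    also have "\<dots> = (\<Oplus>\<^bsub>V\<^esub>e\<in>C. g (d e (f b) \<odot>\<^bsub>W\<^esub> e))"
      using b B C dc fc
      by (intro module_hom_finsum [OF W.module_axioms V.module_axioms g]) (auto)
    also have "\<dots> = (\<Oplus>\<^bsub>V\<^esub>e\<in>C. d e (f b) \<odot>\<^bsub>V\<^esub> g e)"
      using b B C dc fc gc module_hom_smult [OF g] by (intro V.M.finsum_cong') auto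
    also have "c b \<dots> = (\<Oplus>\<^bsub>K\<^esub>e\<in>C. c b (d e (f b) \<odot>\<^bsub>V\<^esub> g e))"
      using b B C dc fc gc by (intro dual_basis_finsum [OF V b]) auto
    also have "\<dots> = (\<Oplus>\<^bsub>K\<^esub>e\<in>C. d e (f b) \<otimes>\<^bsub>K\<^esub> c b (g e))"
      using b B C dc fc gc cc cs by (intro V.R.finsum_cong') auto
    finally show ?thesis .
  qed
  have 2: "d e (f (g e)) = (\<Oplus>\<^bsub>K\<^esub>b\<in>B. d e (f b) \<otimes>\<^bsub>K\<^esub> c b (g e))" if e: "e \<in> C" for e
  proof -
    have "f (g e) = f (\<Oplus>\<^bsub>V\<^esub>b\<in>B. c b (g e) \<odot>\<^bsub>V\<^esub> b)"
      using e C gc by (simp add: ce)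
    also have "\<dots> = (\<Oplus>\<^bsub>W\<^esub>b\<in>B. f (c b (g e) \<odot>\<^bsub>V\<^esub> b))"
      using e B C cc gc
      by (intro module_hom_finsum [OF V.module_axioms W.module_axioms f]) (auto)
    also have "\<dots> = (\<Oplus>\<^bsub>W\<^esub>b\<in>B. c b (g e) \<odot>\<^bsub>W\<^esub> f b)"
      using e B C cc fc gc module_hom_smult [OF f] by (intro W.M.finsum_cong') auto
    also have "d e \<dots> = (\<Oplus>\<^bsub>K\<^esub>b\<in>B. d e (c b (g e) \<odot>\<^bsub>W\<^esub> f b))"
      using e B C cc fc gc by (intro dual_basis_finsum [OF W e]) auto
    also have "\<dots> = (\<Oplus>\<^bsub>K\<^esub>b\<in>B. d e (f b) \<otimes>\<^bsub>K\<^esub> c b (g e))"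
      using e B C dc fc gc cc ds by (intro V.R.finsum_cong') (auto simp: V.R.m_comm)
    finally show ?thesis .
  qed
  have "mtrace K B c (\<lambda>v. g (f v)) = (\<Oplus>\<^bsub>K\<^esub>b\<in>B. \<Oplus>\<^bsub>K\<^esub>e\<in>C. d e (f b) \<otimes>\<^bsub>K\<^esub> c b (g e))"
    unfolding mtrace_def using 1 B C cc dc fc gc
    by (intro V.R.finsum_cong' refl) (auto intro!: V.R.finsum_closed)
  also have "\<dots> = (\<Oplus>\<^bsub>K\<^esub>e\<in>C. \<Oplus>\<^bsub>K\<^esub>b\<in>B. d e (f b) \<otimes>\<^bsub>K\<^esub> c b (g e))"
    using B C cc dc fc gc by (intro V.R.finsum_swap) auto
  also have "\<dots> = mtrace K C d (\<lambda>w. f (g w))"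
    unfolding mtrace_def using 2 B C cc dc fc gc
    by (intro V.R.finsum_cong' refl) (auto intro!: V.R.finsum_closed)
  finally show ?thesis .
qed

lemma mtrace_closed:
  assumes "vectorspace K V" "dual_basis K V B c" "f \<in> carrier V \<rightarrow> carrier V"
  shows "mtrace K B c f \<in> carrier K"
proof -
  interpret vectorspace K V by fact
  show ?thesis
    unfolding mtrace_def using dual_basisD(2,3) [OF assms(2)] assms(3)
    by (intro R.finsum_closed) (auto simp: subset_iff Pi_iff)
qed

lemma mtrace_cong:
  assumes "vectorspace K V" "dual_basis K V B c" "f \<in> carrier V \<rightarrow> carrier V"
    and "\<And>v. v \<in> carrier V \<Longrightarrow> g v = f v"
  shows "mtrace K B c g = mtrace K B c f"
proof -
  interpret vectorspace K V by fact
  show ?thesis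
    unfolding mtrace_def using dual_basisD(2,3) [OF assms(2)] assms(3,4)
    by (intro R.finsum_cong') (auto simp: subset_iff Pi_iff)
qed

lemma mtrace_finsum:
  assumes "vectorspace K V" "dual_basis K V B c" "finite A"
    and f: "\<And>a. a \<in> A \<Longrightarrow> f a \<in> carrier V \<rightarrow> carrier V"
  shows "mtrace K B c (\<lambda>v. \<Oplus>\<^bsub>V\<^esub>a\<in>A. f a v) = (\<Oplus>\<^bsub>K\<^esub>a\<in>A. mtrace K B c (f a))"
proof -
  interpret vectorspace K V by fact
  note B = dual_basisD(1) [OF assms(2)] subsetD [OF dual_basisD(2) [OF assms(2)]]
    and cc = dual_basisD(3) [OF assms(2)]
  have fc: "f a v \<in> carrier V" if "a \<in> A" "v \<in> carrier V" for a v
    using f that by auto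
  have "mtrace K B c (\<lambda>v. \<Oplus>\<^bsub>V\<^esub>a\<in>A. f a v) = (\<Oplus>\<^bsub>K\<^esub>b\<in>B. \<Oplus>\<^bsub>K\<^esub>a\<in>A. c b (f a b))"
    unfolding mtrace_def using B cc fc assms(3)
    by (intro R.finsum_cong' refl)
       (auto intro!: R.finsum_closed dual_basis_finsum [OF assms(1,2)])
  also have "\<dots> = (\<Oplus>\<^bsub>K\<^esub>a\<in>A. \<Oplus>\<^bsub>K\<^esub>b\<in>B. c b (f a b))"
    using B cc fc assms(3) by (intro R.finsum_swap) auto
  finally show ?thesis unfolding mtrace_def .
qed

lemma module_hom_comp:
  assumes "f \<in> module_hom R M N" "g \<in> module_hom R N P"
  shows "(\<lambda>x. g (f x)) \<in> module_hom R M P"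
  using assms unfolding module_hom_def by (auto simp: Pi_iff)

text \<open>Carries the rational coefficients and the natural numbers counting elements and
  dimensions into the field of the traces. Its injectivity brings the final vanishing back to the
  rationals.\<close>

locale rational_embedding = field K for K (structure) +
  fixes \<rho> :: "rat \<Rightarrow> 'a"
  assumes rho_closed [simp]: "\<rho> q \<in> carrier K"
    and rho_one: "\<rho> 1 = \<one>"
    and rho_add: "\<rho> (q + r) = \<rho> q \<oplus> \<rho> r"
    and rho_mult: "\<rho> (q * r) = \<rho> q \<otimes> \<rho> r"
begin

lemma rho_zero: "\<rho> 0 = \<zero>"
  using rho_add [of 0 0] by (metis add_0 local.add.r_cancel_one' rho_closed)

lemma rho_sum: "\<rho> (sum f A) = (\<Oplus>a\<in>A. \<rho> (f a))"
  by (induction A rule: infinite_finite_induct) (auto simp: rho_zero rho_add)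

lemma rho_inj:
  assumes "\<rho> q = \<zero>"
  shows "q = 0"
proof (rule ccontr)
  assume "q \<noteq> 0"
  then have "\<rho> q \<otimes> \<rho> (1 / q) = \<one>"
    by (simp flip: rho_mult add: rho_one)
  then show False
    using assms by simp
qed

lemma rho_of_nat_card:
  assumes "finite A"
  shows "(\<Oplus>a\<in>A. \<one>) = \<rho> (of_nat (card A))"
proof -
  have "(\<Oplus>a\<in>A. \<one>) = (\<Oplus>a\<in>A. \<rho> 1)"
    by (simp add: rho_one)
  then show ?thesis
    using rho_sum [of "\<lambda>_. 1" A] by simp
qed

end

lemma mtrace_scalar:
  assumes "vectorspace K V" "dual_basis K V B c" "rational_embedding K \<rho>" "r \<in> carrier K"
  shows "mtrace K B c (\<lambda>v. r \<odot>\<^bsub>V\<^esub> v) = r \<otimes>\<^bsub>K\<^esub> \<rho> (of_nat (card B))"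
proof -
  interpret vectorspace K V by fact
  interpret rational_embedding K \<rho> by fact
  note B = dual_basisD(1) [OF assms(2)] subsetD [OF dual_basisD(2) [OF assms(2)]]
  have "mtrace K B c (\<lambda>v. r \<odot>\<^bsub>V\<^esub> v) = (\<Oplus>\<^bsub>K\<^esub>b\<in>B. r \<otimes>\<^bsub>K\<^esub> \<one>\<^bsub>K\<^esub>)"
    unfolding mtrace_def using B assms(4) dual_basisD(5,7) [OF assms(2)]
    by (intro R.finsum_cong') auto
  also have "\<dots> = r \<otimes>\<^bsub>K\<^esub> (\<Oplus>\<^bsub>K\<^esub>b\<in>B. \<one>\<^bsub>K\<^esub>)"
    using B assms(4) by (intro finsum_rdistr [symmetric]) auto
  finally show ?thesis
    using rho_of_nat_card [OF B(1)] by simp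
qed

lemma (in group) conj_bij:
  assumes "x \<in> carrier G"
  shows "bij_betw (\<lambda>h. x \<otimes> h \<otimes> inv x) (carrier G) (carrier G)"
  by (rule bij_betwI [where g = "\<lambda>g. inv x \<otimes> g \<otimes> x"])
     (use assms in \<open>auto simp: m_assoc simp flip: m_assoc [of x "inv x"] m_assoc [of "inv x" x]\<close>)

text \<open>No invariant subspaces are needed: the dimension of \<open>W H\<close> is read off the trace of
  \<open>n H \<circ> i H\<close>, which equals the trace of \<open>i H \<circ> n H\<close>, the sum of the traces of the elements of \<open>H\<close>.\<close>

theorem brauer_relation_dim:
  fixes K :: "('k, 'x) ring_scheme" (structure) and V :: "('k, 'v, 'y) module_scheme"
    and G :: "('g, 'z) monoid_scheme" and W :: "'g set \<Rightarrow> ('k, 'w, 'u) module_scheme"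
    and a :: "'g set \<Rightarrow> rat"
  assumes "rational_embedding K \<rho>"
    and V: "vectorspace K V" "vectorspace.fin_dim K V"
    and G: "group G" "finite (carrier G)"
    and T: "\<And>g. g \<in> carrier G \<Longrightarrow> T g \<in> module_hom K V V"
    and T_mult: "\<And>g h v. g \<in> carrier G \<Longrightarrow> h \<in> carrier G \<Longrightarrow> v \<in> carrier V \<Longrightarrow> T (g \<otimes>\<^bsub>G\<^esub> h) v = T g (T h v)"
    and fin: "finite \<H>"
    and sub: "\<And>H. H \<in> \<H> \<Longrightarrow> subgroup H G"
    and W: "\<And>H. H \<in> \<H> \<Longrightarrow> vectorspace K (W H)" "\<And>H. H \<in> \<H> \<Longrightarrow> vectorspace.fin_dim K (W H)"
    and i: "\<And>H. H \<in> \<H> \<Longrightarrow> i H \<in> module_hom K (W H) V"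
    and n: "\<And>H. H \<in> \<H> \<Longrightarrow> n H \<in> module_hom K V (W H)"
    and in_sum: "\<And>H v. H \<in> \<H> \<Longrightarrow> v \<in> carrier V \<Longrightarrow> i H (n H v) = (\<Oplus>\<^bsub>V\<^esub>h\<in>H. T h v)"
    and ni: "\<And>H w. H \<in> \<H> \<Longrightarrow> w \<in> carrier (W H) \<Longrightarrow> n H (i H w) = \<rho> (of_nat (card H)) \<odot>\<^bsub>W H\<^esub> w"
    and brauer: "\<And>g. g \<in> carrier G \<Longrightarrow>
      (\<Sum>H\<in>\<H>. a H / of_nat (card H) * of_nat (card {x \<in> carrier G. inv\<^bsub>G\<^esub> x \<otimes>\<^bsub>G\<^esub> g \<otimes>\<^bsub>G\<^esub> x \<in> H})) = 0"
  shows "(\<Sum>H\<in>\<H>. a H * of_nat (vectorspace.dim K (W H))) = 0"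
proof -
  interpret rational_embedding K \<rho> by fact
  interpret V: vectorspace K V by fact
  interpret G: group G by fact
  obtain B c where Bc: "dual_basis K V B c"
    using V.dual_basis_exists [OF V(2)] by blast
  define t where "t g = mtrace K B c (T g)" for g
  have Tc: "T g \<in> carrier V \<rightarrow> carrier V" if "g \<in> carrier G" for g
    using T [OF that] by (rule module_hom_closed)
  have tc: "t g \<in> carrier K" if "g \<in> carrier G" for g
    unfolding t_def using mtrace_closed [OF V(1) Bc Tc [OF that]] .
  \<comment> \<open>The trace is a class function: cyclic invariance moves the factor for
    \<open>inv x\<close> to the front, where it cancels.\<close>
  have tclass: "t (x \<otimes>\<^bsub>G\<^esub> h \<otimes>\<^bsub>G\<^esub> inv\<^bsub>G\<^esub> x) = t h" if "x \<in> carrier G" "h \<in> carrier G" for x h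
  proof -
    have "t (x \<otimes>\<^bsub>G\<^esub> h \<otimes>\<^bsub>G\<^esub> inv\<^bsub>G\<^esub> x) = mtrace K B c (\<lambda>v. T (x \<otimes>\<^bsub>G\<^esub> h) (T (inv\<^bsub>G\<^esub> x) v))"
      unfolding t_def using that by (intro mtrace_cong [OF V(1) Bc]) (use Tc T_mult in \<open>auto simp: Pi_iff\<close>)
    also have "\<dots> = mtrace K B c (\<lambda>v. T (inv\<^bsub>G\<^esub> x) (T (x \<otimes>\<^bsub>G\<^esub> h) v))"
      using that by (intro mtrace_comm [OF V(1) Bc V(1) Bc]) (use T in auto)
    also have "\<dots> = t h"
      unfolding t_def
    proof (rule mtrace_cong [OF V(1) Bc Tc [OF that(2)]])
      fix v assume v: "v \<in> carrier V"
      have "T (inv\<^bsub>G\<^esub> x) (T (x \<otimes>\<^bsub>G\<^esub> h) v) = T (inv\<^bsub>G\<^esub> x \<otimes>\<^bsub>G\<^esub> (x \<otimes>\<^bsub>G\<^esub> h)) v"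
        using that v by (intro T_mult [symmetric]) auto
      also have "inv\<^bsub>G\<^esub> x \<otimes>\<^bsub>G\<^esub> (x \<otimes>\<^bsub>G\<^esub> h) = h"
        using that by (simp flip: G.m_assoc)
      finally show "T (inv\<^bsub>G\<^esub> x) (T (x \<otimes>\<^bsub>G\<^esub> h) v) = T h v" .
    qed
    finally show ?thesis .
  qed
  have Hc: "h \<in> carrier G" if "H \<in> \<H>" "h \<in> H" for H h
    using subgroup.mem_carrier [OF sub [OF that(1)] that(2)] .
  have Hfin: "finite H" if "H \<in> \<H>" for H
    using Hc [OF that] G(2) by (meson finite_subset subsetI)
  have Hpos: "card H > 0" if "H \<in> \<H>" for H
    using subgroup.one_closed [OF sub [OF that]] Hfin [OF that] card_gt_0_iff by blast
  have dim: "\<rho> (of_nat (card H)) \<otimes> \<rho> (of_nat (vectorspace.dim K (W H))) = (\<Oplus>h\<in>H. t h)" if H: "H \<in> \<H>" for H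
  proof -
    interpret WH: vectorspace K "W H" by (rule W [OF H])
    obtain C d where Cd: "dual_basis K (W H) C d" "card C = WH.dim"
      using WH.dual_basis_exists [OF W(2) [OF H]] by blast
    have "\<rho> (of_nat (card H)) \<otimes> \<rho> (of_nat WH.dim) = mtrace K C d (\<lambda>w. \<rho> (of_nat (card H)) \<odot>\<^bsub>W H\<^esub> w)"
      using mtrace_scalar [OF W(1) [OF H] Cd(1) assms(1)] Cd(2) by simp
    also have "\<dots> = mtrace K C d (\<lambda>w. n H (i H w))"
      using ni [OF H] by (intro mtrace_cong [OF W(1) [OF H] Cd(1), symmetric]) auto
    also have "\<dots> = mtrace K B c (\<lambda>v. i H (n H v))"
      by (rule mtrace_comm [OF W(1) [OF H] Cd(1) V(1) Bc i [OF H] n [OF H]])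
    also have "\<dots> = mtrace K B c (\<lambda>v. \<Oplus>\<^bsub>V\<^esub>h\<in>H. T h v)"
      using in_sum [OF H] Hc [OF H] Tc
      by (intro mtrace_cong [OF V(1) Bc]) (auto intro!: V.M.finsum_closed simp: Pi_iff)
    also have "\<dots> = (\<Oplus>h\<in>H. t h)"
      unfolding t_def using Hfin [OF H] Tc [OF Hc [OF H]] by (intro mtrace_finsum [OF V(1) Bc])
    finally show ?thesis .
  qed
  define m where "m H g = card {x \<in> carrier G. inv\<^bsub>G\<^esub> x \<otimes>\<^bsub>G\<^esub> g \<otimes>\<^bsub>G\<^esub> x \<in> H}" for H g
  \<comment> \<open>Conjugating by any single \<open>x\<close> leaves the sum of \<open>t\<close>
    over \<open>H\<close> unchanged. Summing over all \<open>x\<close> in \<open>G\<close> turns it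
    into a sum over \<open>G\<close> in which \<open>g\<close> is weighted by \<open>m H g\<close>,
    that is, by \<open>card H\<close> times the value at \<open>g\<close> of the character induced
    from the trivial one.\<close>
  have avg: "\<rho> (of_nat (card (carrier G))) \<otimes> (\<Oplus>h\<in>H. t h) = (\<Oplus>g\<in>carrier G. \<rho> (of_nat (m H g)) \<otimes> t g)"
    if H: "H \<in> \<H>" for H
  proof -
    let ?I = "\<lambda>x g. if inv\<^bsub>G\<^esub> x \<otimes>\<^bsub>G\<^esub> g \<otimes>\<^bsub>G\<^esub> x \<in> H then \<one> else \<zero>"
    have inner: "(\<Oplus>h\<in>H. t h) = (\<Oplus>g\<in>carrier G. ?I x g \<otimes> t g)" if x: "x \<in> carrier G" for x
    proof -
      have "(\<Oplus>g\<in>carrier G. ?I x g \<otimes> t g)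
          = (\<Oplus>g\<in>(\<lambda>h. x \<otimes>\<^bsub>G\<^esub> h \<otimes>\<^bsub>G\<^esub> inv\<^bsub>G\<^esub> x) ` carrier G. ?I x g \<otimes> t g)"
        using G.conj_bij [OF x] by (simp add: bij_betw_imp_surj_on)
      also have "\<dots> = (\<Oplus>h\<in>carrier G. ?I x (x \<otimes>\<^bsub>G\<^esub> h \<otimes>\<^bsub>G\<^esub> inv\<^bsub>G\<^esub> x) \<otimes> t (x \<otimes>\<^bsub>G\<^esub> h \<otimes>\<^bsub>G\<^esub> inv\<^bsub>G\<^esub> x))"
        using G.conj_bij [OF x] x tc by (intro finsum_reindex) (auto simp: bij_betw_def)
      also have "\<dots> = (\<Oplus>h\<in>carrier G. if h \<in> H then t h else \<zero>)"
      proof (intro finsum_cong' refl)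
        fix h assume h: "h \<in> carrier G"
        have "inv\<^bsub>G\<^esub> x \<otimes>\<^bsub>G\<^esub> (x \<otimes>\<^bsub>G\<^esub> h \<otimes>\<^bsub>G\<^esub> inv\<^bsub>G\<^esub> x) \<otimes>\<^bsub>G\<^esub> x = h"
          using x h by (simp add: G.m_assoc) (simp flip: G.m_assoc)
        then show "?I x (x \<otimes>\<^bsub>G\<^esub> h \<otimes>\<^bsub>G\<^esub> inv\<^bsub>G\<^esub> x) \<otimes> t (x \<otimes>\<^bsub>G\<^esub> h \<otimes>\<^bsub>G\<^esub> inv\<^bsub>G\<^esub> x) = (if h \<in> H then t h else \<zero>)"
          using tclass [OF x h] tc [OF h] by simp
      qed (use tc in auto)
      also have "\<dots> = (\<Oplus>h\<in>H. t h)"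
        using G(2) Hc [OF H] tc by (intro add.finprod_mono_neutral_cong_right) auto
      finally show ?thesis ..
    qed
    have "\<rho> (of_nat (card (carrier G))) \<otimes> (\<Oplus>h\<in>H. t h) = (\<Oplus>x\<in>carrier G. \<one>) \<otimes> (\<Oplus>h\<in>H. t h)"
      using rho_of_nat_card [OF G(2)] by simp
    also have "\<dots> = (\<Oplus>x\<in>carrier G. \<one> \<otimes> (\<Oplus>h\<in>H. t h))"
      using G(2) tc Hc [OF H] by (intro finsum_ldistr) (auto intro!: finsum_closed)
    also have "\<dots> = (\<Oplus>x\<in>carrier G. \<Oplus>g\<in>carrier G. ?I x g \<otimes> t g)"
      using tc Hc [OF H] inner by (intro finsum_cong' refl) (auto intro!: finsum_closed)
    also have "\<dots> = (\<Oplus>g\<in>carrier G. \<Oplus>x\<in>carrier G. ?I x g \<otimes> t g)"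
      using tc G(2) by (intro finsum_swap) auto
    also have "\<dots> = (\<Oplus>g\<in>carrier G. \<rho> (of_nat (m H g)) \<otimes> t g)"
    proof (intro finsum_cong' refl)
      fix g assume g: "g \<in> carrier G"
      have "(\<Oplus>x\<in>carrier G. ?I x g \<otimes> t g) = (\<Oplus>x\<in>carrier G. ?I x g) \<otimes> t g"
        using g tc G(2) by (intro finsum_ldistr [symmetric]) auto
      also have "(\<Oplus>x\<in>carrier G. ?I x g) = (\<Oplus>x\<in>{x \<in> carrier G. inv\<^bsub>G\<^esub> x \<otimes>\<^bsub>G\<^esub> g \<otimes>\<^bsub>G\<^esub> x \<in> H}. \<one>)"
        using G(2) by (intro add.finprod_mono_neutral_cong_right) auto
      also have "\<dots> = \<rho> (of_nat (m H g))"
        unfolding m_def using G(2) by (intro rho_of_nat_card) auto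
      finally show "(\<Oplus>x\<in>carrier G. ?I x g \<otimes> t g) = \<rho> (of_nat (m H g)) \<otimes> t g" .
    qed (use tc in auto)
    finally show ?thesis .
  qed
  \<comment> \<open>The sum is multiplied by the order of \<open>G\<close> so that
    \<open>avg\<close> applies to every term; the sums over \<H> and over \<open>G\<close> are then
    exchanged and the Brauer relation kills the coefficient of each \<open>t g\<close>.\<close>
  let ?S = "\<Sum>H\<in>\<H>. a H * of_nat (vectorspace.dim K (W H))"
  have "\<rho> (of_nat (card (carrier G)) * ?S)
      = (\<Oplus>H\<in>\<H>. \<rho> (of_nat (card (carrier G)) * (a H * of_nat (vectorspace.dim K (W H)))))"
    by (simp only: sum_distrib_left rho_sum)
  also have "\<dots> = (\<Oplus>H\<in>\<H>. \<rho> (a H / of_nat (card H)) \<otimes> (\<Oplus>g\<in>carrier G. \<rho> (of_nat (m H g)) \<otimes> t g))"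
  proof (intro finsum_cong' refl)
    fix H assume H: "H \<in> \<H>"
    have "of_nat (card (carrier G)) * (a H * of_nat (vectorspace.dim K (W H)))
       = (a H / of_nat (card H)) * (of_nat (card (carrier G)) * (of_nat (card H) * of_nat (vectorspace.dim K (W H))))"
      using Hpos [OF H] by simp
    then have "\<rho> (of_nat (card (carrier G)) * (a H * of_nat (vectorspace.dim K (W H))))
      = \<rho> (a H / of_nat (card H)) \<otimes> (\<rho> (of_nat (card (carrier G))) \<otimes>
          (\<rho> (of_nat (card H)) \<otimes> \<rho> (of_nat (vectorspace.dim K (W H)))))"
      by (simp only: rho_mult)
    then show "\<rho> (of_nat (card (carrier G)) * (a H * of_nat (vectorspace.dim K (W H))))
      = \<rho> (a H / of_nat (card H)) \<otimes> (\<Oplus>g\<in>carrier G. \<rho> (of_nat (m H g)) \<otimes> t g)"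
      by (simp only: dim [OF H] avg [OF H])
  qed (use tc in \<open>auto intro!: finsum_closed\<close>)
  also have "\<dots> = (\<Oplus>H\<in>\<H>. \<Oplus>g\<in>carrier G. \<rho> (a H / of_nat (card H) * of_nat (m H g)) \<otimes> t g)"
  proof (intro finsum_cong' refl)
    fix H assume H: "H \<in> \<H>"
    have "\<rho> (a H / of_nat (card H)) \<otimes> (\<Oplus>g\<in>carrier G. \<rho> (of_nat (m H g)) \<otimes> t g)
        = (\<Oplus>g\<in>carrier G. \<rho> (a H / of_nat (card H)) \<otimes> (\<rho> (of_nat (m H g)) \<otimes> t g))"
      using G(2) tc by (intro finsum_rdistr) auto
    also have "\<dots> = (\<Oplus>g\<in>carrier G. \<rho> (a H / of_nat (card H) * of_nat (m H g)) \<otimes> t g)"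
      using tc by (intro finsum_cong' refl) (auto simp only: rho_mult m_assoc rho_closed Pi_iff intro!: m_closed)
    finally show "\<rho> (a H / of_nat (card H)) \<otimes> (\<Oplus>g\<in>carrier G. \<rho> (of_nat (m H g)) \<otimes> t g)
        = (\<Oplus>g\<in>carrier G. \<rho> (a H / of_nat (card H) * of_nat (m H g)) \<otimes> t g)" .
  qed (use tc in \<open>auto intro!: finsum_closed\<close>)
  also have "\<dots> = (\<Oplus>g\<in>carrier G. \<Oplus>H\<in>\<H>. \<rho> (a H / of_nat (card H) * of_nat (m H g)) \<otimes> t g)"
    using fin G(2) tc by (intro finsum_swap) auto
  also have "\<dots> = (\<Oplus>g\<in>carrier G. \<zero>)"
  proof (intro finsum_cong' refl)
    fix g assume g: "g \<in> carrier G"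
    have "(\<Oplus>H\<in>\<H>. \<rho> (a H / of_nat (card H) * of_nat (m H g)) \<otimes> t g)
        = (\<Oplus>H\<in>\<H>. \<rho> (a H / of_nat (card H) * of_nat (m H g))) \<otimes> t g"
      using fin tc [OF g] by (intro finsum_ldistr [symmetric]) auto
    also have "\<dots> = \<rho> (\<Sum>H\<in>\<H>. a H / of_nat (card H) * of_nat (m H g)) \<otimes> t g"
      by (simp only: rho_sum)
    also have "\<dots> = \<zero>"
      unfolding m_def brauer [OF g] using tc [OF g] by (simp add: rho_zero)
    finally show "(\<Oplus>H\<in>\<H>. \<rho> (a H / of_nat (card H) * of_nat (m H g)) \<otimes> t g) = \<zero>" .
  qed auto
  also have "\<dots> = \<zero>" by simp
  finally have "of_nat (card (carrier G)) * ?S = 0" by (rule rho_inj)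
  moreover have "card (carrier G) > 0"
    using G(2) G.one_closed card_gt_0_iff by blast
  ultimately show ?thesis by simp
qed

subsection \<open>Extension of scalars\<close>

lemma frag_keys_induct [consumes 1, case_names zero diff one]:
  assumes "Poly_Mapping.keys x \<subseteq> Y" "P 0"
    and "\<And>x y. Poly_Mapping.keys x \<subseteq> Y \<Longrightarrow> Poly_Mapping.keys y \<subseteq> Y \<Longrightarrow> P x \<Longrightarrow> P y \<Longrightarrow> P (x - y)"
    and "\<And>a. a \<in> Y \<Longrightarrow> P (frag_of a)"
  shows "P x"
  by (rule free_Abelian_group_induct [of x Y P, OF assms])

lemma (in abelian_group) add_minus_cancel2:
  assumes "x \<in> carrier G" "y \<in> carrier G"
  shows "x \<oplus> y \<ominus> x \<ominus> y = \<zero>"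
  using assms by (simp add: minus_eq a_comm [of x y] a_assoc r_neg)

text \<open>The homomorphism from the free abelian group on \<open>Y\<close> prescribed by
  \<open>b\<close> on generators, spelled out as equations on elements supported in \<open>Y\<close>
  so that later calculations can rewrite with it directly.\<close>

definition is_free_lift ::
    "('p, 'u) ring_scheme \<Rightarrow> 'y set \<Rightarrow> ('y \<Rightarrow> 'p) \<Rightarrow> (('y \<Rightarrow>\<^sub>0 int) \<Rightarrow> 'p) \<Rightarrow> bool" where
  "is_free_lift P Y b h \<longleftrightarrow> (\<forall>f. Poly_Mapping.keys f \<subseteq> Y \<longrightarrow> h f \<in> carrier P) \<and>
     (\<forall>f g. Poly_Mapping.keys f \<subseteq> Y \<longrightarrow> Poly_Mapping.keys g \<subseteq> Y \<longrightarrow> h (f + g) = h f \<oplus>\<^bsub>P\<^esub> h g) \<and>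
     (\<forall>f g. Poly_Mapping.keys f \<subseteq> Y \<longrightarrow> Poly_Mapping.keys g \<subseteq> Y \<longrightarrow> h (f - g) = h f \<ominus>\<^bsub>P\<^esub> h g) \<and>
     h 0 = \<zero>\<^bsub>P\<^esub> \<and> (\<forall>f. Poly_Mapping.keys f \<subseteq> Y \<longrightarrow> h (- f) = \<ominus>\<^bsub>P\<^esub> h f) \<and>
     (\<forall>x\<in>Y. h (frag_of x) = b x)"

lemma is_free_liftD:
  assumes "is_free_lift P Y b h"
  shows "\<And>f. Poly_Mapping.keys f \<subseteq> Y \<Longrightarrow> h f \<in> carrier P"
    "\<And>f g. Poly_Mapping.keys f \<subseteq> Y \<Longrightarrow> Poly_Mapping.keys g \<subseteq> Y \<Longrightarrow> h (f + g) = h f \<oplus>\<^bsub>P\<^esub> h g"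
    "\<And>f g. Poly_Mapping.keys f \<subseteq> Y \<Longrightarrow> Poly_Mapping.keys g \<subseteq> Y \<Longrightarrow> h (f - g) = h f \<ominus>\<^bsub>P\<^esub> h g"
    "h 0 = \<zero>\<^bsub>P\<^esub>" "\<And>f. Poly_Mapping.keys f \<subseteq> Y \<Longrightarrow> h (- f) = \<ominus>\<^bsub>P\<^esub> h f"
    "\<And>x. x \<in> Y \<Longrightarrow> h (frag_of x) = b x"
  using assms unfolding is_free_lift_def by simp_all

lemma (in abelian_group) free_lift_exists:
  assumes "b ` Y \<subseteq> carrier G"
  shows "\<exists>h. is_free_lift G Y b h"
proof -
  have "b ` Y \<subseteq> carrier (add_monoid G)"
    using assms by simp
  then obtain h where h: "h \<in> hom (free_Abelian_group Y) (add_monoid G)" "\<And>x. x \<in> Y \<Longrightarrow> h (frag_of x) = b x"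
    using comm_group.free_Abelian_group_universal [OF a_comm_group] by metis
  interpret h: group_hom "free_Abelian_group Y" "add_monoid G" h
    using h(1) a_comm_group by (simp add: group_hom_def group_hom_axioms_def comm_group_def)
  have hc: "h f \<in> carrier G" if "Poly_Mapping.keys f \<subseteq> Y" for f
    using h.hom_closed [of f] that by simp
  have hadd: "h (f + g) = h f \<oplus> h g" if "Poly_Mapping.keys f \<subseteq> Y" "Poly_Mapping.keys g \<subseteq> Y" for f g
    using h.hom_mult [of f g] that by simp
  have hneg: "h (- f) = \<ominus> h f" if "Poly_Mapping.keys f \<subseteq> Y" for f
    using h.hom_inv [of f] that by (simp add: a_inv_def)
  have hdiff: "h (f - g) = h f \<ominus> h g" if "Poly_Mapping.keys f \<subseteq> Y" "Poly_Mapping.keys g \<subseteq> Y" for f g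
    using hadd [of f "- g"] hneg [of g] that by (simp add: minus_eq)
  have "is_free_lift G Y b h"
    unfolding is_free_lift_def using h.hom_one by (simp add: hc hadd hdiff hneg h(2))
  then show ?thesis by blast
qed

locale scalar_extension = R: cring R + S: cring S + M: Module.module R M
  for R :: "('r, 'x) ring_scheme" and S :: "('s, 'y) ring_scheme"
    and M :: "('r, 'm, 'z) module_scheme" +
  fixes \<phi> :: "'r \<Rightarrow> 's"
  assumes phi_hom: "\<phi> \<in> Ring.ring_hom R S"
begin

abbreviation "TX \<equiv> carrier S \<times> carrier M"
abbreviation "A \<equiv> free_Abelian_group TX"
abbreviation "N \<equiv> tensor_relations R S \<phi> M"
abbreviation "BC \<equiv> base_change R S \<phi> M"
abbreviation "pure \<equiv> pure_tensor R S \<phi> M"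

definition "cls f = N #>\<^bsub>A\<^esub> f"

definition "rels =
     {frag_of (s \<oplus>\<^bsub>S\<^esub> t, m) - frag_of (s, m) - frag_of (t, m) | s t m.
         s \<in> carrier S \<and> t \<in> carrier S \<and> m \<in> carrier M} \<union>
      {frag_of (s, m \<oplus>\<^bsub>M\<^esub> n) - frag_of (s, m) - frag_of (s, n) | s m n.
         s \<in> carrier S \<and> m \<in> carrier M \<and> n \<in> carrier M} \<union>
      {frag_of (s \<otimes>\<^bsub>S\<^esub> \<phi> r, m) - frag_of (s, r \<odot>\<^bsub>M\<^esub> m) | s r m.
         s \<in> carrier S \<and> r \<in> carrier R \<and> m \<in> carrier M}"

lemma N_eq: "N = generate A rels"
  unfolding tensor_relations_def rels_def ..

lemma phi_closed [simp]: "r \<in> carrier R \<Longrightarrow> \<phi> r \<in> carrier S"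
  using phi_hom by (simp add: ring_hom_closed)

lemma rels_keys: "f \<in> rels \<Longrightarrow> Poly_Mapping.keys f \<subseteq> TX"
  unfolding rels_def
  by (elim UnE CollectE exE conjE; simp only:; intro keys_diff [THEN order_trans] Un_least) auto

sublocale A: comm_group A
  by (rule abelian_free_Abelian_group)

lemma N_subgroup: "subgroup N A"
  unfolding N_eq using rels_keys by (intro A.generate_is_subgroup) auto

lemma N_normal: "N \<lhd> A"
  using N_subgroup by (rule A.subgroup_imp_normal)

lemma N_keys: "f \<in> N \<Longrightarrow> Poly_Mapping.keys f \<subseteq> TX"
  using subgroup.mem_carrier [OF N_subgroup] by simp

lemma N_zero: "0 \<in> N"
  using subgroup.one_closed [OF N_subgroup] by simp

lemma N_add: "f \<in> N \<Longrightarrow> g \<in> N \<Longrightarrow> f + g \<in> N"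
  using subgroup.m_closed [OF N_subgroup] by simp

lemma N_minus: "f \<in> N \<Longrightarrow> - f \<in> N"
  using subgroup.m_inv_closed [OF N_subgroup] N_keys by force

lemma N_diff: "f \<in> N \<Longrightarrow> g \<in> N \<Longrightarrow> f - g \<in> N"
  using N_add [of f "- g"] N_minus by simp

lemma N_incl: "f \<in> rels \<Longrightarrow> f \<in> N"
  unfolding N_eq by (rule generate.incl)

lemma N_induct [consumes 1, case_names zero incl minus add]:
  assumes "f \<in> N" "P 0" "\<And>f. f \<in> rels \<Longrightarrow> P f"
    and "\<And>f. f \<in> N \<Longrightarrow> P f \<Longrightarrow> P (- f)" and "\<And>f g. f \<in> N \<Longrightarrow> g \<in> N \<Longrightarrow> P f \<Longrightarrow> P g \<Longrightarrow> P (f + g)"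
  shows "P f"
  using assms(1) [unfolded N_eq]
proof (induction rule: generate.induct)
  case (inv h)
  then show ?case
    using assms(3,4) [of h] rels_keys [of h] N_incl [of h] by simp
next
  case (eng h1 h2)
  then show ?case
    using assms(5) [of h1 h2] by (simp add: N_eq)
qed (use assms in auto)

lemma cls_iff: "cls f = {n + f | n. n \<in> N}"
  unfolding cls_def r_coset_def by auto

lemma cls_eq:
  shows "cls f = cls g \<longleftrightarrow> f - g \<in> N"
proof
  assume eq: "cls f = cls g"
  have "f \<in> cls f"
    unfolding cls_iff using N_zero by force
  then obtain n where "n \<in> N" "f = n + g"
    unfolding eq unfolding cls_iff by blast
  then show "f - g \<in> N" by simp
next
  assume d: "f - g \<in> N"
  show "cls f = cls g"
    unfolding cls_iff
  proof safe
    fix n assume "n \<in> N"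
    then show "\<exists>n'. n + f = n' + g \<and> n' \<in> N"
      using N_add [OF _ d] by (intro exI [of _ "n + (f - g)"]) auto
    show "\<exists>n'. n + g = n' + f \<and> n' \<in> N"
      using N_diff [OF \<open>n \<in> N\<close> d] by (intro exI [of _ "n - (f - g)"]) auto
  qed
qed

lemma carrier_BC: "carrier BC = cls ` {f. Poly_Mapping.keys f \<subseteq> TX}"
  unfolding base_change_def Let_def cls_def by (auto simp: FactGroup_def RCOSETS_def)

lemma cls_closed [simp]: "Poly_Mapping.keys f \<subseteq> TX \<Longrightarrow> cls f \<in> carrier BC"
  unfolding carrier_BC by blast

lemma add_BC:
  assumes "Poly_Mapping.keys f \<subseteq> TX" "Poly_Mapping.keys g \<subseteq> TX"
  shows "cls f \<oplus>\<^bsub>BC\<^esub> cls g = cls (f + g)"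
  using normal.rcos_sum [OF N_normal, of f g] assms
  unfolding base_change_def Let_def cls_def by (simp add: FactGroup_def)

lemma zero_BC: "\<zero>\<^bsub>BC\<^esub> = cls 0"
proof -
  have "\<zero>\<^bsub>BC\<^esub> = N"
    unfolding base_change_def Let_def by (simp add: FactGroup_def)
  also have "N = cls 0"
    unfolding cls_iff by simp
  finally show ?thesis .
qed

lemma pure_eq: "pure s m = cls (frag_of (s, m))"
  unfolding pure_tensor_def cls_def ..

definition "scale s = frag_extend (\<lambda>(t, m). frag_of (s \<otimes>\<^bsub>S\<^esub> t, m))"

lemma scale_simps [simp]:
  "scale s 0 = 0" "scale s (f + g) = scale s f + scale s g" "scale s (f - g) = scale s f - scale s g"
  "scale s (- f) = - scale s f" "scale s (frag_of (t, m)) = frag_of (s \<otimes>\<^bsub>S\<^esub> t, m)"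
  unfolding scale_def by (simp_all add: frag_extend_add frag_extend_diff frag_extend_minus)

lemma scale_keys:
  assumes "s \<in> carrier S" "Poly_Mapping.keys f \<subseteq> TX"
  shows "Poly_Mapping.keys (scale s f) \<subseteq> TX"
  using assms(2)
proof (induction rule: frag_keys_induct)
  case (diff f g)
  then show ?case
    using keys_diff [of "scale s f" "scale s g"] by auto
next
  case (one a)
  then show ?case using assms(1) by (cases a) auto
qed auto

lemma rels_cases [consumes 1, case_names add_left add_right balanced]:
  assumes "f \<in> rels"
  obtains t u m where "t \<in> carrier S" "u \<in> carrier S" "m \<in> carrier M"
      "f = frag_of (t \<oplus>\<^bsub>S\<^esub> u, m) - frag_of (t, m) - frag_of (u, m)"
    | t m n where "t \<in> carrier S" "m \<in> carrier M" "n \<in> carrier M"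
      "f = frag_of (t, m \<oplus>\<^bsub>M\<^esub> n) - frag_of (t, m) - frag_of (t, n)"
    | t r m where "t \<in> carrier S" "r \<in> carrier R" "m \<in> carrier M"
      "f = frag_of (t \<otimes>\<^bsub>S\<^esub> \<phi> r, m) - frag_of (t, r \<odot>\<^bsub>M\<^esub> m)"
  using assms unfolding rels_def Un_iff mem_Collect_eq
  by (elim disjE exE conjE) ((rule that(1); assumption), (rule that(2); assumption), (rule that(3); assumption))

lemma scale_rels:
  assumes s: "s \<in> carrier S" and f: "f \<in> rels"
  shows "scale s f \<in> rels"
proof -
  from f show ?thesis
  proof (cases rule: rels_cases)
    case (add_left t u m)
    then have "scale s f = frag_of (s \<otimes>\<^bsub>S\<^esub> t \<oplus>\<^bsub>S\<^esub> s \<otimes>\<^bsub>S\<^esub> u, m) - frag_of (s \<otimes>\<^bsub>S\<^esub> t, m) - frag_of (s \<otimes>\<^bsub>S\<^esub> u, m)"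
      using s by (simp add: S.r_distr)
    then show ?thesis
      unfolding rels_def using add_left s by blast
  next
    case (add_right t m n)
    then have "scale s f = frag_of (s \<otimes>\<^bsub>S\<^esub> t, m \<oplus>\<^bsub>M\<^esub> n) - frag_of (s \<otimes>\<^bsub>S\<^esub> t, m) - frag_of (s \<otimes>\<^bsub>S\<^esub> t, n)"
      by simp
    then show ?thesis
      unfolding rels_def using add_right s by blast
  next
    case (balanced t r m)
    then have "scale s f = frag_of (s \<otimes>\<^bsub>S\<^esub> t \<otimes>\<^bsub>S\<^esub> \<phi> r, m) - frag_of (s \<otimes>\<^bsub>S\<^esub> t, r \<odot>\<^bsub>M\<^esub> m)"
      using s by (simp add: S.m_assoc)
    then show ?thesis
      unfolding rels_def using balanced s by blast
  qed
qed

lemma scale_N: "f \<in> N \<Longrightarrow> s \<in> carrier S \<Longrightarrow> scale s f \<in> N"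
  by (induction rule: N_induct) (auto simp: N_zero N_minus N_add N_incl scale_rels)

text \<open>The definition scales a whole coset and adds \<open>N\<close> again. Since
  \<open>scale s\<close> maps \<open>N\<close> into itself, the result is the coset of one scaled
  representative.\<close>

lemma smult_BC:
  assumes "s \<in> carrier S"
  shows "s \<odot>\<^bsub>BC\<^esub> cls f = cls (scale s f)"
proof -
  have "s \<odot>\<^bsub>BC\<^esub> cls f = (scale s ` cls f) <#>\<^bsub>A\<^esub> N"
    unfolding base_change_def Let_def scale_def by simp
  also have "\<dots> = {scale s n + scale s f + n' | n n'. n \<in> N \<and> n' \<in> N}"
    unfolding cls_iff set_mult_def by force
  also have "\<dots> = cls (scale s f)"
    unfolding cls_iff
  proof safe
    fix n n' assume "n \<in> N" "n' \<in> N"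
    then show "\<exists>k. scale s n + scale s f + n' = k + scale s f \<and> k \<in> N"
      using N_add scale_N [OF _ assms] by (intro exI [of _ "scale s n + n'"]) auto
  next
    fix n assume "n \<in> N"
    then show "\<exists>m n'. n + scale s f = scale s m + scale s f + n' \<and> m \<in> N \<and> n' \<in> N"
      using N_zero by (intro exI [of _ 0] exI [of _ n]) auto
  qed
  finally show ?thesis .
qed

lemma keys_add_X: "Poly_Mapping.keys f \<subseteq> TX \<Longrightarrow> Poly_Mapping.keys g \<subseteq> TX \<Longrightarrow> Poly_Mapping.keys (f + g) \<subseteq> TX"
  using keys_add [of f g] by blast

lemma keys_diff_X: "Poly_Mapping.keys f \<subseteq> TX \<Longrightarrow> Poly_Mapping.keys g \<subseteq> TX \<Longrightarrow> Poly_Mapping.keys (f - g) \<subseteq> TX"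
  using keys_diff [of f g] by blast

lemma abelian_group_BC: "abelian_group BC"
proof (rule abelian_groupI)
  fix x y z assume x: "x \<in> carrier BC"
  then obtain f where f: "x = cls f" "Poly_Mapping.keys f \<subseteq> TX"
    unfolding carrier_BC by blast
  have "cls (- f) \<oplus>\<^bsub>BC\<^esub> x = \<zero>\<^bsub>BC\<^esub>" "cls (- f) \<in> carrier BC"
    using f by (auto simp: add_BC zero_BC)
  then show "\<exists>y\<in>carrier BC. y \<oplus>\<^bsub>BC\<^esub> x = \<zero>\<^bsub>BC\<^esub>" by blast
  show "\<zero>\<^bsub>BC\<^esub> \<oplus>\<^bsub>BC\<^esub> x = x"
    using f by (simp add: zero_BC add_BC)
qed (auto simp: carrier_BC zero_BC add_BC keys_add_X ac_simps)

text \<open>On the free group scaling is not additive in the scalar; the discrepancy is a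
  combination of the relations for additivity in the left factor.\<close>

lemma scale_add_N:
  assumes "s \<in> carrier S" "t \<in> carrier S" "Poly_Mapping.keys f \<subseteq> TX"
  shows "scale (s \<oplus>\<^bsub>S\<^esub> t) f - scale s f - scale t f \<in> N"
  using assms(3)
proof (induction rule: frag_keys_induct)
  case (diff f g)
  have eq: "scale (s \<oplus>\<^bsub>S\<^esub> t) (f - g) - scale s (f - g) - scale t (f - g)
      = (scale (s \<oplus>\<^bsub>S\<^esub> t) f - scale s f - scale t f) - (scale (s \<oplus>\<^bsub>S\<^esub> t) g - scale s g - scale t g)"
    by simp
  show ?case
    unfolding eq by (rule N_diff [OF diff(3,4)])
next
  case (one a)
  then obtain u m where a: "a = (u, m)" "u \<in> carrier S" "m \<in> carrier M" by blast
  then have "scale (s \<oplus>\<^bsub>S\<^esub> t) (frag_of a) - scale s (frag_of a) - scale t (frag_of a)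
     = frag_of (s \<otimes>\<^bsub>S\<^esub> u \<oplus>\<^bsub>S\<^esub> t \<otimes>\<^bsub>S\<^esub> u, m) - frag_of (s \<otimes>\<^bsub>S\<^esub> u, m) - frag_of (t \<otimes>\<^bsub>S\<^esub> u, m)"
    using assms by (simp add: S.l_distr)
  moreover have "\<dots> \<in> rels"
    unfolding rels_def using a assms by blast
  ultimately show ?case
    using N_incl by simp
qed (simp add: N_zero)

lemma scale_scale:
  assumes "s \<in> carrier S" "t \<in> carrier S" "Poly_Mapping.keys f \<subseteq> TX"
  shows "scale (s \<otimes>\<^bsub>S\<^esub> t) f = scale s (scale t f)"
  using assms(3)
proof (induction rule: frag_keys_induct)
  case (one a)
  then show ?case
    using assms by (cases a) (simp add: S.m_assoc)
qed simp_all

lemma scale_one: "Poly_Mapping.keys f \<subseteq> TX \<Longrightarrow> scale \<one>\<^bsub>S\<^esub> f = f"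
proof (induction rule: frag_keys_induct)
  case (one a)
  then show ?case by (cases a) simp
qed simp_all

lemma module_BC: "Module.module S BC"
proof (rule moduleI)
  show "cring S" by (rule S.is_cring)
  show "abelian_group BC" by (rule abelian_group_BC)
  fix s t x y assume s: "s \<in> carrier S"
  {
    assume "x \<in> carrier BC"
    then show "s \<odot>\<^bsub>BC\<^esub> x \<in> carrier BC"
      using s by (auto simp: carrier_BC smult_BC scale_keys)
  next
    assume "t \<in> carrier S" "x \<in> carrier BC"
    then show "(s \<oplus>\<^bsub>S\<^esub> t) \<odot>\<^bsub>BC\<^esub> x = s \<odot>\<^bsub>BC\<^esub> x \<oplus>\<^bsub>BC\<^esub> t \<odot>\<^bsub>BC\<^esub> x"
      unfolding carrier_BC using s scale_add_N
      by (elim imageE) (simp add: smult_BC scale_keys add_BC cls_eq diff_diff_eq)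
  next
    assume "x \<in> carrier BC" "y \<in> carrier BC"
    then show "s \<odot>\<^bsub>BC\<^esub> (x \<oplus>\<^bsub>BC\<^esub> y) = s \<odot>\<^bsub>BC\<^esub> x \<oplus>\<^bsub>BC\<^esub> s \<odot>\<^bsub>BC\<^esub> y"
      using s by (auto simp: carrier_BC smult_BC scale_keys add_BC)
  next
    assume "t \<in> carrier S" "x \<in> carrier BC"
    then show "(s \<otimes>\<^bsub>S\<^esub> t) \<odot>\<^bsub>BC\<^esub> x = s \<odot>\<^bsub>BC\<^esub> (t \<odot>\<^bsub>BC\<^esub> x)"
      using s by (auto simp: carrier_BC smult_BC scale_keys scale_scale)
  }
next
  fix x assume "x \<in> carrier BC"
  then show "\<one>\<^bsub>S\<^esub> \<odot>\<^bsub>BC\<^esub> x = x"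
    by (auto simp: carrier_BC smult_BC scale_one)
qed

sublocale BC: Module.module S BC
  by (rule module_BC)

lemma pure_closed [simp]: "s \<in> carrier S \<Longrightarrow> m \<in> carrier M \<Longrightarrow> pure s m \<in> carrier BC"
  unfolding pure_eq by simp

lemma minus_BC:
  assumes "Poly_Mapping.keys f \<subseteq> TX" "Poly_Mapping.keys g \<subseteq> TX"
  shows "cls f \<ominus>\<^bsub>BC\<^esub> cls g = cls (f - g)"
proof -
  have "cls f = cls (f - g) \<oplus>\<^bsub>BC\<^esub> cls g"
    using assms by (simp add: add_BC keys_diff_X)
  then show ?thesis
    using assms by (simp add: keys_diff_X BC.M.add.inv_solve_right' BC.M.minus_eq)
qed

text \<open>Differences of pure tensors reach all integer combinations, including zero as the
  difference of a tensor with itself. A single closure step thus suffices.\<close>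

lemma BC_induct [consumes 1, case_names pure diff]:
  assumes "x \<in> carrier BC"
    and pure: "\<And>s m. s \<in> carrier S \<Longrightarrow> m \<in> carrier M \<Longrightarrow> P (pure s m)"
    and diff: "\<And>x y. x \<in> carrier BC \<Longrightarrow> y \<in> carrier BC \<Longrightarrow> P x \<Longrightarrow> P y \<Longrightarrow> P (x \<ominus>\<^bsub>BC\<^esub> y)"
  shows "P x"
proof -
  obtain f where f: "x = cls f" "Poly_Mapping.keys f \<subseteq> TX"
    using assms(1) unfolding carrier_BC by blast
  have "P (cls f)"
    using f(2)
  proof (induction rule: frag_keys_induct)
    case zero
    have z: "pure \<zero>\<^bsub>S\<^esub> \<zero>\<^bsub>M\<^esub> \<in> carrier BC" by simp
    have "P (pure \<zero>\<^bsub>S\<^esub> \<zero>\<^bsub>M\<^esub> \<ominus>\<^bsub>BC\<^esub> pure \<zero>\<^bsub>S\<^esub> \<zero>\<^bsub>M\<^esub>)"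
      by (intro diff pure z) auto
    then show ?case
      using z by (simp add: zero_BC [symmetric] BC.M.minus_eq BC.M.r_neg)
  next
    case (diff f g)
    then show ?case
      using assms(3) [of "cls f" "cls g"] by (simp add: minus_BC)
  next
    case (one a)
    then show ?case
      using pure by (auto simp: pure_eq)
  qed
  then show ?thesis by (simp add: f)
qed

lemma pure_smult: "s \<in> carrier S \<Longrightarrow> t \<in> carrier S \<Longrightarrow> s \<odot>\<^bsub>BC\<^esub> pure t m = pure (s \<otimes>\<^bsub>S\<^esub> t) m"
  by (simp add: pure_eq smult_BC)

lemma pure_one_smult: "s \<in> carrier S \<Longrightarrow> pure s m = s \<odot>\<^bsub>BC\<^esub> pure \<one>\<^bsub>S\<^esub> m"
  by (simp add: pure_smult)

lemma pure_add_right: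
  assumes "s \<in> carrier S" "m \<in> carrier M" "n \<in> carrier M"
  shows "pure s (m \<oplus>\<^bsub>M\<^esub> n) = pure s m \<oplus>\<^bsub>BC\<^esub> pure s n"
proof -
  have "frag_of (s, m \<oplus>\<^bsub>M\<^esub> n) - frag_of (s, m) - frag_of (s, n) \<in> rels"
    unfolding rels_def using assms by blast
  then show ?thesis
    using assms N_incl by (simp add: pure_eq add_BC cls_eq diff_diff_eq)
qed

lemma pure_balanced:
  assumes "s \<in> carrier S" "m \<in> carrier M" "r \<in> carrier R"
  shows "pure s (r \<odot>\<^bsub>M\<^esub> m) = pure (s \<otimes>\<^bsub>S\<^esub> \<phi> r) m"
proof -
  have "frag_of (s \<otimes>\<^bsub>S\<^esub> \<phi> r, m) - frag_of (s, r \<odot>\<^bsub>M\<^esub> m) \<in> rels"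
    unfolding rels_def using assms by blast
  from N_incl [OF this] show ?thesis
    using assms by (metis pure_eq cls_eq)
qed

lemma pure_one_balanced:
  assumes "m \<in> carrier M" "r \<in> carrier R"
  shows "pure \<one>\<^bsub>S\<^esub> (r \<odot>\<^bsub>M\<^esub> m) = \<phi> r \<odot>\<^bsub>BC\<^esub> pure \<one>\<^bsub>S\<^esub> m"
  using assms by (simp add: pure_balanced pure_smult)

lemma BC_hom_eqI:
  assumes P: "Module.module S P" and f: "f \<in> module_hom S BC P" and g: "g \<in> module_hom S BC P"
    and eq: "\<And>m. m \<in> carrier M \<Longrightarrow> f (pure \<one>\<^bsub>S\<^esub> m) = g (pure \<one>\<^bsub>S\<^esub> m)"
    and x: "x \<in> carrier BC"
  shows "f x = g x"
proof -
  interpret P: Module.module S P by fact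
  interpret f: mod_hom S BC P f
    by unfold_locales (rule f)
  interpret g: mod_hom S BC P g
    by unfold_locales (rule g)
  from x show ?thesis
  proof (induction rule: BC_induct)
    case (pure s m)
    then show ?case
      using eq by (simp add: pure_one_smult [of s])
  next
    case (diff x y)
    then show ?case by simp
  qed
qed

text \<open>The condition for \<open>g\<close> to factor through the extension of scalars: linearity
  over \<open>R\<close>, where \<open>R\<close> acts on the \<open>S\<close>-module \<open>P\<close>
  through \<phi>.\<close>

definition bilinear_extends :: "('s, 'p, 'u) module_scheme \<Rightarrow> ('m \<Rightarrow> 'p) \<Rightarrow> bool" where
  "bilinear_extends P g \<longleftrightarrow> g \<in> carrier M \<rightarrow> carrier P \<and>
     (\<forall>m\<in>carrier M. \<forall>n\<in>carrier M. g (m \<oplus>\<^bsub>M\<^esub> n) = g m \<oplus>\<^bsub>P\<^esub> g n) \<and>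
     (\<forall>r\<in>carrier R. \<forall>m\<in>carrier M. g (r \<odot>\<^bsub>M\<^esub> m) = \<phi> r \<odot>\<^bsub>P\<^esub> g m)"

text \<open>The map sending the generator \<open>(s, m)\<close> to \<open>s\<close> times
  \<open>g m\<close> annihilates the three kinds of relations, hence all of \<open>N\<close>, and so
  descends to cosets through an arbitrary choice of representatives.\<close>

lemma lift_exists:
  assumes P: "Module.module S P" and g: "bilinear_extends P g"
  shows "\<exists>f. f \<in> extensional (carrier BC) \<and> f \<in> module_hom S BC P \<and>
    (\<forall>m\<in>carrier M. f (pure \<one>\<^bsub>S\<^esub> m) = g m)"
proof -
  interpret P: Module.module S P by fact
  have gc: "\<And>m. m \<in> carrier M \<Longrightarrow> g m \<in> carrier P"
    and ga: "\<And>m n. m \<in> carrier M \<Longrightarrow> n \<in> carrier M \<Longrightarrow> g (m \<oplus>\<^bsub>M\<^esub> n) = g m \<oplus>\<^bsub>P\<^esub> g n"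
    and gs: "\<And>r m. r \<in> carrier R \<Longrightarrow> m \<in> carrier M \<Longrightarrow> g (r \<odot>\<^bsub>M\<^esub> m) = \<phi> r \<odot>\<^bsub>P\<^esub> g m"
    using g unfolding bilinear_extends_def by auto
  define b where "b = (\<lambda>(s, m). s \<odot>\<^bsub>P\<^esub> g m)"
  have "b ` TX \<subseteq> carrier P"
    unfolding b_def using gc by auto
  then obtain h where lift: "is_free_lift P TX b h"
    using P.M.free_lift_exists by blast
  note hc = is_free_liftD(1) [OF lift] and hadd = is_free_liftD(2) [OF lift]
    and hdiff = is_free_liftD(3) [OF lift] and h0 = is_free_liftD(4) [OF lift]
    and hneg = is_free_liftD(5) [OF lift] and h = is_free_liftD(6) [OF lift]
  have hrel: "h f = \<zero>\<^bsub>P\<^esub>" if "f \<in> rels" for f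
  proof -
    from that show ?thesis
    proof (cases rule: rels_cases)
      case (add_left t u m)
      then have "h f = ((t \<oplus>\<^bsub>S\<^esub> u) \<odot>\<^bsub>P\<^esub> g m \<ominus>\<^bsub>P\<^esub> t \<odot>\<^bsub>P\<^esub> g m) \<ominus>\<^bsub>P\<^esub> u \<odot>\<^bsub>P\<^esub> g m"
        by (simp add: hdiff keys_diff_X h b_def)
      also have "\<dots> = \<zero>\<^bsub>P\<^esub>"
        using add_left gc by (simp add: P.smult_l_distr P.M.add_minus_cancel2)
      finally show ?thesis .
    next
      case (add_right t m n)
      then have "h f = (t \<odot>\<^bsub>P\<^esub> g (m \<oplus>\<^bsub>M\<^esub> n) \<ominus>\<^bsub>P\<^esub> t \<odot>\<^bsub>P\<^esub> g m) \<ominus>\<^bsub>P\<^esub> t \<odot>\<^bsub>P\<^esub> g n"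
        by (simp add: hdiff keys_diff_X h b_def)
      also have "\<dots> = \<zero>\<^bsub>P\<^esub>"
        using add_right gc by (simp add: ga P.smult_r_distr P.M.add_minus_cancel2)
      finally show ?thesis .
    next
      case (balanced t r m)
      then have "h f = (t \<otimes>\<^bsub>S\<^esub> \<phi> r) \<odot>\<^bsub>P\<^esub> g m \<ominus>\<^bsub>P\<^esub> t \<odot>\<^bsub>P\<^esub> g (r \<odot>\<^bsub>M\<^esub> m)"
        by (simp add: hdiff keys_diff_X h b_def)
      also have "\<dots> = \<zero>\<^bsub>P\<^esub>"
        using balanced gc by (simp add: gs P.smult_assoc1 P.M.minus_eq P.M.r_neg)
      finally show ?thesis .
    qed
  qed
  have hN: "h f = \<zero>\<^bsub>P\<^esub>" if "f \<in> N" for f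
    using that by (induction rule: N_induct) (auto simp: h0 hrel hneg hadd N_keys)
  have hscale: "h (scale s f) = s \<odot>\<^bsub>P\<^esub> h f" if "s \<in> carrier S" "Poly_Mapping.keys f \<subseteq> TX" for s f
    using that(2)
  proof (induction rule: frag_keys_induct)
    case (diff f g)
    have "h (scale s (f - g)) = s \<odot>\<^bsub>P\<^esub> h f \<ominus>\<^bsub>P\<^esub> s \<odot>\<^bsub>P\<^esub> h g"
      using diff that(1) by (simp add: hdiff scale_keys)
    also have "\<dots> = s \<odot>\<^bsub>P\<^esub> h (f - g)"
      using diff that(1) hc by (simp add: hdiff P.M.minus_eq P.smult_r_distr P.smult_r_minus)
    finally show ?case .
  next
    case (one a)
    then show ?case
      using that(1) gc by (cases a) (simp add: h b_def P.smult_assoc1)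
  qed (use that in \<open>simp add: h0\<close>)
  define F where "F = (\<lambda>x\<in>carrier BC. h (SOME f. Poly_Mapping.keys f \<subseteq> TX \<and> x = cls f))"
  have F: "F (cls f) = h f" if f: "Poly_Mapping.keys f \<subseteq> TX" for f
  proof -
    define f' where "f' = (SOME f'. Poly_Mapping.keys f' \<subseteq> TX \<and> cls f = cls f')"
    have f': "Poly_Mapping.keys f' \<subseteq> TX" "cls f = cls f'"
      unfolding f'_def using someI [of "\<lambda>f'. Poly_Mapping.keys f' \<subseteq> TX \<and> cls f = cls f'" f] f by auto
    have "h f = h (f' + (f - f'))" by simp
    also have "\<dots> = h f' \<oplus>\<^bsub>P\<^esub> h (f - f')"
      using f f' by (intro hadd keys_diff_X)
    also have "h (f - f') = \<zero>\<^bsub>P\<^esub>"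
      using f'(2) cls_eq hN by blast
    finally have "h f = h f'"
      using hc f' by simp
    then show ?thesis
      unfolding F_def using f by (simp add: f'_def)
  qed
  show ?thesis
  proof (intro exI conjI ballI)
    show "F \<in> extensional (carrier BC)" unfolding F_def by simp
    show "F \<in> module_hom S BC P"
      unfolding module_hom_def
      by (auto simp: carrier_BC F hc add_BC keys_add_X hadd smult_BC scale_keys hscale)
    fix m assume "m \<in> carrier M"
    then show "F (pure \<one>\<^bsub>S\<^esub> m) = g m"
      using gc by (simp add: pure_eq F h b_def)
  qed
qed

text \<open>Justifies the definite description: two lifts agree on the tensors of \<open>1\<close>
  with \<open>m\<close>, which generate, and extensionality fixes the values outside the
  carrier.\<close>

lemma base_change_lift_spec:
  assumes P: "Module.module S P" and g: "bilinear_extends P g"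
  shows "base_change_lift R S \<phi> M P g \<in> module_hom S BC P"
    and "\<And>m. m \<in> carrier M \<Longrightarrow> base_change_lift R S \<phi> M P g (pure \<one>\<^bsub>S\<^esub> m) = g m"
proof -
  let ?Q = "\<lambda>f. f \<in> extensional (carrier BC) \<and> f \<in> module_hom S BC P \<and>
             (\<forall>m\<in>carrier M. f (pure \<one>\<^bsub>S\<^esub> m) = g m)"
  obtain f where f: "?Q f"
    using lift_exists [OF P g] by (elim exE)
  have unique: "f' = f" if f': "?Q f'" for f'
  proof (rule extensionalityI [of _ "carrier BC"])
    fix x assume x: "x \<in> carrier BC"
    show "f' x = f x"
    proof (rule BC_hom_eqI [OF P _ _ _ x])
      show "f' \<in> module_hom S BC P"
        using f' by (elim conjE)
      show "f \<in> module_hom S BC P"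
        using f by (elim conjE)
      fix m assume "m \<in> carrier M"
      with f f' show "f' (pure \<one>\<^bsub>S\<^esub> m) = f (pure \<one>\<^bsub>S\<^esub> m)" by simp
    qed
  qed (rule conjunct1 [OF f'], rule conjunct1 [OF f])
  have Q: "?Q (base_change_lift R S \<phi> M P g)"
    unfolding base_change_lift_def by (rule theI [of ?Q, OF f unique])
  then show "base_change_lift R S \<phi> M P g \<in> module_hom S BC P"
    by (elim conjE)
  fix m assume "m \<in> carrier M"
  with Q show "base_change_lift R S \<phi> M P g (pure \<one>\<^bsub>S\<^esub> m) = g m"
    by simp
qed

lemma base_change_map_spec:
  assumes P: "Module.module R P" and g: "g \<in> module_hom R M P"
  shows "base_change_map R S \<phi> M P g \<in> module_hom S BC (base_change R S \<phi> P)"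
    and "\<And>s m. s \<in> carrier S \<Longrightarrow> m \<in> carrier M \<Longrightarrow>
      base_change_map R S \<phi> M P g (pure s m) = pure_tensor R S \<phi> P s (g m)"
proof -
  interpret P: scalar_extension R S P \<phi>
    by (intro scalar_extension.intro scalar_extension_axioms.intro R.is_cring S.is_cring P phi_hom)
  have gc: "\<And>m. m \<in> carrier M \<Longrightarrow> g m \<in> carrier P"
    using module_hom_closed [OF g] by auto
  have bil: "bilinear_extends (base_change R S \<phi> P) (\<lambda>m. pure_tensor R S \<phi> P \<one>\<^bsub>S\<^esub> (g m))"
    unfolding bilinear_extends_def
    by (auto simp: gc module_hom_add [OF g] module_hom_smult [OF g] P.pure_add_right P.pure_one_balanced)
  note spec = base_change_lift_spec [OF P.module_BC bil, folded base_change_map_def]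
  show "base_change_map R S \<phi> M P g \<in> module_hom S BC (base_change R S \<phi> P)"
    by (rule spec(1))
  fix s m assume "s \<in> carrier S" "m \<in> carrier M"
  then show "base_change_map R S \<phi> M P g (pure s m) = pure_tensor R S \<phi> P s (g m)"
    using spec(2) [of m] module_hom_smult [OF spec(1), of s "pure \<one>\<^bsub>S\<^esub> m"]
    by (simp add: pure_one_smult [of s m] P.pure_one_smult [of s "g m"])
qed

end

section \<open>Extension of scalars to a fraction field, and its flatness\<close>

locale localization_extension = scalar_extension R S M id + S: field S
  for R S :: "('s, 'y) ring_scheme" and M :: "('s, 'm, 'z) module_scheme" +
  assumes R_eq: "R = S\<lparr>carrier := carrier R\<rparr>"
    and R_sub: "carrier R \<subseteq> carrier S"
    and denominators: "\<And>s. s \<in> carrier S \<Longrightarrow> \<exists>z\<in>carrier R. z \<noteq> \<zero>\<^bsub>S\<^esub> \<and> z \<otimes>\<^bsub>S\<^esub> s \<in> carrier R"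
begin

lemma R_ops [simp]: "monoid.mult R = monoid.mult S" "add R = add S" "\<one>\<^bsub>R\<^esub> = \<one>\<^bsub>S\<^esub>" "\<zero>\<^bsub>R\<^esub> = \<zero>\<^bsub>S\<^esub>"
  using arg_cong [OF R_eq, of monoid.mult] arg_cong [OF R_eq, of add]
    arg_cong [OF R_eq, of monoid.one] arg_cong [OF R_eq, of ring.zero] by simp_all

lemma R_in_S [simp]: "r \<in> carrier R \<Longrightarrow> r \<in> carrier S"
  using R_sub by blast

lemma R_closed [simp]:
  "r \<in> carrier R \<Longrightarrow> t \<in> carrier R \<Longrightarrow> r \<otimes>\<^bsub>S\<^esub> t \<in> carrier R"
  "r \<in> carrier R \<Longrightarrow> t \<in> carrier R \<Longrightarrow> r \<oplus>\<^bsub>S\<^esub> t \<in> carrier R"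
  "\<one>\<^bsub>S\<^esub> \<in> carrier R"
  using R.m_closed R.a_closed R.one_closed by simp_all

lemma common_denominator:
  assumes "s \<in> carrier S" "t \<in> carrier S"
  obtains z where "z \<in> carrier R" "z \<noteq> \<zero>\<^bsub>S\<^esub>" "z \<otimes>\<^bsub>S\<^esub> s \<in> carrier R" "z \<otimes>\<^bsub>S\<^esub> t \<in> carrier R"
proof -
  obtain z1 z2 where z: "z1 \<in> carrier R" "z1 \<noteq> \<zero>\<^bsub>S\<^esub>" "z1 \<otimes>\<^bsub>S\<^esub> s \<in> carrier R"
      "z2 \<in> carrier R" "z2 \<noteq> \<zero>\<^bsub>S\<^esub>" "z2 \<otimes>\<^bsub>S\<^esub> t \<in> carrier R"
    using denominators assms by meson
  have "z1 \<otimes>\<^bsub>S\<^esub> z2 \<otimes>\<^bsub>S\<^esub> s = z2 \<otimes>\<^bsub>S\<^esub> (z1 \<otimes>\<^bsub>S\<^esub> s)" "z1 \<otimes>\<^bsub>S\<^esub> z2 \<otimes>\<^bsub>S\<^esub> t = z1 \<otimes>\<^bsub>S\<^esub> (z2 \<otimes>\<^bsub>S\<^esub> t)"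
    using z assms by (simp_all add: S.m_ac)
  moreover have "z1 \<otimes>\<^bsub>S\<^esub> z2 \<noteq> \<zero>\<^bsub>S\<^esub>"
    using z by (simp add: S.integral_iff)
  ultimately show ?thesis
    using that [of "z1 \<otimes>\<^bsub>S\<^esub> z2"] z by simp
qed

definition "cleared z = {s \<in> carrier S. z \<otimes>\<^bsub>S\<^esub> s \<in> carrier R} \<times> carrier M"

text \<open>Multiplication by \<open>z\<close> followed by evaluation in \<open>M\<close>, meaningful on the tensors all of whose
  coefficients \<open>z\<close> clears. Every relation is annihilated by one of these maps.\<close>

definition "clear_eval z = (SOME h. is_free_lift M TX
   (\<lambda>(s, m). if z \<otimes>\<^bsub>S\<^esub> s \<in> carrier R then (z \<otimes>\<^bsub>S\<^esub> s) \<odot>\<^bsub>M\<^esub> m else \<zero>\<^bsub>M\<^esub>) h)"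

lemma clear_eval_lift:
  "is_free_lift M TX (\<lambda>(s, m). if z \<otimes>\<^bsub>S\<^esub> s \<in> carrier R then (z \<otimes>\<^bsub>S\<^esub> s) \<odot>\<^bsub>M\<^esub> m else \<zero>\<^bsub>M\<^esub>) (clear_eval z)"
proof -
  have "\<exists>h. is_free_lift M TX (\<lambda>(s, m). if z \<otimes>\<^bsub>S\<^esub> s \<in> carrier R then (z \<otimes>\<^bsub>S\<^esub> s) \<odot>\<^bsub>M\<^esub> m else \<zero>\<^bsub>M\<^esub>) h"
    by (rule M.M.free_lift_exists) auto
  from someI_ex [OF this] show ?thesis
    unfolding clear_eval_def .
qed

lemmas clear_eval = is_free_liftD(1-5) [OF clear_eval_lift]

lemma clear_eval_frag_of:
  "s \<in> carrier S \<Longrightarrow> m \<in> carrier M \<Longrightarrow> z \<otimes>\<^bsub>S\<^esub> s \<in> carrier R \<Longrightarrow>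
     clear_eval z (frag_of (s, m)) = (z \<otimes>\<^bsub>S\<^esub> s) \<odot>\<^bsub>M\<^esub> m"
  using is_free_liftD(6) [OF clear_eval_lift, of "(s, m)" z] by simp

lemma cleared_sub: "cleared z \<subseteq> TX"
  unfolding cleared_def by auto

lemma cleared_mult:
  assumes "w \<in> carrier R" "z \<in> carrier R"
  shows "cleared z \<subseteq> cleared (w \<otimes>\<^bsub>S\<^esub> z)"
  unfolding cleared_def using assms by (auto simp: S.m_assoc)

lemma clear_eval_mult:
  assumes w: "w \<in> carrier R" and z: "z \<in> carrier R" and f: "Poly_Mapping.keys f \<subseteq> cleared z"
  shows "clear_eval (w \<otimes>\<^bsub>S\<^esub> z) f = w \<odot>\<^bsub>M\<^esub> clear_eval z f"
  using f
proof (induction rule: frag_keys_induct)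
  case zero
  then show ?case using w by (simp add: clear_eval(4))
next
  case (diff f g)
  then have "Poly_Mapping.keys f \<subseteq> TX" "Poly_Mapping.keys g \<subseteq> TX"
    using cleared_sub by blast+
  then show ?case
    using diff w by (simp add: clear_eval(1,3) M.M.minus_eq M.smult_r_distr M.smult_r_minus)
next
  case (one a)
  then obtain s m where a: "a = (s, m)" "s \<in> carrier S" "z \<otimes>\<^bsub>S\<^esub> s \<in> carrier R" "m \<in> carrier M"
    unfolding cleared_def by blast
  then have wz: "w \<otimes>\<^bsub>S\<^esub> z \<otimes>\<^bsub>S\<^esub> s = w \<otimes>\<^bsub>S\<^esub> (z \<otimes>\<^bsub>S\<^esub> s)"
    using w z by (simp add: S.m_assoc)
  moreover have "w \<otimes>\<^bsub>S\<^esub> (z \<otimes>\<^bsub>S\<^esub> s) \<in> carrier R"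
    using a w by simp
  ultimately show ?case
    using a w M.smult_assoc1 [of w "z \<otimes>\<^bsub>S\<^esub> s" m] by (simp add: clear_eval_frag_of)
qed

text \<open>A relation involves finitely many coefficients, so one nonzero \<open>z\<close> clears
  them. For a sum of two relations the product of their denominators works, because
  \<open>clear_eval_mult\<close> shows that annihilation persists under further
  multiplication.\<close>

lemma N_cleared:
  assumes "f \<in> N"
  shows "\<exists>z\<in>carrier R. z \<noteq> \<zero>\<^bsub>S\<^esub> \<and> Poly_Mapping.keys f \<subseteq> cleared z \<and> clear_eval z f = \<zero>\<^bsub>M\<^esub>"
  using assms
proof (induction rule: N_induct)
  case zero
  show ?case
    by (rule bexI [of _ "\<one>\<^bsub>S\<^esub>"]) (auto simp: clear_eval(4))
next
  case (minus f)
  then obtain z where z: "z \<in> carrier R" "z \<noteq> \<zero>\<^bsub>S\<^esub>" "Poly_Mapping.keys f \<subseteq> cleared z" "clear_eval z f = \<zero>\<^bsub>M\<^esub>"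
    by blast
  moreover have "Poly_Mapping.keys f \<subseteq> TX"
    using N_keys [OF minus(1)] .
  ultimately show ?case
    by (intro bexI [of _ z]) (simp_all add: clear_eval(5))
next
  case (add f g)
  then obtain w z where z: "z \<in> carrier R" "z \<noteq> \<zero>\<^bsub>S\<^esub>" "Poly_Mapping.keys f \<subseteq> cleared z" "clear_eval z f = \<zero>\<^bsub>M\<^esub>"
    and w: "w \<in> carrier R" "w \<noteq> \<zero>\<^bsub>S\<^esub>" "Poly_Mapping.keys g \<subseteq> cleared w" "clear_eval w g = \<zero>\<^bsub>M\<^esub>"
    by blast
  have "w \<otimes>\<^bsub>S\<^esub> z \<noteq> \<zero>\<^bsub>S\<^esub>"
    using z w by (simp add: S.integral_iff)
  moreover have comm: "w \<otimes>\<^bsub>S\<^esub> z = z \<otimes>\<^bsub>S\<^esub> w"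
    using w(1) z(1) by (intro S.m_comm) auto
  have keys: "Poly_Mapping.keys (f + g) \<subseteq> cleared (w \<otimes>\<^bsub>S\<^esub> z)"
  proof (rule order_trans [OF keys_add Un_least])
    show "Poly_Mapping.keys f \<subseteq> cleared (w \<otimes>\<^bsub>S\<^esub> z)"
      using z(3) cleared_mult [OF w(1) z(1)] by (rule order_trans)
    show "Poly_Mapping.keys g \<subseteq> cleared (w \<otimes>\<^bsub>S\<^esub> z)"
      unfolding comm using w(3) cleared_mult [OF z(1) w(1)] by (rule order_trans)
  qed
  have f0: "clear_eval (w \<otimes>\<^bsub>S\<^esub> z) f = \<zero>\<^bsub>M\<^esub>"
    unfolding clear_eval_mult [OF w(1) z(1,3)] z(4) using w(1) by (rule M.smult_r_null)
  have g0: "clear_eval (w \<otimes>\<^bsub>S\<^esub> z) g = \<zero>\<^bsub>M\<^esub>"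
    unfolding comm clear_eval_mult [OF z(1) w(1,3)] w(4) using z(1) by (rule M.smult_r_null)
  have "clear_eval (w \<otimes>\<^bsub>S\<^esub> z) (f + g) = \<zero>\<^bsub>M\<^esub>"
    unfolding clear_eval(2) [OF N_keys [OF add(1)] N_keys [OF add(2)]] f0 g0 by simp
  with keys calculation show ?case
    using R_closed(1) [OF w(1) z(1)] by blast
next
  case (incl f)
  then show ?case
  proof (cases rule: rels_cases)
    case (add_left t u m)
    obtain z where z: "z \<in> carrier R" "z \<noteq> \<zero>\<^bsub>S\<^esub>" "z \<otimes>\<^bsub>S\<^esub> t \<in> carrier R" "z \<otimes>\<^bsub>S\<^esub> u \<in> carrier R"
      using common_denominator add_left by metis
    have tu: "z \<otimes>\<^bsub>S\<^esub> (t \<oplus>\<^bsub>S\<^esub> u) = z \<otimes>\<^bsub>S\<^esub> t \<oplus>\<^bsub>S\<^esub> z \<otimes>\<^bsub>S\<^esub> u"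
      using z add_left by (simp add: S.r_distr)
    have "clear_eval z f = (z \<otimes>\<^bsub>S\<^esub> (t \<oplus>\<^bsub>S\<^esub> u)) \<odot>\<^bsub>M\<^esub> m \<ominus>\<^bsub>M\<^esub> (z \<otimes>\<^bsub>S\<^esub> t) \<odot>\<^bsub>M\<^esub> m \<ominus>\<^bsub>M\<^esub> (z \<otimes>\<^bsub>S\<^esub> u) \<odot>\<^bsub>M\<^esub> m"
      using z add_left by (simp add: clear_eval(3) clear_eval_frag_of keys_diff_X tu)
    also have "\<dots> = \<zero>\<^bsub>M\<^esub>"
      using z add_left M.smult_l_distr [of "z \<otimes>\<^bsub>S\<^esub> t" "z \<otimes>\<^bsub>S\<^esub> u" m]
      by (simp add: tu M.M.add_minus_cancel2)
    finally have "clear_eval z f = \<zero>\<^bsub>M\<^esub>" .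
    moreover have "Poly_Mapping.keys f \<subseteq> cleared z"
      unfolding add_left using add_left z
      by (intro keys_diff [THEN order_trans] Un_least) (auto simp: cleared_def tu)
    ultimately show ?thesis using z by blast
  next
    case (add_right t m n)
    obtain z where z: "z \<in> carrier R" "z \<noteq> \<zero>\<^bsub>S\<^esub>" "z \<otimes>\<^bsub>S\<^esub> t \<in> carrier R"
      using denominators add_right by metis
    have "clear_eval z f = (z \<otimes>\<^bsub>S\<^esub> t) \<odot>\<^bsub>M\<^esub> (m \<oplus>\<^bsub>M\<^esub> n) \<ominus>\<^bsub>M\<^esub> (z \<otimes>\<^bsub>S\<^esub> t) \<odot>\<^bsub>M\<^esub> m \<ominus>\<^bsub>M\<^esub> (z \<otimes>\<^bsub>S\<^esub> t) \<odot>\<^bsub>M\<^esub> n"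
      using z add_right by (simp add: clear_eval(3) clear_eval_frag_of keys_diff_X)
    also have "\<dots> = \<zero>\<^bsub>M\<^esub>"
      using z add_right by (simp add: M.smult_r_distr M.M.add_minus_cancel2)
    finally have "clear_eval z f = \<zero>\<^bsub>M\<^esub>" .
    moreover have "Poly_Mapping.keys f \<subseteq> cleared z"
      unfolding add_right using add_right z
      by (intro keys_diff [THEN order_trans] Un_least) (auto simp: cleared_def)
    ultimately show ?thesis using z by blast
  next
    case (balanced t r m)
    obtain z where z: "z \<in> carrier R" "z \<noteq> \<zero>\<^bsub>S\<^esub>" "z \<otimes>\<^bsub>S\<^esub> t \<in> carrier R"
      using denominators balanced by metis
    have tr: "z \<otimes>\<^bsub>S\<^esub> (t \<otimes>\<^bsub>S\<^esub> r) = z \<otimes>\<^bsub>S\<^esub> t \<otimes>\<^bsub>S\<^esub> r"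
      using z balanced by (simp add: S.m_assoc)
    have "clear_eval z f = (z \<otimes>\<^bsub>S\<^esub> t \<otimes>\<^bsub>S\<^esub> r) \<odot>\<^bsub>M\<^esub> m \<ominus>\<^bsub>M\<^esub> (z \<otimes>\<^bsub>S\<^esub> t) \<odot>\<^bsub>M\<^esub> (r \<odot>\<^bsub>M\<^esub> m)"
      using z balanced by (simp add: clear_eval(3) clear_eval_frag_of keys_diff_X tr)
    also have "\<dots> = \<zero>\<^bsub>M\<^esub>"
      using z balanced M.smult_assoc1 [of "z \<otimes>\<^bsub>S\<^esub> t" r m] by (simp add: M.M.minus_eq M.M.r_neg)
    finally have "clear_eval z f = \<zero>\<^bsub>M\<^esub>" .
    moreover have "Poly_Mapping.keys f \<subseteq> cleared z"
      unfolding balanced using balanced z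
      by (intro keys_diff [THEN order_trans] Un_least) (auto simp: cleared_def tr)
    ultimately show ?thesis using z by blast
  qed
qed

text \<open>A vanishing tensor lies in \<open>N\<close>, and the clearing map that annihilates it
  sends the generator of \<open>1\<close> and \<open>m\<close> to a multiple of \<open>m\<close>.
  Extending scalars to the fraction field thus forgets only torsion.\<close>

lemma torsion_of_pure_zero:
  assumes m: "m \<in> carrier M" and zero: "pure \<one>\<^bsub>S\<^esub> m = \<zero>\<^bsub>BC\<^esub>"
  shows "\<exists>z\<in>carrier R. z \<noteq> \<zero>\<^bsub>S\<^esub> \<and> z \<odot>\<^bsub>M\<^esub> m = \<zero>\<^bsub>M\<^esub>"
proof -
  have "frag_of (\<one>\<^bsub>S\<^esub>, m) \<in> N"
    using zero unfolding pure_eq zero_BC cls_eq by simp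
  from N_cleared [OF this] obtain z where "z \<in> carrier R" "z \<noteq> \<zero>\<^bsub>S\<^esub>" "clear_eval z (frag_of (\<one>\<^bsub>S\<^esub>, m)) = \<zero>\<^bsub>M\<^esub>"
    by blast
  then show ?thesis
    using m by (intro bexI [of _ z]) (simp_all add: clear_eval_frag_of)
qed

lemma BC_denominator:
  assumes "x \<in> carrier BC"
  shows "\<exists>z\<in>carrier R. z \<noteq> \<zero>\<^bsub>S\<^esub> \<and> (\<exists>m\<in>carrier M. z \<odot>\<^bsub>BC\<^esub> x = pure \<one>\<^bsub>S\<^esub> m)"
  using assms
proof (induction rule: BC_induct)
  case (pure s m)
  obtain z where z: "z \<in> carrier R" "z \<noteq> \<zero>\<^bsub>S\<^esub>" "z \<otimes>\<^bsub>S\<^esub> s \<in> carrier R"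
    using denominators pure by metis
  have "z \<odot>\<^bsub>BC\<^esub> pure s m = pure \<one>\<^bsub>S\<^esub> ((z \<otimes>\<^bsub>S\<^esub> s) \<odot>\<^bsub>M\<^esub> m)"
    using z pure by (simp add: pure_smult pure_balanced)
  then show ?case
    using z pure by blast
next
  case (diff x y)
  then obtain w z m n where z: "z \<in> carrier R" "z \<noteq> \<zero>\<^bsub>S\<^esub>" "m \<in> carrier M" "z \<odot>\<^bsub>BC\<^esub> x = pure \<one>\<^bsub>S\<^esub> m"
    and w: "w \<in> carrier R" "w \<noteq> \<zero>\<^bsub>S\<^esub>" "n \<in> carrier M" "w \<odot>\<^bsub>BC\<^esub> y = pure \<one>\<^bsub>S\<^esub> n"
    by blast
  have neg: "\<ominus>\<^bsub>S\<^esub> z \<in> carrier R"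
  proof -
    have "\<ominus>\<^bsub>R\<^esub> z \<oplus>\<^bsub>S\<^esub> z = \<zero>\<^bsub>S\<^esub>" "\<ominus>\<^bsub>R\<^esub> z \<in> carrier R"
      using R.l_neg [OF z(1)] z(1) by simp_all
    then show ?thesis
      using S.minus_equality [of "\<ominus>\<^bsub>R\<^esub> z" z] z(1) by simp
  qed
  have "(w \<otimes>\<^bsub>S\<^esub> z) \<odot>\<^bsub>BC\<^esub> (x \<ominus>\<^bsub>BC\<^esub> y) = w \<odot>\<^bsub>BC\<^esub> (z \<odot>\<^bsub>BC\<^esub> x) \<oplus>\<^bsub>BC\<^esub> (\<ominus>\<^bsub>S\<^esub> z) \<odot>\<^bsub>BC\<^esub> (w \<odot>\<^bsub>BC\<^esub> y)"
  proof -
    have "(w \<otimes>\<^bsub>S\<^esub> z) \<odot>\<^bsub>BC\<^esub> (x \<ominus>\<^bsub>BC\<^esub> y) = (w \<otimes>\<^bsub>S\<^esub> z) \<odot>\<^bsub>BC\<^esub> x \<oplus>\<^bsub>BC\<^esub> (\<ominus>\<^bsub>S\<^esub> (z \<otimes>\<^bsub>S\<^esub> w)) \<odot>\<^bsub>BC\<^esub> y"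
      using w(1) z(1) diff(1,2)
      by (simp add: BC.M.minus_eq BC.smult_r_distr BC.smult_r_minus BC.smult_l_minus S.m_comm)
    then show ?thesis
      using w(1) z(1) diff(1,2) by (simp add: BC.smult_assoc1 [symmetric] S.l_minus)
  qed
  also have "\<dots> = pure \<one>\<^bsub>S\<^esub> (w \<odot>\<^bsub>M\<^esub> m \<oplus>\<^bsub>M\<^esub> (\<ominus>\<^bsub>S\<^esub> z) \<odot>\<^bsub>M\<^esub> n)"
    using w z neg by (simp add: pure_add_right pure_one_balanced)
  finally have "(w \<otimes>\<^bsub>S\<^esub> z) \<odot>\<^bsub>BC\<^esub> (x \<ominus>\<^bsub>BC\<^esub> y) = pure \<one>\<^bsub>S\<^esub> (w \<odot>\<^bsub>M\<^esub> m \<oplus>\<^bsub>M\<^esub> (\<ominus>\<^bsub>S\<^esub> z) \<odot>\<^bsub>M\<^esub> n)" .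
  moreover have "w \<otimes>\<^bsub>S\<^esub> z \<noteq> \<zero>\<^bsub>S\<^esub>"
    using z w by (simp add: S.integral_iff)
  moreover have "w \<otimes>\<^bsub>S\<^esub> z \<in> carrier R" "w \<odot>\<^bsub>M\<^esub> m \<oplus>\<^bsub>M\<^esub> (\<ominus>\<^bsub>S\<^esub> z) \<odot>\<^bsub>M\<^esub> n \<in> carrier M"
    using w z neg by simp_all
  ultimately show ?case by blast
qed

text \<open>Flatness by clearing denominators. A multiple of \<open>x\<close> has the form of
  \<open>1\<close> tensored with \<open>m\<close>; its image vanishes, so some multiple of
  \<open>g m\<close> is zero, then the same multiple of \<open>m\<close> is zero by injectivity, and
  both multipliers are invertible in \<open>S\<close>.\<close>

lemma base_change_map_inj:
  assumes P: "Module.module R P" and g: "g \<in> module_hom R M P"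
    and inj: "\<And>m. m \<in> carrier M \<Longrightarrow> g m = \<zero>\<^bsub>P\<^esub> \<Longrightarrow> m = \<zero>\<^bsub>M\<^esub>"
    and x: "x \<in> carrier BC" and zero: "base_change_map R S id M P g x = \<zero>\<^bsub>base_change R S id P\<^esub>"
  shows "x = \<zero>\<^bsub>BC\<^esub>"
proof -
  interpret P: localization_extension R S P
    by (intro localization_extension.intro localization_extension_axioms.intro scalar_extension.intro
        scalar_extension_axioms.intro R.is_cring S.is_cring P phi_hom S.field_axioms R_eq R_sub denominators)
  let ?f = "base_change_map R S id M P g"
  have f: "?f \<in> module_hom S BC P.BC"
    using P g by (rule base_change_map_spec)
  have gc: "\<And>m. m \<in> carrier M \<Longrightarrow> g m \<in> carrier P"
    using module_hom_closed [OF g] by auto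
  obtain z m where z: "z \<in> carrier R" "z \<noteq> \<zero>\<^bsub>S\<^esub>" "m \<in> carrier M" "z \<odot>\<^bsub>BC\<^esub> x = pure \<one>\<^bsub>S\<^esub> m"
    using BC_denominator [OF x] by blast
  have "P.pure \<one>\<^bsub>S\<^esub> (g m) = ?f (z \<odot>\<^bsub>BC\<^esub> x)"
    using z base_change_map_spec(2) [OF P g, of "\<one>\<^bsub>S\<^esub>" m] by simp
  also have "\<dots> = z \<odot>\<^bsub>P.BC\<^esub> ?f x"
    using z(1) x by (intro module_hom_smult [OF f]) auto
  also have "\<dots> = \<zero>\<^bsub>P.BC\<^esub>"
    unfolding zero using z(1) by (intro P.BC.smult_r_null) auto
  finally obtain w where w: "w \<in> carrier R" "w \<noteq> \<zero>\<^bsub>S\<^esub>" "w \<odot>\<^bsub>P\<^esub> g m = \<zero>\<^bsub>P\<^esub>"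
    using P.torsion_of_pure_zero [OF gc [OF z(3)]] by blast
  have "g (w \<odot>\<^bsub>M\<^esub> m) = \<zero>\<^bsub>P\<^esub>"
    using w z by (simp add: module_hom_smult [OF g])
  then have "w \<odot>\<^bsub>M\<^esub> m = \<zero>\<^bsub>M\<^esub>"
    using w z by (intro inj) auto
  then have "pure \<one>\<^bsub>S\<^esub> (w \<odot>\<^bsub>M\<^esub> m) = pure \<one>\<^bsub>S\<^esub> (\<zero>\<^bsub>S\<^esub> \<odot>\<^bsub>M\<^esub> m)"
    using z M.smult_l_null by simp
  then have "w \<odot>\<^bsub>BC\<^esub> (z \<odot>\<^bsub>BC\<^esub> x) = \<zero>\<^bsub>S\<^esub> \<odot>\<^bsub>BC\<^esub> (z \<odot>\<^bsub>BC\<^esub> x)"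
    using w z pure_one_balanced [of m w] pure_one_balanced [of m "\<zero>\<^bsub>S\<^esub>"] R.zero_closed by simp
  then have "(w \<otimes>\<^bsub>S\<^esub> z) \<odot>\<^bsub>BC\<^esub> x = \<zero>\<^bsub>BC\<^esub>"
    using w z x by (simp add: BC.smult_assoc1)
  moreover have "w \<otimes>\<^bsub>S\<^esub> z \<in> Units S"
    using w z by (simp add: S.field_Units S.integral_iff)
  ultimately have "inv\<^bsub>S\<^esub> (w \<otimes>\<^bsub>S\<^esub> z) \<odot>\<^bsub>BC\<^esub> ((w \<otimes>\<^bsub>S\<^esub> z) \<odot>\<^bsub>BC\<^esub> x) = \<zero>\<^bsub>BC\<^esub>"
    by simp
  then show ?thesis
    using \<open>w \<otimes>\<^bsub>S\<^esub> z \<in> Units S\<close> w z x by (simp flip: BC.smult_assoc1)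
qed

end

subsection \<open>Non-archimedean absolute values and completions\<close>

text \<open>One development of completions for two uses, the p-adic numbers and the completions of
  subfields at their places. For places the strong triangle inequality is derived later, in
  \<open>nonarch_of_bounded\<close>.\<close>

locale nonarch =
  fixes F :: "'a::field set" and w :: "'a \<Rightarrow> real"
  assumes zero_mem [simp]: "0 \<in> F" and one_mem [simp]: "1 \<in> F"
    and add_mem [simp]: "x \<in> F \<Longrightarrow> y \<in> F \<Longrightarrow> x + y \<in> F"
    and mult_mem [simp]: "x \<in> F \<Longrightarrow> y \<in> F \<Longrightarrow> x * y \<in> F"
    and uminus_mem [simp]: "x \<in> F \<Longrightarrow> - x \<in> F"
    and inverse_mem [simp]: "x \<in> F \<Longrightarrow> inverse x \<in> F"
    and nonneg [simp]: "x \<in> F \<Longrightarrow> 0 \<le> w x"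
    and eq_0_iff: "x \<in> F \<Longrightarrow> w x = 0 \<longleftrightarrow> x = 0"
    and mult: "x \<in> F \<Longrightarrow> y \<in> F \<Longrightarrow> w (x * y) = w x * w y"
    and add_le_max: "x \<in> F \<Longrightarrow> y \<in> F \<Longrightarrow> w (x + y) \<le> max (w x) (w y)"
begin

lemma diff_mem [simp]: "x \<in> F \<Longrightarrow> y \<in> F \<Longrightarrow> x - y \<in> F"
  using add_mem [of x "- y"] by simp

lemma divide_mem [simp]: "x \<in> F \<Longrightarrow> y \<in> F \<Longrightarrow> x / y \<in> F"
  by (simp add: divide_inverse)

lemma power_mem [simp]: "x \<in> F \<Longrightarrow> x ^ k \<in> F"
  by (induction k) auto

lemma of_nat_mem [simp]: "of_nat k \<in> F"
  by (induction k) auto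

lemma of_int_mem [simp]: "of_int k \<in> F"
  by (cases k rule: int_cases2) auto

lemma sum_mem [simp]: "(\<And>i. i \<in> I \<Longrightarrow> f i \<in> F) \<Longrightarrow> sum f I \<in> F"
  by (induction I rule: infinite_finite_induct) auto

lemma w_0 [simp]: "w 0 = 0"
  by (simp add: eq_0_iff)

lemma w_1 [simp]: "w 1 = 1"
  using mult [of 1 1] eq_0_iff [of 1] by simp

lemma w_minus [simp]: "x \<in> F \<Longrightarrow> w (- x) = w x"
proof -
  have "w (-1) * w (-1) = 1"
    using mult [of "-1" "-1"] by simp
  moreover have "0 \<le> w (-1)" by simp
  ultimately have "w (-1) = 1"
    by (auto simp: square_eq_1_iff)
  moreover assume "x \<in> F"
  ultimately show ?thesis
    using mult [of "-1" x] by simp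
qed

lemma pos: "x \<in> F \<Longrightarrow> x \<noteq> 0 \<Longrightarrow> 0 < w x"
  using nonneg [of x] eq_0_iff [of x] by linarith

lemma diff_le_max: "x \<in> F \<Longrightarrow> y \<in> F \<Longrightarrow> w (x - y) \<le> max (w x) (w y)"
  using add_le_max [of x "- y"] by simp

lemma w_commute: "x \<in> F \<Longrightarrow> y \<in> F \<Longrightarrow> w (x - y) = w (y - x)"
  using w_minus [of "x - y"] by simp

lemma diff_triangle_max: "x \<in> F \<Longrightarrow> y \<in> F \<Longrightarrow> z \<in> F \<Longrightarrow> w (x - z) \<le> max (w (x - y)) (w (y - z))"
  using add_le_max [of "x - y" "y - z"] by simp

lemma w_power [simp]: "x \<in> F \<Longrightarrow> w (x ^ k) = w x ^ k"
  by (induction k) (auto simp: mult)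

lemma w_inverse [simp]: "x \<in> F \<Longrightarrow> w (inverse x) = inverse (w x)"
proof (cases "x = 0")
  case False
  assume x: "x \<in> F"
  then have "w x * w (inverse x) = 1"
    using mult [of x "inverse x"] False by simp
  then show ?thesis
    by (metis inverse_unique)
qed simp

lemma sum_le:
  assumes "0 \<le> B" "\<And>i. i \<in> I \<Longrightarrow> f i \<in> F" "\<And>i. i \<in> I \<Longrightarrow> w (f i) \<le> B"
  shows "w (sum f I) \<le> B"
  using assms(2,3)
proof (induction I rule: infinite_finite_induct)
  case (insert i I)
  then have "w (f i + sum f I) \<le> max (w (f i)) (w (sum f I))"
    by (intro add_le_max) auto
  also have "\<dots> \<le> B"
    using insert by auto
  finally show ?case using insert by simp
qed (use assms(1) in auto)

lemma w_of_nat: "w (of_nat k) \<le> 1"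
proof (induction k)
  case (Suc k)
  have "w (1 + of_nat k) \<le> max (w 1) (w (of_nat k))"
    by (intro add_le_max) auto
  with Suc show ?case by simp
qed simp

lemma w_of_int: "w (of_int k) \<le> 1"
  by (cases k rule: int_cases2) (use w_of_nat in auto)

text \<open>The isosceles triangle principle: in an ultrametric the two longest sides are
  equal.\<close>

lemma w_eq_of_diff_less:
  assumes "x \<in> F" "y \<in> F" "w (x - y) < w y"
  shows "w x = w y"
proof -
  have "w x \<le> max (w (x - y)) (w y)"
    using add_le_max [of "x - y" y] assms by simp
  moreover have "w y \<le> max (w (y - x)) (w x)"
    using add_le_max [of "y - x" x] assms by simp
  ultimately show ?thesis
    using assms w_commute [of x y] by auto
qed

abbreviation "C \<equiv> cauchy_seqs F w"
abbreviation "NS \<equiv> null_seqs F w"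
abbreviation "CR \<equiv> cauchy_ring F w"
abbreviation "Q \<equiv> completion F w"
abbreviation "Abs \<equiv> completion_abs w"

lemma cauchyI:
  assumes "\<And>n. s n \<in> F" "\<And>e. e > 0 \<Longrightarrow> \<exists>N. \<forall>m\<ge>N. \<forall>n\<ge>N. w (s m - s n) < e"
  shows "s \<in> C"
  unfolding cauchy_seqs_def using assms by auto

lemma cauchy_mem: "s \<in> C \<Longrightarrow> s n \<in> F"
  unfolding cauchy_seqs_def by auto

lemma cauchyD: "s \<in> C \<Longrightarrow> e > 0 \<Longrightarrow> \<exists>N. \<forall>m\<ge>N. \<forall>n\<ge>N. w (s m - s n) < e"
  unfolding cauchy_seqs_def by auto

lemma null_mem: "s \<in> NS \<Longrightarrow> s n \<in> F"
  unfolding null_seqs_def by auto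

lemma nullI: "(\<And>n. s n \<in> F) \<Longrightarrow> (\<lambda>n. w (s n)) \<longlonglongrightarrow> 0 \<Longrightarrow> s \<in> NS"
  unfolding null_seqs_def by auto

lemma nullD: "s \<in> NS \<Longrightarrow> (\<lambda>n. w (s n)) \<longlonglongrightarrow> 0"
  unfolding null_seqs_def by auto

lemma null_leI:
  assumes "\<And>n. s n \<in> F" "\<And>n. w (s n) \<le> g n" "g \<longlonglongrightarrow> 0"
  shows "s \<in> NS"
  by (rule nullI [OF assms(1) tendsto_sandwich [OF _ _ tendsto_const assms(3)]]) (use assms in auto)

lemma cauchy_const [simp]: "x \<in> F \<Longrightarrow> (\<lambda>_. x) \<in> C"
  by (rule cauchyI) auto

lemma cauchy_convergent:
  assumes s: "s \<in> C"
  shows "convergent (\<lambda>n. w (s n))"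
proof -
  have "Cauchy (\<lambda>n. w (s n))"
  proof (rule CauchyI)
    fix e :: real assume "e > 0"
    then obtain N where N: "\<forall>m\<ge>N. \<forall>n\<ge>N. w (s m - s n) < e"
      using cauchyD [OF s] by blast
    have "norm (w (s m) - w (s n)) < e" if "m \<ge> N" "n \<ge> N" for m n
    proof -
      have "w (s m) \<le> max (w (s m - s n)) (w (s n))" "w (s n) \<le> max (w (s n - s m)) (w (s m))"
        using add_le_max [of "s m - s n" "s n"] add_le_max [of "s n - s m" "s m"] cauchy_mem [OF s] by auto
      moreover have "w (s m - s n) < e" "w (s n - s m) < e" "w (s m) \<ge> 0" "w (s n) \<ge> 0"
        using N that cauchy_mem [OF s] by auto
      ultimately show ?thesis using \<open>e > 0\<close> by (auto simp: max_def split: if_splits)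
    qed
    then show "\<exists>M. \<forall>m\<ge>M. \<forall>n\<ge>M. norm (w (s m) - w (s n)) < e" by blast
  qed
  then show ?thesis by (rule Cauchy_convergent)
qed

lemma cauchy_bounded:
  assumes "s \<in> C"
  obtains B where "B > 0" "\<And>n. w (s n) \<le> B"
proof -
  have "Bseq (\<lambda>n. w (s n))"
    by (rule convergent_imp_Bseq [OF cauchy_convergent [OF assms]])
  then obtain B where B: "B > 0" "\<And>n. norm (w (s n)) \<le> B"
    by (rule BseqE) blast
  have "w (s n) \<le> B" for n
    using B(2) [of n] by simp
  with B(1) show ?thesis by (rule that)
qed

lemma cauchy_add [simp]:
  assumes "s \<in> C" "t \<in> C" shows "(\<lambda>n. s n + t n) \<in> C"
proof (rule cauchyI)
  fix e :: real assume "e > 0"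
  then obtain N M where N: "\<forall>m\<ge>N. \<forall>n\<ge>N. w (s m - s n) < e" and M: "\<forall>m\<ge>M. \<forall>n\<ge>M. w (t m - t n) < e"
    using cauchyD assms by meson
  have "w (s m + t m - (s n + t n)) < e" if "m \<ge> max N M" "n \<ge> max N M" for m n
  proof -
    have "w ((s m - s n) + (t m - t n)) \<le> max (w (s m - s n)) (w (t m - t n))"
      using assms by (intro add_le_max diff_mem cauchy_mem)
    also have "\<dots> < e" using N M that by simp
    finally show ?thesis by (simp add: algebra_simps)
  qed
  then show "\<exists>N. \<forall>m\<ge>N. \<forall>n\<ge>N. w (s m + t m - (s n + t n)) < e" by blast
qed (use assms cauchy_mem in auto)

lemma cauchy_mult [simp]:
  assumes s: "s \<in> C" and t: "t \<in> C" shows "(\<lambda>n. s n * t n) \<in> C"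
proof (rule cauchyI)
  fix e :: real assume "e > 0"
  obtain A where A: "A > 0" "\<And>n. w (s n) \<le> A" using cauchy_bounded [OF s] by blast
  obtain B where B: "B > 0" "\<And>n. w (t n) \<le> B" using cauchy_bounded [OF t] by blast
  have "e / B > 0" "e / A > 0" using \<open>e > 0\<close> A B by auto
  then obtain N M where N: "\<forall>m\<ge>N. \<forall>n\<ge>N. w (s m - s n) < e / B" and M: "\<forall>m\<ge>M. \<forall>n\<ge>M. w (t m - t n) < e / A"
    using cauchyD s t by meson
  have "w (s m * t m - s n * t n) < e" if "m \<ge> max N M" "n \<ge> max N M" for m n
  proof -
    have "w (s m * (t m - t n) + t n * (s m - s n)) \<le> max (w (s m * (t m - t n))) (w (t n * (s m - s n)))"
      using s t by (intro add_le_max mult_mem diff_mem cauchy_mem)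
    also have "\<dots> = max (w (s m) * w (t m - t n)) (w (t n) * w (s m - s n))"
      using s t by (simp add: mult cauchy_mem)
    also have "\<dots> < e"
    proof -
      have "w (s m) * w (t m - t n) \<le> A * w (t m - t n)"
        using A s t by (intro mult_right_mono) (auto simp: cauchy_mem)
      also have "\<dots> < e" using M that A by (simp add: field_simps)
      finally have 1: "w (s m) * w (t m - t n) < e" .
      have "w (t n) * w (s m - s n) \<le> B * w (s m - s n)"
        using B s t by (intro mult_right_mono) (auto simp: cauchy_mem)
      also have "\<dots> < e" using N that B by (simp add: field_simps)
      finally show ?thesis using 1 by simp
    qed
    finally show ?thesis by (simp add: algebra_simps)
  qed
  then show "\<exists>N. \<forall>m\<ge>N. \<forall>n\<ge>N. w (s m * t m - s n * t n) < e" by blast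
qed (use s t cauchy_mem in auto)

lemma cauchy_minus [simp]: "s \<in> C \<Longrightarrow> (\<lambda>n. - s n) \<in> C"
  using cauchy_mult [OF cauchy_const [of "-1"], of s] by simp

lemma cauchy_diff [simp]: "s \<in> C \<Longrightarrow> t \<in> C \<Longrightarrow> (\<lambda>n. s n - t n) \<in> C"
  using cauchy_add [of s "\<lambda>n. - t n"] by simp

lemma cauchy_power [simp]: "s \<in> C \<Longrightarrow> (\<lambda>n. s n ^ k) \<in> C"
  by (induction k) auto

lemma null_cauchy:
  assumes "s \<in> NS" shows "s \<in> C"
proof (rule cauchyI)
  fix e :: real assume "e > 0"
  then obtain N where N: "\<And>n. n \<ge> N \<Longrightarrow> w (s n) < e"
    using order_tendstoD(2) [OF nullD [OF assms]] unfolding eventually_sequentially by blast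
  have "w (s m - s n) < e" if "m \<ge> N" "n \<ge> N" for m n
    using diff_le_max [of "s m" "s n"] null_mem [OF assms] N [OF that(1)] N [OF that(2)] by fastforce
  then show "\<exists>N. \<forall>m\<ge>N. \<forall>n\<ge>N. w (s m - s n) < e" by blast
qed (use assms null_mem in auto)

lemma null_zero [simp]: "(\<lambda>_. 0) \<in> NS"
  by (rule nullI) auto

lemma null_add [simp]:
  assumes "s \<in> NS" "t \<in> NS" shows "(\<lambda>n. s n + t n) \<in> NS"
proof (rule null_leI)
  show "w (s n + t n) \<le> max (w (s n)) (w (t n))" for n
    using assms by (intro add_le_max null_mem)
  show "(\<lambda>n. max (w (s n)) (w (t n))) \<longlonglongrightarrow> 0"
    using tendsto_max [OF nullD [OF assms(1)] nullD [OF assms(2)]] by simp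
qed (use assms null_mem in auto)

lemma null_mult [simp]:
  assumes "s \<in> NS" "t \<in> C" shows "(\<lambda>n. s n * t n) \<in> NS"
proof -
  obtain B where B: "B > 0" "\<And>n. w (t n) \<le> B" using cauchy_bounded [OF assms(2)] by blast
  show ?thesis
  proof (rule null_leI)
    show "w (s n * t n) \<le> w (s n) * B" for n
      using assms B by (simp add: mult null_mem cauchy_mem mult_left_mono)
    show "(\<lambda>n. w (s n) * B) \<longlonglongrightarrow> 0"
      by (rule tendsto_mult_left_zero [OF nullD [OF assms(1)]])
  qed (use assms null_mem cauchy_mem in auto)
qed

lemma null_minus [simp]: "s \<in> NS \<Longrightarrow> (\<lambda>n. - s n) \<in> NS"
  using null_mult [of s "\<lambda>_. -1"] by simp

lemma CR_simps [simp]: "carrier CR = C" "s \<otimes>\<^bsub>CR\<^esub> t = (\<lambda>n. s n * t n)" "\<one>\<^bsub>CR\<^esub> = (\<lambda>_. 1)"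
  "\<zero>\<^bsub>CR\<^esub> = (\<lambda>_. 0)" "s \<oplus>\<^bsub>CR\<^esub> t = (\<lambda>n. s n + t n)"
  unfolding cauchy_ring_def by simp_all

lemma cring_CR: "cring CR"
proof (rule cringI)
  show "abelian_group CR"
  proof (rule abelian_groupI)
    fix s assume "s \<in> carrier CR"
    then show "\<exists>t\<in>carrier CR. t \<oplus>\<^bsub>CR\<^esub> s = \<zero>\<^bsub>CR\<^esub>"
      by (intro bexI [of _ "\<lambda>n. - s n"]) auto
  qed (auto simp: ac_simps)
  show "Group.comm_monoid CR"
    by (rule comm_monoidI) (auto simp: ac_simps)
qed (auto simp: algebra_simps)

sublocale CR: cring CR
  by (rule cring_CR)

lemma CR_minus: "s \<in> C \<Longrightarrow> \<ominus>\<^bsub>CR\<^esub> s = (\<lambda>n. - s n)"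
  by (rule CR.minus_equality) auto

lemma ideal_NS: "ideal NS CR"
proof (rule idealI)
  show "ring CR" by (rule CR.ring_axioms)
  show "subgroup NS (add_monoid CR)"
  proof (rule CR.add.subgroupI)
    show "NS \<subseteq> carrier CR" using null_cauchy by auto
    show "NS \<noteq> {}" using null_zero by blast
    fix s assume "s \<in> NS"
    then show "\<ominus>\<^bsub>CR\<^esub> s \<in> NS"
      using CR_minus [of s] null_cauchy [of s] by simp
  qed auto
  show "\<And>a x. \<lbrakk>a \<in> NS; x \<in> carrier CR\<rbrakk> \<Longrightarrow> x \<otimes>\<^bsub>CR\<^esub> a \<in> NS"
    using null_mult by (simp add: mult.commute)
qed auto

sublocale NS: ideal NS CR
  by (rule ideal_NS)

sublocale Q: cring Q
  unfolding completion_def by (rule NS.quotient_is_cring) (rule cring_CR)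

definition "cls s = NS +>\<^bsub>CR\<^esub> s"

lemma cls_iff: "cls s = {\<lambda>n. u n + s n | u. u \<in> NS}"
  unfolding cls_def a_r_coset_def r_coset_def by auto

lemma carrier_Q: "carrier Q = cls ` C"
  unfolding completion_def FactRing_def cls_def A_RCOSETS_def' by auto

lemma cls_closed [simp]: "s \<in> C \<Longrightarrow> cls s \<in> carrier Q"
  unfolding carrier_Q by blast

lemma add_Q [simp]: "s \<in> C \<Longrightarrow> t \<in> C \<Longrightarrow> cls s \<oplus>\<^bsub>Q\<^esub> cls t = cls (\<lambda>n. s n + t n)"
  using ring_hom_add [OF NS.rcos_ring_hom, of s t] unfolding completion_def cls_def by simp

lemma mult_Q [simp]: "s \<in> C \<Longrightarrow> t \<in> C \<Longrightarrow> cls s \<otimes>\<^bsub>Q\<^esub> cls t = cls (\<lambda>n. s n * t n)"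
  using ring_hom_mult [OF NS.rcos_ring_hom, of s t] unfolding completion_def cls_def by simp

lemma one_Q: "\<one>\<^bsub>Q\<^esub> = cls (\<lambda>_. 1)"
  using ring_hom_one [OF NS.rcos_ring_hom] unfolding completion_def cls_def by simp

lemma self_mem: "s \<in> cls s"
  unfolding cls_iff using null_zero by force

lemma cls_eq:
  assumes "s \<in> C" "t \<in> C"
  shows "cls s = cls t \<longleftrightarrow> (\<lambda>n. s n - t n) \<in> NS"
proof
  assume eq: "cls s = cls t"
  have "s \<in> cls s"
    by (rule self_mem)
  then obtain u where "u \<in> NS" "s = (\<lambda>n. u n + t n)"
    unfolding eq unfolding cls_iff by blast
  then show "(\<lambda>n. s n - t n) \<in> NS" by simp
next
  assume d: "(\<lambda>n. s n - t n) \<in> NS"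
  have sub: "cls s' \<subseteq> cls t'" if d': "(\<lambda>n. s' n - t' n) \<in> NS" for s' t'
  proof
    fix x assume "x \<in> cls s'"
    then obtain u where u: "u \<in> NS" "x = (\<lambda>n. u n + s' n)" unfolding cls_iff by blast
    have "x = (\<lambda>n. (u n + (s' n - t' n)) + t' n)" by (simp add: u(2))
    then show "x \<in> cls t'"
      unfolding cls_iff mem_Collect_eq
      using null_add [OF u(1) d'] by (intro exI [of _ "\<lambda>n. u n + (s' n - t' n)"] conjI)
  qed
  have "(\<lambda>n. t n - s n) \<in> NS" using null_minus [OF d] by simp
  with d show "cls s = cls t" using sub by blast
qed

lemma zero_Q: "\<zero>\<^bsub>Q\<^esub> = cls (\<lambda>_. 0)"
proof -
  have "\<zero>\<^bsub>Q\<^esub> = NS" unfolding completion_def FactRing_def by simp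
  also have "NS = cls (\<lambda>_. 0)" unfolding cls_iff by simp
  finally show ?thesis .
qed

lemma uminus_Q [simp]: "s \<in> C \<Longrightarrow> \<ominus>\<^bsub>Q\<^esub> cls s = cls (\<lambda>n. - s n)"
  by (rule Q.minus_equality) (auto simp: zero_Q)

lemma minus_Q [simp]: "s \<in> C \<Longrightarrow> t \<in> C \<Longrightarrow> cls s \<ominus>\<^bsub>Q\<^esub> cls t = cls (\<lambda>n. s n - t n)"
  by (simp add: Q.minus_eq)

lemma pow_Q [simp]: "s \<in> C \<Longrightarrow> cls s [^]\<^bsub>Q\<^esub> (k::nat) = cls (\<lambda>n. s n ^ k)"
  by (induction k) (auto simp: one_Q mult.commute)

lemma emb_eq: "completion_emb F w x = cls (\<lambda>_. x)"
  unfolding completion_emb_def cls_def ..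

text \<open>Justifies the definite description in \<open>completion_abs\<close>: representatives
  differ by a null sequence \<open>u\<close>, and by the ultrametric inequality their values differ
  by at most \<open>w (u n)\<close>.\<close>

lemma abs_lim:
  assumes "s \<in> C"
  shows "(\<lambda>n. w (s n)) \<longlonglongrightarrow> Abs (cls s)"
proof -
  obtain l where l: "(\<lambda>n. w (s n)) \<longlonglongrightarrow> l"
    using cauchy_convergent [OF assms] unfolding convergent_def by blast
  have all: "(\<lambda>n. w (t n)) \<longlonglongrightarrow> l" if "t \<in> cls s" for t
  proof -
    from that obtain u where u: "t = (\<lambda>n. u n + s n)" "u \<in> NS"
      unfolding cls_iff mem_Collect_eq by (elim exE conjE)
    have bound: "\<bar>w (t n) - w (s n)\<bar> \<le> w (u n)" for n
    proof -
      have tn: "t n = u n + s n" by (simp only: u(1))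
      have m: "u n \<in> F" "s n \<in> F" by (rule null_mem [OF u(2)], rule cauchy_mem [OF assms])
      have "w (t n) \<le> max (w (u n)) (w (s n))"
        unfolding tn by (rule add_le_max [OF m])
      moreover have "w (s n) \<le> max (w (t n)) (w (u n))"
        using diff_le_max [of "u n + s n" "u n"] m unfolding tn by simp
      moreover have "w (u n) \<ge> 0" "w (s n) \<ge> 0" "w (t n) \<ge> 0"
        unfolding tn using m by simp_all
      ultimately show ?thesis by linarith
    qed
    have "(\<lambda>n. w (t n) - w (s n)) \<longlonglongrightarrow> 0"
      by (rule tendsto_0_le [OF nullD [OF u(2)], where K = 1])
         (auto intro!: always_eventually order_trans [OF bound abs_ge_self])
    from tendsto_add [OF this l] show ?thesis by (simp only: diff_add_cancel add_0_left)
  qed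
  have s: "s \<in> cls s"
    by (rule self_mem)
  have "Abs (cls s) = l"
    unfolding completion_abs_def
  proof (rule the_equality)
    show "\<forall>t\<in>cls s. (\<lambda>n. w (t n)) \<longlonglongrightarrow> l" by (intro ballI all)
    fix r assume "\<forall>t\<in>cls s. (\<lambda>n. w (t n)) \<longlonglongrightarrow> r"
    from LIMSEQ_unique [OF bspec [OF this s] l] show "r = l" .
  qed
  then show ?thesis using l by simp
qed

lemma abs_le:
  assumes "s \<in> C" "eventually (\<lambda>n. w (s n) \<le> e) sequentially"
  shows "Abs (cls s) \<le> e"
  using tendsto_upperbound [OF abs_lim [OF assms(1)] assms(2)] by simp

lemma abs_less:
  assumes "s \<in> C" "Abs (cls s) < e"
  shows "eventually (\<lambda>n. w (s n) < e) sequentially"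
  using order_tendstoD(2) [OF abs_lim [OF assms(1)] assms(2)] .

lemma abs_const [simp]: "x \<in> F \<Longrightarrow> Abs (cls (\<lambda>_. x)) = w x"
  using abs_lim [of "\<lambda>_. x"] by (simp add: LIMSEQ_const_iff)

lemma abs_nonneg:
  assumes "x \<in> carrier Q"
  shows "0 \<le> Abs x"
proof -
  obtain s where s: "s \<in> C" "x = cls s"
    using assms unfolding carrier_Q by blast
  show ?thesis
    unfolding s(2) using s(1) by (intro LIMSEQ_le_const [OF abs_lim [OF s(1)]]) (simp add: cauchy_mem)
qed

lemma abs_mult:
  assumes "x \<in> carrier Q" "y \<in> carrier Q"
  shows "Abs (x \<otimes>\<^bsub>Q\<^esub> y) = Abs x * Abs y"
proof -
  obtain s t where st: "s \<in> C" "t \<in> C" "x = cls s" "y = cls t"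
    using assms unfolding carrier_Q by blast
  have "(\<lambda>n. w (s n * t n)) \<longlonglongrightarrow> Abs (cls s) * Abs (cls t)"
    using tendsto_mult [OF abs_lim [OF st(1)] abs_lim [OF st(2)]] st by (simp add: mult cauchy_mem)
  moreover have "(\<lambda>n. w (s n * t n)) \<longlonglongrightarrow> Abs (cls (\<lambda>n. s n * t n))"
    using st by (intro abs_lim) auto
  ultimately show ?thesis
    using st LIMSEQ_unique [of "\<lambda>n. w (s n * t n)"] by simp
qed

lemma abs_add_le:
  assumes "x \<in> carrier Q" "y \<in> carrier Q"
  shows "Abs (x \<oplus>\<^bsub>Q\<^esub> y) \<le> max (Abs x) (Abs y)"
proof -
  obtain s t where st: "s \<in> C" "t \<in> C" "x = cls s" "y = cls t"
    using assms unfolding carrier_Q by blast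
  have "Abs (cls (\<lambda>n. s n + t n)) \<le> max (Abs (cls s)) (Abs (cls t))"
  proof (rule LIMSEQ_le [OF abs_lim tendsto_max [OF abs_lim [OF st(1)] abs_lim [OF st(2)]]])
    show "\<exists>N. \<forall>n\<ge>N. w (s n + t n) \<le> max (w (s n)) (w (t n))"
      using st by (intro exI allI impI add_le_max cauchy_mem)
  qed (use st in auto)
  then show ?thesis using st by simp
qed

lemma abs_one: "Abs \<one>\<^bsub>Q\<^esub> = 1"
  by (simp add: one_Q)

lemma abs_uminus: "x \<in> carrier Q \<Longrightarrow> Abs (\<ominus>\<^bsub>Q\<^esub> x) = Abs x"
proof -
  assume "x \<in> carrier Q"
  then obtain s where s: "s \<in> C" "x = cls s" unfolding carrier_Q by blast
  have "(\<lambda>n. w (- s n)) \<longlonglongrightarrow> Abs (cls (\<lambda>n. - s n))"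
    using s by (intro abs_lim) auto
  then have "(\<lambda>n. w (s n)) \<longlonglongrightarrow> Abs (cls (\<lambda>n. - s n))"
    using s by (simp add: cauchy_mem)
  from LIMSEQ_unique [OF this abs_lim [OF s(1)]] have "Abs (cls (\<lambda>n. - s n)) = Abs (cls s)" .
  then show ?thesis using s by simp
qed

lemma abs_diff_le: "x \<in> carrier Q \<Longrightarrow> y \<in> carrier Q \<Longrightarrow> Abs (x \<ominus>\<^bsub>Q\<^esub> y) \<le> max (Abs x) (Abs y)"
  using abs_add_le [of x "\<ominus>\<^bsub>Q\<^esub> y"] abs_uminus [of y] by (simp add: Q.minus_eq)

lemma abs_eq_0:
  assumes "x \<in> carrier Q"
  shows "Abs x = 0 \<longleftrightarrow> x = \<zero>\<^bsub>Q\<^esub>"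
proof -
  obtain s where s: "s \<in> C" "x = cls s" using assms unfolding carrier_Q by blast
  have "Abs x = 0 \<longleftrightarrow> (\<lambda>n. w (s n)) \<longlonglongrightarrow> 0"
    using abs_lim [OF s(1)] s(2) LIMSEQ_unique [OF abs_lim [OF s(1)], of 0] by auto
  also have "\<dots> \<longleftrightarrow> s \<in> NS"
    using nullI [of s] nullD [of s] cauchy_mem [OF s(1)] by (intro iffI) simp_all
  also have "\<dots> \<longleftrightarrow> x = \<zero>\<^bsub>Q\<^esub>"
    using s by (simp add: zero_Q cls_eq)
  finally show ?thesis .
qed

lemma eqI_abs:
  assumes "x \<in> carrier Q" "y \<in> carrier Q" "\<And>e. e > 0 \<Longrightarrow> Abs (x \<ominus>\<^bsub>Q\<^esub> y) < e"
  shows "x = y"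
proof -
  have "\<not> 0 < Abs (x \<ominus>\<^bsub>Q\<^esub> y)"
    using assms(3) [of "Abs (x \<ominus>\<^bsub>Q\<^esub> y)"] by auto
  moreover have "0 \<le> Abs (x \<ominus>\<^bsub>Q\<^esub> y)"
    using assms(1,2) by (intro abs_nonneg) simp
  ultimately have "Abs (x \<ominus>\<^bsub>Q\<^esub> y) = 0" by linarith
  then show ?thesis
    using assms(1,2) by (simp add: abs_eq_0 Q.r_right_minus_eq)
qed

lemma cauchy_inverse:
  assumes s: "s \<in> C" and a: "0 < a" "\<And>n. a \<le> w (s n)"
  shows "(\<lambda>n. inverse (s n)) \<in> C"
proof (rule cauchyI)
  fix e :: real assume "e > 0"
  then have "e * a * a > 0" using a by simp
  then obtain N where N: "\<forall>m\<ge>N. \<forall>n\<ge>N. w (s m - s n) < e * a * a"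
    using cauchyD [OF s] by blast
  have "w (inverse (s m) - inverse (s n)) < e" if "m \<ge> N" "n \<ge> N" for m n
  proof -
    have nz: "s m \<noteq> 0" "s n \<noteq> 0" using a w_0 by (metis leD)+
    have "inverse (s m) - inverse (s n) = (s n - s m) * (inverse (s m) * inverse (s n))"
      using nz by (simp add: field_simps)
    then have "w (inverse (s m) - inverse (s n)) = w (s n - s m) * (inverse (w (s m)) * inverse (w (s n)))"
      using s by (simp add: mult cauchy_mem)
    also have "\<dots> \<le> w (s n - s m) * (inverse a * inverse a)"
      using s a by (intro mult_left_mono mult_mono le_imp_inverse_le) (auto simp: cauchy_mem)
    also have "\<dots> < e"
      using N that a by (simp add: field_simps)
    finally show ?thesis .
  qed
  then show "\<exists>N. \<forall>m\<ge>N. \<forall>n\<ge>N. w (inverse (s m) - inverse (s n)) < e" by blast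
qed (use s cauchy_mem in auto)

text \<open>Allows a bound that a representative satisfies eventually to be assumed for all of its
  terms, by overwriting the exceptional ones.\<close>

lemma cls_modify:
  assumes s: "s \<in> C" and t: "\<And>n. t n \<in> F" and ev: "eventually (\<lambda>n. t n = s n) sequentially"
  shows "t \<in> C" "cls t = cls s"
proof -
  have "(\<lambda>n. w (t n - s n)) \<longlonglongrightarrow> 0"
    by (rule tendsto_eventually, rule eventually_mono [OF ev]) simp
  then have d: "(\<lambda>n. t n - s n) \<in> NS"
    using s t by (intro nullI) (auto simp: cauchy_mem)
  have "(\<lambda>n. (t n - s n) + s n) \<in> C"
    using null_cauchy [OF d] s by (rule cauchy_add)
  then show "t \<in> C" by simp
  then show "cls t = cls s" using s d by (simp add: cls_eq)
qed

lemma field_Q: "field Q"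
proof (rule Q.cring_fieldI2)
  show "\<zero>\<^bsub>Q\<^esub> \<noteq> \<one>\<^bsub>Q\<^esub>"
    using abs_one abs_eq_0 [of "\<zero>\<^bsub>Q\<^esub>"] by auto
  fix x assume x: "x \<in> carrier Q" "x \<noteq> \<zero>\<^bsub>Q\<^esub>"
  then obtain s where s: "s \<in> C" "x = cls s" unfolding carrier_Q by blast
  define a where "a = Abs x / 2"
  have a: "0 < a" "a < Abs x"
    unfolding a_def using abs_nonneg [OF x(1)] abs_eq_0 [OF x(1)] x(2) by auto
  have ev: "eventually (\<lambda>n. a < w (s n)) sequentially"
    using order_tendstoD(1) [OF abs_lim [OF s(1)]] a s(2) by simp
  obtain n0 where n0: "a < w (s n0)"
    using ev unfolding eventually_sequentially by blast
  \<comment> \<open>Small terms are replaced by one fixed large term, so that the sequence is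
    bounded away from zero and can be inverted termwise.\<close>
  define t where "t n = (if a < w (s n) then s n else s n0)" for n
  have tC: "t \<in> C" "cls t = cls s"
    using s n0 ev by (intro cls_modify [OF s(1)]; auto simp: t_def cauchy_mem elim: eventually_mono)+
  have ta: "a \<le> w (t n)" for n
    unfolding t_def using n0 by auto
  have tinv: "(\<lambda>n. inverse (t n)) \<in> C"
    using tC(1) a(1) ta by (rule cauchy_inverse)
  have "t n \<noteq> 0" for n
    using ta [of n] a by auto
  then have "cls t \<otimes>\<^bsub>Q\<^esub> cls (\<lambda>n. inverse (t n)) = \<one>\<^bsub>Q\<^esub>"
    using tC(1) tinv by (simp add: one_Q)
  then show "\<exists>b\<in>carrier Q. x \<otimes>\<^bsub>Q\<^esub> b = \<one>\<^bsub>Q\<^esub>"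
    using tinv s(2) tC(2) by (intro bexI [of _ "cls (\<lambda>n. inverse (t n))"]) auto
qed

end

subsection \<open>The field of p-adic numbers\<close>

locale padic_prime =
  fixes p :: nat
  assumes prime_p: "Factorial_Ring.prime p"
begin

lemma p_gt_1: "1 < real p"
  using prime_gt_1_nat [OF prime_p] by simp

lemma p_nonzero: "real p \<noteq> 0"
  using p_gt_1 by linarith

lemma prime_int_p: "Factorial_Ring.prime (int p)"
  using prime_p by simp

lemma prime_elem_int_p: "prime_elem (int p)"
  using prime_int_p by (rule prime_imp_prime_elem)

lemma padic_abs_0 [simp]: "padic_abs p 0 = 0"
  by (simp add: padic_abs_def)

text \<open>The definition uses lowest terms. Cross multiplication and additivity of multiplicities
  show that any fraction gives the same exponent.\<close>

lemma padic_abs_frac: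
  assumes "a \<noteq> 0" "b \<noteq> 0"
  shows "padic_abs p (of_int a / of_int b)
    = real p powi (int (multiplicity (int p) b) - int (multiplicity (int p) a))"
proof -
  define q :: rat where "q = of_int a / of_int b"
  obtain n d where nd: "quotient_of q = (n, d)" by fastforce
  have d: "d \<noteq> 0" using quotient_of_denom_pos [OF nd] by simp
  have q: "q = of_int n / of_int d" by (rule quotient_of_div [OF nd])
  have "q \<noteq> 0" unfolding q_def using assms by simp
  then have n: "n \<noteq> 0" using q by auto
  have "(of_int (a * d) :: rat) = of_int (n * b)"
    using q d assms unfolding q_def by (simp add: field_simps)
  then have "a * d = n * b" by (simp only: of_int_eq_iff)
  then have "multiplicity (int p) (a * d) = multiplicity (int p) (n * b)" by simp
  then have "multiplicity (int p) a + multiplicity (int p) d = multiplicity (int p) n + multiplicity (int p) b"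
    using assms n d by (simp add: prime_elem_multiplicity_mult_distrib [OF prime_elem_int_p])
  then have "int (multiplicity (int p) d) - int (multiplicity (int p) n)
      = int (multiplicity (int p) b) - int (multiplicity (int p) a)" by linarith
  then show ?thesis
    using \<open>q \<noteq> 0\<close> nd unfolding padic_abs_def q_def by simp
qed

lemma rat_frac:
  fixes q :: rat
  obtains a b where "b \<noteq> 0" "q = of_int a / of_int b"
proof -
  obtain n d where nd: "quotient_of q = (n, d)" by fastforce
  show thesis
    using that [of d n] quotient_of_denom_pos [OF nd] quotient_of_div [OF nd] by simp
qed

lemma padic_abs_nonneg: "0 \<le> padic_abs p q"
  by (simp add: padic_abs_def)

lemma padic_abs_eq_0: "padic_abs p q = 0 \<longleftrightarrow> q = 0"
  using p_nonzero by (simp add: padic_abs_def)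

lemma padic_abs_mult: "padic_abs p (q * r) = padic_abs p q * padic_abs p r"
proof (cases "q = 0 \<or> r = 0")
  case False
  obtain a b where ab: "b \<noteq> 0" "q = of_int a / of_int b" by (rule rat_frac)
  obtain c d where cd: "d \<noteq> 0" "r = of_int c / of_int d" by (rule rat_frac)
  have "a \<noteq> 0" "c \<noteq> 0" using False ab cd by auto
  have "q * r = of_int (a * c) / of_int (b * d)" using ab cd by simp
  then have "padic_abs p (q * r) = real p powi (int (multiplicity (int p) (b * d)) - int (multiplicity (int p) (a * c)))"
    using padic_abs_frac [of "a * c" "b * d"] ab cd \<open>a \<noteq> 0\<close> \<open>c \<noteq> 0\<close> by simp
  also have "int (multiplicity (int p) (b * d)) - int (multiplicity (int p) (a * c))
     = (int (multiplicity (int p) b) - int (multiplicity (int p) a)) + (int (multiplicity (int p) d) - int (multiplicity (int p) c))"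
    using ab cd \<open>a \<noteq> 0\<close> \<open>c \<noteq> 0\<close> by (simp add: prime_elem_multiplicity_mult_distrib [OF prime_elem_int_p])
  also have "real p powi \<dots> = padic_abs p q * padic_abs p r"
    using p_nonzero padic_abs_frac [OF \<open>a \<noteq> 0\<close> ab(1)] padic_abs_frac [OF \<open>c \<noteq> 0\<close> cd(1)] ab(2) cd(2)
    by (simp add: power_int_add)
  finally show ?thesis .
qed auto

lemma padic_abs_add: "padic_abs p (q + r) \<le> max (padic_abs p q) (padic_abs p r)"
proof (cases "q = 0 \<or> r = 0 \<or> q + r = 0")
  case True
  then show ?thesis using padic_abs_nonneg [of q] padic_abs_nonneg [of r] by auto
next
  case False
  obtain a1 d1 where 1: "d1 \<noteq> 0" "q = of_int a1 / of_int d1" by (rule rat_frac)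
  obtain a2 d2 where 2: "d2 \<noteq> 0" "r = of_int a2 / of_int d2" by (rule rat_frac)
  define a b d where abd: "a = a1 * d2" "b = a2 * d1" "d = d1 * d2"
  have d: "d \<noteq> 0" and q: "q = of_int a / of_int d" and r: "r = of_int b / of_int d"
    using 1 2 by (simp_all add: abd)
  have qr: "q + r = of_int (a + b) / of_int d"
    using q r by (simp add: add_divide_distrib)
  have ne: "a \<noteq> 0" "b \<noteq> 0" "a + b \<noteq> 0"
    using False q r qr by auto
  define m where "m = min (multiplicity (int p) a) (multiplicity (int p) b)"
  have "int p ^ m dvd a" "int p ^ m dvd b"
    unfolding m_def by (simp_all add: multiplicity_dvd')
  then have "int p ^ m dvd a + b" by simp
  then have "m \<le> multiplicity (int p) (a + b)"
    using ne prime_int_p by (intro multiplicity_geI) auto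
  then have "real p powi (int (multiplicity (int p) d) - int (multiplicity (int p) (a + b)))
      \<le> real p powi (int (multiplicity (int p) d) - int m)"
    using p_gt_1 by (intro power_int_increasing) auto
  also have "\<dots> \<le> max (padic_abs p q) (padic_abs p r)"
    unfolding m_def q r padic_abs_frac [OF ne(1) d] padic_abs_frac [OF ne(2) d]
    by (auto simp: min_def)
  finally show ?thesis
    unfolding qr padic_abs_frac [OF ne(3) d] .
qed

sublocale Q: nonarch "UNIV :: rat set" "padic_abs p"
  by unfold_locales (auto simp: padic_abs_nonneg padic_abs_eq_0 padic_abs_mult padic_abs_add)

lemma padic_abs_p: "padic_abs p (of_nat p) = 1 / real p"
  using padic_abs_frac [of "int p" 1] prime_int_p prime_gt_0_nat [OF prime_p]
  by (simp add: power_int_minus divide_inverse)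

lemma padic_abs_p_power: "padic_abs p (of_nat p ^ j) = (1 / real p) ^ j"
  by (simp add: padic_abs_p)

lemma dvd_imp_padic_abs_le:
  assumes "int p ^ j dvd k"
  shows "padic_abs p (of_int k) \<le> (1 / real p) ^ j"
proof -
  obtain l where "k = int p ^ j * l" using assms by blast
  then have "padic_abs p (of_int k) = (1 / real p) ^ j * padic_abs p (of_int l)"
    using padic_abs_p_power [of j] by (simp add: padic_abs_mult)
  also have "\<dots> \<le> (1 / real p) ^ j * 1"
    using Q.w_of_int [of l] by (intro mult_left_mono) auto
  finally show ?thesis by simp
qed

lemma padic_abs_le_imp_dvd:
  assumes "padic_abs p (of_int k) \<le> (1 / real p) ^ j"
  shows "int p ^ j dvd k"
proof (cases "k = 0")
  case False
  have "padic_abs p (of_int k) = real p powi (- int (multiplicity (int p) k))"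
    using padic_abs_frac [OF False, of 1] by simp
  also have "\<dots> = (1 / real p) ^ multiplicity (int p) k"
    by (simp add: power_int_minus power_one_over divide_inverse power_inverse)
  finally have "(1 / real p) ^ multiplicity (int p) k \<le> (1 / real p) ^ j"
    using assms by simp
  then have "j \<le> multiplicity (int p) k"
    using p_gt_1 by (subst (asm) power_decreasing_iff) auto
  then show ?thesis by (rule multiplicity_dvd')
qed simp

text \<open>The nonzero values are integral powers of \<open>p\<close>, so none lies strictly
  between \<open>1\<close> and \<open>p\<close>.\<close>

lemma padic_abs_less_p:
  assumes "padic_abs p q < real p"
  shows "padic_abs p q \<le> 1"
proof (cases "q = 0")
  case False
  define k where "k = int (multiplicity (int p) (snd (quotient_of q))) - int (multiplicity (int p) (fst (quotient_of q)))"
  have q: "padic_abs p q = real p powi k"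
    using False unfolding padic_abs_def k_def by simp
  have "k < 1"
  proof (rule ccontr)
    assume "\<not> k < 1"
    then have "real p powi 1 \<le> real p powi k"
      using p_gt_1 by (intro power_int_increasing) auto
    then show False using assms q by simp
  qed
  then have "real p powi k \<le> real p powi 0"
    using p_gt_1 by (intro power_int_increasing) auto
  then show ?thesis using q by simp
qed simp

text \<open>In lowest terms the denominator is prime to \<open>p\<close>, hence invertible modulo
  \<open>p^n\<close>; \<open>k\<close> is the residue of the numerator times this inverse.\<close>

lemma padic_nat_approx:
  assumes "padic_abs p q \<le> 1"
  shows "\<exists>k. padic_abs p (q - of_nat k) \<le> (1 / real p) ^ n"
proof -
  obtain a b where ab: "quotient_of q = (a, b)" by fastforce
  have b: "b > 0" and q: "q = of_int a / of_int b" and cop: "coprime a b"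
    using quotient_of_denom_pos [OF ab] quotient_of_div [OF ab] quotient_of_coprime [OF ab] by auto
  have nd: "\<not> int p dvd b"
  proof
    assume pb: "int p dvd b"
    then have pa: "\<not> int p dvd a"
      using cop prime_int_p by (meson not_prime_unit coprime_common_divisor)
    then have a: "a \<noteq> 0" by auto
    have "multiplicity (int p) a = 0" using pa by (rule not_dvd_imp_multiplicity_0)
    moreover have "1 \<le> multiplicity (int p) b"
      using pb b prime_int_p by (intro multiplicity_geI) auto
    then have "real p ^ 1 \<le> real p ^ multiplicity (int p) b"
      using p_gt_1 by (intro power_increasing) auto
    ultimately have "real p \<le> padic_abs p q"
      using padic_abs_frac [OF a, of b] b q by simp
    then show False using assms p_gt_1 by simp
  qed
  then have "coprime b (int p ^ n)"
    using prime_imp_coprime [OF prime_int_p nd] by (simp add: coprime_commute)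
  then have "gcd b (int p ^ n) = 1" by simp
  then obtain x y where xy: "x * b + y * int p ^ n = 1"
    using bezout_int [of b "int p ^ n"] by metis
  have pn: "int p ^ n > 0" using prime_gt_0_nat [OF prime_p] by simp
  define k where "k = nat ((x * a) mod (int p ^ n))"
  have k: "int k = (x * a) mod (int p ^ n)" unfolding k_def using pn by simp
  then obtain z where z: "int k = x * a - z * int p ^ n"
    using minus_div_mult_eq_mod [of "x * a" "int p ^ n"] by metis
  have "a = a * (x * b + y * int p ^ n)" using xy by simp
  then have "a - b * int k = int p ^ n * (a * y + b * z)"
    unfolding z by (simp add: algebra_simps)
  then have "int p ^ n dvd a - b * int k" by simp
  then have "padic_abs p (of_int (a - b * int k)) \<le> (1 / real p) ^ n"
    by (rule dvd_imp_padic_abs_le)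
  moreover have "q - of_nat k = of_int (a - b * int k) * inverse (of_int b)"
    using q b by (simp add: field_simps)
  moreover have "padic_abs p (inverse (of_int b)) = 1"
    using padic_abs_frac [of 1 b] b nd by (simp add: not_dvd_imp_multiplicity_0 inverse_eq_divide)
  ultimately show ?thesis
    by (intro exI [of _ k]) (simp add: padic_abs_mult)
qed

lemma Qp_eq: "Qp p = Q.Q"
  unfolding Qp_def ..

abbreviation "qcls \<equiv> Q.cls"
abbreviation "nat_seq k \<equiv> (\<lambda>n::nat. rat_of_nat (k n))"

lemma rat_to_Qp_eq: "rat_to_Qp p x = qcls (\<lambda>_. x)"
  by (rule Q.emb_eq)

lemma geometric_p: "(\<lambda>n. (1 / real p) ^ n) \<longlonglongrightarrow> 0"
  using p_gt_1 by (intro LIMSEQ_realpow_zero) auto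

lemma Zp_carrier: "carrier (Zp p) = {x \<in> carrier Q.Q. Q.Abs x \<le> 1}"
  unfolding Zp_def Qp_eq by simp

text \<open>Density of the natural numbers in the p-adic integers, in the form that makes termwise
  powers possible. Terms of absolute value \<open>p\<close> or more are set to \<open>0\<close>,
  which happens finitely often, and the \<open>n\<close>-th term is then approximated by a natural
  number up to \<open>p^-n\<close>.\<close>

lemma Zp_nat_seq:
  assumes "x \<in> carrier (Zp p)"
  obtains k where "nat_seq k \<in> Q.C" "x = qcls (nat_seq k)"
proof -
  obtain s where s: "s \<in> Q.C" "x = qcls s"
    using assms unfolding Zp_carrier Q.carrier_Q by blast
  have "Q.Abs (qcls s) < real p"
    using assms p_gt_1 unfolding Zp_carrier s(2) by auto
  then have ev: "eventually (\<lambda>n. padic_abs p (s n) < real p) sequentially"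
    by (rule Q.abs_less [OF s(1)])
  define t where "t n = (if padic_abs p (s n) < real p then s n else 0)" for n
  have ev2: "eventually (\<lambda>n. t n = s n) sequentially"
    using ev by (rule eventually_mono) (simp add: t_def)
  have t: "t \<in> Q.C" "qcls t = qcls s"
    using Q.cls_modify [OF s(1) UNIV_I ev2] by simp_all
  have t1: "padic_abs p (t n) \<le> 1" for n
    unfolding t_def using padic_abs_less_p by simp
  define k where "k n = (SOME k. padic_abs p (t n - of_nat k) \<le> (1 / real p) ^ n)" for n
  have k: "padic_abs p (t n - of_nat (k n)) \<le> (1 / real p) ^ n" for n
    unfolding k_def using padic_nat_approx [OF t1] by (rule someI_ex)
  have d: "(\<lambda>n. t n - nat_seq k n) \<in> Q.NS"
    by (rule Q.null_leI [OF UNIV_I k geometric_p])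
  have "(\<lambda>n. t n - (t n - nat_seq k n)) \<in> Q.C"
    by (rule Q.cauchy_diff [OF t(1) Q.null_cauchy [OF d]])
  then have C: "nat_seq k \<in> Q.C" by simp
  moreover have "x = qcls (nat_seq k)"
    unfolding s(2) t(2) [symmetric] using Q.cls_eq [OF t(1) C] d by simp
  ultimately show thesis by (rule that)
qed

lemma nat_seq_cauchyD:
  assumes "nat_seq k \<in> Q.C"
  shows "\<exists>N. \<forall>m\<ge>N. \<forall>n\<ge>N. int p ^ j dvd int (k m) - int (k n)"
proof -
  have "(1 / real p) ^ j > 0" using p_gt_1 by simp
  then obtain N where N: "\<forall>m\<ge>N. \<forall>n\<ge>N. padic_abs p (nat_seq k m - nat_seq k n) < (1 / real p) ^ j"
    using Q.cauchyD [OF assms] by blast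
  have "int p ^ j dvd int (k m) - int (k n)" if "m \<ge> N" "n \<ge> N" for m n
  proof (rule padic_abs_le_imp_dvd)
    have "padic_abs p (nat_seq k m - nat_seq k n) < (1 / real p) ^ j" using N that by blast
    then show "padic_abs p (of_int (int (k m) - int (k n))) \<le> (1 / real p) ^ j" by simp
  qed
  then show ?thesis by blast
qed

lemma field_Qp: "field (Qp p)"
  unfolding Qp_eq by (rule Q.field_Q)

lemma subcring_Zp: "subcring (carrier (Zp p)) Q.Q"
proof (rule Q.Q.subcringI', rule Q.Q.subringI)
  fix x y assume x: "x \<in> carrier (Zp p)" and y: "y \<in> carrier (Zp p)"
  then show "x \<otimes>\<^bsub>Q.Q\<^esub> y \<in> carrier (Zp p)"
    using mult_le_one [of "Q.Abs x" "Q.Abs y"] by (simp add: Zp_carrier Q.abs_mult Q.abs_nonneg)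
  show "x \<oplus>\<^bsub>Q.Q\<^esub> y \<in> carrier (Zp p)"
    using x y Q.abs_add_le [of x y] by (auto simp: Zp_carrier max_def split: if_splits)
  show "\<ominus>\<^bsub>Q.Q\<^esub> x \<in> carrier (Zp p)"
    using x by (simp add: Zp_carrier Q.abs_uminus)
qed (auto simp: Zp_carrier Q.abs_one)

lemma Zp_eq: "Zp p = Q.Q\<lparr>carrier := carrier (Zp p)\<rparr>"
  unfolding Zp_def Qp_eq by simp

lemma cring_Zp: "cring (Zp p)"
  using Q.Q.subcring_iff [of "carrier (Zp p)"] subcring_Zp subcringE(1) [OF subcring_Zp] Zp_eq by simp

lemma id_Zp_Qp: "id \<in> Ring.ring_hom (Zp p) (Qp p)"
  by (rule ring_hom_memI) (auto simp: Zp_def)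

lemma Qp_denominator:
  assumes "s \<in> carrier (Qp p)"
  shows "\<exists>z\<in>carrier (Zp p). z \<noteq> \<zero>\<^bsub>Qp p\<^esub> \<and> z \<otimes>\<^bsub>Qp p\<^esub> s \<in> carrier (Zp p)"
proof -
  obtain j where j: "Q.Abs s < real p ^ j"
    using real_arch_pow [OF p_gt_1] by blast
  define z where "z = qcls (\<lambda>_. of_nat p ^ j)"
  have z: "z \<in> carrier Q.Q" "Q.Abs z = (1 / real p) ^ j"
    unfolding z_def using padic_abs_p_power by simp_all
  have "z \<noteq> \<zero>\<^bsub>Q.Q\<^esub>"
    using z p_gt_1 Q.abs_eq_0 [OF z(1)] by simp
  moreover have "z \<in> carrier (Zp p)"
    using z p_gt_1 by (simp add: Zp_carrier power_le_one)
  moreover have "Q.Abs (z \<otimes>\<^bsub>Q.Q\<^esub> s) \<le> 1"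
  proof -
    have "(1 / real p) ^ j * Q.Abs s \<le> (1 / real p) ^ j * real p ^ j"
      using j p_gt_1 by (intro mult_left_mono) auto
    also have "\<dots> = 1"
      using p_gt_1 by (simp add: power_one_over)
    finally show ?thesis
      using z assms by (simp add: Q.abs_mult Qp_eq)
  qed
  ultimately show ?thesis
    using z(1) assms unfolding Qp_eq by (intro bexI [of _ z]) (simp_all add: Zp_carrier)
qed

lemma int_to_Zp_hom: "int_to_Zp p \<in> Ring.ring_hom int_ring (Zp p)"
proof (rule ring_hom_memI)
  fix k l :: int
  show "int_to_Zp p k \<in> carrier (Zp p)"
    unfolding Zp_carrier rat_to_Qp_eq by (simp add: Q.w_of_int)
  show "int_to_Zp p (k \<otimes>\<^bsub>int_ring\<^esub> l) = int_to_Zp p k \<otimes>\<^bsub>Zp p\<^esub> int_to_Zp p l"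
    "int_to_Zp p (k \<oplus>\<^bsub>int_ring\<^esub> l) = int_to_Zp p k \<oplus>\<^bsub>Zp p\<^esub> int_to_Zp p l"
    unfolding rat_to_Qp_eq by (simp_all add: Zp_def Qp_eq)
qed (simp add: Zp_def Qp_eq rat_to_Qp_eq Q.one_Q)

end

subsection \<open>Principal units and their p-adic powers\<close>

locale place = padic_prime p + nonarch F w for p :: nat and F :: "'a::field_char_0 set" and w +
  assumes w_rat: "w (of_rat q) = padic_abs p q"
begin

lemma w_of_int_dvd: "int p ^ j dvd k \<Longrightarrow> w (of_int k) \<le> (1 / real p) ^ j"
  using dvd_imp_padic_abs_le [of j k] w_rat [of "of_int k"] by simp

lemma w_p: "w (of_nat p) = 1 / real p"
  using padic_abs_p w_rat [of "of_nat p"] by simp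

lemma unit_power_diff:
  assumes a: "a \<in> F" "w a \<le> 1" and b: "b \<in> F" "w b \<le> 1"
  shows "w (a ^ k - b ^ k) \<le> w (a - b)"
proof (induction k)
  case 0
  then show ?case using a b by simp
next
  case (Suc k)
  have "a ^ Suc k - b ^ Suc k = a * (a ^ k - b ^ k) + (a - b) * b ^ k"
    by (simp add: algebra_simps)
  then have "w (a ^ Suc k - b ^ Suc k) \<le> max (w (a * (a ^ k - b ^ k))) (w ((a - b) * b ^ k))"
    using a b by (simp add: add_le_max)
  also have "w (a * (a ^ k - b ^ k)) = w a * w (a ^ k - b ^ k)"
    using a b by (simp add: mult)
  also have "\<dots> \<le> 1 * w (a - b)"
    using a b Suc by (intro mult_mono) auto
  also have "w ((a - b) * b ^ k) = w (a - b) * w b ^ k"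
    using a b by (simp add: mult)
  also have "\<dots> \<le> w (a - b) * 1"
    using a b by (intro mult_left_mono power_le_one) auto
  finally show ?case by simp
qed

lemma principal_abs:
  assumes "x \<in> F" "w (x - 1) < 1"
  shows "w x = 1"
  using w_eq_of_diff_less [of x 1] assms by simp

lemma principal_power:
  assumes "x \<in> F" "w (x - 1) \<le> r" "r < 1"
  shows "w (x ^ k - 1) \<le> r"
  using unit_power_diff [of x 1 k] principal_abs [of x] assms by simp

text \<open>Factor \<open>x\<^sup>p - 1 = (x - 1) (1 + x + \<dots> + x\<^bsup>p-1\<^esup>)\<close>; the second factor is \<open>p\<close> plus a sum of
  terms \<open>x\<^sup>i - 1\<close>.\<close>

lemma principal_power_p:
  assumes x: "x \<in> F" "w (x - 1) \<le> r" "r < 1"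
  shows "w (x ^ p - 1) \<le> w (x - 1) * max (1 / real p) r"
proof -
  have "0 \<le> w (x - 1)" using x by simp
  with x have r: "0 \<le> r" by linarith
  have "(\<Sum>i<p. x ^ i) = of_nat p + (\<Sum>i<p. x ^ i - 1)"
    by (simp add: sum_subtractf)
  then have "w (\<Sum>i<p. x ^ i) \<le> max (w (of_nat p)) (w (\<Sum>i<p. x ^ i - 1))"
    using x add_le_max [of "of_nat p" "\<Sum>i<p. x ^ i - 1"] by simp
  also have "\<dots> \<le> max (1 / real p) r"
    using sum_le [OF r, of "{..<p}" "\<lambda>i. x ^ i - 1"] x principal_power [OF x] w_p by auto
  finally have S: "w (\<Sum>i<p. x ^ i) \<le> max (1 / real p) r" .
  have "x ^ p - 1 = (x - 1) * (\<Sum>i<p. x ^ i)"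
    by (rule power_diff_1_eq)
  then have "w (x ^ p - 1) = w (x - 1) * w (\<Sum>i<p. x ^ i)"
    using x by (simp add: mult)
  also have "\<dots> \<le> w (x - 1) * max (1 / real p) r"
    using S x by (intro mult_left_mono) auto
  finally show ?thesis .
qed

lemma rate:
  assumes "r < 1"
  shows "0 < max (1 / real p) r" "max (1 / real p) r < 1"
  using assms p_gt_1 by (auto simp: less_max_iff_disj)

text \<open>Each \<open>p\<close>-th power contracts the distance from \<open>1\<close> by the
  factor \<open>max (1/p) r\<close>, so the iterates approach \<open>1\<close> geometrically, at a
  rate that depends on \<open>x\<close> only through \<open>r\<close>.\<close>

lemma principal_power_p_power:
  assumes x: "x \<in> F" "w (x - 1) \<le> r" "r < 1"
  shows "w (x ^ (p ^ j) - 1) \<le> max (1 / real p) r ^ j"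
proof (induction j)
  case 0
  then show ?case using x by simp
next
  case (Suc j)
  have "w ((x ^ (p ^ j)) ^ p - 1) \<le> w (x ^ (p ^ j) - 1) * max (1 / real p) r"
    using x by (intro principal_power_p principal_power) auto
  also have "\<dots> \<le> max (1 / real p) r ^ j * max (1 / real p) r"
    using Suc rate [OF x(3)] by (intro mult_right_mono) auto
  finally show ?case by (simp add: power_mult [symmetric] mult.commute)
qed

lemma principal_power_dvd:
  assumes x: "x \<in> F" "w (x - 1) \<le> r" "r < 1" and d: "p ^ j dvd d"
  shows "w (x ^ d - 1) \<le> max (1 / real p) r ^ j"
proof -
  obtain e where e: "d = p ^ j * e" using d by blast
  have y: "w (x ^ (p ^ j) - 1) < 1"
    using principal_power [OF x, of "p ^ j"] x(3) by simp
  have "w ((x ^ (p ^ j)) ^ e - 1) \<le> w (x ^ (p ^ j) - 1)"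
    using principal_power [OF _ order_refl y, of e] x by simp
  also have "\<dots> \<le> max (1 / real p) r ^ j"
    by (rule principal_power_p_power [OF x])
  finally show ?thesis by (simp add: e power_mult)
qed

text \<open>Continuity of a power in its exponent for the p-adic topology: factor out the smaller
  power and apply the estimate for exponents divisible by \<open>p^j\<close>. This is what gives
  meaning to p-adic exponents.\<close>

lemma principal_power_cong:
  assumes x: "x \<in> F" "w (x - 1) \<le> r" "r < 1" and kl: "int p ^ j dvd int k - int l"
  shows "w (x ^ k - x ^ l) \<le> max (1 / real p) r ^ j"
proof -
  have wx: "w x = 1" using principal_abs x by simp
  have le: "w (x ^ k - x ^ l) \<le> max (1 / real p) r ^ j" if "l \<le> k" "int p ^ j dvd int k - int l" for k l
  proof -
    have "int (p ^ j) dvd int (k - l)" using that by (simp add: of_nat_diff)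
    then have "p ^ j dvd k - l" by (simp only: int_dvd_int_iff)
    then have "w (x ^ (k - l) - 1) \<le> max (1 / real p) r ^ j"
      by (rule principal_power_dvd [OF x])
    moreover have "x ^ k - x ^ l = x ^ l * (x ^ (k - l) - 1)"
      using that by (simp add: algebra_simps flip: power_add)
    ultimately show ?thesis
      using x wx by (simp add: mult)
  qed
  show ?thesis
  proof (cases "l \<le> k")
    case True
    then show ?thesis using le kl by blast
  next
    case False
    moreover have "int p ^ j dvd int l - int k"
      using kl by (simp add: dvd_diff_commute)
    ultimately have "w (x ^ l - x ^ k) \<le> max (1 / real p) r ^ j"
      by (intro le) auto
    then show ?thesis using x w_commute [of "x ^ k" "x ^ l"] by simp
  qed
qed

text \<open>A representative all of whose terms are principal with a common radius \<open>r\<close>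
  below \<open>1\<close>. The common radius gives one contraction rate for all terms.\<close>

definition pseq :: "(nat \<Rightarrow> 'a) \<Rightarrow> real \<Rightarrow> bool" where
  "pseq s r \<longleftrightarrow> s \<in> C \<and> 0 \<le> r \<and> r < 1 \<and> (\<forall>n. w (s n - 1) \<le> r)"

abbreviation "PU \<equiv> principal_units F w"

lemma pseqD:
  assumes "pseq s r"
  shows "s \<in> C" "0 \<le> r" "r < 1" "\<And>n. w (s n - 1) \<le> r" "\<And>n. s n \<in> F" "\<And>n. w (s n) = 1" "\<And>n. s n \<noteq> 0"
proof -
  show *: "s \<in> C" "0 \<le> r" "r < 1" "\<And>n. w (s n - 1) \<le> r"
    using assms unfolding pseq_def by simp_all
  show F: "\<And>n. s n \<in> F" by (rule cauchy_mem [OF *(1)])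
  show 1: "w (s n) = 1" for n
    using principal_abs [OF F] *(3) *(4) [of n] by simp
  show "s n \<noteq> 0" for n
    using 1 [of n] by auto
qed

lemma pseq_PU:
  assumes "pseq s r"
  shows "cls s \<in> PU"
proof -
  note s = pseqD [OF assms]
  have "Abs (cls (\<lambda>n. s n - 1)) \<le> r"
    using s by (intro abs_le) auto
  then show ?thesis
    using s unfolding principal_units_def by (simp add: one_Q)
qed

lemma PU_pseq:
  assumes "x \<in> PU"
  obtains s r where "pseq s r" "x = cls s"
proof -
  obtain s where s: "s \<in> C" "x = cls s"
    using assms unfolding principal_units_def carrier_Q by blast
  have "Abs (cls (\<lambda>n. s n - 1)) < 1"
    using assms s unfolding principal_units_def by (simp add: one_Q)
  then obtain r where r: "Abs (cls (\<lambda>n. s n - 1)) < r" "r < 1"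
    using dense by blast
  have "(\<lambda>n. s n - 1) \<in> C" using s by simp
  from abs_less [OF this r(1)] have ev: "eventually (\<lambda>n. w (s n - 1) < r) sequentially" .
  have r0: "0 \<le> r"
    using r abs_nonneg [of "cls (\<lambda>n. s n - 1)"] s by simp
  \<comment> \<open>Terms outside the radius are replaced by \<open>1\<close>, which is principal
    for every radius.\<close>
  define t where "t n = (if w (s n - 1) < r then s n else 1)" for n
  have tF: "t n \<in> F" for n
    unfolding t_def using cauchy_mem [OF s(1)] by simp
  have ev2: "eventually (\<lambda>n. t n = s n) sequentially"
    using ev by (rule eventually_mono) (simp add: t_def)
  note t = cls_modify [OF s(1) tF ev2]
  have "w (t n - 1) \<le> r" for n
    unfolding t_def using r0 by simp
  then have "pseq t r"
    unfolding pseq_def using t(1) r(2) r0 by simp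
  moreover have "x = cls t" using s t by simp
  ultimately show thesis by (rule that)
qed

lemma PU_carrier: "x \<in> PU \<Longrightarrow> x \<in> carrier Q"
  unfolding principal_units_def by simp

lemma pseq_mult:
  assumes "pseq s r" "pseq t q"
  shows "pseq (\<lambda>n. s n * t n) (max r q)"
proof -
  note s = pseqD [OF assms(1)] and t = pseqD [OF assms(2)]
  have "w (s n * t n - 1) \<le> max r q" for n
  proof -
    have eq: "s n * t n - 1 = s n * (t n - 1) + (s n - 1)" by (simp add: algebra_simps)
    have "w (s n * t n - 1) \<le> max (w (s n * (t n - 1))) (w (s n - 1))"
      unfolding eq using s(5) t(5) by (intro add_le_max) auto
    also have "\<dots> \<le> max r q"
      using s(4,5,6) [of n] t(4,5) [of n] by (auto simp: mult max_def)
    finally show ?thesis .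
  qed
  then show ?thesis
    unfolding pseq_def using s t by auto
qed

lemma pseq_one: "pseq (\<lambda>_. 1) 0"
  unfolding pseq_def by simp

lemma pseq_inverse:
  assumes "pseq s r"
  shows "pseq (\<lambda>n. inverse (s n)) r"
proof -
  note s = pseqD [OF assms]
  have "(\<lambda>n. inverse (s n)) \<in> C"
    using s(6) by (intro cauchy_inverse [OF s(1), of 1]) auto
  moreover have "w (inverse (s n) - 1) \<le> r" for n
  proof -
    have "inverse (s n) - 1 = inverse (s n) * (1 - s n)"
      using s(7) [of n] by (simp add: algebra_simps)
    then have "w (inverse (s n) - 1) = w (1 - s n)"
      using s(5,6) [of n] by (simp add: mult)
    then show ?thesis
      using s(4,5) [of n] w_commute [of "s n" 1] by simp
  qed
  ultimately show ?thesis
    unfolding pseq_def using s by simp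
qed

text \<open>Base and exponent vary together. The difference of two terms is split by changing the
  exponent first, controlled by congruence modulo \<open>p^j\<close>, and then the base, controlled
  by \<open>unit_power_diff\<close>.\<close>

lemma pseq_power:
  assumes s: "pseq s r" and k: "nat_seq k \<in> Q.C"
  shows "pseq (\<lambda>n. s n ^ k n) r"
proof -
  note s = pseqD [OF s]
  define \<rho> where "\<rho> = max (1 / real p) r"
  have "(\<lambda>n. s n ^ k n) \<in> C"
  proof (rule cauchyI)
    fix e :: real assume e: "e > 0"
    obtain j where j: "\<rho> ^ j < e"
      using real_arch_pow_inv [OF e, of \<rho>] rate [OF s(3)] unfolding \<rho>_def by blast
    obtain N where N: "\<forall>m\<ge>N. \<forall>n\<ge>N. int p ^ j dvd int (k m) - int (k n)"
      using nat_seq_cauchyD [OF k] by blast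
    obtain M where M: "\<forall>m\<ge>M. \<forall>n\<ge>M. w (s m - s n) < e"
      using cauchyD [OF s(1) e] by blast
    have "w (s m ^ k m - s n ^ k n) < e" if "m \<ge> max N M" "n \<ge> max N M" for m n
    proof -
      have "w (s m ^ k m - s n ^ k n) \<le> max (w (s m ^ k m - s m ^ k n)) (w (s m ^ k n - s n ^ k n))"
        using s(5) by (intro diff_triangle_max) auto
      moreover have "w (s m ^ k m - s m ^ k n) \<le> \<rho> ^ j"
        unfolding \<rho>_def using N that by (intro principal_power_cong s) auto
      moreover have "w (s m ^ k n - s n ^ k n) \<le> w (s m - s n)"
        using s(5,6) by (intro unit_power_diff) auto
      moreover have "w (s m - s n) < e" using M that by simp
      ultimately show ?thesis using j by linarith
    qed
    then show "\<exists>N. \<forall>m\<ge>N. \<forall>n\<ge>N. w (s m ^ k m - s n ^ k n) < e" by blast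
  qed (use s in simp)
  then show ?thesis
    unfolding pseq_def using s principal_power by simp
qed

text \<open>Powers of Cauchy sequences are computed termwise, which reduces all module axioms to laws
  of powers with natural exponents.\<close>

lemma padic_power_cls:
  assumes ps: "pseq s r" and k: "nat_seq k \<in> Q.C"
  shows "padic_power p F w (qcls (nat_seq k)) (cls s) = cls (\<lambda>n. s n ^ k n)"
proof -
  note s = pseqD [OF ps]
  note sk = pseqD [OF pseq_power [OF ps k]]
  define \<rho> where "\<rho> = max (1 / real p) r"
  let ?a = "qcls (nat_seq k)"
  let ?near = "\<lambda>l::nat. Q.Abs (rat_to_Qp p (of_nat l) \<ominus>\<^bsub>Qp p\<^esub> ?a)"
  let ?P = "\<lambda>y. y \<in> PU \<and> (\<forall>e>0. \<exists>d>0. \<forall>l::nat. ?near l < d \<longrightarrow> Abs (cls s [^]\<^bsub>Q\<^esub> l \<ominus>\<^bsub>Q\<^esub> y) < e)"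
  have near: "?near l = Q.Abs (qcls (\<lambda>n. of_nat l - nat_seq k n))" for l
    using k by (simp add: rat_to_Qp_eq Qp_eq)
  have "?P (cls (\<lambda>n. s n ^ k n))"
  proof (intro conjI allI impI)
    show "cls (\<lambda>n. s n ^ k n) \<in> PU"
      by (rule pseq_PU [OF pseq_power [OF ps k]])
    fix e :: real assume e: "e > 0"
    obtain j where j: "\<rho> ^ j < e"
      using real_arch_pow_inv [OF e, of \<rho>] rate [OF s(3)] unfolding \<rho>_def by blast
    show "\<exists>d>0. \<forall>l::nat. ?near l < d \<longrightarrow> Abs (cls s [^]\<^bsub>Q\<^esub> l \<ominus>\<^bsub>Q\<^esub> cls (\<lambda>n. s n ^ k n)) < e"
    proof (intro exI [of _ "(1 / real p) ^ j"] conjI allI impI)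
      show "0 < (1 / real p) ^ j" using p_gt_1 by simp
      fix l assume l: "?near l < (1 / real p) ^ j"
      have "(\<lambda>n. of_nat l - nat_seq k n) \<in> Q.C" using k by simp
      from Q.abs_less [OF this] l near
      have "eventually (\<lambda>n. padic_abs p (of_nat l - nat_seq k n) < (1 / real p) ^ j) sequentially"
        by simp
      then have "eventually (\<lambda>n. w (s n ^ l - s n ^ k n) \<le> \<rho> ^ j) sequentially"
      proof (rule eventually_mono)
        fix n assume "padic_abs p (of_nat l - nat_seq k n) < (1 / real p) ^ j"
        then have "int p ^ j dvd int l - int (k n)"
          by (intro padic_abs_le_imp_dvd) simp
        then show "w (s n ^ l - s n ^ k n) \<le> \<rho> ^ j"
          unfolding \<rho>_def by (intro principal_power_cong s)
      qed
      then have "Abs (cls (\<lambda>n. s n ^ l - s n ^ k n)) \<le> \<rho> ^ j"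
        using s(1) sk(1) by (intro abs_le) auto
      then show "Abs (cls s [^]\<^bsub>Q\<^esub> l \<ominus>\<^bsub>Q\<^esub> cls (\<lambda>n. s n ^ k n)) < e"
        using s(1) sk(1) j by simp
    qed
  qed
  \<comment> \<open>Uniqueness: for \<open>N\<close> large, \<open>k N\<close> is so close to the
    exponent that one and the same power of \<open>cls s\<close> is within \<open>e\<close> of both
    candidate limits.\<close>
  moreover have "y = cls (\<lambda>n. s n ^ k n)" if y: "?P y" for y
  proof (rule eqI_abs)
    show "y \<in> carrier Q" using y PU_carrier by blast
    show "cls (\<lambda>n. s n ^ k n) \<in> carrier Q" using sk(1) by simp
    obtain t where t: "t \<in> C" "y = cls t"
      using \<open>y \<in> carrier Q\<close> unfolding carrier_Q by blast
    fix e :: real assume e: "e > 0"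
    obtain d1 where d1: "d1 > 0" "\<And>l::nat. ?near l < d1 \<Longrightarrow> Abs (cls s [^]\<^bsub>Q\<^esub> l \<ominus>\<^bsub>Q\<^esub> y) < e"
      using conjunct2 [OF y] e by meson
    obtain d2 where d2: "d2 > 0" "\<And>l::nat. ?near l < d2 \<Longrightarrow> Abs (cls s [^]\<^bsub>Q\<^esub> l \<ominus>\<^bsub>Q\<^esub> cls (\<lambda>n. s n ^ k n)) < e"
      using conjunct2 [OF \<open>?P (cls (\<lambda>n. s n ^ k n))\<close>] e by meson
    define d where "d = min d1 d2"
    have d: "d > 0" unfolding d_def using d1 d2 by simp
    \<comment> \<open>Passing to the limit only gives a weak inequality, so half of \<open>d\<close>
      is used to stay strictly below \<open>d\<close>.\<close>
    then have "d / 2 > 0" by simp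
    then obtain N where N: "\<forall>m\<ge>N. \<forall>n\<ge>N. padic_abs p (nat_seq k m - nat_seq k n) < d / 2"
      using Q.cauchyD [OF k] by blast
    have "Q.Abs (qcls (\<lambda>n. of_nat (k N) - nat_seq k n)) \<le> d / 2"
      using N k by (intro Q.abs_le) (auto simp: eventually_sequentially intro!: exI [of _ N] less_imp_le)
    then have nl: "?near (k N) < d" using near d by simp
    have "Abs (cls s [^]\<^bsub>Q\<^esub> k N \<ominus>\<^bsub>Q\<^esub> y) < e" "Abs (cls s [^]\<^bsub>Q\<^esub> k N \<ominus>\<^bsub>Q\<^esub> cls (\<lambda>n. s n ^ k n)) < e"
      using nl unfolding d_def by (auto intro: d1 d2)
    then have *: "Abs (cls (\<lambda>n. s n ^ k N - t n)) < e" "Abs (cls (\<lambda>n. s n ^ k N - s n ^ k n)) < e"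
      using s(1) sk(1) t by simp_all
    have "Abs (cls (\<lambda>n. s n ^ k N - s n ^ k n) \<ominus>\<^bsub>Q\<^esub> cls (\<lambda>n. s n ^ k N - t n)) < e"
      using abs_diff_le [of "cls (\<lambda>n. s n ^ k N - s n ^ k n)" "cls (\<lambda>n. s n ^ k N - t n)"] * s(1) sk(1) t(1)
      by simp
    moreover have "cls (\<lambda>n. s n ^ k N - s n ^ k n) \<ominus>\<^bsub>Q\<^esub> cls (\<lambda>n. s n ^ k N - t n) = y \<ominus>\<^bsub>Q\<^esub> cls (\<lambda>n. s n ^ k n)"
      using s(1) sk(1) t by simp
    ultimately show "Abs (y \<ominus>\<^bsub>Q\<^esub> cls (\<lambda>n. s n ^ k n)) < e" by simp
  qed
  ultimately show ?thesis
    unfolding padic_power_def by (intro the_equality)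
qed

end

section \<open>Roots of unity of order prime to p and the principal part of a global unit\<close>

context place
begin

lemma w_of_nat_coprime:
  assumes "0 < n" "coprime n p"
  shows "w (of_nat n) = 1"
proof -
  have "\<not> p dvd n"
    using assms(2) prime_p by (metis coprime_common_divisor dvd_refl not_prime_unit)
  then have "\<not> int p dvd int n" by simp
  then have "padic_abs p (of_int (int n) / of_int 1) = 1"
    using assms(1) by (subst padic_abs_frac) (simp_all add: not_dvd_imp_multiplicity_0)
  then show ?thesis
    using w_rat [of "of_nat n"] by simp
qed

text \<open>The cofactor \<open>1 + x + ... + x^(n-1)\<close> differs from \<open>n\<close> by less
  than \<open>1\<close> in absolute value, and \<open>n\<close> is a unit, so the cofactor has
  absolute value \<open>1\<close>. Consequently principal units have no torsion of order prime to
  \<open>p\<close>.\<close>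

lemma principal_power_coprime:
  assumes x: "x \<in> F" "w (x - 1) < 1" and n: "0 < n" "coprime n p"
  shows "w (x ^ n - 1) = w (x - 1)"
proof -
  have "w (\<Sum>i<n. x ^ i - 1) \<le> w (x - 1)"
    using x principal_power [OF x(1) order_refl x(2)] by (intro sum_le) auto
  moreover have "(\<Sum>i<n. x ^ i) - of_nat n = (\<Sum>i<n. x ^ i - 1)"
    by (simp add: sum_subtractf)
  ultimately have "w ((\<Sum>i<n. x ^ i) - of_nat n) < w (of_nat n)"
    using x(2) w_of_nat_coprime [OF n] by simp
  then have "w (\<Sum>i<n. x ^ i) = 1"
    using w_eq_of_diff_less [of "\<Sum>i<n. x ^ i" "of_nat n"] x w_of_nat_coprime [OF n] by simp
  moreover have "x ^ n - 1 = (x - 1) * (\<Sum>i<n. x ^ i)"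
    by (rule power_diff_1_eq)
  ultimately show ?thesis
    using x by (simp add: mult)
qed

lemma PU_mult: "x \<in> PU \<Longrightarrow> y \<in> PU \<Longrightarrow> x \<otimes>\<^bsub>Q\<^esub> y \<in> PU"
proof -
  assume "x \<in> PU" "y \<in> PU"
  obtain s r where s: "pseq s r" "x = cls s" using PU_pseq [OF \<open>x \<in> PU\<close>] .
  obtain t q where t: "pseq t q" "y = cls t" using PU_pseq [OF \<open>y \<in> PU\<close>] .
  show ?thesis
    using pseq_PU [OF pseq_mult [OF s(1) t(1)]] pseqD(1) [OF s(1)] pseqD(1) [OF t(1)] s t by simp
qed

lemma PU_one: "\<one>\<^bsub>Q\<^esub> \<in> PU"
  using pseq_PU [OF pseq_one] by (simp add: one_Q)

lemma PU_inverse: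
  assumes "x \<in> PU"
  obtains y where "y \<in> PU" "y \<otimes>\<^bsub>Q\<^esub> x = \<one>\<^bsub>Q\<^esub>"
proof -
  obtain s r where s: "pseq s r" "x = cls s" using PU_pseq [OF assms] .
  note i = pseq_inverse [OF s(1)]
  have "cls (\<lambda>n. inverse (s n)) \<otimes>\<^bsub>Q\<^esub> x = \<one>\<^bsub>Q\<^esub>"
    using s pseqD(1) [OF s(1)] pseqD(7) [OF s(1)] pseqD(1) [OF i] by (simp add: one_Q)
  with pseq_PU [OF i] show thesis by (rule that)
qed

lemma PU_torsion:
  assumes y: "y \<in> PU" and n: "0 < n" "coprime n p" and pow: "y [^]\<^bsub>Q\<^esub> n = \<one>\<^bsub>Q\<^esub>"
  shows "y = \<one>\<^bsub>Q\<^esub>"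
proof -
  obtain s r where ps: "pseq s r" and ys: "y = cls s" using PU_pseq [OF y] .
  note s = pseqD [OF ps]
  have "(\<lambda>m. s m ^ n - 1) \<in> NS"
    using pow s(1) unfolding ys by (simp add: one_Q cls_eq)
  then have "(\<lambda>m. w (s m ^ n - 1)) \<longlonglongrightarrow> 0" by (rule nullD)
  moreover have "w (s m ^ n - 1) = w (s m - 1)" for m
    using s(5) le_less_trans [OF s(4) s(3)] n by (intro principal_power_coprime) auto
  ultimately have "(\<lambda>m. s m - 1) \<in> NS"
    using s(5) by (intro nullI) simp_all
  then show ?thesis
    using s(1) unfolding ys by (simp add: one_Q cls_eq)
qed

definition teich :: "(nat \<Rightarrow> 'a) set \<Rightarrow> bool" where
  "teich \<zeta> \<longleftrightarrow> \<zeta> \<in> carrier Q \<and> (\<exists>n::nat. n > 0 \<and> coprime n p \<and> \<zeta> [^]\<^bsub>Q\<^esub> n = \<one>\<^bsub>Q\<^esub>)"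

lemma pow_mult_eq_one:
  assumes "x \<in> carrier Q" "x [^]\<^bsub>Q\<^esub> (n::nat) = \<one>\<^bsub>Q\<^esub>"
  shows "x [^]\<^bsub>Q\<^esub> (n * m) = \<one>\<^bsub>Q\<^esub>" "x [^]\<^bsub>Q\<^esub> (m * n) = \<one>\<^bsub>Q\<^esub>"
proof -
  show "x [^]\<^bsub>Q\<^esub> (n * m) = \<one>\<^bsub>Q\<^esub>"
    using assms by (simp flip: Q.nat_pow_pow)
  then show "x [^]\<^bsub>Q\<^esub> (m * n) = \<one>\<^bsub>Q\<^esub>"
    by (simp only: mult.commute)
qed

lemma teich_mult:
  assumes "teich x" "teich y"
  shows "teich (x \<otimes>\<^bsub>Q\<^esub> y)"
proof -
  obtain n m where n: "x \<in> carrier Q" "0 < n" "coprime n p" "x [^]\<^bsub>Q\<^esub> n = \<one>\<^bsub>Q\<^esub>"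
    and m: "y \<in> carrier Q" "0 < m" "coprime m p" "y [^]\<^bsub>Q\<^esub> m = \<one>\<^bsub>Q\<^esub>"
    using assms unfolding teich_def by blast
  have "(x \<otimes>\<^bsub>Q\<^esub> y) [^]\<^bsub>Q\<^esub> (n * m) = x [^]\<^bsub>Q\<^esub> (n * m) \<otimes>\<^bsub>Q\<^esub> y [^]\<^bsub>Q\<^esub> (n * m)"
    using n m by (simp add: Q.nat_pow_distrib)
  also have "\<dots> = \<one>\<^bsub>Q\<^esub>" using n m by (simp add: pow_mult_eq_one)
  finally show ?thesis
    unfolding teich_def using n m by (intro conjI exI [of _ "n * m"]) auto
qed

text \<open>Raising to the product of the two orders removes both roots of unity. The quotient of
  \<open>y\<close> and \<open>y'\<close> is then a principal unit that is torsion of order prime to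
  \<open>p\<close>, hence \<open>1\<close>.\<close>

lemma principal_part_unique:
  assumes y: "y \<in> PU" "teich \<zeta>" and y': "y' \<in> PU" "teich \<zeta>'"
    and eq: "\<zeta> \<otimes>\<^bsub>Q\<^esub> y = \<zeta>' \<otimes>\<^bsub>Q\<^esub> y'"
  shows "y = y'"
proof -
  obtain n m where n: "\<zeta> \<in> carrier Q" "0 < n" "coprime n p" "\<zeta> [^]\<^bsub>Q\<^esub> n = \<one>\<^bsub>Q\<^esub>"
    and m: "\<zeta>' \<in> carrier Q" "0 < m" "coprime m p" "\<zeta>' [^]\<^bsub>Q\<^esub> m = \<one>\<^bsub>Q\<^esub>"
    using y y' unfolding teich_def by blast
  have yc: "y \<in> carrier Q" "y' \<in> carrier Q" using y y' PU_carrier by auto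
  have "\<zeta> [^]\<^bsub>Q\<^esub> (n * m) = \<one>\<^bsub>Q\<^esub>" "\<zeta>' [^]\<^bsub>Q\<^esub> (n * m) = \<one>\<^bsub>Q\<^esub>"
    using n m by (simp_all add: pow_mult_eq_one)
  then have pw: "y [^]\<^bsub>Q\<^esub> (n * m) = y' [^]\<^bsub>Q\<^esub> (n * m)"
    using arg_cong [OF eq, of "\<lambda>x. x [^]\<^bsub>Q\<^esub> (n * m)"] n m yc by (simp add: Q.nat_pow_distrib)
  obtain z where z: "z \<in> PU" "z \<otimes>\<^bsub>Q\<^esub> y' = \<one>\<^bsub>Q\<^esub>"
    using PU_inverse [OF y'(1)] .
  have zc: "z \<in> carrier Q" using z PU_carrier by auto
  have "(z \<otimes>\<^bsub>Q\<^esub> y) [^]\<^bsub>Q\<^esub> (n * m) = z [^]\<^bsub>Q\<^esub> (n * m) \<otimes>\<^bsub>Q\<^esub> y' [^]\<^bsub>Q\<^esub> (n * m)"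
    using zc yc by (simp add: Q.nat_pow_distrib pw)
  also have "\<dots> = (z \<otimes>\<^bsub>Q\<^esub> y') [^]\<^bsub>Q\<^esub> (n * m)"
    using zc yc by (simp add: Q.nat_pow_distrib)
  also have "\<dots> = \<one>\<^bsub>Q\<^esub>" by (simp add: z)
  finally have pw1: "(z \<otimes>\<^bsub>Q\<^esub> y) [^]\<^bsub>Q\<^esub> (n * m) = \<one>\<^bsub>Q\<^esub>" .
  have nm: "0 < n * m" "coprime (n * m) p" using n m by simp_all
  have zy: "z \<otimes>\<^bsub>Q\<^esub> y = \<one>\<^bsub>Q\<^esub>"
    by (rule PU_torsion [OF PU_mult [OF z(1) y(1)] nm pw1])
  have "y = (z \<otimes>\<^bsub>Q\<^esub> y') \<otimes>\<^bsub>Q\<^esub> y" unfolding z(2) using yc by simp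
  also have "\<dots> = (z \<otimes>\<^bsub>Q\<^esub> y) \<otimes>\<^bsub>Q\<^esub> y'" using zc yc by (simp add: Q.m_assoc Q.m_comm [of y' y])
  also have "\<dots> = y'" unfolding zy using yc by simp
  finally show ?thesis .
qed

text \<open>Pigeonhole on the residues of the powers of \<open>p\<close> modulo \<open>n\<close>;
  the common factor \<open>p^i\<close> cancels because it is prime to \<open>n\<close>.\<close>

lemma exists_power_cong_1:
  assumes n: "0 < n" "coprime n p"
  obtains f where "0 < f" "n dvd p ^ f - 1"
proof -
  have "\<not> inj_on (\<lambda>i. p ^ i mod n) (UNIV :: nat set)"
  proof
    assume "inj_on (\<lambda>i. p ^ i mod n) (UNIV :: nat set)"
    moreover have "range (\<lambda>i. p ^ i mod n) \<subseteq> {..<n}" using n by auto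
    ultimately show False
      using finite_subset finite_imageD infinite_UNIV_nat by blast
  qed
  then obtain i j where ij: "p ^ i mod n = p ^ j mod n" "i < j"
    unfolding inj_on_def by (metis linorder_neqE_nat)
  have "n dvd p ^ j - p ^ i"
    using ij prime_gt_0_nat [OF prime_p]
    by (metis mod_eq_dvd_iff_nat less_imp_le power_increasing One_nat_def Suc_leI)
  moreover have "p ^ j - p ^ i = p ^ i * (p ^ (j - i) - 1)"
    using ij(2) by (simp add: diff_mult_distrib2 flip: power_add)
  ultimately have "n dvd p ^ (j - i) - 1"
    using n(2) by (simp add: coprime_dvd_mult_right_iff)
  then show thesis using ij(2) by (intro that [of "j - i"]) auto
qed

text \<open>The inner binomial coefficients are divisible by \<open>p\<close>, so \<open>t^p\<close>
  and \<open>(1 + t)^p - 1\<close> agree up to terms of absolute value at most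
  \<open>1/p\<close>.\<close>

lemma frobenius_injective:
  assumes t: "t \<in> F" "w t \<le> 1" and lt: "w ((1 + t) ^ p - 1) < 1"
  shows "w t < 1"
proof -
  have p0: "0 < p" using prime_gt_0_nat [OF prime_p] .
  have "(t + 1) ^ p = (\<Sum>k\<le>p. of_nat (p choose k) * t ^ k * 1 ^ (p - k))"
    by (rule binomial_ring)
  also have "{..p} = insert 0 (insert p {0<..<p})" using p0 by auto
  also have "(\<Sum>k\<in>\<dots>. of_nat (p choose k) * t ^ k * 1 ^ (p - k))
      = 1 + (t ^ p + (\<Sum>k\<in>{0<..<p}. of_nat (p choose k) * t ^ k))"
    using p0 by simp
  finally have eq: "t ^ p = ((1 + t) ^ p - 1) - (\<Sum>k\<in>{0<..<p}. of_nat (p choose k) * t ^ k)"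
    by (simp add: add.commute)
  have "w (\<Sum>k\<in>{0<..<p}. of_nat (p choose k) * t ^ k) \<le> 1 / real p"
  proof (rule sum_le)
    fix k assume k: "k \<in> {0<..<p}"
    have "p dvd (p choose k)" using k prime_p by (intro dvd_choose_prime) auto
    then have "w (of_nat (p choose k)) \<le> 1 / real p"
      using w_of_int_dvd [of 1 "int (p choose k)"] by simp
    then have "w (of_nat (p choose k)) * w t ^ k \<le> 1 / real p * 1"
      using t by (intro mult_mono power_le_one) auto
    then show "w (of_nat (p choose k) * t ^ k) \<le> 1 / real p"
      using t by (simp add: mult)
  qed (use t in auto)
  also have "\<dots> < 1" using p_gt_1 by simp
  finally have "w (t ^ p) < 1"
    unfolding eq
    using diff_le_max [of "(1 + t) ^ p - 1" "\<Sum>k\<in>{0<..<p}. of_nat (p choose k) * t ^ k"] lt t by auto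
  then have "w t ^ p < 1" using t by simp
  then show ?thesis
    using t by (metis le_less less_irrefl power_one)
qed

text \<open>If \<open>w u\<close> exceeded \<open>1\<close>, the leading term of a monic integral
  equation would be strictly larger than all the others together.\<close>

lemma algebraic_int_le_1:
  assumes u: "u \<in> F" "algebraic_int u"
  shows "w u \<le> 1"
proof (rule ccontr)
  assume "\<not> w u \<le> 1"
  then have gt: "1 < w u" by simp
  obtain P where P: "lead_coeff P = 1" "\<forall>i. coeff P i \<in> \<int>" "poly P u = 0"
    using u(2) by (auto simp: algebraic_int.simps)
  define d where "d = degree P"
  have "d > 0"
  proof (rule ccontr)
    assume "\<not> d > 0"
    then have "P = [:1:]" using P(1) unfolding d_def by (auto elim!: degree_eq_zeroE)
    then show False using P(3) by simp
  qed
  have cF: "coeff P i \<in> F" "w (coeff P i) \<le> 1" for i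
    using P(2) w_of_int by (metis Ints_cases of_int_mem)+
  have "poly P u = (\<Sum>i<d. coeff P i * u ^ i) + u ^ d"
    unfolding poly_altdef d_def [symmetric] lessThan_Suc_atMost [symmetric] sum.lessThan_Suc
    using P(1) by (simp add: d_def)
  then have "u ^ d = - (\<Sum>i<d. coeff P i * u ^ i)"
    using P(3) by (simp add: eq_neg_iff_add_eq_0 add.commute)
  then have "w u ^ d = w (\<Sum>i<d. coeff P i * u ^ i)"
    using u(1) cF w_power [OF u(1), of d] by simp
  also have "\<dots> \<le> w u ^ (d - 1)"
  proof (rule sum_le)
    fix i assume "i \<in> {..<d}"
    then have "w (coeff P i) * w u ^ i \<le> 1 * w u ^ (d - 1)"
      using u(1) cF gt by (intro mult_mono power_increasing) auto
    then show "w (coeff P i * u ^ i) \<le> w u ^ (d - 1)"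
      using u(1) cF by (simp add: mult)
  qed (use u(1) cF gt in auto)
  also have "\<dots> < w u ^ d"
    using gt \<open>d > 0\<close> by (intro power_strict_increasing) auto
  finally show False by simp
qed

text \<open>The residue ring of \<open>\<int>[u]\<close> modulo \<open>p\<close> is finite, so some power of a unit \<open>u\<close> is principal;
  injectivity of Frobenius makes the exponent prime to \<open>p\<close>.\<close>

lemma unit_power_principal:
  assumes u: "u \<in> F" "algebraic_int u" "w u = 1"
  obtains n where "0 < n" "coprime n p" "w (u ^ n - 1) < 1"
proof -
  obtain P where P: "lead_coeff P = 1" "\<forall>i. coeff P i \<in> \<int>" "poly P u = 0"
    using u(2) by (auto simp: algebraic_int.simps)
  define d where "d = degree P"
  have "\<forall>i. \<exists>c::int. coeff P i = of_int c" using P(2) by (auto elim: Ints_cases)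
  then obtain c where c: "\<And>i. coeff P i = of_int (c i)" by metis
  have "poly P u = (\<Sum>i<d. coeff P i * u ^ i) + u ^ d"
    unfolding poly_altdef d_def [symmetric] lessThan_Suc_atMost [symmetric] sum.lessThan_Suc
    using P(1) by (simp add: d_def)
  then have ud: "u ^ d = (\<Sum>i<d. of_int (- c i) * u ^ i)"
    using P(3) by (simp add: c sum_negf eq_neg_iff_add_eq_0 add.commute)
  have "d > 0"
  proof (rule ccontr)
    assume "\<not> d > 0"
    then have "P = [:1:]" using P(1) unfolding d_def by (auto elim!: degree_eq_zeroE)
    then show False using P(3) by simp
  qed
  \<comment> \<open>Multiplication by \<open>u\<close> shifts the coefficients and rewrites the
    overflow with the monic relation \<open>ud\<close>, so the coefficients remain integers.\<close>
  have span: "\<exists>b::nat \<Rightarrow> int. u ^ k = (\<Sum>i<d. of_int (b i) * u ^ i)" for k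
  proof (induction k)
    case 0
    have "(\<Sum>i<d. of_int (if i = 0 then 1 else 0) * u ^ i) = (\<Sum>i<d. if i = 0 then 1 else 0)"
      by (rule sum.cong) auto
    also have "\<dots> = u ^ 0" using \<open>d > 0\<close> by (simp add: sum.delta)
    finally show ?case by (intro exI [of _ "\<lambda>i. if i = 0 then 1 else 0"]) simp
  next
    case (Suc k)
    then obtain b :: "nat \<Rightarrow> int" where b: "u ^ k = (\<Sum>i<d. of_int (b i) * u ^ i)" by blast
    obtain d' where d': "d = Suc d'" using \<open>d > 0\<close> gr0_implies_Suc by blast
    have "u ^ Suc k = (\<Sum>i<d. of_int (b i) * u ^ Suc i)"
      unfolding power_Suc [of u k] b sum_distrib_left by (simp add: mult_ac)
    also have "\<dots> = (\<Sum>i<d'. of_int (b i) * u ^ Suc i) + of_int (b d') * u ^ d"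
      unfolding d' by simp
    also have "(\<Sum>i<d'. of_int (b i) * u ^ Suc i) = (\<Sum>i<d. of_int (if i = 0 then 0 else b (i - 1)) * u ^ i)"
      unfolding d' sum.lessThan_Suc_shift by simp
    also have "of_int (b d') * u ^ d = (\<Sum>i<d. of_int (- b d' * c i) * u ^ i)"
      unfolding ud sum_distrib_left by (simp add: mult_ac)
    also have "(\<Sum>i<d. of_int (if i = 0 then 0 else b (i - 1)) * u ^ i) + (\<Sum>i<d. of_int (- b d' * c i) * u ^ i)
        = (\<Sum>i<d. of_int ((if i = 0 then 0 else b (i - 1)) + - b d' * c i) * u ^ i)"
      unfolding sum.distrib [symmetric] by (rule sum.cong) (simp_all only: of_int_add distrib_right)
    finally show ?case
      by (intro exI [of _ "\<lambda>i. (if i = 0 then 0 else b (i - 1)) + - b d' * c i"])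
  qed
  define B where "B = PiE {..<d} (\<lambda>_. {0..<int p})"
  have "finite B" unfolding B_def by (intro finite_PiE) auto
  have near: "\<exists>b\<in>B. w (u ^ k - (\<Sum>i<d. of_int (b i) * u ^ i)) < 1" for k
  proof -
    obtain b :: "nat \<Rightarrow> int" where b: "u ^ k = (\<Sum>i<d. of_int (b i) * u ^ i)" using span by blast
    define b' where "b' = (\<lambda>i\<in>{..<d}. b i mod int p)"
    have "b' \<in> B" unfolding B_def b'_def using prime_gt_0_nat [OF prime_p] by auto
    have "u ^ k - (\<Sum>i<d. of_int (b' i) * u ^ i) = (\<Sum>i<d. of_int (b i - b i mod int p) * u ^ i)"
      unfolding b b'_def by (simp add: sum_subtractf left_diff_distrib)
    also have "w \<dots> \<le> 1 / real p"
    proof (rule sum_le)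
      fix i
      have "int p ^ 1 dvd b i - b i mod int p" by (simp add: minus_mod_eq_mult_div)
      from w_of_int_dvd [OF this] have "w (of_int (b i - b i mod int p)) \<le> 1 / real p"
        by (simp only: power_one_right)
      moreover have "w (of_int (b i - b i mod int p) * u ^ i) = w (of_int (b i - b i mod int p)) * w (u ^ i)"
        by (rule mult [OF of_int_mem power_mem [OF u(1)]])
      moreover have "w (u ^ i) = 1" using w_power [OF u(1)] u(3) by simp
      ultimately show "w (of_int (b i - b i mod int p) * u ^ i) \<le> 1 / real p" by (simp only: mult_1_right)
    qed (use u(1) in \<open>auto intro: mult_mem simp del: of_int_diff\<close>)
    also have "\<dots> < 1" using p_gt_1 by simp
    finally show ?thesis using \<open>b' \<in> B\<close> by blast
  qed
  define g where "g k = (SOME b. b \<in> B \<and> w (u ^ k - (\<Sum>i<d. of_int (b i) * u ^ i)) < 1)" for k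
  have gk: "g k \<in> B \<and> w (u ^ k - (\<Sum>i<d. of_int (g k i) * u ^ i)) < 1" for k
  proof -
    have "\<exists>b. b \<in> B \<and> w (u ^ k - (\<Sum>i<d. of_int (b i) * u ^ i)) < 1"
      using near [of k] by (simp only: Bex_def)
    from someI_ex [OF this] show ?thesis unfolding g_def .
  qed
  note g = conjunct1 [OF gk] conjunct2 [OF gk]
  have "\<not> inj_on g UNIV"
  proof
    assume "inj_on g UNIV"
    moreover have "finite (range g)"
      by (rule finite_subset [OF _ \<open>finite B\<close>]) (use g(1) in auto)
    ultimately show False using finite_imageD infinite_UNIV_nat by blast
  qed
  then obtain i j where ij: "g i = g j" "i < j"
    unfolding inj_on_def by (metis linorder_neqE_nat)
  define v where "v = (\<Sum>l<d. of_int (g i l) * u ^ l)"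
  have vF: "v \<in> F" unfolding v_def using u(1) by simp
  have "w (u ^ j - u ^ i) < 1"
    using diff_triangle_max [of "u ^ j" v "u ^ i"] g(2) [of i] g(2) [of j] w_commute [of "u ^ i" v] u(1) vF
    unfolding ij(1) [symmetric] v_def [symmetric] by auto
  moreover have "u ^ j - u ^ i = u ^ i * (u ^ (j - i) - 1)"
    using ij(2) by (simp add: algebra_simps flip: power_add)
  ultimately have m: "w (u ^ (j - i) - 1) < 1" "0 < j - i"
    using u ij(2) by (simp_all add: mult)
  define m where "m = j - i"
  define s where "s = multiplicity p m"
  define n where "n = m div p ^ s"
  have "m = p ^ s * n"
    unfolding n_def s_def by (simp add: multiplicity_dvd)
  moreover have "\<not> p dvd n"
    unfolding n_def s_def using m(2) prime_p by (intro multiplicity_decompose) (auto simp: m_def)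
  ultimately have n: "m = p ^ s * n" "\<not> p dvd n" by blast+
  \<comment> \<open>Strips the factors \<open>p\<close> from the exponent one at a time, each by
    injectivity of Frobenius.\<close>
  have desc: "w (u ^ n - 1) < 1" if "w (u ^ (p ^ k * n) - 1) < 1" for k
    using that
  proof (induction k)
    case (Suc k)
    define t where "t = u ^ (p ^ k * n) - 1"
    have t: "t \<in> F" unfolding t_def using u(1) by simp
    have "w t \<le> 1" unfolding t_def using diff_le_max [of "u ^ (p ^ k * n)" 1] u by simp
    moreover have "(1 + t) ^ p = u ^ (p ^ Suc k * n)"
      unfolding t_def by (simp add: power_mult [symmetric] mult_ac)
    ultimately have "w t < 1"
      using frobenius_injective [OF t] Suc.prems by simp
    then show ?case unfolding t_def by (rule Suc.IH)
  qed simp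
  have "w (u ^ n - 1) < 1"
    using desc [of s] m(1) n(1) unfolding m_def by simp
  moreover have "0 < n" using n m(2) unfolding m_def by (cases n) auto
  moreover have "coprime n p"
    using prime_imp_coprime [OF prime_p n(2)] by (simp add: coprime_commute)
  ultimately show thesis using that by blast
qed

text \<open>Teichmueller's construction. Some power \<open>u^n\<close> with \<open>n\<close> prime
  to \<open>p\<close> is principal; choosing \<open>q = p^f\<close> congruent to \<open>1\<close>
  modulo \<open>n\<close> makes \<open>u^(q-1)\<close> principal too. Then \<open>u^(q^k)\<close>
  converges to a root of unity killed by \<open>q - 1\<close>, and \<open>u\<close> divided by this
  limit is principal.\<close>

lemma principal_part_exists:
  assumes u: "u \<in> F" "algebraic_int u" "w u = 1"
  shows "\<exists>y \<zeta>. y \<in> PU \<and> teich \<zeta> \<and> completion_emb F w u = \<zeta> \<otimes>\<^bsub>Q\<^esub> y"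
proof -
  obtain n where n: "0 < n" "coprime n p" "w (u ^ n - 1) < 1"
    using unit_power_principal [OF u] .
  obtain f where f: "0 < f" "n dvd p ^ f - 1"
    using exists_power_cong_1 [OF n(1,2)] .
  define q where "q = p ^ f"
  have "1 < q" unfolding q_def using prime_gt_1_nat [OF prime_p] f(1) by (rule one_less_power)
  obtain e where e: "q - 1 = n * e" using f(2) unfolding q_def by blast
  define a where "a = u ^ (q - 1)"
  have aF: "a \<in> F" unfolding a_def using u by simp
  define r where "r = w (a - 1)"
  have "w ((u ^ n) ^ e - 1) \<le> w (u ^ n - 1)"
    by (rule principal_power [OF power_mem [OF u(1)] order_refl n(3)])
  then have r: "r < 1"
    using n(3) unfolding r_def a_def e by (simp add: power_mult)
  define \<rho> where "\<rho> = max (1 / real p) r"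
  have rho: "0 < \<rho>" "\<rho> < 1" unfolding \<rho>_def using rate [OF r] by auto
  \<comment> \<open>The exponent is a multiple of \<open>q - 1\<close>, which makes the power one of
    the principal unit \<open>a\<close>, and a multiple of \<open>p^k\<close>, which makes it
    converge to \<open>1\<close>.\<close>
  have key: "w (u ^ (q ^ k * (q ^ l - 1)) - 1) \<le> \<rho> ^ k \<and> w (u ^ (q ^ k * (q ^ l - 1)) - 1) \<le> r" for k l
  proof -
    obtain q' where q': "q = Suc q'" using \<open>1 < q\<close> by (cases q) auto
    have "\<exists>b. Suc q' ^ l = q' * b + 1"
    proof (induction l)
      case (Suc l)
      then obtain b where "Suc q' ^ l = q' * b + 1" by blast
      then have "Suc q' ^ Suc l = q' * (b * q' + b + 1) + 1" by (simp add: algebra_simps)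
      then show ?case by blast
    qed auto
    then obtain b where "Suc q' ^ l = q' * b + 1" by (elim exE)
    then have b: "q ^ l - 1 = (q - 1) * b" unfolding q' by simp
    have ex: "u ^ (q ^ k * (q ^ l - 1)) = a ^ (q ^ k * b)"
      unfolding b a_def by (simp add: power_mult [symmetric] mult_ac)
    have "p ^ k dvd q ^ k * b"
      unfolding q_def using f(1) by (intro dvd_mult2 dvd_power_same) (simp add: dvd_power)
    then have "w (a ^ (q ^ k * b) - 1) \<le> \<rho> ^ k"
      unfolding \<rho>_def using aF r by (intro principal_power_dvd) (auto simp: r_def)
    moreover have "w (a ^ (q ^ k * b) - 1) \<le> r"
      using aF r by (intro principal_power) (auto simp: r_def)
    ultimately show ?thesis unfolding ex by blast
  qed
  define z where "z k = u ^ (q ^ k)" for k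
  have zF: "z k \<in> F" and wz: "w (z k) = 1" for k
    unfolding z_def using u by simp_all
  have z0: "z k \<noteq> 0" for k
    using wz [of k] by auto
  have zdiff: "w (z l - z k) \<le> \<rho> ^ k" if "k \<le> l" for k l
  proof -
    have "q ^ l = q ^ k + q ^ k * (q ^ (l - k) - 1)"
      using that \<open>1 < q\<close> by (simp add: diff_mult_distrib2 flip: power_add)
    then have "z l = z k * u ^ (q ^ k * (q ^ (l - k) - 1))"
      unfolding z_def by (simp flip: power_add)
    then have eq: "z l - z k = z k * (u ^ (q ^ k * (q ^ (l - k) - 1)) - 1)"
      by (simp add: algebra_simps)
    show ?thesis
      unfolding eq using key [of k "l - k"] u(1) zF wz by (simp add: mult)
  qed
  have zC: "z \<in> C"
  proof (rule cauchyI)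
    fix \<epsilon> :: real assume "\<epsilon> > 0"
    then obtain N where N: "\<rho> ^ N < \<epsilon>" using real_arch_pow_inv rho by blast
    have "w (z l - z k) < \<epsilon>" if "l \<ge> N" "k \<ge> N" for l k
    proof -
      have "w (z l - z k) \<le> max (w (z l - z N)) (w (z N - z k))"
        using zF by (intro diff_triangle_max)
      moreover have "w (z N - z k) = w (z k - z N)" using zF by (intro w_commute)
      ultimately show ?thesis using zdiff [OF that(1)] zdiff [OF that(2)] N by linarith
    qed
    then show "\<exists>N. \<forall>l\<ge>N. \<forall>k\<ge>N. w (z l - z k) < \<epsilon>" by blast
  qed (rule zF)
  have ziC: "(\<lambda>k. inverse (z k)) \<in> C"
    by (rule cauchy_inverse [OF zC, of 1]) (simp_all add: wz)
  have "teich (cls z)"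
    unfolding teich_def
  proof (intro conjI exI)
    show "cls z \<in> carrier Q" using zC by simp
    show "0 < q - 1" using \<open>1 < q\<close> by simp
    \<comment> \<open>Consecutive numbers are coprime, so \<open>q - 1\<close> is an admissible
      order prime to \<open>p\<close>.\<close>
    have "coprime (q - 1) q" using \<open>1 < q\<close> by (intro coprime_diff_one_left_nat) simp
    then show "coprime (q - 1) p" unfolding q_def using f(1) by simp
    have "(\<lambda>k. z k ^ (q - 1) - 1) \<in> NS"
    proof (rule null_leI)
      show "w (z k ^ (q - 1) - 1) \<le> \<rho> ^ k" for k
        using key [of k 1] unfolding z_def by (simp add: power_mult [symmetric])
      show "(\<lambda>k. \<rho> ^ k) \<longlonglongrightarrow> 0" using rho by (intro LIMSEQ_realpow_zero) auto
    qed (use zF in simp)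
    then show "cls z [^]\<^bsub>Q\<^esub> (q - 1) = \<one>\<^bsub>Q\<^esub>"
      using zC by (simp add: one_Q cls_eq)
  qed
  moreover have "pseq (\<lambda>k. u * inverse (z k)) r"
    unfolding pseq_def
  proof (intro conjI allI)
    show "(\<lambda>k. u * inverse (z k)) \<in> C" using u(1) ziC by (intro cauchy_mult) auto
    show "0 \<le> r" unfolding r_def using aF by simp
    fix k
    have qk: "q ^ k = Suc (q ^ k - 1)" using \<open>1 < q\<close> by simp
    have "z k = u * u ^ (q ^ k - 1)" unfolding z_def by (subst qk) simp
    then have "u * inverse (z k) - 1 = u * inverse (z k) * (1 - u ^ (q ^ k - 1))"
      using z0 [of k] by (simp add: field_simps)
    then have "w (u * inverse (z k) - 1) = w (1 - u ^ (q ^ k - 1))"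
      using u zF wz by (simp add: mult)
    also have "\<dots> \<le> r"
      using key [of 0 k] u(1) w_commute [of 1 "u ^ (q ^ k - 1)"] by simp
    finally show "w (u * inverse (z k) - 1) \<le> r" .
  qed (rule r)
  moreover have "completion_emb F w u = cls z \<otimes>\<^bsub>Q\<^esub> cls (\<lambda>k. u * inverse (z k))"
  proof -
    have zz: "(\<lambda>k. z k * (u * inverse (z k))) = (\<lambda>_. u)" using z0 by (simp add: fun_eq_iff)
    have "(\<lambda>k. u * inverse (z k)) \<in> C" using u(1) ziC by (intro cauchy_mult) auto
    from mult_Q [OF zC this] show ?thesis by (simp only: emb_eq zz)
  qed
  ultimately show ?thesis
    using pseq_PU by blast
qed

lemma unit_abs:
  assumes "u \<in> F" "u \<noteq> 0" "algebraic_int u" "algebraic_int (inverse u)"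
  shows "w u = 1"
proof -
  have "w u \<le> 1" "w (inverse u) \<le> 1"
    using assms by (simp_all only: algebraic_int_le_1 inverse_mem)
  then have "w u \<le> 1" "inverse (w u) \<le> 1" using assms(1) by simp_all
  then show ?thesis
    using pos [OF assms(1,2)] by (simp add: field_simps)
qed

lemma principal_part_eqI:
  assumes "y \<in> PU" "teich \<zeta>" "completion_emb F w u = \<zeta> \<otimes>\<^bsub>Q\<^esub> y"
  shows "principal_part p F w u = y"
  unfolding principal_part_def
proof (rule the_equality)
  show "y \<in> PU \<and> (\<exists>\<zeta>\<in>carrier Q. (\<exists>n::nat. n > 0 \<and> coprime n p \<and> \<zeta> [^]\<^bsub>Q\<^esub> n = \<one>\<^bsub>Q\<^esub>)
      \<and> completion_emb F w u = \<zeta> \<otimes>\<^bsub>Q\<^esub> y)"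
    using assms unfolding teich_def by (intro conjI bexI [of _ \<zeta>]) simp_all
  fix y' assume y': "y' \<in> PU \<and> (\<exists>\<zeta>\<in>carrier Q. (\<exists>n::nat. n > 0 \<and> coprime n p \<and> \<zeta> [^]\<^bsub>Q\<^esub> n = \<one>\<^bsub>Q\<^esub>)
      \<and> completion_emb F w u = \<zeta> \<otimes>\<^bsub>Q\<^esub> y')"
  then obtain \<zeta>' where "teich \<zeta>'" "completion_emb F w u = \<zeta>' \<otimes>\<^bsub>Q\<^esub> y'"
    unfolding teich_def by (elim conjE bexE) simp
  with y' assms show "y' = y"
    by (intro principal_part_unique [of y' \<zeta>' y \<zeta>]) simp_all
qed

lemma principal_part_spec:
  assumes "u \<in> F" "u \<noteq> 0" "algebraic_int u" "algebraic_int (inverse u)"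
  shows "principal_part p F w u \<in> PU"
    and "\<exists>\<zeta>. teich \<zeta> \<and> completion_emb F w u = \<zeta> \<otimes>\<^bsub>Q\<^esub> principal_part p F w u"
proof -
  obtain y \<zeta> where y: "y \<in> PU" "teich \<zeta>" "completion_emb F w u = \<zeta> \<otimes>\<^bsub>Q\<^esub> y"
    using principal_part_exists [OF assms(1,3) unit_abs [OF assms]] by (elim exE conjE)
  note eq = principal_part_eqI [OF y]
  show "principal_part p F w u \<in> PU" unfolding eq by (rule y)
  show "\<exists>\<zeta>. teich \<zeta> \<and> completion_emb F w u = \<zeta> \<otimes>\<^bsub>Q\<^esub> principal_part p F w u"
    unfolding eq using y by (intro exI [of _ \<zeta>]) simp
qed

end

subsection \<open>Sums and products of algebraic integers\<close>

interpretation zmod: Modules.module "\<lambda>(n::int) (x::'a::field_char_0). of_int n * x"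
  by unfold_locales (simp_all add: algebra_simps)

text \<open>The determinant trick: multiplication by \<open>x\<close> acts on the generators through
  an integer matrix with the vector of generators as eigenvector, so \<open>x\<close> is a root of a
  monic integral characteristic polynomial.\<close>

lemma algebraic_int_if_stable:
  fixes x :: "'a::field_char_0"
  assumes G: "finite G" "\<exists>g\<in>G. g \<noteq> 0" and stable: "\<And>g. g \<in> G \<Longrightarrow> x * g \<in> zmod.span G"
  shows "algebraic_int x"
proof -
  define n where "n = card G"
  obtain f where f: "bij_betw f {..<n} G"
    using ex_bij_betw_nat_finite [OF G(1)] unfolding n_def atLeast0LessThan by blast
  have fG: "f i \<in> G" if "i < n" for i
    using f that unfolding bij_betw_def by blast
  have "\<exists>c. x * g = (\<Sum>h\<in>G. of_int (c h) * h)" if "g \<in> G" for g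
    using stable [OF that] unfolding zmod.span_finite [OF G(1)] by blast
  then obtain c where c: "\<And>g. g \<in> G \<Longrightarrow> x * g = (\<Sum>h\<in>G. of_int (c g h) * h)"
    by metis
  define A0 where "A0 = mat n n (\<lambda>(i, j). c (f i) (f j))"
  define A where "A = map_mat (of_int :: int \<Rightarrow> 'a) A0"
  define v where "v = vec n f"
  have A0: "A0 \<in> carrier_mat n n" and A: "A \<in> carrier_mat n n"
    unfolding A0_def A_def by auto
  have "eigenvector A v x"
    unfolding eigenvector_def
  proof (intro conjI)
    show "v \<in> carrier_vec (dim_row A)"
      unfolding v_def using A by auto
    obtain g where "g \<in> G" "g \<noteq> 0" using G(2) by blast
    then obtain i where "i < n" "f i \<noteq> 0"
      using f unfolding bij_betw_def by auto
    then show "v \<noteq> 0\<^sub>v (dim_row A)"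
      using A unfolding v_def by (metis carrier_matD(1) index_vec index_zero_vec(1))
    show "A *\<^sub>v v = x \<cdot>\<^sub>v v"
    proof (rule eq_vecI)
      fix i assume "i < dim_vec (x \<cdot>\<^sub>v v)"
      then have i: "i < n" unfolding v_def by simp
      have "(A *\<^sub>v v) $ i = (\<Sum>j<n. of_int (c (f i) (f j)) * f j)"
        using i A0 unfolding A_def v_def
        by (simp add: scalar_prod_def A0_def atLeast0LessThan)
      also have "\<dots> = (\<Sum>h\<in>G. of_int (c (f i) h) * h)"
        by (rule sum.reindex_bij_betw [OF f])
      also have "\<dots> = x * f i" using c [OF fG [OF i]] by simp
      also have "\<dots> = (x \<cdot>\<^sub>v v) $ i" using i unfolding v_def by simp
      finally show "(A *\<^sub>v v) $ i = (x \<cdot>\<^sub>v v) $ i" .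
    qed (simp add: A_def A0_def v_def)
  qed
  then have "poly (char_poly A) x = 0"
    using eigenvalue_root_char_poly [OF A] unfolding eigenvalue_def by blast
  moreover have "char_poly A = map_poly of_int (char_poly A0)"
    unfolding A_def by (rule of_int_hom.char_poly_hom [OF A0])
  moreover have "lead_coeff (char_poly A0) = 1"
    using degree_monic_char_poly [OF A0] by simp
  ultimately show ?thesis
    unfolding algebraic_int_altdef_ipoly by auto
qed

lemma algebraic_int_finite_module:
  fixes x :: "'a::field_char_0"
  assumes "algebraic_int x"
  obtains G where "finite G" "1 \<in> G" "\<And>g. g \<in> G \<Longrightarrow> x * g \<in> zmod.span G"
proof -
  obtain P where P: "lead_coeff P = 1" "\<forall>i. coeff P i \<in> \<int>" "poly P x = 0"
    using assms by (auto simp: algebraic_int.simps)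
  define d where "d = degree P"
  have "d > 0"
  proof (rule ccontr)
    assume "\<not> d > 0"
    then have "P = [:1:]" using P(1) unfolding d_def by (auto elim!: degree_eq_zeroE)
    then show False using P(3) by simp
  qed
  define G where "G = (\<lambda>i. x ^ i) ` {..<d}"
  have base: "x ^ i \<in> zmod.span G" if "i < d" for i
    unfolding G_def using that by (intro zmod.span_base) auto
  have "poly P x = (\<Sum>i<d. coeff P i * x ^ i) + x ^ d"
    unfolding poly_altdef d_def [symmetric] lessThan_Suc_atMost [symmetric] sum.lessThan_Suc
    using P(1) by (simp add: d_def)
  then have xd: "x ^ d = - (\<Sum>i<d. coeff P i * x ^ i)"
    using P(3) by (simp add: eq_neg_iff_add_eq_0 add.commute)
  have cf: "coeff P i * x ^ i \<in> zmod.span G" if "i < d" for i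
  proof -
    obtain k where "coeff P i = of_int k" using P(2) by (auto elim: Ints_cases)
    then show ?thesis using zmod.span_scale [OF base [OF that], of k] by simp
  qed
  have top: "x ^ d \<in> zmod.span G"
    unfolding xd by (rule zmod.span_neg, rule zmod.span_sum, rule cf) simp
  show thesis
  proof (rule that [of G])
    show "finite G" unfolding G_def by simp
    show "1 \<in> G" unfolding G_def using \<open>d > 0\<close> by (auto intro!: image_eqI [of _ _ 0])
    fix g assume "g \<in> G"
    then obtain i where i: "i < d" "g = x ^ i" unfolding G_def by blast
    have eq: "x * g = x ^ Suc i" unfolding i(2) by simp
    have "x ^ Suc i \<in> zmod.span G"
    proof (cases "Suc i < d")
      case True
      then show ?thesis by (rule base)
    next
      case False
      then have "Suc i = d" using i by simp
      then show ?thesis using top by simp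
    qed
    then show "x * g \<in> zmod.span G" unfolding eq .
  qed
qed

lemma zmod_span_mult:
  fixes x y :: "'a::field_char_0"
  assumes "x \<in> zmod.span G" "y \<in> zmod.span H"
  shows "x * y \<in> zmod.span {g * h | g h. g \<in> G \<and> h \<in> H}"
  using assms(1)
proof (induction rule: zmod.span_induct_alt)
  case base
  then show ?case by (simp add: zmod.span_zero)
next
  case (step c g z)
  have "g * y \<in> zmod.span {g * h | g h. g \<in> G \<and> h \<in> H}"
    using assms(2)
  proof (induction rule: zmod.span_induct_alt)
    case base
    then show ?case by (simp add: zmod.span_zero)
  next
    case (step c' h z')
    have "g * h \<in> zmod.span {g * h | g h. g \<in> G \<and> h \<in> H}"
      using \<open>g \<in> G\<close> step by (intro zmod.span_base) blast
    from zmod.span_add [OF zmod.span_scale [OF this, of c'] step(2)] show ?case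
      by (simp add: algebra_simps)
  qed
  from zmod.span_add [OF zmod.span_scale [OF this, of c] step(2)] show ?case
    by (simp add: algebra_simps)
qed

text \<open>The products of generators for \<open>x\<close> with generators for \<open>y\<close>
  span a finitely generated group stable under multiplication by both.\<close>

lemma
  fixes x y :: "'a::field_char_0"
  assumes x: "algebraic_int x" and y: "algebraic_int y"
  shows algebraic_int_times: "algebraic_int (x * y)"
    and algebraic_int_plus: "algebraic_int (x + y)"
proof -
  obtain G where G: "finite G" "1 \<in> G" "\<And>g. g \<in> G \<Longrightarrow> x * g \<in> zmod.span G"
    using algebraic_int_finite_module [OF x] by blast
  obtain H where H: "finite H" "1 \<in> H" "\<And>g. g \<in> H \<Longrightarrow> y * g \<in> zmod.span H"
    using algebraic_int_finite_module [OF y] by blast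
  let ?S = "{g * h | g h. g \<in> G \<and> h \<in> H}"
  have "?S = (\<lambda>(g, h). g * h) ` (G \<times> H)" by auto
  then have fin: "finite ?S" using G(1) H(1) by simp
  have "1 = (1::'a) * 1" by simp
  then have "1 \<in> ?S" using G(2) H(2) by blast
  then have nz: "\<exists>g\<in>?S. g \<noteq> 0" by (intro bexI [of _ 1]) simp_all
  show "algebraic_int (x * y)"
  proof (rule algebraic_int_if_stable [OF fin nz])
    fix s assume "s \<in> ?S"
    then obtain g h where s: "s = g * h" "g \<in> G" "h \<in> H" by blast
    have eq: "x * y * s = (x * g) * (y * h)" unfolding s(1) by (simp only: mult_ac)
    show "x * y * s \<in> zmod.span ?S"
      unfolding eq by (rule zmod_span_mult [OF G(3) [OF s(2)] H(3) [OF s(3)]])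
  qed
  show "algebraic_int (x + y)"
  proof (rule algebraic_int_if_stable [OF fin nz])
    fix s assume "s \<in> ?S"
    then obtain g h where s: "s = g * h" "g \<in> G" "h \<in> H" by blast
    have eq: "(x + y) * s = (x * g) * h + g * (y * h)" unfolding s(1) by (simp only: ring_distribs mult_ac)
    show "(x + y) * s \<in> zmod.span ?S"
      unfolding eq
      by (rule zmod.span_add [OF zmod_span_mult [OF G(3) [OF s(2)] zmod.span_base [OF s(3)]]
          zmod_span_mult [OF zmod.span_base [OF s(2)] H(3) [OF s(3)]]])
  qed
qed

lemma algebraic_int_power_int:
  fixes u :: "'a::field_char_0"
  assumes "algebraic_int u" "algebraic_int (inverse u)"
  shows "algebraic_int (u powi k)"
proof -
  have pow: "algebraic_int (x ^ n)" if "algebraic_int x" for x :: 'a and n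
    using that by (induction n) (auto intro: algebraic_int_times)
  show ?thesis
    using assms by (simp add: power_int_def pow)
qed

subsection \<open>The module of local units\<close>

context place
begin

lemma Zp_ops [simp]: "a \<oplus>\<^bsub>Zp p\<^esub> b = a \<oplus>\<^bsub>Q.Q\<^esub> b" "a \<otimes>\<^bsub>Zp p\<^esub> b = a \<otimes>\<^bsub>Q.Q\<^esub> b" "\<one>\<^bsub>Zp p\<^esub> = \<one>\<^bsub>Q.Q\<^esub>"
  by (subst Zp_eq; simp)+

lemma padic_power_closed:
  assumes "a \<in> carrier (Zp p)" "x \<in> PU"
  shows "padic_power p F w a x \<in> PU"
proof -
  obtain k where k: "nat_seq k \<in> Q.C" "a = qcls (nat_seq k)" using Zp_nat_seq [OF assms(1)] .
  obtain s r where s: "pseq s r" "x = cls s" using PU_pseq [OF assms(2)] .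
  show ?thesis
    unfolding k(2) s(2) padic_power_cls [OF s(1) k(1)] by (rule pseq_PU [OF pseq_power [OF s(1) k(1)]])
qed

lemma padic_power_add:
  assumes "a \<in> carrier (Zp p)" "b \<in> carrier (Zp p)" "x \<in> PU"
  shows "padic_power p F w (a \<oplus>\<^bsub>Zp p\<^esub> b) x = padic_power p F w a x \<otimes>\<^bsub>Q\<^esub> padic_power p F w b x"
proof -
  obtain k where k: "nat_seq k \<in> Q.C" "a = qcls (nat_seq k)" using Zp_nat_seq [OF assms(1)] .
  obtain l where l: "nat_seq l \<in> Q.C" "b = qcls (nat_seq l)" using Zp_nat_seq [OF assms(2)] .
  obtain s r where s: "pseq s r" "x = cls s" using PU_pseq [OF assms(3)] .
  have kl: "nat_seq (\<lambda>n. k n + l n) \<in> Q.C" "a \<oplus>\<^bsub>Zp p\<^esub> b = qcls (nat_seq (\<lambda>n. k n + l n))"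
    using Q.cauchy_add [OF k(1) l(1)] k l by simp_all
  show ?thesis
    unfolding kl(2) unfolding k(2) l(2) s(2) padic_power_cls [OF s(1) kl(1)] padic_power_cls [OF s(1) k(1)]
      padic_power_cls [OF s(1) l(1)] power_add
    by (rule mult_Q [symmetric]) (rule pseqD(1) [OF pseq_power [OF s(1) k(1)]], rule pseqD(1) [OF pseq_power [OF s(1) l(1)]])
qed

lemma padic_power_mult_right:
  assumes "a \<in> carrier (Zp p)" "x \<in> PU" "y \<in> PU"
  shows "padic_power p F w a (x \<otimes>\<^bsub>Q\<^esub> y) = padic_power p F w a x \<otimes>\<^bsub>Q\<^esub> padic_power p F w a y"
proof -
  obtain k where k: "nat_seq k \<in> Q.C" "a = qcls (nat_seq k)" using Zp_nat_seq [OF assms(1)] .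
  obtain s r where s: "pseq s r" "x = cls s" using PU_pseq [OF assms(2)] .
  obtain t q where t: "pseq t q" "y = cls t" using PU_pseq [OF assms(3)] .
  have st: "cls s \<otimes>\<^bsub>Q\<^esub> cls t = cls (\<lambda>n. s n * t n)"
    by (rule mult_Q [OF pseqD(1) [OF s(1)] pseqD(1) [OF t(1)]])
  show ?thesis
    unfolding k(2) s(2) t(2) st padic_power_cls [OF pseq_mult [OF s(1) t(1)] k(1)] padic_power_cls [OF s(1) k(1)]
      padic_power_cls [OF t(1) k(1)] power_mult_distrib
    by (rule mult_Q [symmetric]) (rule pseqD(1) [OF pseq_power [OF s(1) k(1)]], rule pseqD(1) [OF pseq_power [OF t(1) k(1)]])
qed

lemma padic_power_assoc:
  assumes "a \<in> carrier (Zp p)" "b \<in> carrier (Zp p)" "x \<in> PU"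
  shows "padic_power p F w (a \<otimes>\<^bsub>Zp p\<^esub> b) x = padic_power p F w a (padic_power p F w b x)"
proof -
  obtain k where k: "nat_seq k \<in> Q.C" "a = qcls (nat_seq k)" using Zp_nat_seq [OF assms(1)] .
  obtain l where l: "nat_seq l \<in> Q.C" "b = qcls (nat_seq l)" using Zp_nat_seq [OF assms(2)] .
  obtain s r where s: "pseq s r" "x = cls s" using PU_pseq [OF assms(3)] .
  have kl: "nat_seq (\<lambda>n. l n * k n) \<in> Q.C" "a \<otimes>\<^bsub>Zp p\<^esub> b = qcls (nat_seq (\<lambda>n. l n * k n))"
    using Q.cauchy_mult [OF l(1) k(1)] k l by (simp_all add: mult.commute)
  show ?thesis
    unfolding kl(2) unfolding k(2) l(2) s(2) padic_power_cls [OF s(1) kl(1)]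
      padic_power_cls [OF s(1) l(1)] padic_power_cls [OF pseq_power [OF s(1) l(1)] k(1)] power_mult ..
qed

lemma padic_power_one:
  assumes "x \<in> PU"
  shows "padic_power p F w \<one>\<^bsub>Zp p\<^esub> x = x"
proof -
  obtain s r where s: "pseq s r" "x = cls s" using PU_pseq [OF assms(1)] .
  have one: "nat_seq (\<lambda>_. 1) \<in> Q.C" "\<one>\<^bsub>Zp p\<^esub> = qcls (nat_seq (\<lambda>_. 1))"
    by (simp_all add: Q.one_Q)
  show ?thesis
    unfolding one(2) s(2) padic_power_cls [OF s(1) one(1)] by simp
qed

end

text \<open>The binomial expansion of \<open>(x + y)^n\<close> has \<open>n + 1\<close> terms, each
  bounded by \<open>M^n\<close> because integers are bounded by \<open>1\<close>. A linear factor
  cannot compensate a strict excess raised to the power \<open>n\<close>.\<close>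

lemma nonarch_of_bounded:
  fixes F :: "'a::field set" and w :: "'a \<Rightarrow> real"
  assumes cl: "1 \<in> F" "\<And>x y. x \<in> F \<Longrightarrow> y \<in> F \<Longrightarrow> x + y \<in> F" "\<And>x y. x \<in> F \<Longrightarrow> y \<in> F \<Longrightarrow> x * y \<in> F" "0 \<in> F"
    and av: "absolute_value_on F w" and bd: "\<And>n. w (of_nat n) \<le> 1"
    and xy: "x \<in> F" "y \<in> F"
  shows "w (x + y) \<le> max (w x) (w y)"
proof (rule ccontr)
  assume "\<not> w (x + y) \<le> max (w x) (w y)"
  then have gt: "max (w x) (w y) < w (x + y)" by (rule not_le_imp_less)
  have nn: "\<And>x. x \<in> F \<Longrightarrow> 0 \<le> w x" and z: "\<And>x. x \<in> F \<Longrightarrow> w x = 0 \<longleftrightarrow> x = 0"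
    and m: "\<And>x y. x \<in> F \<Longrightarrow> y \<in> F \<Longrightarrow> w (x * y) = w x * w y"
    and a: "\<And>x y. x \<in> F \<Longrightarrow> y \<in> F \<Longrightarrow> w (x + y) \<le> w x + w y"
    using av unfolding absolute_value_on_def by simp_all
  have w1: "w 1 = 1" using m [OF cl(1) cl(1)] z [OF cl(1)] by simp
  have pw: "x ^ n \<in> F" "w (x ^ n) = w x ^ n" if "x \<in> F" for x n
    by (induction n) (simp_all add: cl that w1 m)
  have nat: "of_nat n \<in> F" for n by (induction n) (simp_all add: cl)
  have sumF: "sum f I \<in> F \<and> w (sum f I) \<le> (\<Sum>i\<in>I. w (f i))" if "finite I" "\<And>i. i \<in> I \<Longrightarrow> f i \<in> F" for f and I :: "nat set"
    using that
  proof (induction I rule: finite_induct)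
    case empty
    then show ?case using cl z [of 0] by simp
  next
    case (insert i I)
    then have "f i \<in> F" "sum f I \<in> F" "w (sum f I) \<le> (\<Sum>i\<in>I. w (f i))" by simp_all
    then show ?case
      using insert.hyps a [of "f i" "sum f I"] cl(2) [of "f i" "sum f I"] by simp
  qed
  define M where "M = max (w x) (w y)"
  have M0: "0 \<le> M" unfolding M_def using nn xy by (simp add: le_max_iff_disj)
  have bound: "w (x + y) ^ n \<le> real (Suc n) * M ^ n" for n
  proof -
    have xyF: "x + y \<in> F" using xy by (rule cl)
    have "w (x + y) ^ n = w ((x + y) ^ n)" using pw(2) [OF xyF] by simp
    also have "(x + y) ^ n = (\<Sum>k\<le>n. of_nat (n choose k) * x ^ k * y ^ (n - k))"
      by (rule binomial_ring)
    also have "w \<dots> \<le> (\<Sum>k\<le>n. w (of_nat (n choose k) * x ^ k * y ^ (n - k)))"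
      by (intro conjunct2 [OF sumF] finite_atMost cl(3) nat pw(1) xy)
    also have "\<dots> \<le> (\<Sum>k\<le>n. M ^ n)"
    proof (rule sum_mono)
      fix k assume k: "k \<in> {..n}"
      have "w (of_nat (n choose k) * x ^ k * y ^ (n - k)) = w (of_nat (n choose k)) * w x ^ k * w y ^ (n - k)"
        using pw xy nat cl(3) by (simp add: m)
      also have "\<dots> \<le> 1 * M ^ k * M ^ (n - k)"
        using bd nn xy nat M0 unfolding M_def by (intro mult_mono power_mono) (auto intro!: mult_nonneg_nonneg)
      also have "\<dots> = M ^ n" using k by (simp flip: power_add)
      finally show "w (of_nat (n choose k) * x ^ k * y ^ (n - k)) \<le> M ^ n" .
    qed
    also have "\<dots> = real (Suc n) * M ^ n" by simp
    finally show ?thesis .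
  qed
  define q where "q = M / w (x + y)"
  have pos: "0 < w (x + y)" using gt M0 unfolding M_def by linarith
  have q: "0 \<le> q" "q < 1" unfolding q_def using gt M0 pos unfolding M_def by simp_all
  \<comment> \<open>This lower bound contradicts the convergence of \<open>n q^n\<close> to zero for
    \<open>q\<close> below \<open>1\<close>.\<close>
  have ge: "1 \<le> real (Suc n) * q ^ n" for n
    using bound [of n] pos unfolding q_def by (simp add: power_divide field_simps)
  have "q > 0" using ge [of 1] q(1) by (cases "q = 0") auto
  have "(\<lambda>n. real n * q ^ n) \<longlonglongrightarrow> 0"
    using q by (intro powser_times_n_limit_0) simp
  from order_tendstoD(2) [OF this \<open>q > 0\<close>] obtain N where N: "\<forall>n\<ge>N. real n * q ^ n < q"
    unfolding eventually_sequentially ..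
  have "real (Suc N) * q ^ Suc N < q" using N [rule_format, of "Suc N"] by simp
  also have "q \<le> q * (real (Suc N) * q ^ N)" using mult_left_mono [OF ge q(1), of N] by simp
  finally show False by (simp add: mult_ac)
qed

text \<open>Closure under the field operations only, so that it applies at once to \<open>L\<close>
  and to the fixed fields. Finiteness over the rationals enters later, for the extension of places
  and the rank of the units.\<close>

locale padic_subfield = padic_prime p for p :: nat +
  fixes F :: "'a::field_char_0 set"
  assumes F_closed: "0 \<in> F" "1 \<in> F" "\<And>x y. x \<in> F \<Longrightarrow> y \<in> F \<Longrightarrow> x + y \<in> F"
    "\<And>x y. x \<in> F \<Longrightarrow> y \<in> F \<Longrightarrow> x * y \<in> F" "\<And>x. x \<in> F \<Longrightarrow> - x \<in> F" "\<And>x. x \<in> F \<Longrightarrow> inverse x \<in> F"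
begin

abbreviation "LU \<equiv> local_units p F"
abbreviation "P \<equiv> places_above p F"

lemma place: 
  assumes "w \<in> P"
  shows "place p F w"
proof -
  have av: "absolute_value_on F w" and wq: "\<And>q. w (of_rat q) = padic_abs p q"
    using assms unfolding places_above_def by simp_all
  have "w (of_nat n) \<le> 1" for n
    using wq [of "of_nat n"] Q.w_of_nat [of n] by simp
  from nonarch_of_bounded [OF F_closed(2,3,4,1) av this]
  have na: "\<And>x y. x \<in> F \<Longrightarrow> y \<in> F \<Longrightarrow> w (x + y) \<le> max (w x) (w y)" .
  show ?thesis
    by unfold_locales (use F_closed av na wq in \<open>simp_all add: absolute_value_on_def\<close>)
qed

lemma LU_carrier: "carrier LU = (\<Pi>\<^sub>E w\<in>P. principal_units F w)"
  unfolding local_units_def by simp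

lemma LU_mem: "x \<in> carrier LU \<Longrightarrow> w \<in> P \<Longrightarrow> x w \<in> principal_units F w"
  unfolding LU_carrier by (simp add: PiE_def Pi_def)

lemma LU_eqI:
  assumes "x \<in> extensional P" "y \<in> extensional P" "\<And>w. w \<in> P \<Longrightarrow> x w = y w"
  shows "x = y"
  using assms by (rule extensionalityI)

lemma LU_ext: "x \<in> carrier LU \<Longrightarrow> x \<in> extensional P"
  unfolding LU_carrier by (simp add: PiE_def)

lemma LU_ops: "x \<oplus>\<^bsub>LU\<^esub> y = (\<lambda>w\<in>P. x w \<otimes>\<^bsub>completion F w\<^esub> y w)" "\<zero>\<^bsub>LU\<^esub> = (\<lambda>w\<in>P. \<one>\<^bsub>completion F w\<^esub>)"
  "a \<odot>\<^bsub>LU\<^esub> x = (\<lambda>w\<in>P. padic_power p F w a (x w))"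
  unfolding local_units_def by simp_all

lemma completion_cring: "w \<in> P \<Longrightarrow> cring (completion F w)"
proof -
  assume "w \<in> P"
  then interpret place p F w by (rule place)
  show ?thesis by (rule Q.is_cring)
qed

lemma PU_in: "w \<in> P \<Longrightarrow> x \<in> principal_units F w \<Longrightarrow> x \<in> carrier (completion F w)"
  unfolding principal_units_def by simp

lemma abelian_group_LU: "abelian_group LU"
proof (rule abelian_groupI)
  fix x y assume x: "x \<in> carrier LU" and y: "y \<in> carrier LU"
  have "x w \<otimes>\<^bsub>completion F w\<^esub> y w \<in> principal_units F w" if "w \<in> P" for w
    using place.PU_mult [OF place [OF that] LU_mem [OF x that] LU_mem [OF y that]] .
  then show "x \<oplus>\<^bsub>LU\<^esub> y \<in> carrier LU"
    unfolding LU_ops LU_carrier by auto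
  show "x \<oplus>\<^bsub>LU\<^esub> y = y \<oplus>\<^bsub>LU\<^esub> x"
    unfolding LU_ops
  proof (rule restrict_ext)
    fix w assume w: "w \<in> P"
    interpret cring "completion F w" by (rule completion_cring [OF w])
    show "x w \<otimes>\<^bsub>completion F w\<^esub> y w = y w \<otimes>\<^bsub>completion F w\<^esub> x w"
      using PU_in [OF w LU_mem [OF x w]] PU_in [OF w LU_mem [OF y w]] by (rule m_comm)
  qed
next
  show "\<zero>\<^bsub>LU\<^esub> \<in> carrier LU"
    unfolding LU_ops LU_carrier using place.PU_one [OF place] by auto
next
  fix x y z assume x: "x \<in> carrier LU" and y: "y \<in> carrier LU" and z: "z \<in> carrier LU"
  show "x \<oplus>\<^bsub>LU\<^esub> y \<oplus>\<^bsub>LU\<^esub> z = x \<oplus>\<^bsub>LU\<^esub> (y \<oplus>\<^bsub>LU\<^esub> z)"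
    unfolding LU_ops
  proof (rule restrict_ext)
    fix w assume w: "w \<in> P"
    interpret cring "completion F w" by (rule completion_cring [OF w])
    show "(\<lambda>w\<in>P. x w \<otimes>\<^bsub>completion F w\<^esub> y w) w \<otimes>\<^bsub>completion F w\<^esub> z w
        = x w \<otimes>\<^bsub>completion F w\<^esub> (\<lambda>w\<in>P. y w \<otimes>\<^bsub>completion F w\<^esub> z w) w"
      using w m_assoc [OF PU_in [OF w LU_mem [OF x w]] PU_in [OF w LU_mem [OF y w]] PU_in [OF w LU_mem [OF z w]]]
      by simp
  qed
next
  fix x assume x: "x \<in> carrier LU"
  show "\<zero>\<^bsub>LU\<^esub> \<oplus>\<^bsub>LU\<^esub> x = x"
  proof (rule LU_eqI [OF _ LU_ext [OF x]])
    fix w assume w: "w \<in> P"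
    interpret cring "completion F w" by (rule completion_cring [OF w])
    show "(\<zero>\<^bsub>LU\<^esub> \<oplus>\<^bsub>LU\<^esub> x) w = x w"
      unfolding LU_ops using w l_one [OF PU_in [OF w LU_mem [OF x w]]] by simp
  qed (simp add: LU_ops)
  have ex: "\<exists>y. y \<in> principal_units F w \<and> y \<otimes>\<^bsub>completion F w\<^esub> x w = \<one>\<^bsub>completion F w\<^esub>" if w: "w \<in> P" for w
  proof -
    obtain y where "y \<in> principal_units F w" "y \<otimes>\<^bsub>completion F w\<^esub> x w = \<one>\<^bsub>completion F w\<^esub>"
      using place.PU_inverse [OF place [OF w] LU_mem [OF x w]] .
    then show ?thesis by blast
  qed
  define i where "i = (\<lambda>w\<in>P. SOME y. y \<in> principal_units F w \<and> y \<otimes>\<^bsub>completion F w\<^esub> x w = \<one>\<^bsub>completion F w\<^esub>)"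
  have i: "i w \<in> principal_units F w \<and> i w \<otimes>\<^bsub>completion F w\<^esub> x w = \<one>\<^bsub>completion F w\<^esub>" if w: "w \<in> P" for w
    using someI_ex [OF ex [OF w]] w unfolding i_def by simp
  have "i \<in> carrier LU"
    unfolding LU_carrier by (rule PiE_I) (use i in \<open>auto simp: i_def\<close>)
  moreover have "i \<oplus>\<^bsub>LU\<^esub> x = \<zero>\<^bsub>LU\<^esub>"
    unfolding LU_ops by (rule restrict_ext) (use i in simp)
  ultimately show "\<exists>y\<in>carrier LU. y \<oplus>\<^bsub>LU\<^esub> x = \<zero>\<^bsub>LU\<^esub>" by blast
qed

lemma module_LU: "Module.module (Zp p) LU"
proof (rule moduleI)
  show "cring (Zp p)" by (rule cring_Zp)
  show "abelian_group LU" by (rule abelian_group_LU)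
next
  fix a x assume a: "a \<in> carrier (Zp p)" and x: "x \<in> carrier LU"
  show "a \<odot>\<^bsub>LU\<^esub> x \<in> carrier LU"
    unfolding LU_ops LU_carrier
    using place.padic_power_closed [OF place a LU_mem [OF x]] by auto
next
  fix a b x assume a: "a \<in> carrier (Zp p)" and b: "b \<in> carrier (Zp p)" and x: "x \<in> carrier LU"
  show "(a \<oplus>\<^bsub>Zp p\<^esub> b) \<odot>\<^bsub>LU\<^esub> x = a \<odot>\<^bsub>LU\<^esub> x \<oplus>\<^bsub>LU\<^esub> b \<odot>\<^bsub>LU\<^esub> x"
    unfolding LU_ops
    by (rule restrict_ext) (use place.padic_power_add [OF place a b LU_mem [OF x]] in simp)
  show "(a \<otimes>\<^bsub>Zp p\<^esub> b) \<odot>\<^bsub>LU\<^esub> x = a \<odot>\<^bsub>LU\<^esub> (b \<odot>\<^bsub>LU\<^esub> x)"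
    unfolding LU_ops
    by (rule restrict_ext) (use place.padic_power_assoc [OF place a b LU_mem [OF x]] in simp)
next
  fix a x y assume a: "a \<in> carrier (Zp p)" and x: "x \<in> carrier LU" and y: "y \<in> carrier LU"
  show "a \<odot>\<^bsub>LU\<^esub> (x \<oplus>\<^bsub>LU\<^esub> y) = a \<odot>\<^bsub>LU\<^esub> x \<oplus>\<^bsub>LU\<^esub> a \<odot>\<^bsub>LU\<^esub> y"
    unfolding LU_ops
    by (rule restrict_ext) (use place.padic_power_mult_right [OF place a LU_mem [OF x] LU_mem [OF y]] in simp)
next
  fix x assume x: "x \<in> carrier LU"
  show "\<one>\<^bsub>Zp p\<^esub> \<odot>\<^bsub>LU\<^esub> x = x"
  proof (rule LU_eqI [OF _ LU_ext [OF x]])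
    fix w assume w: "w \<in> P"
    show "(\<one>\<^bsub>Zp p\<^esub> \<odot>\<^bsub>LU\<^esub> x) w = x w"
      unfolding LU_ops using w place.padic_power_one [OF place [OF w] LU_mem [OF x w]] by simp
  qed (simp add: LU_ops)
qed

end

text \<open>Independent subsets of \<open>W\<close> are independent in \<open>V\<close>, so their
  size is bounded by the dimension and a maximal one is a basis.\<close>

lemma (in vectorspace) fin_dim_subspace:
  assumes "fin_dim" "subspace K W V"
  shows "vectorspace.fin_dim K (vs W)"
proof -
  interpret W: vectorspace K "vs W"
    by (rule subspace_is_vs [OF assms(2)])
  have sub: "submodule K W V" using assms(2) by (rule is_module)
  have WV: "W \<subseteq> carrier V" using sub by (simp add: submodule_def)
  let ?P = "\<lambda>S. S \<subseteq> carrier (vs W) \<and> \<not> W.lin_dep S"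
  have li: "lin_indpt S" "S \<subseteq> carrier V" if "?P S" for S
    using that span_li_not_depend(2) [OF _ sub, of S] WV by auto
  have "\<exists>A. finite A \<and> maximal A ?P"
  proof (rule maximal_exists)
    show "finite S \<and> card S \<le> dim" if "?P S" for S
      using li_le_dim [OF assms(1) li(2) [OF that] li(1) [OF that]] by simp
    show "?P {}"
      by (simp add: W.lin_dep_def)
  qed
  then obtain A where A: "finite A" "maximal A ?P" by blast
  have "W.basis A" by (rule W.max_li_is_basis [OF A(2)])
  then show ?thesis
    unfolding W.fin_dim_def W.basis_def using A(1) by blast
qed

subsection \<open>The Leopoldt kernel\<close>

context padic_subfield
begin

abbreviation "E \<equiv> global_units F"

lemma E_simps: "carrier E = {u \<in> F. u \<noteq> 0 \<and> algebraic_int u \<and> algebraic_int (inverse u)}"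
  "u \<oplus>\<^bsub>E\<^esub> v = u * v" "\<zero>\<^bsub>E\<^esub> = 1" "k \<odot>\<^bsub>E\<^esub> u = u powi k"
  unfolding global_units_def by simp_all

lemma F_power_int: "u \<in> F \<Longrightarrow> u powi k \<in> F"
proof -
  have "x ^ n \<in> F" if "x \<in> F" for x n
    by (induction n) (simp_all add: F_closed that)
  then show "u \<in> F \<Longrightarrow> u powi k \<in> F"
    by (simp add: power_int_def F_closed)
qed

lemma module_E: "Module.module int_ring E"
proof (rule moduleI)
  show "cring int_ring" by (rule int_is_cring)
  show "abelian_group E"
  proof (rule abelian_groupI)
    fix u assume "u \<in> carrier E"
    then show "\<exists>v\<in>carrier E. v \<oplus>\<^bsub>E\<^esub> u = \<zero>\<^bsub>E\<^esub>"
      by (intro bexI [of _ "inverse u"]) (simp_all add: E_simps F_closed)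
  qed (simp_all add: E_simps F_closed algebraic_int_times mult_ac)
next
  fix k :: int and u assume "u \<in> carrier E"
  then show "k \<odot>\<^bsub>E\<^esub> u \<in> carrier E"
    by (simp add: E_simps F_power_int algebraic_int_power_int flip: power_int_inverse)
qed (simp_all add: E_simps power_int_add power_int_mult_distrib flip: power_int_mult add: mult.commute)

sublocale ZE: scalar_extension int_ring "Zp p" E "int_to_Zp p"
  by (intro scalar_extension.intro scalar_extension_axioms.intro int_is_cring cring_Zp module_E int_to_Zp_hom)

abbreviation "D \<equiv> diagonal_embedding p F"

lemma E_unit: "u \<in> carrier E \<Longrightarrow> u \<in> F" "u \<in> carrier E \<Longrightarrow> u \<noteq> 0"
  "u \<in> carrier E \<Longrightarrow> algebraic_int u" "u \<in> carrier E \<Longrightarrow> algebraic_int (inverse u)"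
  by (simp_all add: E_simps)

lemma D_closed: "u \<in> carrier E \<Longrightarrow> D u \<in> carrier LU"
  unfolding diagonal_embedding_def LU_carrier
  using place.principal_part_spec(1) [OF place E_unit] by auto

text \<open>Multiply the two factorizations: roots of unity of order prime to \<open>p\<close> and
  principal units are each closed under products, and the decomposition is unique.\<close>

lemma D_mult:
  assumes u: "u \<in> carrier E" and v: "v \<in> carrier E"
  shows "D (u \<oplus>\<^bsub>E\<^esub> v) = D u \<oplus>\<^bsub>LU\<^esub> D v"
  unfolding LU_ops diagonal_embedding_def
proof (rule restrict_ext)
  fix w assume w: "w \<in> P"
  interpret place p F w by (rule place [OF w])
  note su = principal_part_spec [OF E_unit [OF u]] and sv = principal_part_spec [OF E_unit [OF v]]
  obtain \<zeta> where z: "teich \<zeta>" "completion_emb F w u = \<zeta> \<otimes>\<^bsub>Q\<^esub> principal_part p F w u"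
    using su(2) by (elim exE conjE)
  obtain \<xi> where x: "teich \<xi>" "completion_emb F w v = \<xi> \<otimes>\<^bsub>Q\<^esub> principal_part p F w v"
    using sv(2) by (elim exE conjE)
  have c: "\<zeta> \<in> carrier Q" "\<xi> \<in> carrier Q" "principal_part p F w u \<in> carrier Q" "principal_part p F w v \<in> carrier Q"
    using z(1) x(1) su(1) sv(1) PU_carrier by (simp_all add: teich_def)
  have "completion_emb F w (u \<oplus>\<^bsub>E\<^esub> v) = completion_emb F w u \<otimes>\<^bsub>Q\<^esub> completion_emb F w v"
    using E_unit [OF u] E_unit [OF v] by (simp add: emb_eq E_simps)
  also have "\<dots> = (\<zeta> \<otimes>\<^bsub>Q\<^esub> \<xi>) \<otimes>\<^bsub>Q\<^esub> (principal_part p F w u \<otimes>\<^bsub>Q\<^esub> principal_part p F w v)"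
    unfolding z(2) x(2) using c by (simp add: Q.m_ac)
  finally have "principal_part p F w (u \<oplus>\<^bsub>E\<^esub> v) = principal_part p F w u \<otimes>\<^bsub>Q\<^esub> principal_part p F w v"
    by (rule principal_part_eqI [OF PU_mult [OF su(1) sv(1)] teich_mult [OF z(1) x(1)]])
  then show "principal_part p F w (u \<oplus>\<^bsub>E\<^esub> v) = (\<lambda>w\<in>P. principal_part p F w u) w \<otimes>\<^bsub>Q\<^esub> (\<lambda>w\<in>P. principal_part p F w v) w"
    using w by simp
qed

text \<open>Integer powers of units correspond to integer multiples. Induction in both directions
  from zero, with cancellation in \<open>Y\<close>, reduces linearity over the integers to products
  of two units.\<close>

lemma int_linear_of_additive:
  fixes Y :: "(padic, 'b, 'c) module_scheme"
  assumes Y: "Module.module (Zp p) Y" and g: "g \<in> carrier E \<rightarrow> carrier Y"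
    and add: "\<And>u v. u \<in> carrier E \<Longrightarrow> v \<in> carrier E \<Longrightarrow> g (u \<oplus>\<^bsub>E\<^esub> v) = g u \<oplus>\<^bsub>Y\<^esub> g v"
    and u: "u \<in> carrier E"
  shows "g (k \<odot>\<^bsub>E\<^esub> u) = int_to_Zp p k \<odot>\<^bsub>Y\<^esub> g u"
proof -
  interpret Y: Module.module "Zp p" Y by fact
  have gc: "\<And>u. u \<in> carrier E \<Longrightarrow> g u \<in> carrier Y" using g by auto
  have uc: "k \<odot>\<^bsub>E\<^esub> u \<in> carrier E" for k using u by simp
  have succ: "g ((k + 1) \<odot>\<^bsub>E\<^esub> u) = g (k \<odot>\<^bsub>E\<^esub> u) \<oplus>\<^bsub>Y\<^esub> g u" for k
  proof -
    have "(k + 1) \<odot>\<^bsub>E\<^esub> u = k \<odot>\<^bsub>E\<^esub> u \<oplus>\<^bsub>E\<^esub> u"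
      using u by (simp add: E_simps power_int_add)
    then show ?thesis using add [OF uc u] by simp
  qed
  have succ': "int_to_Zp p (k + 1) \<odot>\<^bsub>Y\<^esub> g u = int_to_Zp p k \<odot>\<^bsub>Y\<^esub> g u \<oplus>\<^bsub>Y\<^esub> g u" for k
  proof -
    have "int_to_Zp p (k + 1) = int_to_Zp p k \<oplus>\<^bsub>Zp p\<^esub> \<one>\<^bsub>Zp p\<^esub>"
      using ring_hom_add [OF int_to_Zp_hom, of k 1] ring_hom_one [OF int_to_Zp_hom] by simp
    moreover have "(int_to_Zp p k \<oplus>\<^bsub>Zp p\<^esub> \<one>\<^bsub>Zp p\<^esub>) \<odot>\<^bsub>Y\<^esub> g u = int_to_Zp p k \<odot>\<^bsub>Y\<^esub> g u \<oplus>\<^bsub>Y\<^esub> \<one>\<^bsub>Zp p\<^esub> \<odot>\<^bsub>Y\<^esub> g u"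
      using gc [OF u] by (intro Y.smult_l_distr ZE.phi_closed ZE.S.one_closed) auto
    ultimately show ?thesis using Y.smult_one [OF gc [OF u]] by (simp only:)
  qed
  have sc: "int_to_Zp p k \<odot>\<^bsub>Y\<^esub> g u \<in> carrier Y" for k
    using gc [OF u] by (intro Y.smult_closed ZE.phi_closed) auto
  have cancel: "x = y" if eq: "x \<oplus>\<^bsub>Y\<^esub> g u = y \<oplus>\<^bsub>Y\<^esub> g u" and xy: "x \<in> carrier Y" "y \<in> carrier Y" for x y
  proof -
    have "x = x \<oplus>\<^bsub>Y\<^esub> g u \<oplus>\<^bsub>Y\<^esub> (\<ominus>\<^bsub>Y\<^esub> g u)" using xy gc [OF u] by (simp add: Y.M.a_assoc Y.M.r_neg)
    also have "\<dots> = y" unfolding eq using xy gc [OF u] by (simp add: Y.M.a_assoc Y.M.r_neg)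
    finally show ?thesis .
  qed
  show ?thesis
  proof (induction k rule: int_induct [where k = 0])
    case base
    have "g (0 \<odot>\<^bsub>E\<^esub> u) \<oplus>\<^bsub>Y\<^esub> g u = \<zero>\<^bsub>Y\<^esub> \<oplus>\<^bsub>Y\<^esub> g u"
      using succ [of 0] gc [OF u] u by (simp add: E_simps)
    moreover have "int_to_Zp p 0 \<odot>\<^bsub>Y\<^esub> g u \<oplus>\<^bsub>Y\<^esub> g u = \<zero>\<^bsub>Y\<^esub> \<oplus>\<^bsub>Y\<^esub> g u"
    proof -
      have "int_to_Zp p 1 = \<one>\<^bsub>Zp p\<^esub>" using ring_hom_one [OF int_to_Zp_hom] by simp
      then show ?thesis
        using succ' [of 0] Y.smult_one [OF gc [OF u]] gc [OF u] by (simp only: add_0 Y.M.l_zero)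
    qed
    ultimately have "g (0 \<odot>\<^bsub>E\<^esub> u) \<oplus>\<^bsub>Y\<^esub> g u = int_to_Zp p 0 \<odot>\<^bsub>Y\<^esub> g u \<oplus>\<^bsub>Y\<^esub> g u"
      by (simp only:)
    then show ?case by (rule cancel [OF _ gc [OF uc] sc])
  next
    case (step1 i)
    then show ?case unfolding succ [of i] succ' [of i] by simp
  next
    case (step2 i)
    have "g ((i - 1) \<odot>\<^bsub>E\<^esub> u) \<oplus>\<^bsub>Y\<^esub> g u = int_to_Zp p (i - 1) \<odot>\<^bsub>Y\<^esub> g u \<oplus>\<^bsub>Y\<^esub> g u"
      using succ [of "i - 1"] succ' [of "i - 1"] step2(2) by (simp only: diff_add_cancel)
    then show ?case by (rule cancel [OF _ gc [OF uc] sc])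
  qed
qed

lemma D_bilinear: "ZE.bilinear_extends LU D"
  unfolding ZE.bilinear_extends_def
proof (intro conjI ballI)
  show D: "D \<in> carrier E \<rightarrow> carrier LU" using D_closed by auto
  show "\<And>u v. u \<in> carrier E \<Longrightarrow> v \<in> carrier E \<Longrightarrow> D (u \<oplus>\<^bsub>E\<^esub> v) = D u \<oplus>\<^bsub>LU\<^esub> D v" by (rule D_mult)
  show "\<And>r u. u \<in> carrier E \<Longrightarrow> D (r \<odot>\<^bsub>E\<^esub> u) = int_to_Zp p r \<odot>\<^bsub>LU\<^esub> D u"
    by (rule int_linear_of_additive [OF module_LU D D_mult])
qed

abbreviation "ZU \<equiv> Zp_units p F"
abbreviation "zten \<equiv> ZE.pure \<one>\<^bsub>Zp p\<^esub>"

lemma ZU_eq: "ZU = ZE.BC"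
  unfolding Zp_units_def ..

lemma leopoldt_map_spec:
  "leopoldt_map p F \<in> module_hom (Zp p) ZU LU"
  "u \<in> carrier E \<Longrightarrow> leopoldt_map p F (zten u) = D u"
proof -
  note spec = ZE.base_change_lift_spec [OF module_LU D_bilinear, folded leopoldt_map_def]
  show "leopoldt_map p F \<in> module_hom (Zp p) ZU LU"
    unfolding ZU_eq by (rule spec(1))
  show "u \<in> carrier E \<Longrightarrow> leopoldt_map p F (zten u) = D u"
    by (rule spec(2))
qed

lemma localization_intro:
  assumes "Module.module (Zp p) Y"
  shows "localization_extension (Zp p) (Qp p) Y"
proof (intro localization_extension.intro scalar_extension.intro scalar_extension_axioms.intro localization_extension_axioms.intro)
  show "cring (Zp p)" by (rule cring_Zp)
  show "cring (Qp p)" unfolding Qp_eq by (rule Q.Q.is_cring)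
  show "Module.module (Zp p) Y" by fact
  show "id \<in> Ring.ring_hom (Zp p) (Qp p)" by (rule id_Zp_Qp)
  show "field (Qp p)" by (rule field_Qp)
  show "Zp p = Qp p\<lparr>carrier := carrier (Zp p)\<rparr>" unfolding Zp_def by simp
  show "carrier (Zp p) \<subseteq> carrier (Qp p)" unfolding Zp_def by auto
  show "\<And>s. s \<in> carrier (Qp p) \<Longrightarrow> \<exists>z\<in>carrier (Zp p). z \<noteq> \<zero>\<^bsub>Qp p\<^esub> \<and> z \<otimes>\<^bsub>Qp p\<^esub> s \<in> carrier (Zp p)"
    by (rule Qp_denominator)
qed

sublocale QZ: localization_extension "Zp p" "Qp p" ZU
  by (rule localization_intro) (unfold ZU_eq, rule ZE.module_BC)

sublocale QL: localization_extension "Zp p" "Qp p" LU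
  by (rule localization_intro [OF module_LU])

abbreviation "V \<equiv> QZ.BC"
abbreviation "W \<equiv> QL.BC"
abbreviation "reg \<equiv> base_change_map (Zp p) (Qp p) id ZU LU (leopoldt_map p F)"
abbreviation "qten u \<equiv> QZ.pure \<one>\<^bsub>Qp p\<^esub> (zten u)"

lemma reg_hom: "reg \<in> module_hom (Qp p) V W"
  by (rule QZ.base_change_map_spec(1) [OF module_LU leopoldt_map_spec(1)])

lemma zten_closed: "u \<in> carrier E \<Longrightarrow> zten u \<in> carrier ZU"
  unfolding ZU_eq by (rule ZE.pure_closed [OF ZE.S.one_closed])

lemma qten_closed: "u \<in> carrier E \<Longrightarrow> qten u \<in> carrier V"
  by (rule QZ.pure_closed [OF QZ.S.one_closed zten_closed])

lemma reg_qten: "u \<in> carrier E \<Longrightarrow> reg (qten u) = QL.pure \<one>\<^bsub>Qp p\<^esub> (D u)"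
  using QZ.base_change_map_spec(2) [OF module_LU leopoldt_map_spec(1) QZ.S.one_closed zten_closed]
    leopoldt_map_spec(2) by simp

sublocale V: vectorspace "Qp p" V
  by (intro vectorspace.intro QZ.module_BC field_Qp)

sublocale W: vectorspace "Qp p" W
  by (intro vectorspace.intro QL.module_BC field_Qp)

sublocale reg: linear_map "Qp p" V W reg
  by (intro linear_map.intro mod_hom.intro mod_hom_axioms.intro V.vectorspace_axioms W.vectorspace_axioms
      QZ.module_BC QL.module_BC reg_hom)

abbreviation "LK \<equiv> leopoldt_kernel p F"

lemma LK_eq: "LK = V\<lparr>carrier := reg.ker\<rparr>"
  unfolding leopoldt_kernel_def Let_def ..

lemma LK_carrier: "v \<in> carrier LK \<longleftrightarrow> v \<in> carrier V \<and> reg v = \<zero>\<^bsub>W\<^esub>"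
  unfolding LK_eq by (simp add: reg.ker_def)

lemma vectorspace_LK: "vectorspace (Qp p) LK"
  unfolding LK_eq by (rule V.subspace_is_vs [OF reg.kerT_is_subspace])

lemma LK_ops: "add LK = add V" "\<zero>\<^bsub>LK\<^esub> = \<zero>\<^bsub>V\<^esub>" "module.smult LK = module.smult V"
  unfolding LK_eq by simp_all

lemma restrict_scalars:
  assumes "Module.module (Qp p) Y"
  shows "Module.module (Zp p) Y"
proof -
  interpret Y: Module.module "Qp p" Y by fact
  show ?thesis
  proof (rule moduleI [OF cring_Zp Y.M.abelian_group_axioms])
  qed (simp_all add: Y.smult_l_distr Y.smult_r_distr Y.smult_assoc1 Y.smult_one)
qed

text \<open>The two successive extensions of scalars are generated by the images of units, so linear
  maps out of \<open>V\<close> may be compared there. For the inner extension the target is regarded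
  as a module over the p-adic integers.\<close>

lemma V_hom_eqI:
  assumes Y: "Module.module (Qp p) Y" and f: "f \<in> module_hom (Qp p) V Y" and g: "g \<in> module_hom (Qp p) V Y"
    and eq: "\<And>u. u \<in> carrier E \<Longrightarrow> f (qten u) = g (qten u)" and v: "v \<in> carrier V"
  shows "f v = g v"
proof (rule QZ.BC_hom_eqI [OF Y f g _ v])
  have hom: "(\<lambda>y. h (QZ.pure \<one>\<^bsub>Qp p\<^esub> y)) \<in> module_hom (Zp p) ZE.BC Y" if h: "h \<in> module_hom (Qp p) V Y" for h
    unfolding module_hom_def ZU_eq [symmetric] mem_Collect_eq
  proof (intro conjI allI impI Pi_I; (elim conjE)?)
    fix y assume y: "y \<in> carrier ZU"
    then show "h (QZ.pure \<one>\<^bsub>Qp p\<^esub> y) \<in> carrier Y"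
      using module_hom_closed [OF h] by auto
    fix r assume r: "r \<in> carrier (Zp p)"
    have "QZ.pure \<one>\<^bsub>Qp p\<^esub> (r \<odot>\<^bsub>ZU\<^esub> y) = r \<odot>\<^bsub>V\<^esub> QZ.pure \<one>\<^bsub>Qp p\<^esub> y"
      using QZ.pure_one_balanced [OF y r] by (simp only: id_apply)
    then show "h (QZ.pure \<one>\<^bsub>Qp p\<^esub> (r \<odot>\<^bsub>ZU\<^esub> y)) = r \<odot>\<^bsub>Y\<^esub> h (QZ.pure \<one>\<^bsub>Qp p\<^esub> y)"
      using module_hom_smult [OF h QZ.R_in_S [OF r] QZ.pure_closed [OF QZ.S.one_closed y]] by (simp only:)
  next
    fix x y assume x: "x \<in> carrier ZU" and y: "y \<in> carrier ZU"
    show "h (QZ.pure \<one>\<^bsub>Qp p\<^esub> (x \<oplus>\<^bsub>ZU\<^esub> y)) = h (QZ.pure \<one>\<^bsub>Qp p\<^esub> x) \<oplus>\<^bsub>Y\<^esub> h (QZ.pure \<one>\<^bsub>Qp p\<^esub> y)"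
      unfolding QZ.pure_add_right [OF QZ.S.one_closed x y]
      by (intro module_hom_add [OF h] QZ.pure_closed QZ.S.one_closed x y)
  qed
  fix y assume y: "y \<in> carrier ZU"
  show "f (QZ.pure \<one>\<^bsub>Qp p\<^esub> y) = g (QZ.pure \<one>\<^bsub>Qp p\<^esub> y)"
    by (rule ZE.BC_hom_eqI [OF restrict_scalars [OF Y] hom [OF f] hom [OF g] eq])
       (use y in \<open>simp_all add: ZU_eq\<close>)
qed

lemma qten_mult: "u \<in> carrier E \<Longrightarrow> v \<in> carrier E \<Longrightarrow> qten (u * v) = qten u \<oplus>\<^bsub>V\<^esub> qten v"
  using ZE.pure_add_right [of "\<one>\<^bsub>Zp p\<^esub>" u v] QZ.pure_add_right [of "\<one>\<^bsub>Qp p\<^esub>" "zten u" "zten v"] zten_closed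
  by (simp add: ZU_eq E_simps(2))

end

subsection \<open>Functoriality\<close>

text \<open>Defined for every homomorphism of unit groups, and not just for those restricted from
  field homomorphisms, since it is also applied to the norm.\<close>

definition unit_space_map ::
  "nat \<Rightarrow> 'a::field_char_0 set \<Rightarrow> 'a set \<Rightarrow> ('a \<Rightarrow> 'a)
    \<Rightarrow> (padic \<times> (padic \<times> 'a \<Rightarrow>\<^sub>0 int) set \<Rightarrow>\<^sub>0 int) set \<Rightarrow> (padic \<times> (padic \<times> 'a \<Rightarrow>\<^sub>0 int) set \<Rightarrow>\<^sub>0 int) set" where
  "unit_space_map p F F' g = base_change_map (Zp p) (Qp p) id (Zp_units p F) (Zp_units p F')
     (base_change_map int_ring (Zp p) (int_to_Zp p) (global_units F) (global_units F') g)"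

locale padic_subfield_pair = A: padic_subfield p F + B: padic_subfield p F'
  for p :: nat and F F' :: "'a::field_char_0 set"
begin

lemma unit_space_map_spec:
  assumes g: "g \<in> module_hom int_ring A.E B.E"
  shows "unit_space_map p F F' g \<in> module_hom (Qp p) A.V B.V"
    and "u \<in> carrier A.E \<Longrightarrow> unit_space_map p F F' g (A.qten u) = B.qten (g u)"
proof -
  note z = A.ZE.base_change_map_spec [OF B.module_E g, folded A.ZU_eq Zp_units_def]
  note v = A.QZ.base_change_map_spec [OF B.QZ.M.module_axioms z(1), folded unit_space_map_def]
  show "unit_space_map p F F' g \<in> module_hom (Qp p) A.V B.V" by (rule v(1))
  assume u: "u \<in> carrier A.E"
  show "unit_space_map p F F' g (A.qten u) = B.qten (g u)"
    unfolding v(2) [OF A.QZ.S.one_closed A.zten_closed [OF u]] z(2) [OF A.ZE.S.one_closed u] ..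
qed

end

text \<open>Serves both the Galois automorphisms of \<open>L\<close> and the inclusion of a fixed
  field into \<open>L\<close>.\<close>

locale padic_field_hom = padic_subfield_pair p F F'
  for p :: nat and F F' :: "'a::field_char_0 set" +
  fixes \<sigma> :: "'a \<Rightarrow> 'a"
  assumes sigma_mem: "x \<in> F \<Longrightarrow> \<sigma> x \<in> F'"
    and sigma_one: "\<sigma> 1 = 1"
    and sigma_add: "x \<in> F \<Longrightarrow> y \<in> F \<Longrightarrow> \<sigma> (x + y) = \<sigma> x + \<sigma> y"
    and sigma_mult: "x \<in> F \<Longrightarrow> y \<in> F \<Longrightarrow> \<sigma> (x * y) = \<sigma> x * \<sigma> y"
begin

lemma sigma_zero: "\<sigma> 0 = 0"
  using sigma_add [OF A.F_closed(1) A.F_closed(1)] by simp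

lemma sigma_uminus: "x \<in> F \<Longrightarrow> \<sigma> (- x) = - \<sigma> x"
  using sigma_add [of x "- x"] A.F_closed(5) [of x] sigma_zero by (simp add: eq_neg_iff_add_eq_0 add.commute)

lemma F_diff: "x \<in> F \<Longrightarrow> y \<in> F \<Longrightarrow> x - y \<in> F"
  using A.F_closed(3) [of x "- y"] A.F_closed(5) [of y] by simp

lemma sigma_diff: "x \<in> F \<Longrightarrow> y \<in> F \<Longrightarrow> \<sigma> (x - y) = \<sigma> x - \<sigma> y"
  using sigma_add [of x "- y"] sigma_uminus [of y] A.F_closed(5) [of y] by simp

lemma F_power: "x \<in> F \<Longrightarrow> x ^ n \<in> F"
  by (induction n) (simp_all add: A.F_closed)

lemma sigma_power: "x \<in> F \<Longrightarrow> \<sigma> (x ^ n) = \<sigma> x ^ n"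
  by (induction n) (simp_all add: sigma_one sigma_mult F_power)

lemma sigma_inverse:
  assumes "x \<in> F" shows "\<sigma> (inverse x) = inverse (\<sigma> x)"
proof (cases "x = 0")
  case False
  then have "\<sigma> x * \<sigma> (inverse x) = 1"
    using sigma_mult [OF assms A.F_closed(6) [OF assms]] sigma_one by simp
  then show ?thesis by (metis inverse_unique)
qed (simp add: sigma_zero)

lemma sigma_nonzero:
  assumes "x \<in> F" "x \<noteq> 0" shows "\<sigma> x \<noteq> 0"
proof
  assume "\<sigma> x = 0"
  then have "\<sigma> (x * inverse x) = 0"
    using sigma_mult [OF assms(1) A.F_closed(6) [OF assms(1)]] by simp
  then show False using assms sigma_one by simp
qed

lemma of_nat_F: "of_nat n \<in> F" and sigma_of_nat: "\<sigma> (of_nat n) = of_nat n"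
  by (induction n) (simp_all add: A.F_closed sigma_zero sigma_one sigma_add)

lemma of_int_F: "of_int k \<in> F" and sigma_of_int: "\<sigma> (of_int k) = of_int k"
  by (cases k rule: int_cases2, simp_all add: of_nat_F A.F_closed sigma_of_nat sigma_uminus)+

lemma of_rat_F: "of_rat q \<in> F" and sigma_of_rat: "\<sigma> (of_rat q) = of_rat q"
proof -
  obtain a b where "b \<noteq> 0" "q = of_int a / of_int b" by (rule A.rat_frac)
  then have q: "of_rat q = (of_int a * inverse (of_int b) :: 'a)"
    by (simp add: of_rat_divide divide_inverse of_rat_mult of_rat_inverse)
  show "of_rat q \<in> F" unfolding q by (intro A.F_closed of_int_F)
  show "\<sigma> (of_rat q) = of_rat q"
    unfolding q by (simp add: sigma_mult sigma_inverse sigma_of_int of_int_F A.F_closed)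
qed

lemma sigma_sum:
  "(\<And>i. i \<in> I \<Longrightarrow> f i \<in> F) \<Longrightarrow> sum f I \<in> F \<and> \<sigma> (sum f I) = (\<Sum>i\<in>I. \<sigma> (f i))"
  by (induction I rule: infinite_finite_induct) (simp_all add: A.F_closed sigma_zero sigma_add)

lemma sigma_algebraic_int:
  assumes u: "u \<in> F" "algebraic_int u"
  shows "algebraic_int (\<sigma> u)"
proof -
  obtain P where P: "lead_coeff P = 1" "\<forall>i. poly.coeff P i \<in> \<int>" "poly P u = 0"
    using u(2) by (auto simp: algebraic_int.simps)
  have c: "poly.coeff P i \<in> F" "\<sigma> (poly.coeff P i) = poly.coeff P i" for i
    using P(2) of_int_F sigma_of_int by (metis Ints_cases)+
  have t: "poly.coeff P i * u ^ i \<in> F" "\<sigma> (poly.coeff P i * u ^ i) = poly.coeff P i * \<sigma> u ^ i" for i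
    using c u(1) by (simp_all add: A.F_closed F_power sigma_mult sigma_power)
  have "poly P (\<sigma> u) = \<sigma> (poly P u)"
    unfolding poly_altdef using sigma_sum [of "{..degree P}" "\<lambda>i. poly.coeff P i * u ^ i"] t by simp
  then have "poly P (\<sigma> u) = 0" using P(3) sigma_zero by simp
  with P(1,2) show ?thesis by (auto simp: algebraic_int.simps)
qed

lemma sigma_E: "u \<in> carrier A.E \<Longrightarrow> \<sigma> u \<in> carrier B.E"
  using sigma_algebraic_int [of u] sigma_algebraic_int [of "inverse u"]
  by (simp add: A.E_simps B.E_simps sigma_mem sigma_nonzero sigma_inverse A.F_closed)

lemma sigma_hom: "\<sigma> \<in> module_hom int_ring A.E B.E"
  unfolding module_hom_def
proof (intro CollectI conjI allI impI Pi_I; (elim conjE)?)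
  fix u assume u: "u \<in> carrier A.E"
  then show "\<sigma> u \<in> carrier B.E" by (rule sigma_E)
  note uF = A.E_unit(1,2) [OF u]
  fix k :: int
  show "\<sigma> (k \<odot>\<^bsub>A.E\<^esub> u) = k \<odot>\<^bsub>B.E\<^esub> \<sigma> u"
    using uF by (simp add: A.E_simps B.E_simps power_int_def sigma_power sigma_inverse A.F_closed)
next
  fix u v assume "u \<in> carrier A.E" "v \<in> carrier A.E"
  then show "\<sigma> (u \<oplus>\<^bsub>A.E\<^esub> v) = \<sigma> u \<oplus>\<^bsub>B.E\<^esub> \<sigma> v"
    by (simp add: A.E_simps B.E_simps sigma_mult)
qed

text \<open>Places pull back along \<sigma>, whereas local units move forward: the component at
  \<open>w\<close> is computed from the component at \<open>pb w\<close>.\<close>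

definition "pb w = (\<lambda>x\<in>F. w (\<sigma> x))"

lemma pb_place: "w \<in> B.P \<Longrightarrow> pb w \<in> A.P"
proof -
  assume w: "w \<in> B.P"
  then have av: "absolute_value_on F' w" and wq: "\<And>q. w (of_rat q) = padic_abs p q"
    unfolding places_above_def by simp_all
  have "absolute_value_on F (pb w)"
    unfolding absolute_value_on_def
  proof (intro conjI ballI)
    fix x assume x: "x \<in> F"
    note sx = sigma_mem [OF x]
    show "0 \<le> pb w x" using x sx av by (simp add: pb_def absolute_value_on_def)
    show "pb w x = 0 \<longleftrightarrow> x = 0"
      using x sx av sigma_nonzero [OF x] sigma_zero by (auto simp: pb_def absolute_value_on_def)
    fix y assume y: "y \<in> F"
    note sy = sigma_mem [OF y]
    show "pb w (x * y) = pb w x * pb w y"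
      using x y sx sy av A.F_closed by (simp add: pb_def absolute_value_on_def sigma_mult)
    show "pb w (x + y) \<le> pb w x + pb w y"
      using x y sx sy av A.F_closed by (simp add: pb_def absolute_value_on_def sigma_add)
  qed
  then show ?thesis
    unfolding places_above_def using wq by (simp add: pb_def sigma_of_rat of_rat_F)
qed

text \<open>The map of completions induced by applying \<sigma> termwise. Elements of a completion
  are cosets, so a representative has to be chosen; \<open>Cm_cls\<close> shows that the choice is
  immaterial.\<close>

definition "Cm w x = (SOME z. \<exists>s\<in>cauchy_seqs F (pb w). x = nonarch.cls F (pb w) s \<and> z = nonarch.cls F' w (\<lambda>n. \<sigma> (s n)))"

context
  fixes w assumes w: "w \<in> B.P"
begin

interpretation a: place p F "pb w" by (rule A.place [OF pb_place [OF w]])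
interpretation b: place p F' w by (rule B.place [OF w])

lemma pb_eq: "x \<in> F \<Longrightarrow> w (\<sigma> x) = pb w x"
  unfolding pb_def by simp

lemma sigma_cauchy:
  assumes s: "s \<in> a.C"
  shows "(\<lambda>n. \<sigma> (s n)) \<in> b.C"
proof (rule b.cauchyI)
  note sF = a.cauchy_mem [OF s]
  show "\<sigma> (s n) \<in> F'" for n by (rule sigma_mem [OF sF])
  fix e :: real assume "e > 0"
  from a.cauchyD [OF s this] show "\<exists>N. \<forall>m\<ge>N. \<forall>n\<ge>N. w (\<sigma> (s m) - \<sigma> (s n)) < e"
    using pb_eq [OF F_diff [OF sF sF]] by (simp add: sigma_diff [OF sF sF])
qed

lemma sigma_null:
  assumes sF: "\<And>n. s n \<in> F"
  shows "(\<lambda>n. \<sigma> (s n)) \<in> b.NS \<longleftrightarrow> s \<in> a.NS"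
  unfolding null_seqs_def using sF sigma_mem [OF sF] pb_eq [OF sF] by auto

text \<open>By construction \<sigma> is isometric from \<open>pb w\<close> to \<open>w\<close> and
  so preserves and reflects null sequences. One direction makes \<open>Cm\<close> well defined, the
  other makes it injective.\<close>

lemma sigma_cls_eq:
  assumes "s \<in> a.C" "t \<in> a.C"
  shows "b.cls (\<lambda>n. \<sigma> (s n)) = b.cls (\<lambda>n. \<sigma> (t n)) \<longleftrightarrow> a.cls s = a.cls t"
proof -
  note sF = a.cauchy_mem [OF assms(1)] and tF = a.cauchy_mem [OF assms(2)]
  have "(\<lambda>n. \<sigma> (s n) - \<sigma> (t n)) = (\<lambda>n. \<sigma> (s n - t n))"
    using sigma_diff [OF sF tF] by simp
  then show ?thesis
    using sigma_null [of "\<lambda>n. s n - t n"] F_diff [OF sF tF] assms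
    by (simp add: b.cls_eq [OF sigma_cauchy sigma_cauchy] a.cls_eq)
qed

lemma Cm_cls:
  assumes s: "s \<in> a.C"
  shows "Cm w (a.cls s) = b.cls (\<lambda>n. \<sigma> (s n))"
  unfolding Cm_def
proof (rule some_equality)
  show "\<exists>t\<in>a.C. a.cls s = a.cls t \<and> b.cls (\<lambda>n. \<sigma> (s n)) = b.cls (\<lambda>n. \<sigma> (t n))"
    using s by (intro bexI [of _ s] conjI refl)
  fix z assume "\<exists>t\<in>a.C. a.cls s = a.cls t \<and> z = b.cls (\<lambda>n. \<sigma> (t n))"
  then obtain t where t: "t \<in> a.C" "a.cls s = a.cls t" "z = b.cls (\<lambda>n. \<sigma> (t n))" by (elim bexE conjE)
  show "z = b.cls (\<lambda>n. \<sigma> (s n))"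
    unfolding t(3) using sigma_cls_eq [OF s t(1)] t(2) by simp
qed

lemma a_carrierE:
  assumes "x \<in> carrier a.Q"
  obtains s where "s \<in> a.C" "x = a.cls s"
  using assms unfolding a.carrier_Q by (elim imageE) (rule that; assumption)

lemma Cm_closed: "x \<in> carrier a.Q \<Longrightarrow> Cm w x \<in> carrier b.Q"
  using Cm_cls sigma_cauchy by (elim a_carrierE) simp

lemma Cm_mult:
  assumes "x \<in> carrier a.Q" "y \<in> carrier a.Q"
  shows "Cm w (x \<otimes>\<^bsub>a.Q\<^esub> y) = Cm w x \<otimes>\<^bsub>b.Q\<^esub> Cm w y"
proof -
  obtain s where s: "s \<in> a.C" "x = a.cls s" using a_carrierE [OF assms(1)] .
  obtain t where t: "t \<in> a.C" "y = a.cls t" using a_carrierE [OF assms(2)] .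
  show ?thesis
    unfolding s(2) t(2) a.mult_Q [OF s(1) t(1)] Cm_cls [OF s(1)] Cm_cls [OF t(1)] Cm_cls [OF a.cauchy_mult [OF s(1) t(1)]]
      b.mult_Q [OF sigma_cauchy [OF s(1)] sigma_cauchy [OF t(1)]]
      sigma_mult [OF a.cauchy_mem [OF s(1)] a.cauchy_mem [OF t(1)]] ..
qed

lemma Cm_emb: "x \<in> F \<Longrightarrow> Cm w (completion_emb F (pb w) x) = completion_emb F' w (\<sigma> x)"
  unfolding a.emb_eq b.emb_eq by (rule Cm_cls) simp

lemma Cm_one: "Cm w \<one>\<^bsub>a.Q\<^esub> = \<one>\<^bsub>b.Q\<^esub>"
  using Cm_emb [OF A.F_closed(2)] by (simp add: a.emb_eq b.emb_eq a.one_Q b.one_Q sigma_one)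

lemma Cm_pow: "x \<in> carrier a.Q \<Longrightarrow> Cm w (x [^]\<^bsub>a.Q\<^esub> (n::nat)) = Cm w x [^]\<^bsub>b.Q\<^esub> n"
  by (induction n) (simp_all add: Cm_one Cm_mult)

lemma Cm_eq_one:
  assumes "x \<in> carrier a.Q" "Cm w x = \<one>\<^bsub>b.Q\<^esub>"
  shows "x = \<one>\<^bsub>a.Q\<^esub>"
proof -
  obtain s where s: "s \<in> a.C" "x = a.cls s" using a_carrierE [OF assms(1)] .
  have one: "(\<lambda>_. 1) \<in> a.C" by simp
  have "b.cls (\<lambda>n. \<sigma> (s n)) = b.cls (\<lambda>n. \<sigma> 1)"
    using assms(2) Cm_cls [OF s(1)] by (simp add: s(2) b.one_Q sigma_one)
  then show ?thesis
    using sigma_cls_eq [OF s(1) one] by (simp add: s(2) a.one_Q)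
qed

lemma sigma_pseq: "a.pseq s r \<Longrightarrow> b.pseq (\<lambda>n. \<sigma> (s n)) r"
proof -
  assume "a.pseq s r"
  note s = a.pseqD [OF this]
  have "w (\<sigma> (s n) - 1) \<le> r" for n
    using pb_eq [OF F_diff [OF s(5) A.F_closed(2)]] s(4) [of n]
    by (simp add: sigma_diff [OF s(5) A.F_closed(2)] sigma_one)
  then show ?thesis
    unfolding b.pseq_def using s sigma_cauchy [OF s(1)] by simp
qed

lemma Cm_PU:
  assumes "x \<in> a.PU" shows "Cm w x \<in> b.PU"
proof -
  obtain s r where s: "a.pseq s r" "x = a.cls s" using a.PU_pseq [OF assms] .
  show ?thesis
    unfolding s(2) Cm_cls [OF a.pseqD(1) [OF s(1)]] by (rule b.pseq_PU [OF sigma_pseq [OF s(1)]])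
qed

lemma Cm_padic_power:
  assumes "c \<in> carrier (Zp p)" "x \<in> a.PU"
  shows "Cm w (padic_power p F (pb w) c x) = padic_power p F' w c (Cm w x)"
proof -
  obtain k where k: "A.nat_seq k \<in> A.Q.C" "c = A.qcls (A.nat_seq k)" using A.Zp_nat_seq [OF assms(1)] .
  obtain s r where s: "a.pseq s r" "x = a.cls s" using a.PU_pseq [OF assms(2)] .
  note sk = a.pseqD(1) [OF a.pseq_power [OF s(1) k(1)]]
  show ?thesis
    unfolding k(2) s(2) a.padic_power_cls [OF s(1) k(1)] Cm_cls [OF sk] Cm_cls [OF a.pseqD(1) [OF s(1)]]
      b.padic_power_cls [OF sigma_pseq [OF s(1)] k(1)] sigma_power [OF a.pseqD(5) [OF s(1)]] ..
qed

lemma Cm_teich: "a.teich z \<Longrightarrow> b.teich (Cm w z)"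
  unfolding a.teich_def b.teich_def
  by (elim conjE exE, intro conjI exI) (assumption | simp only: Cm_closed Cm_pow [symmetric] Cm_one)+

lemma Cm_principal_part:
  assumes u: "u \<in> carrier A.E"
  shows "Cm w (principal_part p F (pb w) u) = principal_part p F' w (\<sigma> u)"
proof -
  note su = a.principal_part_spec [OF A.E_unit [OF u]]
  obtain z where z: "a.teich z" "completion_emb F (pb w) u = z \<otimes>\<^bsub>a.Q\<^esub> principal_part p F (pb w) u"
    using su(2) by (elim exE conjE)
  have zc: "z \<in> carrier a.Q" using z(1) unfolding a.teich_def by (rule conjunct1)
  have "completion_emb F' w (\<sigma> u) = Cm w z \<otimes>\<^bsub>b.Q\<^esub> Cm w (principal_part p F (pb w) u)"
    unfolding Cm_emb [OF A.E_unit(1) [OF u], symmetric] z(2) by (rule Cm_mult [OF zc a.PU_carrier [OF su(1)]])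
  from b.principal_part_eqI [OF Cm_PU [OF su(1)] Cm_teich [OF z(1)] this] show ?thesis ..
qed

end

definition "local_map x = (\<lambda>w\<in>B.P. Cm w (x (pb w)))"

lemma local_map_hom: "local_map \<in> module_hom (Zp p) A.LU B.LU"
  unfolding module_hom_def
proof (intro CollectI conjI allI impI Pi_I; (elim conjE)?)
  fix x assume x: "x \<in> carrier A.LU"
  show "local_map x \<in> carrier B.LU"
    unfolding local_map_def B.LU_carrier using Cm_PU [OF _ A.LU_mem [OF x pb_place]] by auto
  fix c assume c: "c \<in> carrier (Zp p)"
  show "local_map (c \<odot>\<^bsub>A.LU\<^esub> x) = c \<odot>\<^bsub>B.LU\<^esub> local_map x"
    unfolding local_map_def B.LU_ops
  proof (rule restrict_ext)
    fix w assume w: "w \<in> B.P"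
    show "Cm w ((c \<odot>\<^bsub>A.LU\<^esub> x) (pb w)) = padic_power p F' w c ((\<lambda>w\<in>B.P. Cm w (x (pb w))) w)"
      unfolding A.LU_ops using w pb_place [OF w] Cm_padic_power [OF w c A.LU_mem [OF x pb_place [OF w]]] by simp
  qed
next
  fix x y assume x: "x \<in> carrier A.LU" and y: "y \<in> carrier A.LU"
  show "local_map (x \<oplus>\<^bsub>A.LU\<^esub> y) = local_map x \<oplus>\<^bsub>B.LU\<^esub> local_map y"
    unfolding local_map_def B.LU_ops
  proof (rule restrict_ext)
    fix w assume w: "w \<in> B.P"
    note pw = pb_place [OF w]
    show "Cm w ((x \<oplus>\<^bsub>A.LU\<^esub> y) (pb w)) = (\<lambda>w\<in>B.P. Cm w (x (pb w))) w \<otimes>\<^bsub>completion F' w\<^esub> (\<lambda>w\<in>B.P. Cm w (y (pb w))) w"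
      unfolding A.LU_ops using w pw Cm_mult [OF w A.PU_in [OF pw A.LU_mem [OF x pw]] A.PU_in [OF pw A.LU_mem [OF y pw]]] by simp
  qed
qed

lemma local_map_D: "u \<in> carrier A.E \<Longrightarrow> local_map (A.D u) = B.D (\<sigma> u)"
  unfolding local_map_def diagonal_embedding_def
  by (rule restrict_ext) (simp add: pb_place Cm_principal_part)

abbreviation "unit_map \<equiv> unit_space_map p F F' \<sigma>"
abbreviation "local_space_map \<equiv> base_change_map (Zp p) (Qp p) id A.LU B.LU local_map"

lemmas unit_map_hom = unit_space_map_spec(1) [OF sigma_hom]
lemmas unit_map_qten = unit_space_map_spec(2) [OF sigma_hom]

lemma local_space_map_hom: "local_space_map \<in> module_hom (Qp p) A.W B.W"
  by (rule A.QL.base_change_map_spec(1) [OF B.module_LU local_map_hom])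

text \<open>Naturality of the regulator. On the image of a unit \<open>u\<close> both sides are the
  diagonal embedding of \<sigma>\<open>(u)\<close>, because \<sigma> carries roots of unity to roots
  of unity and principal units to principal units.\<close>

lemma unit_map_comm:
  assumes "v \<in> carrier A.V"
  shows "local_space_map (A.reg v) = B.reg (unit_map v)"
proof (rule A.V_hom_eqI [OF B.QL.module_BC _ _ _ assms])
  show "(\<lambda>v. local_space_map (A.reg v)) \<in> module_hom (Qp p) A.V B.W"
    by (rule module_hom_comp [OF A.reg_hom local_space_map_hom])
  show "(\<lambda>v. B.reg (unit_map v)) \<in> module_hom (Qp p) A.V B.W"
    by (rule module_hom_comp [OF unit_map_hom B.reg_hom])
  fix u assume u: "u \<in> carrier A.E"
  show "local_space_map (A.reg (A.qten u)) = B.reg (unit_map (A.qten u))"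
    unfolding A.reg_qten [OF u] unit_map_qten [OF u] B.reg_qten [OF sigma_E [OF u]]
      A.QL.base_change_map_spec(2) [OF B.module_LU local_map_hom A.QZ.S.one_closed A.D_closed [OF u]]
      local_map_D [OF u] ..
qed

lemma unit_map_LK:
  assumes "v \<in> carrier A.LK"
  shows "unit_map v \<in> carrier B.LK"
proof -
  have v: "v \<in> carrier A.V" "A.reg v = \<zero>\<^bsub>A.W\<^esub>" using assms A.LK_carrier by auto
  have "B.reg (unit_map v) = \<zero>\<^bsub>B.W\<^esub>"
    unfolding unit_map_comm [OF v(1), symmetric] v(2)
    by (rule module_hom_zero [OF A.QL.module_BC B.QL.module_BC local_space_map_hom])
  moreover have "unit_map v \<in> carrier B.V"
    using module_hom_closed [OF unit_map_hom] v(1) by auto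
  ultimately show ?thesis using B.LK_carrier by blast
qed

text \<open>The component of \<open>x\<close> at \<open>v\<close> can be read off at any place above
  \<open>v\<close>, into whose completion that of \<open>v\<close> embeds. Hence every place of
  \<open>F\<close> must have one above it.\<close>

lemma local_map_zero:
  assumes surj: "\<And>v. v \<in> A.P \<Longrightarrow> \<exists>w\<in>B.P. pb w = v"
    and x: "x \<in> carrier A.LU" and zero: "local_map x = \<zero>\<^bsub>B.LU\<^esub>"
  shows "x = \<zero>\<^bsub>A.LU\<^esub>"
proof (rule A.LU_eqI [OF A.LU_ext [OF x]])
  show "\<zero>\<^bsub>A.LU\<^esub> \<in> extensional A.P" unfolding A.LU_ops by simp
  fix v assume v: "v \<in> A.P"
  then obtain w where w: "w \<in> B.P" "pb w = v" using surj by blast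
  have "local_map x w = \<zero>\<^bsub>B.LU\<^esub> w" using zero by simp
  then have "Cm w (x (pb w)) = \<one>\<^bsub>completion F' w\<^esub>"
    unfolding local_map_def B.LU_ops using w(1) by simp
  then have "x (pb w) = \<one>\<^bsub>completion F (pb w)\<^esub>"
    by (rule Cm_eq_one [OF w(1) A.PU_in [OF pb_place [OF w(1)] A.LU_mem [OF x pb_place [OF w(1)]]]])
  then show "x v = \<zero>\<^bsub>A.LU\<^esub> v"
    unfolding A.LU_ops using v w(2) by simp
qed

text \<open>The kernel can be tested after enlarging the field: the regulators commute with the
  local map, which is injective and stays so over the p-adic numbers by
  \<open>base_change_map_inj\<close>.\<close>

lemma LK_reflect:
  assumes surj: "\<And>v. v \<in> A.P \<Longrightarrow> \<exists>w\<in>B.P. pb w = v"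
    and v: "v \<in> carrier A.V" and LK: "unit_map v \<in> carrier B.LK"
  shows "v \<in> carrier A.LK"
proof -
  have rv: "A.reg v \<in> carrier A.W"
    using module_hom_closed [OF A.reg_hom] v by auto
  have zero: "local_space_map (A.reg v) = \<zero>\<^bsub>B.W\<^esub>"
    unfolding unit_map_comm [OF v] using LK B.LK_carrier by blast
  have inj: "x = \<zero>\<^bsub>A.LU\<^esub>" if "x \<in> carrier A.LU" "local_map x = \<zero>\<^bsub>B.LU\<^esub>" for x
    using surj that by (rule local_map_zero)
  have "A.reg v = \<zero>\<^bsub>A.W\<^esub>"
    by (rule A.QL.base_change_map_inj [OF B.module_LU local_map_hom inj rv zero])
  with v show ?thesis using A.LK_carrier by blast
qed

end

subsection \<open>Extension of non-archimedean absolute values\<close>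

text \<open>A finite extension with a basis \<open>B\<close> and an ultrametric absolute value
  \<open>v\<close> on the base field, which need not be complete.\<close>

locale valued_extension =
  fixes F L :: "'a::field set" and v :: "'a \<Rightarrow> real" and B :: "'a set"
  assumes F: "0 \<in> F" "1 \<in> F" "\<And>x y. x \<in> F \<Longrightarrow> y \<in> F \<Longrightarrow> x + y \<in> F"
      "\<And>x y. x \<in> F \<Longrightarrow> y \<in> F \<Longrightarrow> x * y \<in> F" "\<And>x. x \<in> F \<Longrightarrow> - x \<in> F" "\<And>x. x \<in> F \<Longrightarrow> inverse x \<in> F"
    and L: "\<And>x y. x \<in> L \<Longrightarrow> y \<in> L \<Longrightarrow> x + y \<in> L"
      "\<And>x y. x \<in> L \<Longrightarrow> y \<in> L \<Longrightarrow> x * y \<in> L" "\<And>x. x \<in> L \<Longrightarrow> inverse x \<in> L"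
    and FL: "F \<subseteq> L"
    and finite_B: "finite B" and B_L: "B \<subseteq> L"
    and span_B: "\<And>x. x \<in> L \<Longrightarrow> \<exists>c. (\<forall>b\<in>B. c b \<in> F) \<and> x = (\<Sum>b\<in>B. c b * b)"
    and unique_B: "\<And>c b. \<forall>b\<in>B. c b \<in> F \<Longrightarrow> (\<Sum>b\<in>B. c b * b) = 0 \<Longrightarrow> b \<in> B \<Longrightarrow> c b = 0"
    and v: "absolute_value_on F v"
    and v_max: "\<And>x y. x \<in> F \<Longrightarrow> y \<in> F \<Longrightarrow> v (x + y) \<le> max (v x) (v y)"
begin

lemma FL': "x \<in> F \<Longrightarrow> x \<in> L" using FL by auto

lemma v_ge: "x \<in> F \<Longrightarrow> 0 \<le> v x" and v_zero: "x \<in> F \<Longrightarrow> v x = 0 \<longleftrightarrow> x = 0"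
  and v_mult: "x \<in> F \<Longrightarrow> y \<in> F \<Longrightarrow> v (x * y) = v x * v y"
  using v unfolding absolute_value_on_def by simp_all

lemma v_0: "v 0 = 0"
  using v_zero [OF F(1)] by simp

lemma v_one: "v 1 = 1"
  using v_mult [OF F(2) F(2)] v_zero [OF F(2)] by simp

lemma of_nat_F: "of_nat n \<in> F" and v_of_nat: "v (of_nat n) \<le> 1"
proof -
  have "of_nat n \<in> F \<and> v (of_nat n) \<le> 1"
  proof (induction n)
    case (Suc n)
    then show ?case using v_max [OF F(2), of "of_nat n"] by (simp add: F v_one)
  qed (simp add: F v_0)
  then show "of_nat n \<in> F" "v (of_nat n) \<le> 1" by simp_all
qed

lemma F_power: "x \<in> F \<Longrightarrow> x ^ n \<in> F"
  by (induction n) (simp_all add: F)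

lemma L_power: "x \<in> L \<Longrightarrow> x ^ n \<in> L"
  by (induction n) (simp_all add: F FL' L)

lemma v_power: "x \<in> F \<Longrightarrow> v (x ^ n) = v x ^ n"
  by (induction n) (simp_all add: v_one v_mult F_power)

text \<open>Compatibility with \<open>v\<close> is only an inequality, so that it survives infima;
  equality is recovered for minimal norms. The bound at \<open>1\<close> excludes the zero function,
  and the fixed value outside \<open>L\<close> makes the pointwise order antisymmetric.\<close>

definition algebra_norm :: "('a \<Rightarrow> real) \<Rightarrow> bool" where
  "algebra_norm N \<longleftrightarrow> (\<forall>x\<in>L. 0 \<le> N x) \<and> 1 \<le> N 1 \<and> (\<forall>x\<in>L. \<forall>y\<in>L. N (x + y) \<le> max (N x) (N y) \<and> N (x * y) \<le> N x * N y) \<and>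
     (\<forall>c\<in>F. \<forall>x\<in>L. N (c * x) \<le> v c * N x) \<and> (\<forall>x. x \<notin> L \<longrightarrow> N x = 0)"

lemma algebra_normI:
  assumes "\<And>x. x \<in> L \<Longrightarrow> 0 \<le> N x" "1 \<le> N 1"
    "\<And>x y. x \<in> L \<Longrightarrow> y \<in> L \<Longrightarrow> N (x + y) \<le> max (N x) (N y)" "\<And>x y. x \<in> L \<Longrightarrow> y \<in> L \<Longrightarrow> N (x * y) \<le> N x * N y"
    "\<And>c x. c \<in> F \<Longrightarrow> x \<in> L \<Longrightarrow> N (c * x) \<le> v c * N x" "\<And>x. x \<notin> L \<Longrightarrow> N x = 0"
  shows "algebra_norm N"
  unfolding algebra_norm_def using assms by blast

lemma algebra_normD:
  assumes "algebra_norm N"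
  shows "x \<in> L \<Longrightarrow> 0 \<le> N x" "1 \<le> N 1" "x \<in> L \<Longrightarrow> y \<in> L \<Longrightarrow> N (x + y) \<le> max (N x) (N y)"
    "x \<in> L \<Longrightarrow> y \<in> L \<Longrightarrow> N (x * y) \<le> N x * N y" "c \<in> F \<Longrightarrow> x \<in> L \<Longrightarrow> N (c * x) \<le> v c * N x" "x \<notin> L \<Longrightarrow> N x = 0"
  using assms unfolding algebra_norm_def by blast+

text \<open>The common pattern of three constructions: the infimum of a chain of norms, the spectral
  norm, and the norm obtained by testing against powers of a fixed element. It suffices that
  candidates for \<open>x\<close> and \<open>y\<close> dominate some candidate for the sum, product
  or multiple.\<close>

lemma algebra_norm_Inf:
  assumes ne: "\<And>x. x \<in> L \<Longrightarrow> R x \<noteq> {}" and nn: "\<And>x r. x \<in> L \<Longrightarrow> r \<in> R x \<Longrightarrow> 0 \<le> r"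
    and one: "\<And>r. r \<in> R 1 \<Longrightarrow> 1 \<le> r"
    and plus: "\<And>x y r s. x \<in> L \<Longrightarrow> y \<in> L \<Longrightarrow> r \<in> R x \<Longrightarrow> s \<in> R y \<Longrightarrow> \<exists>t\<in>R (x + y). t \<le> max r s"
    and times: "\<And>x y r s. x \<in> L \<Longrightarrow> y \<in> L \<Longrightarrow> r \<in> R x \<Longrightarrow> s \<in> R y \<Longrightarrow> \<exists>t\<in>R (x * y). t \<le> r * s"
    and scale: "\<And>c x r. c \<in> F \<Longrightarrow> x \<in> L \<Longrightarrow> r \<in> R x \<Longrightarrow> \<exists>t\<in>R (c * x). t \<le> v c * r"
  shows "algebra_norm (\<lambda>x. if x \<in> L then Inf (R x) else 0)"
proof -
  have 1: "1 \<in> L" by (rule FL' [OF F(2)])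
  have low: "Inf (R x) \<le> t" if "x \<in> L" "r \<in> R x" "r \<le> t" for x r t
  proof -
    have "bdd_below (R x)" using nn [OF that(1)] by (rule bdd_belowI)
    from cInf_lower [OF that(2) this] that(3) show ?thesis by simp
  qed
  have pos: "0 \<le> Inf (R x)" if "x \<in> L" for x
    by (rule cInf_greatest [OF ne [OF that] nn [OF that]])
  \<comment> \<open>Passes from all candidates to their infimum. For positive \<open>k\<close> one
    divides by \<open>k\<close>; for \<open>k = 0\<close> any candidate will do, and there is
    one.\<close>
  have mul: "a \<le> k * Inf (R x)" if x: "x \<in> L" and k: "0 \<le> k" and le: "\<And>r. r \<in> R x \<Longrightarrow> a \<le> k * r" for a k x
  proof (cases "k = 0")
    case True
    obtain r where "r \<in> R x" using ne [OF x] by blast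
    with le True show ?thesis by fastforce
  next
    case False
    with k have k: "0 < k" by simp
    have "a / k \<le> Inf (R x)"
      by (rule cInf_greatest [OF ne [OF x]]) (use le k in \<open>simp add: field_simps\<close>)
    then show ?thesis using k by (simp add: field_simps)
  qed
  have ex: "\<exists>r\<in>R x. r < a" if "x \<in> L" "Inf (R x) < a" for x a
    using cInf_lessD [OF ne [OF that(1)] that(2)] by blast
  show ?thesis
  proof (rule algebra_normI)
    fix x assume x: "x \<in> L"
    then show "0 \<le> (if x \<in> L then Inf (R x) else 0)" using pos by simp
    show "(if c * x \<in> L then Inf (R (c * x)) else 0) \<le> v c * (if x \<in> L then Inf (R x) else 0)" if c: "c \<in> F" for c
    proof -
      have cx: "c * x \<in> L" by (intro L FL' c x)
      have "Inf (R (c * x)) \<le> v c * r" if "r \<in> R x" for r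
        using scale [OF c x that] low [OF cx] by blast
      from mul [OF x v_ge [OF c] this] show ?thesis using x cx by simp
    qed
    fix y assume y: "y \<in> L"
    note xy = L(1) [OF x y] L(2) [OF x y]
    have "Inf (R (x + y)) \<le> max (Inf (R x)) (Inf (R y))"
    proof (rule ccontr)
      assume "\<not> ?thesis"
      then have "Inf (R x) < Inf (R (x + y))" "Inf (R y) < Inf (R (x + y))" by simp_all
      then obtain r s where rs: "r \<in> R x" "r < Inf (R (x + y))" "s \<in> R y" "s < Inf (R (x + y))"
        using ex [OF x] ex [OF y] by metis
      obtain t where "t \<in> R (x + y)" "t \<le> max r s" using plus [OF x y rs(1,3)] by blast
      from low [OF xy(1) this] rs show False by simp
    qed
    then show "(if x + y \<in> L then Inf (R (x + y)) else 0) \<le> max (if x \<in> L then Inf (R x) else 0) (if y \<in> L then Inf (R y) else 0)"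
      using x y xy by simp
    have "Inf (R (x * y)) \<le> Inf (R y) * Inf (R x)"
    proof (rule mul [OF x pos [OF y]])
      fix r assume r: "r \<in> R x"
      have "Inf (R (x * y)) \<le> r * Inf (R y)"
      proof (rule mul [OF y nn [OF x r]])
        fix s assume s: "s \<in> R y"
        show "Inf (R (x * y)) \<le> r * s" using times [OF x y r s] low [OF xy(2)] by blast
      qed
      then show "Inf (R (x * y)) \<le> Inf (R y) * r" by (simp add: mult.commute)
    qed
    then show "(if x * y \<in> L then Inf (R (x * y)) else 0) \<le> (if x \<in> L then Inf (R x) else 0) * (if y \<in> L then Inf (R y) else 0)"
      using x y xy by (simp add: mult.commute)
  next
    show "1 \<le> (if 1 \<in> L then Inf (R 1) else 0)" using cInf_greatest [OF ne [OF 1] one] 1 by simp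
  qed simp
qed

definition "coord x = (SOME c. (\<forall>b\<in>B. c b \<in> F) \<and> x = (\<Sum>b\<in>B. c b * b))"

lemma coord: "x \<in> L \<Longrightarrow> b \<in> B \<Longrightarrow> coord x b \<in> F" "x \<in> L \<Longrightarrow> (\<Sum>b\<in>B. coord x b * b) = x"
proof -
  have "(\<forall>b\<in>B. coord x b \<in> F) \<and> x = (\<Sum>b\<in>B. coord x b * b)" if "x \<in> L"
    unfolding coord_def by (rule someI_ex [OF span_B [OF that]])
  then show "x \<in> L \<Longrightarrow> b \<in> B \<Longrightarrow> coord x b \<in> F" "x \<in> L \<Longrightarrow> (\<Sum>b\<in>B. coord x b * b) = x" by simp_all
qed

lemma coord_eqI:
  assumes c: "\<And>b. b \<in> B \<Longrightarrow> c b \<in> F" and x: "x \<in> L" "x = (\<Sum>b\<in>B. c b * b)" and b: "b \<in> B"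
  shows "coord x b = c b"
proof -
  have "coord x b + - c b = 0"
  proof (rule unique_B [OF _ _ b, of "\<lambda>b. coord x b + - c b"])
    show "\<forall>b\<in>B. coord x b + - c b \<in> F" using coord(1) [OF x(1)] c F by blast
    have "(\<Sum>b\<in>B. (coord x b + - c b) * b) = (\<Sum>b\<in>B. coord x b * b) - (\<Sum>b\<in>B. c b * b)"
      by (simp add: algebra_simps sum_subtractf)
    then show "(\<Sum>b\<in>B. (coord x b + - c b) * b) = 0" using coord(2) [OF x(1)] x(2) by simp
  qed
  then show ?thesis by simp
qed

text \<open>The maximum norm of the coordinates, rescaled to become submultiplicative.\<close>

lemma exists_algebra_norm: "\<exists>N. algebra_norm N"
proof -
  define N0 where "N0 x = Max (insert 0 ((\<lambda>b. v (coord x b)) ` B))" for x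
  have N0_le: "N0 x \<le> r \<longleftrightarrow> 0 \<le> r \<and> (\<forall>b\<in>B. v (coord x b) \<le> r)" for x r
    unfolding N0_def using finite_B by (subst Max_le_iff) auto
  have N0: "0 \<le> N0 x" "b \<in> B \<Longrightarrow> v (coord x b) \<le> N0 x" for x b
    using N0_le [of x "N0 x"] by auto
  \<comment> \<open>Bounds the norms of the products of basis elements, so \<open>N0 (x * y)\<close>
    is at most \<open>C\<close> times \<open>N0 x * N0 y\<close> and \<open>C * N0\<close> is
    submultiplicative. Inserting \<open>1\<close> keeps \<open>C\<close> positive.\<close>
  define C where "C = Max (insert 1 ((\<lambda>(b, d). N0 (b * d)) ` (B \<times> B)))"
  have C: "1 \<le> C" "b \<in> B \<Longrightarrow> d \<in> B \<Longrightarrow> N0 (b * d) \<le> C" for b d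
    unfolding C_def using finite_B by (auto intro!: Max_ge)
  have plus: "N0 (x + y) \<le> max (N0 x) (N0 y)" if x: "x \<in> L" and y: "y \<in> L" for x y
    unfolding N0_le
  proof (intro conjI ballI)
    fix b assume b: "b \<in> B"
    have "coord (x + y) b = coord x b + coord y b"
    proof (rule coord_eqI [OF _ _ _ b])
      show "x + y = (\<Sum>b\<in>B. (coord x b + coord y b) * b)"
        by (simp add: distrib_right sum.distrib coord(2) x y)
    qed (simp_all add: F L coord x y)
    then show "v (coord (x + y) b) \<le> max (N0 x) (N0 y)"
      using v_max [OF coord(1) [OF x b] coord(1) [OF y b]] N0(2) [OF b, of x] N0(2) [OF b, of y] by auto
  qed (use N0(1) in \<open>simp add: le_max_iff_disj\<close>)
  have scale: "N0 (c * x) \<le> v c * N0 x" if c: "c \<in> F" and x: "x \<in> L" for c x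
    unfolding N0_le
  proof (intro conjI ballI)
    fix b assume b: "b \<in> B"
    have "coord (c * x) b = c * coord x b"
    proof (rule coord_eqI [OF _ _ _ b])
      show "c * x = (\<Sum>b\<in>B. (c * coord x b) * b)"
        using coord(2) [OF x] by (simp add: mult.assoc flip: sum_distrib_left)
    qed (simp_all add: F L coord x c FL')
    then show "v (coord (c * x) b) \<le> v c * N0 x"
      using v_mult [OF c coord(1) [OF x b]] N0(2) [OF b, of x] v_ge [OF c] by (simp add: mult_left_mono)
  qed (use N0(1) v_ge [OF c] in simp)
  have zero: "N0 0 \<le> 0" using scale [OF F(1) FL' [OF F(2)]] v_zero [OF F(1)] by simp
  have sum: "sum f I \<in> L \<and> N0 (sum f I) \<le> r" if "0 \<le> r" "\<And>i. i \<in> I \<Longrightarrow> f i \<in> L \<and> N0 (f i) \<le> r" for f r and I :: "'a set"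
    using that
  proof (induction I rule: infinite_finite_induct)
    case (insert i I)
    then have "f i \<in> L" "N0 (f i) \<le> r" "sum f I \<in> L" "N0 (sum f I) \<le> r" by simp_all
    with insert.hyps show ?case using plus [of "f i" "sum f I"] by (simp add: L)
  qed (use zero in \<open>simp_all add: F FL'\<close>)
  have times: "N0 (x * y) \<le> C * (N0 x * N0 y)" if x: "x \<in> L" and y: "y \<in> L" for x y
  proof -
    have r: "0 \<le> C * (N0 x * N0 y)" using C(1) N0(1) by simp
    have "x * y = (\<Sum>b\<in>B. coord x b * b) * (\<Sum>d\<in>B. coord y d * d)" using coord(2) x y by simp
    also have "\<dots> = (\<Sum>b\<in>B. \<Sum>d\<in>B. (coord x b * coord y d) * (b * d))"
      unfolding sum_product by (simp add: mult_ac)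
    finally have eq: "x * y = (\<Sum>b\<in>B. \<Sum>d\<in>B. (coord x b * coord y d) * (b * d))" .
    have one: "coord x b * coord y d * (b * d) \<in> L \<and> N0 (coord x b * coord y d * (b * d)) \<le> C * (N0 x * N0 y)"
      if b: "b \<in> B" and d: "d \<in> B" for b d
    proof -
      have m: "coord x b * coord y d \<in> F" "b * d \<in> L" using F coord(1) x y b d B_L
        by (auto intro!: L(2))
      have "N0 (coord x b * coord y d * (b * d)) \<le> v (coord x b * coord y d) * N0 (b * d)"
        by (rule scale [OF m])
      also have "\<dots> \<le> (N0 x * N0 y) * C"
        unfolding v_mult [OF coord(1) [OF x b] coord(1) [OF y d]]
        by (intro mult_mono N0 C(2) b d v_ge coord(1) x y mult_nonneg_nonneg)
      finally show ?thesis using L(2) [OF FL' [OF m(1)] m(2)] by (simp add: mult_ac)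
    qed
    show ?thesis unfolding eq by (intro conjunct2 [OF sum] sum r one)
  qed
  define N where "N x = (if x \<in> L then C * N0 x else 0)" for x
  have 1: "1 \<in> L" by (rule FL' [OF F(2)])
  have C0: "0 \<le> C" using C(1) by simp
  have N0_one: "N0 1 \<noteq> 0"
  proof
    assume "N0 1 = 0"
    then have "v (coord 1 b) = 0" if "b \<in> B" for b
      using N0(2) [OF that, of 1] v_ge [OF coord(1) [OF 1 that]] by simp
    then have "coord 1 b = 0" if "b \<in> B" for b
      using that v_zero [OF coord(1) [OF 1 that]] by simp
    then show False using coord(2) [OF 1] by simp
  qed
  have mult: "N (x * y) \<le> N x * N y" if "x \<in> L" "y \<in> L" for x y
    using mult_left_mono [OF times [OF that] C0] that by (simp add: N_def L mult_ac)
  have "algebra_norm N"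
  proof (rule algebra_normI)
    \<comment> \<open>With positivity, submultiplicativity at \<open>1 * 1\<close> forces the norm
      of \<open>1\<close> to be at least \<open>1\<close>.\<close>
    have "0 < N 1" unfolding N_def using N0_one N0(1) [of 1] C(1) 1 by simp
    with mult [OF 1 1] show "1 \<le> N 1" by simp
  next
    fix x y assume "x \<in> L" "y \<in> L"
    then show "N (x + y) \<le> max (N x) (N y)"
      using mult_left_mono [OF plus C0] C0 by (simp add: N_def L max_mult_distrib_left)
  next
    fix c x assume "c \<in> F" "x \<in> L"
    then show "N (c * x) \<le> v c * N x"
      using mult_left_mono [OF scale C0] by (simp add: N_def L FL' mult_ac)
  qed (use C0 N0 mult in \<open>simp_all add: N_def\<close>)
  then show ?thesis by blast
qed

definition "minimal_norm N \<longleftrightarrow> algebra_norm N \<and> (\<forall>M. algebra_norm M \<longrightarrow> (\<forall>x\<in>L. M x \<le> N x) \<longrightarrow> (\<forall>x\<in>L. M x = N x))"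

text \<open>Zorn's lemma in the descending direction. The infimum of a chain is again a norm, since
  of any two members one lies below the other everywhere and can stand in for both.\<close>

lemma exists_minimal_norm: "\<exists>N. minimal_norm N"
proof -
  let ?A = "Collect algebra_norm" and ?P = "\<lambda>N M. \<forall>x\<in>L. M x \<le> (N x :: real)"
  have ext: "N = M" if "algebra_norm N" "algebra_norm M" "\<And>x. x \<in> L \<Longrightarrow> N x = M x" for N M
  proof
    show "N x = M x" for x
      using that(3) [of x] algebra_normD(6) [OF that(1), of x] algebra_normD(6) [OF that(2), of x] by (cases "x \<in> L") simp_all
  qed
  have "\<exists>N\<in>?A. \<forall>M\<in>?A. ?P N M \<longrightarrow> M = N"
  proof (rule predicate_Zorn)
    show "partial_order_on ?A (relation_of ?P ?A)"
    proof (rule partial_order_on_relation_ofI)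
      show "?P N N" for N by simp
      show "?P N M \<Longrightarrow> ?P M M' \<Longrightarrow> ?P N M'" for N M M' by (meson order_trans)
      show "N \<in> ?A \<Longrightarrow> M \<in> ?A \<Longrightarrow> ?P N M \<Longrightarrow> ?P M N \<Longrightarrow> N = M" for N M
        by (rule ext) (simp_all add: order_antisym)
    qed
    fix C assume "C \<in> Chains (relation_of ?P ?A)"
    then have C: "\<And>N. N \<in> C \<Longrightarrow> algebra_norm N" and chain: "\<And>N M. N \<in> C \<Longrightarrow> M \<in> C \<Longrightarrow> ?P N M \<or> ?P M N"
      unfolding Chains_def relation_of_def by (auto 0 4)
    show "\<exists>M\<in>?A. \<forall>N\<in>C. ?P N M"
    proof (cases "C = {}")
      case True
      then show ?thesis using exists_algebra_norm by auto
    next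
      case False
      let ?R = "\<lambda>x. (\<lambda>N. N x) ` C"
      let ?M = "\<lambda>x. if x \<in> L then Inf (?R x) else 0"
      have below: "\<exists>K\<in>C. K x \<le> N x \<and> K y \<le> M y" if "N \<in> C" "M \<in> C" "x \<in> L" "y \<in> L" for N M x y
        using chain [OF that(1,2)] that by blast
      have "algebra_norm ?M"
      proof (rule algebra_norm_Inf)
        show "?R x \<noteq> {}" for x using False by simp
        show "x \<in> L \<Longrightarrow> r \<in> ?R x \<Longrightarrow> 0 \<le> r" for x r using algebra_normD(1) [OF C] by auto
        show "r \<in> ?R 1 \<Longrightarrow> 1 \<le> r" for r using algebra_normD(2) [OF C] by auto
        fix x y r s assume x: "x \<in> L" and y: "y \<in> L" and "r \<in> ?R x" "s \<in> ?R y"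
        then obtain K where K: "K \<in> C" "K x \<le> r" "K y \<le> s" using below [of _ _ x y] by blast
        note n = algebra_normD [OF C [OF K(1)]]
        show "\<exists>t\<in>?R (x + y). t \<le> max r s"
          using K n(3) [OF x y] by (intro bexI [of _ "K (x + y)"]) auto
        have "K x * K y \<le> r * s" using K(2,3) n(1) [OF x] n(1) [OF y] by (intro mult_mono) auto
        with K(1) n(4) [OF x y] show "\<exists>t\<in>?R (x * y). t \<le> r * s"
          by (intro bexI [of _ "K (x * y)"]) auto
      next
        fix c x r assume c: "c \<in> F" and x: "x \<in> L" and "r \<in> ?R x"
        then obtain K where K: "K \<in> C" "r = K x" by blast
        show "\<exists>t\<in>?R (c * x). t \<le> v c * r"
          using algebra_normD(5) [OF C [OF K(1)] c x] K by (intro bexI [of _ "K (c * x)"]) auto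
      qed
      moreover have "?P N ?M" if "N \<in> C" for N
      proof
        fix x assume x: "x \<in> L"
        have "bdd_below (?R x)" using algebra_normD(1) [OF C _] x by (intro bdd_belowI [of _ 0]) auto
        then show "?M x \<le> N x" using x that by (simp add: cInf_lower)
      qed
      ultimately show ?thesis by (intro bexI [of _ ?M]) blast+
    qed
  qed
  then obtain N where "algebra_norm N" "\<And>M. algebra_norm M \<Longrightarrow> ?P N M \<Longrightarrow> M = N" by auto
  then have "minimal_norm N" unfolding minimal_norm_def by blast
  then show ?thesis by blast
qed

section \<open>A minimal norm is multiplicative and extends the given absolute value\<close>

context
  fixes N assumes min: "minimal_norm N"
begin

lemma N: "algebra_norm N"
  using min unfolding minimal_norm_def by simp

lemma N_le: "algebra_norm M \<Longrightarrow> (\<And>x. x \<in> L \<Longrightarrow> M x \<le> N x) \<Longrightarrow> x \<in> L \<Longrightarrow> M x = N x"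
  using min unfolding minimal_norm_def by blast

lemmas N_nonneg = algebra_normD(1) [OF N] and N_one = algebra_normD(2) [OF N] and N_plus = algebra_normD(3) [OF N]
  and N_times = algebra_normD(4) [OF N] and N_scale = algebra_normD(5) [OF N]

lemma N_zero: "N 0 = 0"
  using N_scale [OF F(1) FL' [OF F(2)]] v_zero [OF F(1)] N_nonneg [OF FL' [OF F(1)]] by simp

lemma N_pos:
  assumes "x \<in> L" "x \<noteq> 0" shows "0 < N x"
proof (rule ccontr)
  assume "\<not> 0 < N x"
  then have "N x = 0" using N_nonneg [OF assms(1)] by simp
  then show False using N_times [OF assms(1) L(3) [OF assms(1)]] N_one assms(2) by simp
qed

lemma N_sum_le:
  "0 \<le> r \<Longrightarrow> (\<And>i. i \<in> I \<Longrightarrow> f i \<in> L \<and> N (f i) \<le> r) \<Longrightarrow> sum f I \<in> L \<and> N (sum f I) \<le> r"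
proof (induction I rule: infinite_finite_induct)
  case (insert i I)
  then have "f i \<in> L" "N (f i) \<le> r" "sum f I \<in> L" "N (sum f I) \<le> r" by simp_all
  with insert.hyps show ?case using N_plus [of "f i" "sum f I"] by (simp add: L)
qed (simp_all add: F FL' N_zero)

text \<open>The rates \<open>r\<close> for which the norms of the powers of \<open>x\<close> are of
  order at most \<open>r^n\<close>. The infimum is the spectral radius, described without roots and
  limits.\<close>

definition "growth x = {r. 0 \<le> r \<and> (\<exists>A. \<forall>n. N (x ^ n) \<le> A * r ^ n)}"

lemma growthD:
  assumes "r \<in> growth x"
  shows "\<exists>A. 0 \<le> A \<and> (\<forall>n. N (x ^ n) \<le> A * r ^ n)"
proof -
  obtain A where A: "\<And>n. N (x ^ n) \<le> A * r ^ n" using assms unfolding growth_def by blast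
  have "0 \<le> A" using A [of 0] N_one by simp
  with A show ?thesis by blast
qed

lemma growth_self:
  assumes "x \<in> L" shows "N x \<in> growth x"
proof -
  have "N (x ^ n) \<le> N 1 * N x ^ n" for n
  proof (induction n)
    case (Suc n)
    have "N (x ^ Suc n) \<le> N x * N (x ^ n)" using N_times [OF assms L_power [OF assms]] by simp
    also have "\<dots> \<le> N x * (N 1 * N x ^ n)" by (intro mult_left_mono Suc N_nonneg assms)
    finally show ?case by (simp add: mult_ac)
  qed simp
  then show ?thesis unfolding growth_def using N_nonneg [OF assms] by blast
qed

lemma growth_one: "r \<in> growth 1 \<Longrightarrow> 1 \<le> r"
proof (rule ccontr)
  assume r: "r \<in> growth 1" and "\<not> 1 \<le> r"
  then have r1: "0 \<le> r" "r < 1" unfolding growth_def by simp_all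
  obtain A where A: "\<And>n. N (1 ^ n) \<le> A * r ^ n" using growthD [OF r] by blast
  have "(\<lambda>n. A * r ^ n) \<longlonglongrightarrow> A * 0" by (intro tendsto_mult_left LIMSEQ_realpow_zero r1)
  then have "N 1 \<le> A * 0" using A by (intro LIMSEQ_le_const) auto
  then show False using N_one by simp
qed

text \<open>The ultrametric inequality reduces a power of the sum to its largest binomial term, and
  binomial coefficients are integers, hence of absolute value at most \<open>1\<close>.\<close>

lemma growth_plus:
  assumes x: "x \<in> L" and y: "y \<in> L" and r: "r \<in> growth x" and s: "s \<in> growth y"
  shows "max r s \<in> growth (x + y)"
proof -
  obtain A where A: "0 \<le> A" "\<And>n. N (x ^ n) \<le> A * r ^ n" using growthD [OF r] by blast
  obtain A' where A': "0 \<le> A'" "\<And>n. N (y ^ n) \<le> A' * s ^ n" using growthD [OF s] by blast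
  have rs: "0 \<le> r" "0 \<le> s" "0 \<le> max r s" using r s unfolding growth_def by auto
  have "N ((x + y) ^ n) \<le> (A * A') * max r s ^ n" for n
    unfolding binomial_ring
  proof (rule conjunct2 [OF N_sum_le])
    show "0 \<le> A * A' * max r s ^ n" using A A' rs by simp
    fix k assume k: "k \<in> {..n}"
    note xy = L_power [OF x, of k] L_power [OF y, of "n - k"]
    have xyL: "x ^ k * y ^ (n - k) \<in> L" by (rule L(2) [OF xy])
    have "N (of_nat (n choose k) * (x ^ k * y ^ (n - k))) \<le> v (of_nat (n choose k)) * N (x ^ k * y ^ (n - k))"
      by (rule N_scale [OF of_nat_F xyL])
    also have "\<dots> \<le> 1 * (N (x ^ k) * N (y ^ (n - k)))"
      by (intro mult_mono v_of_nat N_times xy N_nonneg xyL) simp_all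
    also have "\<dots> \<le> 1 * ((A * r ^ k) * (A' * s ^ (n - k)))"
      by (intro mult_left_mono mult_mono A A' N_nonneg xy mult_nonneg_nonneg zero_le_power rs) simp
    also have "\<dots> = (A * A') * (r ^ k * s ^ (n - k))" by simp
    also have "\<dots> \<le> (A * A') * (max r s ^ k * max r s ^ (n - k))"
      using A(1) A'(1) rs by (intro mult_left_mono mult_mono power_mono) auto
    also have "\<dots> = A * A' * max r s ^ n" using k by (simp flip: power_add)
    finally show "of_nat (n choose k) * x ^ k * y ^ (n - k) \<in> L \<and> N (of_nat (n choose k) * x ^ k * y ^ (n - k)) \<le> A * A' * max r s ^ n"
      using L(2) [OF FL' [OF of_nat_F] xyL] by (simp add: mult.assoc)
  qed
  then show ?thesis unfolding growth_def using rs(3) by blast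
qed

lemma growth_times:
  assumes x: "x \<in> L" and y: "y \<in> L" and r: "r \<in> growth x" and s: "s \<in> growth y"
  shows "r * s \<in> growth (x * y)"
proof -
  obtain A where A: "0 \<le> A" "\<And>n. N (x ^ n) \<le> A * r ^ n" using growthD [OF r] by blast
  obtain A' where A': "0 \<le> A'" "\<And>n. N (y ^ n) \<le> A' * s ^ n" using growthD [OF s] by blast
  have rs: "0 \<le> r" "0 \<le> s" using r s unfolding growth_def by auto
  have "N ((x * y) ^ n) \<le> (A * A') * (r * s) ^ n" for n
  proof -
    have "N ((x * y) ^ n) \<le> N (x ^ n) * N (y ^ n)"
      unfolding power_mult_distrib by (rule N_times [OF L_power [OF x] L_power [OF y]])
    also have "\<dots> \<le> (A * r ^ n) * (A' * s ^ n)"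
      by (intro mult_mono A A' N_nonneg L_power x y mult_nonneg_nonneg zero_le_power rs)
    finally show ?thesis by (simp add: power_mult_distrib mult_ac)
  qed
  then show ?thesis unfolding growth_def using rs by (intro CollectI conjI mult_nonneg_nonneg) blast+
qed

lemma growth_scale:
  assumes c: "c \<in> F" and x: "x \<in> L" and r: "r \<in> growth x"
  shows "v c * r \<in> growth (c * x)"
proof -
  obtain A where A: "0 \<le> A" "\<And>n. N (x ^ n) \<le> A * r ^ n" using growthD [OF r] by blast
  have "N ((c * x) ^ n) \<le> A * (v c * r) ^ n" for n
  proof -
    have "N ((c * x) ^ n) \<le> v c ^ n * N (x ^ n)"
      unfolding power_mult_distrib using N_scale [OF F_power [OF c] L_power [OF x]] v_power [OF c] by simp
    also have "\<dots> \<le> v c ^ n * (A * r ^ n)"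
      by (intro mult_left_mono A zero_le_power v_ge c)
    finally show ?thesis by (simp add: power_mult_distrib mult_ac)
  qed
  then show ?thesis unfolding growth_def using v_ge [OF c] r unfolding growth_def by (intro CollectI conjI mult_nonneg_nonneg) blast+
qed

text \<open>The spectral norm is another algebra norm below the given one, so minimality makes them equal.\<close>

lemma N_eq_spectral:
  assumes "x \<in> L" shows "N x = Inf (growth x)"
proof -
  let ?M = "\<lambda>x. if x \<in> L then Inf (growth x) else 0"
  have nn: "0 \<le> r" if "r \<in> growth y" for r y using that unfolding growth_def by simp
  have "algebra_norm ?M"
    by (rule algebra_norm_Inf)
      (use growth_self growth_one growth_plus growth_times growth_scale nn in blast)+
  moreover have "?M y \<le> N y" if "y \<in> L" for y
    using that cInf_lower [OF growth_self [OF that] bdd_belowI [OF nn]] by simp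
  ultimately have "?M x = N x" using assms by (rule N_le)
  then show ?thesis using assms by simp
qed

text \<open>The spectral radius respects squares: if \<open>s\<close> is a rate for
  \<open>x^2\<close>, then its square root is a rate for \<open>x\<close>.\<close>

lemma N_square:
  assumes x: "x \<in> L" shows "N x ^ 2 \<le> N (x ^ 2)"
proof (cases "x = 0")
  case False
  have s: "N x \<le> sqrt s" if s: "s \<in> growth (x ^ 2)" for s
  proof -
    obtain A where A: "0 \<le> A" "\<And>n. N ((x ^ 2) ^ n) \<le> A * s ^ n" using growthD [OF s] by blast
    have "0 < N ((x ^ 2) ^ 1)" using N_pos [OF L_power [OF x]] False by simp
    then have "0 < A * s" using A(2) [of 1] by simp
    then have s0: "0 < s" using A(1) by (simp add: zero_less_mult_iff)
    define t where "t = sqrt s"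
    have t: "0 < t" "t ^ 2 = s" unfolding t_def using s0 by simp_all
    \<comment> \<open>Even exponents are powers of \<open>x^2\<close> and need the constant
      \<open>A\<close>. Odd ones have one further factor \<open>x\<close> and need
      \<open>N x * A / t\<close>; the sum of both constants covers all \<open>n\<close>.\<close>
    have "N (x ^ n) \<le> (A + N x * A / t) * t ^ n" for n
    proof (cases "even n")
      case True
      then obtain k where n: "n = 2 * k" by blast
      have "N (x ^ n) \<le> A * t ^ n" using A(2) [of k] by (simp add: n power_mult t(2))
      also have "\<dots> \<le> (A + N x * A / t) * t ^ n"
        using A(1) t N_nonneg [OF x] by (intro mult_right_mono) simp_all
      finally show ?thesis .
    next
      case False
      then obtain k where n: "n = 2 * k + 1" by (rule oddE)
      have "N (x ^ n) \<le> N x * N ((x ^ 2) ^ k)"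
        using N_times [OF x L_power [OF L_power [OF x]], of 2 k] by (simp add: n power_mult)
      also have "\<dots> \<le> N x * (A * s ^ k)" by (intro mult_left_mono A N_nonneg x)
      also have "\<dots> = (N x * A / t) * t ^ n" using t(1) by (simp add: n power_mult t(2))
      also have "\<dots> \<le> (A + N x * A / t) * t ^ n"
        using A(1) t by (intro mult_right_mono) simp_all
      finally show ?thesis .
    qed
    then have "t \<in> growth x" unfolding growth_def using t(1) by (intro CollectI conjI exI allI) (simp, assumption)
    then show ?thesis unfolding N_eq_spectral [OF x] t_def [symmetric]
      by (rule cInf_lower) (rule bdd_belowI [of _ 0], simp add: growth_def)
  qed
  have "N x ^ 2 \<le> Inf (growth (x ^ 2))"
  proof (rule cInf_greatest)
    show "growth (x ^ 2) \<noteq> {}" using growth_self [OF L_power [OF x]] by blast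
    fix s assume s': "s \<in> growth (x ^ 2)"
    then have "0 \<le> s" unfolding growth_def by simp
    then show "N x ^ 2 \<le> s" using power_mono [OF s [OF s'] N_nonneg [OF x], of 2] by simp
  qed
  then show ?thesis unfolding N_eq_spectral [OF L_power [OF x]] .
qed (simp add: N_zero)

text \<open>Repeated squaring settles exponents that are powers of two. For general
  \<open>n\<close>, write \<open>2^n\<close> as \<open>n\<close> plus a remainder and cancel the
  remainder with submultiplicativity.\<close>

lemma N_power:
  assumes x: "x \<in> L" and x0: "x \<noteq> 0" shows "N x ^ n \<le> N (x ^ n)"
proof -
  have two: "N x ^ (2 ^ k) \<le> N (x ^ (2 ^ k))" for k
  proof (induction k)
    case (Suc k)
    have "N x ^ (2 ^ Suc k) = (N x ^ (2 ^ k)) ^ 2" by (simp flip: power_mult add: mult.commute)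
    also have "\<dots> \<le> N (x ^ (2 ^ k)) ^ 2" by (intro power_mono Suc zero_le_power N_nonneg x)
    also have "\<dots> \<le> N ((x ^ (2 ^ k)) ^ 2)" by (rule N_square [OF L_power [OF x]])
    also have "(x ^ (2 ^ k)) ^ 2 = x ^ (2 ^ Suc k)" by (simp flip: power_mult add: mult.commute)
    finally show ?case .
  qed simp
  have step: "N (x ^ (n + m)) \<le> N (x ^ n) * N x ^ m" for m
  proof (induction m)
    case (Suc m)
    have "N (x ^ (n + Suc m)) \<le> N x * N (x ^ (n + m))" using N_times [OF x L_power [OF x]] by simp
    also have "\<dots> \<le> N x * (N (x ^ n) * N x ^ m)" by (intro mult_left_mono Suc N_nonneg x)
    finally show ?case by (simp add: mult_ac)
  qed simp
  have "n \<le> 2 ^ n" by (rule less_imp_le) (rule less_exp)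
  then have eq: "2 ^ n = n + (2 ^ n - n)" by simp
  have "N x ^ n * N x ^ (2 ^ n - n) = N x ^ (2 ^ n)" using eq by (simp flip: power_add)
  also have "\<dots> \<le> N (x ^ (2 ^ n))" by (rule two)
  also have "\<dots> \<le> N (x ^ n) * N x ^ (2 ^ n - n)" using step [of "2 ^ n - n"] eq by simp
  finally show ?thesis using N_pos [OF x x0] by simp
qed

text \<open>For fixed \<open>x\<close>, \<open>inf\<^sub>n N (x\<^sup>n y) / N(x)\<^sup>n\<close> is again an algebra norm in \<open>y\<close>,
  hence equal to \<open>N\<close> by minimality.\<close>

lemma N_mult:
  assumes x: "x \<in> L" and y: "y \<in> L"
  shows "N (x * y) = N x * N y"
proof (cases "x = 0")
  case False
  define f where "f n z = N (x ^ n * z) / N x ^ n" for n z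
  have pos: "0 < N x ^ n" for n using N_pos [OF x False] by simp
  have xL: "x ^ n * z \<in> L" if "z \<in> L" for n z by (intro L L_power x that)
  \<comment> \<open>The quotients decrease in \<open>n\<close>, so candidates with different indices
    can be compared at the sum of their indices.\<close>
  have decr: "f (n + m) z \<le> f n z" if z: "z \<in> L" for n m z
  proof (induction m)
    case (Suc m)
    have "N (x * (x ^ (n + m) * z)) \<le> N x * N (x ^ (n + m) * z)" by (rule N_times [OF x xL [OF z]])
    then have "f (n + Suc m) z \<le> f (n + m) z"
      unfolding f_def using pos [of "n + m"] N_pos [OF x False] by (simp add: divide_simps mult_ac)
    with Suc show ?case by simp
  qed simp
  let ?R = "\<lambda>z. range (\<lambda>n. f n z)"
  let ?M = "\<lambda>z. if z \<in> L then Inf (?R z) else 0"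
  have nn: "0 \<le> r" if "z \<in> L" "r \<in> ?R z" for z r
    using that pos N_nonneg [OF xL [OF that(1)]] unfolding f_def by (auto intro!: divide_nonneg_pos)
  have M: "algebra_norm ?M"
  proof (rule algebra_norm_Inf)
    show "r \<in> ?R 1 \<Longrightarrow> 1 \<le> r" for r
      using N_power [OF x False] pos unfolding f_def by auto
    fix z u r s assume z: "z \<in> L" and u: "u \<in> L" and "r \<in> ?R z" "s \<in> ?R u"
    then obtain n m where r: "r = f n z" and s: "s = f m u" by blast
    have "f (n + m) (z + u) \<le> max (f (n + m) z) (f (n + m) u)"
      using N_plus [OF xL [OF z] xL [OF u], of "n + m" "n + m"] pos [of "n + m"]
      unfolding f_def by (auto simp: distrib_left le_max_iff_disj intro!: divide_right_mono)
    also have "\<dots> \<le> max r s"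
    proof -
      have "f (n + m) z \<le> r" "f (n + m) u \<le> s"
        using decr [OF z, of n m] decr [OF u, of m n] unfolding r s by (simp_all add: add.commute)
      then show ?thesis by linarith
    qed
    finally show "\<exists>t\<in>?R (z + u). t \<le> max r s" by blast
    have "N (x ^ (n + m) * (z * u)) \<le> N (x ^ n * z) * N (x ^ m * u)"
      using N_times [OF xL [OF z] xL [OF u], of n m] by (simp add: power_add mult_ac)
    then have "f (n + m) (z * u) \<le> r * s"
      unfolding r s f_def using pos [of "n + m"] by (simp add: power_add divide_right_mono)
    then show "\<exists>t\<in>?R (z * u). t \<le> r * s" by blast
  next
    fix c z r assume c: "c \<in> F" and z: "z \<in> L" and "r \<in> ?R z"
    then obtain n where r: "r = f n z" by blast
    have "N (x ^ n * (c * z)) \<le> v c * N (x ^ n * z)"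
      using N_scale [OF c xL [OF z], of n] by (simp add: mult_ac)
    then have "f n (c * z) \<le> v c * r"
      unfolding r f_def using pos [of n] by (simp add: divide_right_mono)
    then show "\<exists>t\<in>?R (c * z). t \<le> v c * r" by blast
  qed (use nn in auto)
  have low: "?M z \<le> f n z" if "z \<in> L" for n z
    using that cInf_lower [of "f n z" "?R z"] bdd_belowI [of "?R z" 0, OF nn [OF that]] by simp
  have "?M z \<le> N z" if "z \<in> L" for z
    using low [OF that, of 0] unfolding f_def by simp
  \<comment> \<open>By minimality the infimum equals \<open>N y\<close>, and it is at most its
    member with index \<open>1\<close>, which is \<open>N (x * y) / N x\<close>.\<close>
  from N_le [OF M this y] low [OF y, of 1] have "N y \<le> f 1 y" by simp
  then have "N x * N y \<le> N (x * y)"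
    unfolding f_def using N_pos [OF x False] by (simp add: field_simps)
  with N_times [OF x y] show ?thesis by simp
qed (simp add: N_zero)

text \<open>On \<open>F\<close> the norm is at most \<open>v\<close>. Applied to \<open>c\<close>
  and to its inverse, whose values multiply to \<open>1\<close> on both sides, neither inequality
  can be strict.\<close>

lemma N_extends:
  assumes c: "c \<in> F" shows "N c = v c"
proof (cases "c = 0")
  case False
  have 1: "1 \<in> L" by (rule FL' [OF F(2)])
  have one: "N 1 = 1" using N_mult [OF 1 1] N_one by simp
  have le: "N d \<le> v d" if "d \<in> F" for d using N_scale [OF that 1] one by simp
  note ic = F(6) [OF c]
  have "N c * N (inverse c) = 1" using N_mult [OF FL' [OF c] FL' [OF ic]] False one by simp
  moreover have "v c * v (inverse c) = 1" using v_mult [OF c ic] False v_one by simp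
  moreover have "0 < v c" using v_ge [OF c] v_zero [OF c] False by simp
  moreover have "N c * N (inverse c) \<le> N c * v (inverse c)"
    by (intro mult_left_mono le ic N_nonneg FL' c)
  ultimately have "v c * 1 \<le> v c * (N c * v (inverse c))"
    by (intro mult_left_mono) simp_all
  also have "\<dots> = N c" using \<open>v c * v (inverse c) = 1\<close> by (simp add: mult.left_commute)
  finally have "v c \<le> N c" by simp
  with le [OF c] show ?thesis by simp
qed (simp add: N_zero v_0)

lemma N_absolute_value: "absolute_value_on L N"
  unfolding absolute_value_on_def
proof (intro conjI ballI)
  fix x assume x: "x \<in> L"
  show "0 \<le> N x" by (rule N_nonneg [OF x])
  show "N x = 0 \<longleftrightarrow> x = 0" using N_pos [OF x] N_zero by (cases "x = 0") auto
  fix y assume y: "y \<in> L"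
  show "N (x * y) = N x * N y" by (rule N_mult [OF x y])
  show "N (x + y) \<le> N x + N y" using N_plus [OF x y] N_nonneg [OF x] N_nonneg [OF y] by linarith
qed

end

lemma exists_extension: "\<exists>w. absolute_value_on L w \<and> (\<forall>c\<in>F. w c = v c)"
  using exists_minimal_norm N_absolute_value N_extends by blast

end

text \<open>A relation with nonzero coefficient at \<open>b\<close> expresses \<open>b\<close>
  through the other generators, so \<open>b\<close> could be discarded.\<close>

lemma (in padic_subfield) minimal_spanning_set_independent:
  fixes L :: "'a set" and B :: "'a set"
  defines "spans \<equiv> \<lambda>B. finite B \<and> B \<subseteq> L \<and> (\<forall>x\<in>L. \<exists>c. (\<forall>b\<in>B. c b \<in> F) \<and> x = (\<Sum>b\<in>B. c b * b))"
  assumes B: "spans B" and min: "\<And>B'. spans B' \<Longrightarrow> card B \<le> card B'"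
    and c: "\<forall>b\<in>B. c b \<in> F" "(\<Sum>b\<in>B. c b * b) = 0" and b: "b \<in> B"
  shows "c b = 0"
proof (rule ccontr)
  assume cb: "c b \<noteq> 0"
  note fin = B [unfolded spans_def, THEN conjunct1]
  let ?B = "B - {b}"
  have "(\<Sum>d\<in>B. c d * d) = c b * b + (\<Sum>d\<in>?B. c d * d)" by (rule sum.remove [OF fin b])
  then have "c b * b = - (\<Sum>d\<in>?B. c d * d)" using c(2) by (simp add: eq_neg_iff_add_eq_0)
  then have "inverse (c b) * (c b * b) = inverse (c b) * - (\<Sum>d\<in>?B. c d * d)" by simp
  then have b_eq: "b = (\<Sum>d\<in>?B. - (inverse (c b) * c d) * d)"
    using cb by (simp add: sum_distrib_left sum_negf mult.assoc flip: mult.assoc [of "inverse (c b)" "c b"])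
  have "spans ?B"
    unfolding spans_def
  proof (intro conjI ballI)
    show "finite ?B" "?B \<subseteq> L" using B unfolding spans_def by auto
    fix x assume "x \<in> L"
    then obtain e where e: "\<And>d. d \<in> B \<Longrightarrow> e d \<in> F" "x = (\<Sum>d\<in>B. e d * d)" using B unfolding spans_def by blast
    have "x = e b * b + (\<Sum>d\<in>?B. e d * d)" unfolding e(2) by (rule sum.remove [OF fin b])
    also have "\<dots> = (\<Sum>d\<in>?B. (e b * - (inverse (c b) * c d) + e d) * d)"
      using arg_cong [OF b_eq, of "\<lambda>x. e b * x"]
      by (simp only: sum_distrib_left sum.distrib distrib_right mult.assoc)
    finally have "x = (\<Sum>d\<in>?B. (e b * - (inverse (c b) * c d) + e d) * d)" .
    moreover have "\<forall>d\<in>?B. e b * - (inverse (c b) * c d) + e d \<in> F"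
      using e(1) b c(1) by (intro ballI F_closed) auto
    ultimately show "\<exists>c. (\<forall>b\<in>?B. c b \<in> F) \<and> x = (\<Sum>b\<in>?B. c b * b)" by (intro exI conjI)
  qed
  from min [OF this] show False using card_Diff1_less [OF fin b] by simp
qed

text \<open>A spanning set of least size is a basis, which is what the norm construction requires.
  The normalization at \<open>p\<close> is inherited because the rationals lie in
  \<open>F\<close>.\<close>

lemma (in padic_subfield_pair) place_extension:
  assumes sub: "F \<subseteq> F'" and fin: "finite B" "B \<subseteq> F'"
    and span: "\<And>x. x \<in> F' \<Longrightarrow> \<exists>c. (\<forall>b\<in>B. c b \<in> F) \<and> x = (\<Sum>b\<in>B. c b * b)"
    and v: "v \<in> A.P"
  shows "\<exists>w\<in>B.P. (\<lambda>x\<in>F. w x) = v"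
proof -
  let ?spans = "\<lambda>B. finite B \<and> B \<subseteq> F' \<and> (\<forall>x\<in>F'. \<exists>c. (\<forall>b\<in>B. c b \<in> F) \<and> x = (\<Sum>b\<in>B. c b * b))"
  have "?spans B" using fin span by blast
  from ex_has_least_nat [of ?spans, OF this, of card]
  obtain B0 where B0: "?spans B0" and min: "\<forall>B'. ?spans B' \<longrightarrow> card B0 \<le> card B'" by blast
  interpret v: place p F v by (rule A.place [OF v])
  have v_av: "absolute_value_on F v" and vq: "\<And>q. v (of_rat q) = padic_abs p q" and v_ext: "v \<in> extensional F"
    using v unfolding places_above_def by simp_all
  interpret valued_extension F F' v B0
  proof
    show "c b = 0" if "\<forall>b\<in>B0. c b \<in> F" "(\<Sum>b\<in>B0. c b * b) = 0" "b \<in> B0" for c b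
      by (rule A.minimal_spanning_set_independent [OF B0 min [rule_format] that])
    show "\<exists>c. (\<forall>b\<in>B0. c b \<in> F) \<and> x = (\<Sum>b\<in>B0. c b * b)" if "x \<in> F'" for x
      using B0 that by (elim conjE) (erule (1) bspec)
  qed (assumption | rule A.F_closed B.F_closed sub v_av v.add_le_max B0 [THEN conjunct1] B0 [THEN conjunct2, THEN conjunct1])+
  obtain w where w: "absolute_value_on F' w" "\<And>c. c \<in> F \<Longrightarrow> w c = v c" using exists_extension by blast
  have rat: "of_rat q \<in> F" for q
  proof -
    obtain a b where q: "b \<noteq> 0" "q = of_int a / of_int b" by (rule A.rat_frac)
    have "of_int k \<in> F" for k by (cases k rule: int_cases2) (simp_all add: of_nat_F A.F_closed)
    then have "of_int a * inverse (of_int b) \<in> F" by (intro A.F_closed)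
    then show ?thesis by (simp add: q(2) of_rat_divide divide_inverse of_rat_mult of_rat_inverse)
  qed
  show ?thesis
  proof (rule bexI)
    show "(\<lambda>x\<in>F. (\<lambda>x\<in>F'. w x) x) = v"
    proof (rule extensionalityI [OF restrict_extensional v_ext])
      show "x \<in> F \<Longrightarrow> (\<lambda>x\<in>F. (\<lambda>x\<in>F'. w x) x) x = v x" for x using w(2) sub by auto
    qed
    have "absolute_value_on F' (\<lambda>x\<in>F'. w x)"
      using w(1) B.F_closed unfolding absolute_value_on_def by simp
    moreover have "(\<lambda>x\<in>F'. w x) (of_rat q) = padic_abs p q" for q
      using w(2) [OF rat] vq rat sub by auto
    ultimately show "(\<lambda>x\<in>F'. w x) \<in> B.P" unfolding places_above_def by simp
  qed
qed

subsection \<open>Embeddings\<close>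

interpretation Qvec: vector_space "\<lambda>(q::rat) (x::'a::field_char_0). of_rat q * x"
  by unfold_locales (simp_all add: distrib_left distrib_right of_rat_add of_rat_mult mult.assoc)

text \<open>Unlike \<open>padic_field_hom\<close>, the target may be another type; here it will
  mostly be the complex numbers.\<close>

locale field_embedding =
  fixes K :: "'a::field_char_0 set" and \<sigma> :: "'a \<Rightarrow> 'b::field_char_0"
  assumes K: "0 \<in> K" "1 \<in> K" "\<And>x y. x \<in> K \<Longrightarrow> y \<in> K \<Longrightarrow> x + y \<in> K"
      "\<And>x y. x \<in> K \<Longrightarrow> y \<in> K \<Longrightarrow> x * y \<in> K" "\<And>x. x \<in> K \<Longrightarrow> - x \<in> K" "\<And>x. x \<in> K \<Longrightarrow> inverse x \<in> K"
    and one: "\<sigma> 1 = 1" and add: "\<And>x y. x \<in> K \<Longrightarrow> y \<in> K \<Longrightarrow> \<sigma> (x + y) = \<sigma> x + \<sigma> y"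
    and mult: "\<And>x y. x \<in> K \<Longrightarrow> y \<in> K \<Longrightarrow> \<sigma> (x * y) = \<sigma> x * \<sigma> y"
begin

lemma zero: "\<sigma> 0 = 0"
  using add [OF K(1) K(1)] by simp

lemma uminus: "x \<in> K \<Longrightarrow> \<sigma> (- x) = - \<sigma> x"
  using add [of x "- x"] K(5) [of x] zero by (simp add: eq_neg_iff_add_eq_0 add.commute)

lemma inverse:
  assumes "x \<in> K" shows "\<sigma> (inverse x) = inverse (\<sigma> x)"
proof (cases "x = 0")
  case False
  then have "\<sigma> x * \<sigma> (inverse x) = 1"
    using mult [OF assms K(6) [OF assms]] one by simp
  then show ?thesis by (metis inverse_unique)
qed (simp add: zero)

lemma nonzero:
  assumes "x \<in> K" "x \<noteq> 0" shows "\<sigma> x \<noteq> 0"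
  using mult [OF assms(1) K(6) [OF assms(1)]] assms(2) one by auto

lemma of_nat: "of_nat n \<in> K" "\<sigma> (of_nat n) = of_nat n"
  by (induction n) (simp_all add: K zero one add)

lemma of_int: "of_int k \<in> K" "\<sigma> (of_int k) = of_int k"
  by (cases k rule: int_cases2, simp_all add: of_nat K uminus)+

lemma of_rat: "of_rat q \<in> K" "\<sigma> (of_rat q) = of_rat q"
proof -
  obtain a b where "quotient_of q = (a, b)" by (cases "quotient_of q")
  then have "q = of_int a / of_int b" by (rule quotient_of_div)
  then have q: "of_rat q = (of_int a * inverse (of_int b) :: 'c)" for dummy :: "'c::field_char_0"
    by (simp add: of_rat_divide divide_inverse of_rat_mult of_rat_inverse)
  show "of_rat q \<in> K" unfolding q by (intro K of_int)
  show "\<sigma> (of_rat q) = of_rat q"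
    unfolding q by (simp add: mult inverse of_int K)
qed

lemma Rats_subset: "\<rat> \<subseteq> K"
  using of_rat(1) by (auto elim: Rats_cases)

lemma sum:
  assumes "\<And>i. i \<in> I \<Longrightarrow> f i \<in> K"
  shows "sum f I \<in> K" "\<sigma> (sum f I) = (\<Sum>i\<in>I. \<sigma> (f i))"
proof -
  have "sum f I \<in> K \<and> \<sigma> (sum f I) = (\<Sum>i\<in>I. \<sigma> (f i))"
    using assms by (induction I rule: infinite_finite_induct) (simp_all add: K zero add)
  then show "sum f I \<in> K" "\<sigma> (sum f I) = (\<Sum>i\<in>I. \<sigma> (f i))" by simp_all
qed

lemma power: "x \<in> K \<Longrightarrow> x ^ n \<in> K" "x \<in> K \<Longrightarrow> \<sigma> (x ^ n) = \<sigma> x ^ n"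
proof -
  have "x ^ n \<in> K \<and> \<sigma> (x ^ n) = \<sigma> x ^ n" if "x \<in> K"
    using that by (induction n) (simp_all add: K one mult)
  then show "x \<in> K \<Longrightarrow> x ^ n \<in> K" "x \<in> K \<Longrightarrow> \<sigma> (x ^ n) = \<sigma> x ^ n" by simp_all
qed

definition "KP = {p. \<forall>i. poly.coeff p i \<in> K}"
abbreviation "mp \<equiv> map_poly \<sigma>"

lemma KP: "p \<in> KP \<Longrightarrow> poly.coeff p i \<in> K"
  unfolding KP_def by simp

lemma coeff_mp: "poly.coeff (mp p) i = \<sigma> (poly.coeff p i)"
  by (rule coeff_map_poly) (rule zero)

lemma KP_add: "p \<in> KP \<Longrightarrow> q \<in> KP \<Longrightarrow> p + q \<in> KP \<and> mp (p + q) = mp p + mp q"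
  unfolding KP_def by (auto simp: poly_eq_iff coeff_mp K add)

lemma KP_uminus: "p \<in> KP \<Longrightarrow> - p \<in> KP \<and> mp (- p) = - mp p"
  unfolding KP_def by (auto simp: poly_eq_iff coeff_mp K uminus)

lemma KP_mult: "p \<in> KP \<Longrightarrow> q \<in> KP \<Longrightarrow> p * q \<in> KP \<and> mp (p * q) = mp p * mp q"
  by (auto simp: KP_def poly_eq_iff coeff_mp coeff_mult K sum mult)

lemma KP_monom: "c \<in> K \<Longrightarrow> monom c n \<in> KP \<and> mp (monom c n) = monom (\<sigma> c) n"
  unfolding KP_def by (auto simp: poly_eq_iff coeff_mp K zero)

lemma KP_const: "c \<in> K \<Longrightarrow> [:c:] \<in> KP \<and> mp [:c:] = [:\<sigma> c:]"
  using KP_monom [of c 0] by (simp add: monom_0)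

lemma KP_diff: "p \<in> KP \<Longrightarrow> q \<in> KP \<Longrightarrow> p - q \<in> KP \<and> mp (p - q) = mp p - mp q"
  using KP_add [of p "- q"] KP_uminus [of q] by simp

lemma poly_KP: "p \<in> KP \<Longrightarrow> x \<in> K \<Longrightarrow> poly p x \<in> K \<and> \<sigma> (poly p x) = poly (mp p) (\<sigma> x)"
proof -
  assume p: "p \<in> KP" and x: "x \<in> K"
  have "degree (mp p) \<le> degree p" by (rule degree_map_poly_le)
  then have "poly (mp p) (\<sigma> x) = (\<Sum>i\<le>degree p. poly.coeff (mp p) i * \<sigma> x ^ i)"
    unfolding poly_altdef by (intro sum.mono_neutral_left) (auto simp: coeff_eq_0)
  then show ?thesis
    unfolding poly_altdef [of p] using p x by (simp add: sum K power mult KP coeff_mp)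
qed

lemma algebraic_int_image:
  assumes u: "u \<in> K" "algebraic_int u"
  shows "algebraic_int (\<sigma> u)"
proof -
  obtain p where p: "lead_coeff p = 1" "\<forall>i. poly.coeff p i \<in> \<int>" "poly p u = 0"
    using u(2) by (auto simp: algebraic_int.simps)
  have c: "poly.coeff p i \<in> K" "poly.coeff (mp p) i \<in> \<int>" for i
  proof -
    have "poly.coeff p i \<in> \<int>" using p(2) by simp
    then obtain k where "poly.coeff p i = of_int k" by (rule Ints_cases)
    then show "poly.coeff p i \<in> K" "poly.coeff (mp p) i \<in> \<int>" by (simp_all add: of_int coeff_mp)
  qed
  have deg: "degree (mp p) = degree p" by (rule degree_map_poly) (use p(1) one in auto)
  have "poly (mp p) (\<sigma> u) = 0" using poly_KP [of p u] c(1) u(1) p(3) zero unfolding KP_def by simp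
  moreover have "lead_coeff (mp p) = 1" unfolding deg coeff_mp p(1) by (rule one)
  ultimately show ?thesis using c(2) by (intro algebraic_int.intros [of "mp p"]) simp_all
qed

definition "min_poly a m \<longleftrightarrow> m \<in> KP \<and> lead_coeff m = 1 \<and> poly m a = 0 \<and> (\<forall>p\<in>KP. p \<noteq> 0 \<longrightarrow> poly p a = 0 \<longrightarrow> degree m \<le> degree p)"

lemma exists_min_poly:
  assumes "p \<in> KP" "p \<noteq> 0" "poly p a = 0"
  shows "\<exists>m. min_poly a m"
proof -
  let ?P = "\<lambda>p. p \<in> KP \<and> p \<noteq> 0 \<and> poly p a = 0"
  have "?P p" using assms by simp
  from ex_has_least_nat [of ?P, OF this, of degree]
  obtain q where q: "?P q" "\<And>p. ?P p \<Longrightarrow> degree q \<le> degree p" by blast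
  let ?c = "inverse (lead_coeff q)"
  have c: "?c \<noteq> 0" using q(1) by simp
  have "poly.coeff q i \<in> K" for i using q(1) KP by blast
  then have "smult ?c q \<in> KP" unfolding KP_def by (simp add: K)
  moreover have "lead_coeff (smult ?c q) = 1" unfolding lead_coeff_smult using q(1) by simp
  moreover have "poly (smult ?c q) a = 0" using q(1) by simp
  moreover have "\<forall>p\<in>KP. p \<noteq> 0 \<longrightarrow> poly p a = 0 \<longrightarrow> degree (smult ?c q) \<le> degree p"
    unfolding degree_smult_eq using c q(2) by simp
  ultimately have "min_poly a (smult ?c q)" unfolding min_poly_def by (intro conjI)
  then show ?thesis by blast
qed

text \<open>Division by the monic polynomial \<open>m\<close>, one leading term at a time and
  simultaneously on both sides of \<open>mp\<close>. It makes evaluation at \<open>z\<close> well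
  defined on the ring generated by \<open>a\<close>.\<close>

lemma min_poly_annihilates:
  assumes m: "min_poly a m" and z: "poly (mp m) z = 0"
  shows "p \<in> KP \<Longrightarrow> poly p a = 0 \<Longrightarrow> poly (mp p) z = 0"
proof (induction "degree p" arbitrary: p rule: less_induct)
  case less
  show ?case
  proof (cases "p = 0")
    case False
    have m': "m \<in> KP" "poly.coeff m (degree m) = 1" "poly m a = 0" "degree m \<le> degree p"
      using m less False unfolding min_poly_def by auto
    let ?h = "monom (lead_coeff p) (degree p - degree m)"
    have h: "?h \<in> KP" "?h * m \<in> KP" "mp (?h * m) = mp ?h * mp m"
      using KP_monom [OF KP [OF less(2)]] KP_mult m'(1) by blast+
    define q where "q = p - ?h * m"
    have q: "q \<in> KP" "mp q = mp p - mp (?h * m)" "poly q a = 0"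
      unfolding q_def using KP_diff [OF less(2) h(2)] less(3) m'(3) by simp_all
    have "degree (?h * m) \<le> degree p"
      using degree_mult_le [of ?h m] degree_monom_le [of "lead_coeff p" "degree p - degree m"] m'(4) by linarith
    then have "degree q \<le> degree p" unfolding q_def by (intro degree_diff_le) simp_all
    moreover have "poly.coeff q (degree p) = 0"
      unfolding q_def using m'(2,4) by (simp add: coeff_monom_mult)
    ultimately have "q = 0 \<or> degree q < degree p" by (rule eq_zero_or_degree_less)
    then have "poly (mp q) z = 0" using less(1) [OF _ q(1,3)] by auto
    then show ?thesis using q(2) z unfolding h(3) by simp
  qed simp
qed

end

text \<open>The only embedding of the prime field into the other type, from which all further
  embeddings are extended.\<close>

lemma rational_embedding_field:
  "field_embedding (\<rat> :: 'a::field_char_0 set) (\<lambda>x. of_rat (inv_into UNIV of_rat x) :: 'b::field_char_0)"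
proof -
  have inv: "inv_into UNIV of_rat (of_rat q :: 'a) = q" for q by (rule inv_f_f) (simp add: inj_def)
  show ?thesis
  proof
    show "of_rat (inv_into UNIV of_rat (1::'a)) = (1::'b)" using inv [of 1] by simp
    fix x y :: 'a assume "x \<in> \<rat>" "y \<in> \<rat>"
    then obtain q r where qr: "x = of_rat q" "y = of_rat r" unfolding Rats_def by blast
    show "of_rat (inv_into UNIV of_rat (x + y)) = (of_rat (inv_into UNIV of_rat x) + of_rat (inv_into UNIV of_rat y) :: 'b)"
      unfolding qr of_rat_add [symmetric] inv ..
    show "of_rat (inv_into UNIV of_rat (x * y)) = (of_rat (inv_into UNIV of_rat x) * of_rat (inv_into UNIV of_rat y) :: 'b)"
      unfolding qr of_rat_mult [symmetric] inv ..
  qed simp_all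
qed

locale rational_extension =
  fixes L B :: "'a::field_char_0 set"
  assumes L: "0 \<in> L" "1 \<in> L" "\<And>x y. x \<in> L \<Longrightarrow> y \<in> L \<Longrightarrow> x + y \<in> L"
      "\<And>x y. x \<in> L \<Longrightarrow> y \<in> L \<Longrightarrow> x * y \<in> L" "\<And>x. x \<in> L \<Longrightarrow> - x \<in> L" "\<And>x. x \<in> L \<Longrightarrow> inverse x \<in> L"
    and finite_B: "finite B" and B_L: "B \<subseteq> L"
    and span_B: "\<And>x. x \<in> L \<Longrightarrow> \<exists>c. x = (\<Sum>b\<in>B. of_rat (c b) * b)"
begin

lemma L_power: "x \<in> L \<Longrightarrow> x ^ n \<in> L"
  by (induction n) (simp_all add: L)

lemma Rats_subset_L: "\<rat> \<subseteq> L"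
  by (rule field_embedding.Rats_subset [of L id], unfold_locales) (simp_all add: L)

text \<open>There is one more power than there are generators. Linear dependence speaks of sets, so
  the case of two coinciding powers is treated apart.\<close>

lemma power_relation:
  assumes x: "x \<in> L"
  shows "\<exists>c::nat \<Rightarrow> rat. (\<exists>i\<le>card B. c i \<noteq> 0) \<and> (\<Sum>i\<le>card B. of_rat (c i) * x ^ i) = 0"
proof (cases "inj_on (\<lambda>i. x ^ i) {..card B}")
  case False
  then obtain i j where ij: "i \<le> card B" "j \<le> card B" "i \<noteq> j" "x ^ i = x ^ j" unfolding inj_on_def by auto
  let ?c = "\<lambda>k. if k = i then 1 else if k = j then - 1 else 0 :: rat"
  have "(\<Sum>k\<le>card B. of_rat (?c k) * x ^ k) = (\<Sum>k\<in>{i, j}. of_rat (?c k) * x ^ k)"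
    using ij by (intro sum.mono_neutral_right) auto
  also have "\<dots> = 0" using ij by simp
  finally show ?thesis using ij(1) by (intro exI [of _ ?c] conjI exI [of _ i]) auto
next
  case True
  let ?S = "(\<lambda>i. x ^ i) ` {..card B}"
  have "?S \<subseteq> Qvec.span B"
  proof (rule image_subsetI)
    fix i
    obtain c where "x ^ i = (\<Sum>b\<in>B. of_rat (c b) * b)" using span_B [OF L_power [OF x]] by blast
    then show "x ^ i \<in> Qvec.span B"
      by (simp only:) (intro Qvec.span_sum Qvec.span_scale Qvec.span_base)
  qed
  moreover have "card ?S = Suc (card B)" by (simp add: card_image [OF True])
  ultimately have "Qvec.dependent ?S"
    using Qvec.independent_span_bound [OF finite_B, of ?S] by auto
  then obtain u where u: "\<exists>v\<in>?S. u v \<noteq> 0" "(\<Sum>v\<in>?S. of_rat (u v) * v) = 0"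
    by (subst (asm) Qvec.dependent_finite) auto
  have "(\<Sum>i\<le>card B. of_rat (u (x ^ i)) * x ^ i) = 0"
    using u(2) by (simp add: sum.reindex [OF True] o_def)
  with u(1) show ?thesis by (intro exI [of _ "\<lambda>i. u (x ^ i)"]) auto
qed

lemma rational_poly:
  assumes x: "x \<in> L"
  shows "\<exists>p. (\<forall>i. poly.coeff p i \<in> \<rat>) \<and> p \<noteq> 0 \<and> degree p \<le> card B \<and> poly p x = 0"
proof -
  obtain c :: "nat \<Rightarrow> rat" where c: "\<exists>i\<le>card B. c i \<noteq> 0" "(\<Sum>i\<le>card B. of_rat (c i) * x ^ i) = 0"
    using power_relation [OF x] by blast
  define p where "p = (\<Sum>i\<le>card B. monom (of_rat (c i)) i :: 'a poly)"
  have coeff: "poly.coeff p i = (if i \<le> card B then of_rat (c i) else 0)" for i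
    unfolding p_def by (simp add: coeff_sum)
  have "p \<noteq> 0" using c(1) coeff by (metis coeff_0 of_rat_eq_0_iff)
  moreover have "degree p \<le> card B" by (rule degree_le) (simp add: coeff)
  moreover have "poly p x = 0" unfolding p_def using c(2) by (simp add: poly_sum poly_monom)
  ultimately show ?thesis using coeff by (intro exI [of _ p]) auto
qed

text \<open>Cancel powers of \<open>x\<close> from a rational equation until its constant term is
  nonzero, then solve for the inverse as a rational polynomial in \<open>x\<close>. Thus the ring
  generated by an algebraic element is a field.\<close>

lemma inverse_in_subring:
  assumes K: "\<And>q. of_rat q \<in> K" "\<And>x y. x \<in> K \<Longrightarrow> y \<in> K \<Longrightarrow> x + y \<in> K" "\<And>x y. x \<in> K \<Longrightarrow> y \<in> K \<Longrightarrow> x * y \<in> K"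
    and x: "x \<in> K" "x \<in> L"
  shows "inverse x \<in> K"
proof (cases "x = 0")
  case True
  then show ?thesis using K(1) [of 0] by simp
next
  case False
  have polyK: "poly p x \<in> K" if "\<forall>i. poly.coeff p i \<in> \<rat>" for p
    using that
  proof (induction p)
    case 0
    show ?case using K(1) [of 0] by simp
  next
    case (pCons a p)
    obtain r where r: "a = of_rat r" using pCons.prems [rule_format, of 0] by (auto elim: Rats_cases)
    have "\<forall>i. poly.coeff p i \<in> \<rat>"
    proof
      show "poly.coeff p i \<in> \<rat>" for i using pCons.prems [rule_format, of "Suc i"] by simp
    qed
    then have "poly p x \<in> K" by (rule pCons.IH)
    then show ?case unfolding r poly_pCons by (intro K x)
  qed
  have "inverse x \<in> K" if "p \<noteq> 0" "\<forall>i. poly.coeff p i \<in> \<rat>" "poly p x = 0" for p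
    using that
  proof (induction p)
    case (pCons a p)
    obtain r where r: "a = of_rat r" using pCons.prems(2) [rule_format, of 0] by (auto elim: Rats_cases)
    have p: "\<forall>i. poly.coeff p i \<in> \<rat>"
    proof
      show "poly.coeff p i \<in> \<rat>" for i using pCons.prems(2) [rule_format, of "Suc i"] by simp
    qed
    show ?case
    proof (cases "r = 0")
      case True
      with pCons.prems False r have "p \<noteq> 0" "poly p x = 0" by auto
      with p show ?thesis by (intro pCons.IH)
    next
      case False
      have "of_rat r + x * poly p x = 0" using pCons.prems(3) unfolding r by simp
      then have xy: "x * poly p x = - of_rat r" by (simp add: eq_neg_iff_add_eq_0 add.commute)
      have "x * (of_rat (- inverse r) * poly p x) = of_rat (- inverse r) * (x * poly p x)"
        by (rule mult.left_commute)
      also have "\<dots> = of_rat (inverse r * r)" unfolding xy of_rat_mult of_rat_minus by simp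
      also have "\<dots> = 1" using False by simp
      finally have "inverse x = of_rat (- inverse r) * poly p x" by (rule inverse_unique)
      then show ?thesis by (simp only:) (intro K polyK p)
    qed
  qed simp
  then show ?thesis using rational_poly [OF x(2)] by blast
qed

text \<open>The value of a polynomial at \<open>a\<close> is sent to the value at \<open>z\<close>
  of its image under \<sigma>. This is well defined because \<open>z\<close> is a root of the image
  of the minimal polynomial.\<close>

lemma extend_embedding:
  fixes \<sigma> :: "'a \<Rightarrow> 'b::field_char_0"
  assumes \<sigma>: "field_embedding K \<sigma>" and KL: "K \<subseteq> L" and a: "a \<in> L"
    and m: "field_embedding.min_poly K a m" and z: "poly (map_poly \<sigma> m) z = 0"
  shows "\<exists>K' \<tau>. field_embedding K' \<tau> \<and> K \<subseteq> K' \<and> K' \<subseteq> L \<and> a \<in> K' \<and> (\<forall>x\<in>K. \<tau> x = \<sigma> x) \<and> \<tau> a = z"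
proof -
  interpret field_embedding K \<sigma> by fact
  define K' where "K' = (\<lambda>p. poly p a) ` KP"
  define \<tau> where "\<tau> x = (SOME y. \<exists>p\<in>KP. x = poly p a \<and> y = poly (mp p) z)" for x
  have tau: "\<tau> (poly p a) = poly (mp p) z" if p: "p \<in> KP" for p
    unfolding \<tau>_def
  proof (rule some_equality)
    show "\<exists>q\<in>KP. poly p a = poly q a \<and> poly (mp p) z = poly (mp q) z" using p by blast
    fix y assume "\<exists>q\<in>KP. poly p a = poly q a \<and> y = poly (mp q) z"
    then obtain q where q: "q \<in> KP" "poly p a = poly q a" "y = poly (mp q) z" by blast
    have "poly (mp (p - q)) z = 0"
      by (rule min_poly_annihilates [OF m z]) (use KP_diff [OF p q(1)] q(2) in simp_all)
    then show "y = poly (mp p) z" using KP_diff [OF p q(1)] q(3) by simp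
  qed
  have mem: "p \<in> KP \<Longrightarrow> poly p a \<in> K'" for p unfolding K'_def by simp
  have KK': "x \<in> K'" "\<tau> x = \<sigma> x" if "x \<in> K" for x
    using KP_const [OF that] mem [of "[:x:]"] tau [of "[:x:]"] by simp_all
  have closed: "x + y \<in> K'" "x * y \<in> K'" "- x \<in> K'" "\<tau> (x + y) = \<tau> x + \<tau> y" "\<tau> (x * y) = \<tau> x * \<tau> y" if xy: "x \<in> K'" "y \<in> K'" for x y
  proof -
    obtain p where p: "p \<in> KP" "x = poly p a" using xy(1) unfolding K'_def by blast
    obtain q where q: "q \<in> KP" "y = poly q a" using xy(2) unfolding K'_def by blast
    show "x + y \<in> K'" "x * y \<in> K'" "- x \<in> K'"
      using mem [of "p + q"] mem [of "p * q"] mem [of "- p"] KP_add [OF p(1) q(1)] KP_mult [OF p(1) q(1)] KP_uminus [OF p(1)]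
      by (simp_all add: p(2) q(2))
    show "\<tau> (x + y) = \<tau> x + \<tau> y" "\<tau> (x * y) = \<tau> x * \<tau> y"
      using tau [of "p + q"] tau [of "p * q"] KP_add [OF p(1) q(1)] KP_mult [OF p(1) q(1)] tau [OF p(1)] tau [OF q(1)]
      by (simp_all add: p(2) q(2))
  qed
  have K'L: "K' \<subseteq> L"
  proof -
    have sumL: "sum f I \<in> L" if "\<And>i. i \<in> I \<Longrightarrow> f i \<in> L" for f :: "nat \<Rightarrow> 'a" and I
      using that by (induction I rule: infinite_finite_induct) (simp_all add: L)
    show ?thesis unfolding K'_def poly_altdef using KP KL L_power [OF a] L(4) by (blast intro: sumL)
  qed
  have rat: "of_rat q \<in> K'" for q by (rule KK'(1) [OF of_rat(1)])
  have "field_embedding K' \<tau>"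
  proof
    show "0 \<in> K'" "1 \<in> K'" using KK'(1) K by blast+
    show "\<tau> 1 = 1" using KK'(2) [OF K(2)] one by simp
    show "inverse x \<in> K'" if "x \<in> K'" for x
      by (rule inverse_in_subring [OF rat closed(1,2) that]) (use K'L that in auto)
  qed (assumption | rule closed)+
  moreover have "a \<in> K'" "\<tau> a = z"
  proof -
    have X: "[:0, 1:] \<in> KP" "mp [:0, 1:] = [:0, 1:]"
      using KP_monom [OF K(2), of 1] one by (simp_all add: monom_altdef)
    show "a \<in> K'" "\<tau> a = z" using mem [OF X(1)] tau [OF X(1)] unfolding X(2) by simp_all
  qed
  ultimately show ?thesis
    using KK' K'L by (intro exI [of _ K'] exI [of _ \<tau>] conjI subsetI ballI) auto
qed

lemma exists_min_poly:
  assumes \<sigma>: "field_embedding K \<sigma>" and a: "a \<in> L"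
  shows "\<exists>m. field_embedding.min_poly K a m \<and> degree m \<le> card B"
proof -
  interpret field_embedding K \<sigma> by fact
  obtain p where p: "\<forall>i. poly.coeff p i \<in> \<rat>" "p \<noteq> 0" "degree p \<le> card B" "poly p a = 0"
    using rational_poly [OF a] by blast
  have "p \<in> KP" unfolding KP_def using p(1) Rats_subset by auto
  with p(2,4) obtain m where m: "min_poly a m" using exists_min_poly by blast
  have "degree m \<le> degree p" using m \<open>p \<in> KP\<close> p(2,4) unfolding min_poly_def by blast
  with m p(3) show ?thesis by (intro exI [of _ m]) simp
qed

lemma min_poly_root:
  fixes \<sigma> :: "'a \<Rightarrow> complex"
  assumes \<sigma>: "field_embedding K \<sigma>" and m: "field_embedding.min_poly K a m"
  shows "\<exists>z. poly (map_poly \<sigma> m) z = 0"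
proof -
  interpret field_embedding K \<sigma> by fact
  have m': "lead_coeff m = 1" "poly m a = 0" using m unfolding min_poly_def by simp_all
  have "degree m \<noteq> 0"
  proof
    assume "degree m = 0"
    then obtain c where "m = [:c:]" by (rule degree_eq_zeroE)
    with m' show False by simp
  qed
  moreover have "degree (mp m) = degree m"
    by (rule degree_map_poly) (use m' one in auto)
  ultimately show ?thesis
    using fundamental_theorem_of_algebra [of "mp m"] by (simp add: constant_degree)
qed

lemma extend_embedding_set:
  fixes \<sigma> :: "'a \<Rightarrow> complex"
  assumes "finite A" "A \<subseteq> L" "field_embedding K \<sigma>" "K \<subseteq> L"
  shows "\<exists>K' \<tau>. field_embedding K' \<tau> \<and> K \<union> A \<subseteq> K' \<and> K' \<subseteq> L \<and> (\<forall>x\<in>K. \<tau> x = \<sigma> x)"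
  using assms
proof (induction A rule: finite_induct)
  case (insert a A)
  then obtain K1 \<sigma>1 where 1: "field_embedding K1 \<sigma>1" "K \<union> A \<subseteq> K1" "K1 \<subseteq> L" "\<forall>x\<in>K. \<sigma>1 x = \<sigma> x" by auto
  have a: "a \<in> L" using insert by simp
  obtain m where m: "field_embedding.min_poly K1 a m" using exists_min_poly [OF 1(1) a] by blast
  obtain z where "poly (map_poly \<sigma>1 m) z = 0" using min_poly_root [OF 1(1) m] by blast
  from extend_embedding [OF 1(1,3) a m this] obtain K' \<tau> where
    "field_embedding K' \<tau>" "K1 \<subseteq> K'" "K' \<subseteq> L" "a \<in> K'" "\<forall>x\<in>K1. \<tau> x = \<sigma>1 x" by blast
  with 1 show ?case by (intro exI [of _ K'] exI [of _ \<tau>]) auto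
qed blast

lemma embedding_L:
  fixes \<sigma> :: "'a \<Rightarrow> complex"
  assumes "field_embedding K \<sigma>" "K \<subseteq> L"
  shows "\<exists>\<tau>. field_embedding L \<tau> \<and> (\<forall>x\<in>K. \<tau> x = \<sigma> x)"
proof -
  obtain K' \<tau> where t: "field_embedding K' \<tau>" "K \<union> B \<subseteq> K'" "K' \<subseteq> L" "\<forall>x\<in>K. \<tau> x = \<sigma> x"
    using extend_embedding_set [OF finite_B B_L assms] by blast
  interpret field_embedding K' \<tau> by fact
  have "L \<subseteq> K'"
  proof
    fix x assume "x \<in> L"
    then obtain c where "x = (\<Sum>b\<in>B. of_rat (c b) * b)" using span_B by blast
    then show "x \<in> K'" using t(2) by (simp only:) (intro sum K of_rat, auto)
  qed
  with t(3) have "K' = L" by simp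
  with t show ?thesis by blast
qed

definition "embeddings = {\<tau> \<in> extensional L. field_embedding L (\<tau> :: 'a \<Rightarrow> complex)}"

text \<open>A homomorphism is determined by its values on \<open>B\<close>, and each value is a root
  of a fixed nonzero rational polynomial. The target type is arbitrary, since the bound serves the
  complex embeddings as well as the Galois group.\<close>

lemma finite_homs:
  "finite {\<tau> \<in> extensional L. field_embedding L (\<tau> :: 'a \<Rightarrow> 'b::field_char_0)}"
proof -
  let ?H = "{\<tau> \<in> extensional L. field_embedding L (\<tau> :: 'a \<Rightarrow> 'b)}"
  define p where "p b = (SOME p. (\<forall>i. poly.coeff p i \<in> \<rat>) \<and> p \<noteq> 0 \<and> degree p \<le> card B \<and> poly p b = 0)" for b :: 'a
  have p: "(\<forall>i. poly.coeff (p b) i \<in> \<rat>) \<and> p b \<noteq> 0 \<and> degree (p b) \<le> card B \<and> poly (p b) b = 0" if "b \<in> B" for b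
    unfolding p_def by (rule someI_ex, rule rational_poly) (use that B_L in auto)
  define r :: "'a \<Rightarrow> 'b poly" where "r b = map_poly (\<lambda>x. of_rat (inv_into UNIV of_rat x)) (p b)" for b
  have r: "r b \<noteq> 0" if "b \<in> B" for b
  proof -
    interpret field_embedding "\<rat> :: 'a set" "\<lambda>x. of_rat (inv_into UNIV of_rat x) :: 'b" by (rule rational_embedding_field)
    have "poly.coeff (r b) (degree (p b)) \<noteq> 0"
      unfolding r_def coeff_mp using p [OF that] by (intro nonzero) auto
    then show ?thesis by auto
  qed
  have root: "poly (r b) (\<tau> b) = 0" if "\<tau> \<in> ?H" "b \<in> B" for \<tau> b
  proof -
    interpret q: field_embedding "\<rat> :: 'a set" "\<lambda>x. of_rat (inv_into UNIV of_rat x) :: 'b" by (rule rational_embedding_field)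
    interpret field_embedding L \<tau> using that by simp
    have c: "poly.coeff (p b) i \<in> \<rat>" for i using p [OF that(2)] by simp
    have "\<tau> x = of_rat (inv_into UNIV of_rat x)" if x: "x \<in> \<rat>" for x
    proof -
      obtain q where "x = of_rat q" using x by (rule Rats_cases)
      then show ?thesis using of_rat(2) [of q] q.of_rat(2) [of q] by simp
    qed
    then have rb: "r b = mp (p b)" using c by (simp add: r_def poly_eq_iff coeff_mp q.coeff_mp)
    have "p b \<in> KP" unfolding KP_def using c Rats_subset by auto
    moreover have "b \<in> L" using that B_L by auto
    ultimately show ?thesis using poly_KP [of "p b" b] p [OF that(2)] zero unfolding rb by simp
  qed
  have fin: "finite (\<Pi>\<^sub>E b\<in>B. {z. poly (r b) z = 0})"
    by (intro finite_PiE finite_B poly_roots_finite r)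
  show ?thesis
  proof (rule inj_on_finite [OF _ _ fin])
    show "(\<lambda>\<tau>. restrict \<tau> B) ` ?H \<subseteq> (\<Pi>\<^sub>E b\<in>B. {z. poly (r b) z = 0})" using root by auto
    show "inj_on (\<lambda>\<tau>. restrict \<tau> B) ?H"
    proof (rule inj_onI)
      fix \<tau> \<tau>' assume t: "\<tau> \<in> ?H" "\<tau>' \<in> ?H" and eq: "restrict \<tau> B = restrict \<tau>' B"
      interpret a: field_embedding L \<tau> using t by simp
      interpret b: field_embedding L \<tau>' using t by simp
      have eqB: "\<tau> b = \<tau>' b" if "b \<in> B" for b using fun_cong [OF eq, of b] that by simp
      show "\<tau> = \<tau>'"
      proof (rule extensionalityI [of _ L])
        fix x assume "x \<in> L"
        then obtain c where x: "x = (\<Sum>b\<in>B. of_rat (c b) * b)" using span_B by blast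
        have val: "\<rho> x = (\<Sum>b\<in>B. of_rat (c b) * \<rho> b)" if "field_embedding L \<rho>" for \<rho> :: "'a \<Rightarrow> 'b"
        proof -
          interpret field_embedding L \<rho> by fact
          have b: "b \<in> B \<Longrightarrow> b \<in> L" for b using B_L by auto
          have "\<rho> x = (\<Sum>b\<in>B. \<rho> (of_rat (c b) * b))"
            unfolding x by (rule sum(2)) (rule L(4) [OF of_rat(1) b])
          then show ?thesis using b by (simp add: mult of_rat)
        qed
        show "\<tau> x = \<tau>' x"
          unfolding val [OF a.field_embedding_axioms] val [OF b.field_embedding_axioms] using eqB by simp
      qed (use t in simp_all)
    qed
  qed
qed

lemma finite_embeddings: "finite embeddings"
  unfolding embeddings_def by (rule finite_homs)

end

subsection \<open>Dirichlet's bound on the rank of the unit group\<close>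

text \<open>A further root \<open>z\<close> turns each coefficient into \<open>- z\<close> times
  itself plus its lower neighbour, which multiplies the bound by at most
  \<open>1 + C\<close>.\<close>

lemma coeff_prod_linear_factors:
  assumes "0 \<le> C" "\<And>z. z \<in># A \<Longrightarrow> algebraic_int z \<and> cmod z \<le> C"
  shows "algebraic_int (poly.coeff (\<Prod>z\<in>#A. [:- z, 1:]) k) \<and> cmod (poly.coeff (\<Prod>z\<in>#A. [:- z, 1:]) k) \<le> (1 + C) ^ size A"
  using assms(2)
proof (induction A arbitrary: k)
  case (add z A)
  let ?P = "\<Prod>z\<in>#A. [:- z, 1:]"
  have IH: "algebraic_int (poly.coeff ?P k)" "cmod (poly.coeff ?P k) \<le> (1 + C) ^ size A" for k
    using add by simp_all
  have z: "algebraic_int z" "cmod z \<le> C" using add.prems by simp_all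
  define r where "r = (case k of 0 \<Rightarrow> 0 | Suc j \<Rightarrow> poly.coeff ?P j)"
  have r: "algebraic_int r" "cmod r \<le> (1 + C) ^ size A"
    unfolding r_def using IH assms(1) by (auto split: nat.split)
  have eq: "poly.coeff (\<Prod>z\<in>#add_mset z A. [:- z, 1:]) k = - z * poly.coeff ?P k + r"
    by (simp add: r_def coeff_pCons)
  have "cmod (- z * poly.coeff ?P k + r) \<le> cmod z * cmod (poly.coeff ?P k) + cmod r"
    using norm_triangle_ineq [of "- z * poly.coeff ?P k" r] by (simp add: norm_mult)
  also have "\<dots> \<le> C * (1 + C) ^ size A + (1 + C) ^ size A"
    by (intro add_mono mult_mono z IH r assms(1)) simp_all
  also have "\<dots> = (1 + C) ^ size (add_mset z A)" by (simp add: algebra_simps)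
  finally have "cmod (- z * poly.coeff ?P k + r) \<le> (1 + C) ^ size (add_mset z A)" .
  moreover have "algebraic_int (- z * poly.coeff ?P k + r)"
    by (intro algebraic_int_plus algebraic_int_times r IH) (use z in simp)
  ultimately show ?case unfolding eq by (intro conjI)
qed simp

text \<open>Gaussian elimination over the coordinates in \<open>H\<close>. The vectors are indexed
  by \<open>I\<close>, so the outcome is a set of indices; in the application these are the
  generating units themselves.\<close>

lemma spanning_subset:
  fixes l :: "'i \<Rightarrow> 'h \<Rightarrow> real"
  assumes "finite H"
  shows "\<exists>S. finite S \<and> S \<subseteq> I \<and> (\<forall>u\<in>I. \<exists>t. \<forall>h\<in>H. l u h = (\<Sum>s\<in>S. t s * l s h))"
  using assms
proof (induction H arbitrary: l rule: finite_induct)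
  case empty
  then show ?case by (intro exI [of _ "{}"]) simp
next
  case (insert h0 H)
  show ?case
  proof (cases "\<forall>a\<in>I. l a h0 = 0")
    case True
    obtain S where S: "finite S" "S \<subseteq> I" "\<forall>u\<in>I. \<exists>t. \<forall>h\<in>H. l u h = (\<Sum>s\<in>S. t s * l s h)"
      using insert.IH [of l] by blast
    have "(\<Sum>s\<in>S. t s * l s h0) = 0" for t using True S(2) by (intro sum.neutral) auto
    with S True show ?thesis by (intro exI [of _ S]) auto
  next
    case False
    then obtain a where a: "a \<in> I" "l a h0 \<noteq> 0" by blast
    define c where "c u = l u h0 / l a h0" for u
    define l' where "l' u h = l u h - c u * l a h" for u h
    obtain S where S: "finite S" "S \<subseteq> I" "\<forall>u\<in>I. \<exists>t. \<forall>h\<in>H. l' u h = (\<Sum>s\<in>S. t s * l' s h)"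
      using insert.IH [of l'] by blast
    have l'0: "l' u h0 = 0" for u unfolding l'_def c_def using a(2) by simp
    have "\<exists>t. \<forall>h\<in>insert h0 H. l u h = (\<Sum>s\<in>insert a S. t s * l s h)" if u: "u \<in> I" for u
    proof -
      obtain t where t: "\<forall>h\<in>H. l' u h = (\<Sum>s\<in>S. t s * l' s h)" using S(3) u by blast
      \<comment> \<open>The two contributions are added, so that the formula stays correct when the
        pivot \<open>a\<close> already belongs to \<open>S\<close>.\<close>
      define t' where "t' s = (if s \<in> S then t s else 0) + (if s = a then c u - (\<Sum>s\<in>S. t s * c s) else 0)" for s
      have "l u h = (\<Sum>s\<in>insert a S. t' s * l s h)" if h: "h \<in> insert h0 H" for h
      proof -
        have "l' u h = (\<Sum>s\<in>S. t s * l' s h)" using t h l'0 by auto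
        then have "l u h = c u * l a h + (\<Sum>s\<in>S. t s * (l s h - c s * l a h))" unfolding l'_def by simp
        also have "\<dots> = (\<Sum>s\<in>S. t s * l s h) + (c u - (\<Sum>s\<in>S. t s * c s)) * l a h"
          by (simp add: sum_subtractf right_diff_distrib left_diff_distrib sum_distrib_right mult.assoc)
        also have "(\<Sum>s\<in>S. t s * l s h) = (\<Sum>s\<in>insert a S. (if s \<in> S then t s else 0) * l s h)"
          using S(1) by (intro sum.mono_neutral_cong_left) auto
        also have "(c u - (\<Sum>s\<in>S. t s * c s)) * l a h
            = (\<Sum>s\<in>insert a S. (if s = a then c u - (\<Sum>s\<in>S. t s * c s) else 0) * l s h)"
          using S(1) by (subst sum.remove [of _ a]) (auto intro!: sum.neutral)
        finally show ?thesis unfolding t'_def by (simp only: sum.distrib distrib_right)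
      qed
      then show ?thesis by blast
    qed
    with S a show ?thesis by (intro exI [of _ "insert a S"]) auto
  qed
qed

context rational_extension
begin

text \<open>Every complex root of the minimal polynomial over the rationals is the image of
  \<open>u\<close> under some embedding of \<open>L\<close>, so all roots are bounded by
  \<open>C\<close>. The coefficients are rational algebraic integers, hence integers, and are
  bounded by expanding the linear factors.\<close>

lemma bounded_integer_poly:
  assumes u: "u \<in> L" "algebraic_int u" and C: "0 \<le> C" "\<And>\<tau>. \<tau> \<in> embeddings \<Longrightarrow> cmod (\<tau> u) \<le> C"
  shows "\<exists>m. m \<noteq> 0 \<and> degree m \<le> card B \<and> poly m u = 0 \<and>
    (\<forall>i. poly.coeff m i \<in> of_int ` {k. \<bar>real_of_int k\<bar> \<le> (1 + C) ^ card B})"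
proof -
  interpret q: field_embedding "\<rat> :: 'a set" "\<lambda>x. of_rat (inv_into UNIV of_rat x) :: complex" by (rule rational_embedding_field)
  obtain m where m: "q.min_poly u m" "degree m \<le> card B"
    using exists_min_poly [OF q.field_embedding_axioms u(1)] by blast
  have m': "m \<in> q.KP" "lead_coeff m = 1" "poly m u = 0" using m(1) unfolding q.min_poly_def by simp_all
  have deg: "degree (q.mp m) = degree m" by (rule degree_map_poly) (use m'(2) q.one in auto)
  have lc: "lead_coeff (q.mp m) = 1" unfolding deg q.coeff_mp m'(2) by (rule q.one)
  then have "q.mp m \<noteq> 0" by auto
  from alg_closed_imp_factorization [OF this] obtain A where
    A: "size A = degree m" "q.mp m = (\<Prod>z\<in>#A. [:- z, 1:])" unfolding deg lc [unfolded deg] by auto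
  have roots: "algebraic_int z \<and> cmod z \<le> C" if z: "z \<in># A" for z
  proof -
    have "poly (q.mp m) z = 0"
    proof -
      obtain A' where "A = add_mset z A'" using z by (rule mset_add)
      then show ?thesis unfolding A(2) by simp
    qed
    moreover have "\<rat> \<subseteq> L"
      using Rats_subset_L .
    ultimately obtain K' \<tau>' where 1: "field_embedding K' \<tau>'" "K' \<subseteq> L" "u \<in> K'" "\<tau>' u = z"
      using extend_embedding [OF q.field_embedding_axioms _ u(1) m(1)] by blast
    obtain \<tau> where 2: "field_embedding L \<tau>" "\<forall>x\<in>K'. \<tau> x = \<tau>' x" using embedding_L [OF 1(1,2)] by blast
    interpret field_embedding L \<tau> by fact
    have "field_embedding L (restrict \<tau> L)"
      by unfold_locales (use L one add mult in simp_all)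
    then have "restrict \<tau> L \<in> embeddings" unfolding embeddings_def by simp
    from C(2) [OF this] have "cmod z \<le> C" using u(1) 1(3,4) 2(2) by simp
    moreover have "algebraic_int z" using algebraic_int_image [OF u] 1(3,4) 2(2) by simp
    ultimately show ?thesis by simp
  qed
  have "poly.coeff m i \<in> of_int ` {k. \<bar>real_of_int k\<bar> \<le> (1 + C) ^ card B}" for i
  proof -
    note c = coeff_prod_linear_factors [OF C(1) roots, of A i, folded A(2)]
    obtain r where r: "poly.coeff m i = of_rat r" using q.KP [OF m'(1), of i] by (rule Rats_cases)
    have f: "poly.coeff (q.mp m) i = of_rat r" unfolding q.coeff_mp r by (rule q.of_rat(2))
    have "(of_rat r :: complex) \<in> \<int>"
      by (rule rational_algebraic_int_is_int) (use c f in simp_all)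
    then obtain k where k: "(of_rat r :: complex) = of_int k" by (rule Ints_cases)
    then have rk: "r = of_int k" by (metis of_rat_of_int_eq of_rat_eq_iff)
    have "(1 + C) ^ size A \<le> (1 + C) ^ card B" using C(1) m(2) A(1) by (intro power_increasing) simp_all
    then have "\<bar>real_of_int k\<bar> \<le> (1 + C) ^ card B" using c f k by simp
    then show ?thesis unfolding r rk by simp
  qed
  moreover have "m \<noteq> 0" using m'(2) by auto
  ultimately show ?thesis using m(2) m'(3) by blast
qed

text \<open>Bounded degree and bounded integer coefficients leave finitely many polynomials, each
  with finitely many roots.\<close>

lemma finite_bounded_integers:
  assumes C: "0 \<le> C"
  shows "finite {u \<in> L. algebraic_int u \<and> (\<forall>\<tau>\<in>embeddings. cmod (\<tau> u) \<le> C)}"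
proof -
  let ?k = "{k. \<bar>real_of_int k\<bar> \<le> (1 + C) ^ card B}"
  have sub: "?k \<subseteq> {- \<lceil>(1 + C) ^ card B\<rceil>..\<lceil>(1 + C) ^ card B\<rceil>}" by auto linarith+
  have fin: "finite (of_int ` ?k :: 'a set)"
    by (rule finite_imageI) (rule finite_subset [OF sub finite_atLeastAtMost_int])
  define P where "P = {m \<in> Poly ` {xs. set xs \<subseteq> (of_int ` ?k :: 'a set) \<and> length xs \<le> Suc (card B)}. m \<noteq> 0}"
  have P: "finite P" unfolding P_def using finite_lists_length_le [OF fin] by simp
  have "{u \<in> L. algebraic_int u \<and> (\<forall>\<tau>\<in>embeddings. cmod (\<tau> u) \<le> C)} \<subseteq> (\<Union>m\<in>P. {u. poly m u = 0})"
  proof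
    fix u assume "u \<in> {u \<in> L. algebraic_int u \<and> (\<forall>\<tau>\<in>embeddings. cmod (\<tau> u) \<le> C)}"
    then obtain m where m: "m \<noteq> 0" "degree m \<le> card B" "poly m u = 0" "\<And>i. poly.coeff m i \<in> of_int ` ?k"
      using bounded_integer_poly [OF _ _ C, of u] by blast
    have "set (coeffs m) \<subseteq> of_int ` ?k" unfolding coeffs_def using m(4) by (auto simp del: upt_Suc)
    moreover have "length (coeffs m) \<le> Suc (card B)" using m(1,2) by (simp add: length_coeffs_degree)
    moreover have "m = Poly (coeffs m)" by simp
    ultimately have "m \<in> P" unfolding P_def using m(1) by blast
    with m(3) show "u \<in> (\<Union>m\<in>P. {u. poly m u = 0})" by blast
  qed
  then show ?thesis by (rule finite_subset) (use P in \<open>auto intro!: poly_roots_finite simp: P_def\<close>)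
qed

definition "U = {u \<in> L. u \<noteq> 0 \<and> algebraic_int u \<and> algebraic_int (inverse u)}"

lemma U_mult: "u \<in> U \<Longrightarrow> w \<in> U \<Longrightarrow> u * w \<in> U"
  unfolding U_def by (simp add: L algebraic_int_times)

lemma U_power: "u \<in> U \<Longrightarrow> u ^ n \<in> U"
  by (induction n) (auto simp: U_mult, simp add: U_def L)

lemma U_power_int: "u \<in> U \<Longrightarrow> u powi k \<in> U"
  unfolding power_int_def using U_power [of u] U_power [of "inverse u"] by (simp add: U_def L)

lemma U_prod: "(\<And>s. s \<in> S \<Longrightarrow> f s \<in> U) \<Longrightarrow> prod f S \<in> U"
  by (induction S rule: infinite_finite_induct) (auto simp: U_mult, simp_all add: U_def L)

definition "log_abs u \<tau> = ln (cmod (\<tau> u))"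

context
  fixes \<tau> assumes t: "\<tau> \<in> embeddings"
begin

interpretation field_embedding L \<tau>
  using t unfolding embeddings_def by simp

lemma log_mult: "u \<in> U \<Longrightarrow> w \<in> U \<Longrightarrow> log_abs (u * w) \<tau> = log_abs u \<tau> + log_abs w \<tau>"
  unfolding log_abs_def U_def by (simp add: mult norm_mult ln_mult nonzero)

lemma log_one: "log_abs 1 \<tau> = 0"
  unfolding log_abs_def by (simp add: one)

lemma log_power: "u \<in> U \<Longrightarrow> log_abs (u ^ n) \<tau> = real n * log_abs u \<tau>"
  by (induction n) (simp_all add: log_one log_mult U_power algebra_simps)

lemma log_power_int:
  assumes "u \<in> U" shows "log_abs (u powi k) \<tau> = of_int k * log_abs u \<tau>"
proof -
  have inv: "inverse u \<in> U" using assms unfolding U_def by (simp add: L)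
  have "log_abs (inverse u) \<tau> = - log_abs u \<tau>"
    using log_mult [OF assms inv] log_one assms unfolding U_def by simp
  then show ?thesis unfolding power_int_def using log_power [OF assms] log_power [OF inv] by simp
qed

lemma log_prod: "(\<And>s. s \<in> S \<Longrightarrow> f s \<in> U) \<Longrightarrow> log_abs (prod f S) \<tau> = (\<Sum>s\<in>S. log_abs (f s) \<tau>)"
  by (induction S rule: infinite_finite_induct) (simp_all add: log_one log_mult U_prod)

lemma cmod_le:
  assumes "u \<in> U" "log_abs u \<tau> \<le> C" shows "cmod (\<tau> u) \<le> exp C"
proof -
  have "0 < cmod (\<tau> u)" using assms(1) nonzero [of u] unfolding U_def by simp
  then have "cmod (\<tau> u) = exp (log_abs u \<tau>)" unfolding log_abs_def by simp
  then show ?thesis using assms(2) by simp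
qed

end

text \<open>Only a power of \<open>u\<close> is generated by \<open>S\<close>. This is enough,
  because exponents become invertible after tensoring with the p-adic numbers.\<close>

theorem units_finite_rank:
  "\<exists>S. finite S \<and> S \<subseteq> U \<and> (\<forall>u\<in>U. \<exists>n>0. \<exists>k. u ^ n = (\<Prod>s\<in>S. s powi k s))"
proof -
  obtain S where S: "finite S" "S \<subseteq> U" "\<forall>u\<in>U. \<exists>t. \<forall>\<tau>\<in>embeddings. log_abs u \<tau> = (\<Sum>s\<in>S. t s * log_abs s \<tau>)"
    using spanning_subset [OF finite_embeddings, of U log_abs] by blast
  \<comment> \<open>Summing over all embeddings makes one constant work for each of them.\<close>
  define C where "C = (\<Sum>\<tau>\<in>embeddings. \<Sum>s\<in>S. \<bar>log_abs s \<tau>\<bar>)"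
  have "\<exists>n>0. \<exists>k. u ^ n = (\<Prod>s\<in>S. s powi k s)" if u: "u \<in> U" for u
  proof -
    obtain t where t: "\<And>\<tau>. \<tau> \<in> embeddings \<Longrightarrow> log_abs u \<tau> = (\<Sum>s\<in>S. t s * log_abs s \<tau>)" using S(3) u by blast
    \<comment> \<open>The coordinates of \<open>u^j\<close> are rounded down to integers, and the
      corresponding product is divided out, which leaves the remainder \<open>w j\<close>.\<close>
    define f where "f j s = \<lfloor>real j * t s\<rfloor>" for j s
    define w where "w j = u ^ j * (\<Prod>s\<in>S. s powi (- f j s))" for j
    have sU: "\<And>s k. s \<in> S \<Longrightarrow> s powi k \<in> U" using S(2) U_power_int by blast
    have pU: "(\<Prod>s\<in>S. s powi k s) \<in> U" for k by (rule U_prod) (rule sU)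
    have wU: "w j \<in> U" for j unfolding w_def by (intro U_mult U_power u pU)
    have "cmod (\<tau> (w j)) \<le> exp C" if \<tau>: "\<tau> \<in> embeddings" for \<tau> j
    proof (rule cmod_le [OF \<tau> wU])
      have "log_abs (w j) \<tau> = real j * log_abs u \<tau> + (\<Sum>s\<in>S. log_abs (s powi (- f j s)) \<tau>)"
        unfolding w_def by (simp add: log_mult [OF \<tau> U_power [OF u] pU] log_power [OF \<tau> u] log_prod [OF \<tau> sU])
      also have "(\<Sum>s\<in>S. log_abs (s powi (- f j s)) \<tau>) = (\<Sum>s\<in>S. - of_int (f j s) * log_abs s \<tau>)"
        by (intro sum.cong refl) (use log_power_int [OF \<tau>] S(2) in auto)
      \<comment> \<open>Only the fractional parts of the coordinates are left, so the remainders are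
        bounded independently of \<open>j\<close>. Finitely many values are then available, and two
        coinciding remainders give the relation.\<close>
      also have "real j * log_abs u \<tau> + \<dots> = (\<Sum>s\<in>S. frac (real j * t s) * log_abs s \<tau>)"
        unfolding t [OF \<tau>] sum_distrib_left sum.distrib [symmetric]
        by (simp add: frac_def f_def algebra_simps)
      also have "\<dots> \<le> (\<Sum>s\<in>S. \<bar>log_abs s \<tau>\<bar>)"
      proof (rule sum_mono)
        fix s
        have "frac (real j * t s) * log_abs s \<tau> \<le> frac (real j * t s) * \<bar>log_abs s \<tau>\<bar>"
          by (intro mult_left_mono) simp_all
        also have "\<dots> \<le> 1 * \<bar>log_abs s \<tau>\<bar>"
          by (rule mult_right_mono [OF less_imp_le [OF frac_lt_1]]) simp
        finally show "frac (real j * t s) * log_abs s \<tau> \<le> \<bar>log_abs s \<tau>\<bar>" by simp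
      qed
      also have "\<dots> \<le> C"
        unfolding C_def using \<tau> finite_embeddings by (intro member_le_sum sum_nonneg) simp_all
      finally show "log_abs (w j) \<tau> \<le> C" .
    qed
    then have "range w \<subseteq> {u \<in> L. algebraic_int u \<and> (\<forall>\<tau>\<in>embeddings. cmod (\<tau> u) \<le> exp C)}"
      using wU unfolding U_def by auto
    then have "finite (range w)" by (rule finite_subset) (rule finite_bounded_integers, simp)
    then have "\<not> inj w" using finite_imageD [of w UNIV] infinite_UNIV_nat by blast
    then obtain i j where ij: "i < j" "w i = w j" unfolding inj_def by (metis linorder_neqE_nat)
    have u0: "u \<noteq> 0" and s0: "\<And>s. s \<in> S \<Longrightarrow> s \<noteq> 0" using u S(2) unfolding U_def by auto
    have "u ^ j = u ^ (j - i) * u ^ i" using ij(1) by (simp flip: power_add)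
    with ij(2) have "u ^ i * (\<Prod>s\<in>S. s powi (- f i s)) = u ^ i * (u ^ (j - i) * (\<Prod>s\<in>S. s powi (- f j s)))"
      unfolding w_def by (simp add: mult_ac)
    then have eq: "(\<Prod>s\<in>S. s powi (- f i s)) = u ^ (j - i) * (\<Prod>s\<in>S. s powi (- f j s))" using u0 by simp
    have "u ^ (j - i) = u ^ (j - i) * (\<Prod>s\<in>S. s powi (- f j s) * s powi (f j s))"
      using s0 by (simp add: power_int_minus)
    also have "\<dots> = (\<Prod>s\<in>S. s powi (- f i s)) * (\<Prod>s\<in>S. s powi (f j s))"
      unfolding eq by (simp add: prod.distrib mult.assoc)
    also have "\<dots> = (\<Prod>s\<in>S. s powi (f j s - f i s))"
      unfolding prod.distrib [symmetric] using s0 by (intro prod.cong refl) (simp flip: power_int_add)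
    finally show ?thesis using ij(1) by (intro exI [of _ "j - i"] conjI exI [of _ "\<lambda>s. f j s - f i s"]) simp_all
  qed
  with S(1,2) show ?thesis by blast
qed

end

subsection \<open>The Leopoldt kernel is finite dimensional\<close>

lemma (in abelian_group) minus_add_cancel:
  "x \<in> carrier G \<Longrightarrow> y \<in> carrier G \<Longrightarrow> (x \<ominus> y) \<oplus> y = x"
  by (simp add: a_minus_def a_assoc l_neg)

lemma (in abelian_group) eq_minusI:
  "x = z \<oplus> y \<Longrightarrow> y \<in> carrier G \<Longrightarrow> z \<in> carrier G \<Longrightarrow> z = x \<ominus> y"
  by (simp add: a_minus_def a_assoc r_neg)

lemma (in padic_prime) rational_embedding_Qp: "rational_embedding (Qp p) (rat_to_Qp p)"
proof (intro rational_embedding.intro rational_embedding_axioms.intro field_Qp)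
qed (simp_all add: rat_to_Qp_eq Qp_eq Q.one_Q)

lemma (in padic_prime) rat_to_Qp_inverse:
  "q \<noteq> 0 \<Longrightarrow> rat_to_Qp p (inverse q) \<otimes>\<^bsub>Qp p\<^esub> rat_to_Qp p q = \<one>\<^bsub>Qp p\<^esub>"
  unfolding rational_embedding.rho_mult [OF rational_embedding_Qp, symmetric]
  using rational_embedding.rho_one [OF rational_embedding_Qp] by simp

context padic_subfield
begin

lemmas rat_to_Qp_closed = rational_embedding.rho_closed [OF rational_embedding_Qp]

lemma qten_power_int: "u \<in> carrier E \<Longrightarrow> qten (u powi k) = rat_to_Qp p (of_int k) \<odot>\<^bsub>V\<^esub> qten u"
proof -
  assume u: "u \<in> carrier E"
  have "(\<lambda>u. qten u) \<in> carrier E \<rightarrow> carrier V" using qten_closed by auto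
  from int_linear_of_additive [OF restrict_scalars [OF QZ.module_BC] this _ u, of k]
  show ?thesis using qten_mult unfolding E_simps(2,4) by blast
qed

lemma qten_one: "qten 1 = \<zero>\<^bsub>V\<^esub>"
proof -
  have 1: "1 \<in> carrier E" by (simp add: E_simps F_closed)
  have "qten 1 \<oplus>\<^bsub>V\<^esub> qten 1 = qten 1" using qten_mult [OF 1 1] by simp
  then show ?thesis
    using qten_closed [OF 1] QZ.BC.M.a_assoc [of "qten 1" "qten 1" "\<ominus>\<^bsub>V\<^esub> qten 1"]
    by (simp add: QZ.BC.M.r_neg)
qed

lemma E_closed: "u \<in> carrier E \<Longrightarrow> v \<in> carrier E \<Longrightarrow> u * v \<in> carrier E" "1 \<in> carrier E" "u \<in> carrier E \<Longrightarrow> u powi k \<in> carrier E"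
  by (simp_all add: E_simps F_closed algebraic_int_times F_power_int algebraic_int_power_int flip: power_int_inverse)

lemma E_prod: "(\<And>s. s \<in> S \<Longrightarrow> f s \<in> carrier E) \<Longrightarrow> prod f S \<in> carrier E"
  by (induction S rule: infinite_finite_induct) (simp_all add: E_closed)

lemma qten_prod:
  assumes "finite S" "\<And>s. s \<in> S \<Longrightarrow> f s \<in> carrier E"
  shows "qten (prod f S) = (\<Oplus>\<^bsub>V\<^esub>s\<in>S. qten (f s))"
  using assms
proof (induction S rule: finite_induct)
  case (insert s S)
  have S: "prod f S \<in> carrier E" using insert by (intro E_prod) simp
  have "(\<lambda>s. qten (f s)) \<in> S \<rightarrow> carrier V" "qten (f s) \<in> carrier V" using insert qten_closed by auto
  then have eq: "(\<Oplus>\<^bsub>V\<^esub>s\<in>insert s S. qten (f s)) = qten (f s) \<oplus>\<^bsub>V\<^esub> (\<Oplus>\<^bsub>V\<^esub>s\<in>S. qten (f s))"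
    using insert by (intro QZ.BC.M.finsum_insert) simp_all
  have fs: "f s \<in> carrier E" using insert.prems by simp
  have IH: "qten (prod f S) = (\<Oplus>\<^bsub>V\<^esub>s\<in>S. qten (f s))"
    by (rule insert.IH) (rule insert.prems, erule insertI2)
  show ?case by (simp only: prod.insert [OF insert.hyps] qten_mult [OF fs S] IH eq)
qed (simp only: prod.empty QZ.BC.M.finsum_empty qten_one)

text \<open>A relation for \<open>u^n\<close> puts \<open>n\<close> times \<open>qten u\<close> into
  the span of the generators, and \<open>n\<close> is invertible in the p-adic numbers. The
  generators form a family because for a fixed field they will be norms of units of
  \<open>L\<close>, which may coincide.\<close>

lemma fin_dim_LK:
  assumes S: "finite S" "\<And>s. s \<in> S \<Longrightarrow> f s \<in> carrier E"
    and gen: "\<And>u. u \<in> carrier E \<Longrightarrow> \<exists>n>0::nat. \<exists>k. u ^ n = (\<Prod>s\<in>S. f s powi k s)"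
  shows "vectorspace.fin_dim (Qp p) LK"
proof -
  let ?A = "(\<lambda>s. qten (f s)) ` S"
  have A: "finite ?A" "?A \<subseteq> carrier V" using S qten_closed by auto
  interpret Sp: LinearCombinations.submodule "Qp p" "QZ.BC.span ?A" V by (rule QZ.BC.span_is_submodule [OF A(2)])
  have qten: "qten u \<in> QZ.BC.span ?A" if u: "u \<in> carrier E" for u
  proof -
    obtain n :: nat and k where nk: "n > 0" "u ^ n = (\<Prod>s\<in>S. f s powi k s)" using gen [OF u] by blast
    have fk: "\<And>s. s \<in> S \<Longrightarrow> f s powi k s \<in> carrier E" by (intro E_closed S)
    have "qten (u ^ n) = (\<Oplus>\<^bsub>V\<^esub>s\<in>S. qten (f s powi k s))"
      unfolding nk(2) by (rule qten_prod [OF S(1) fk])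
    also have "\<dots> \<in> QZ.BC.span ?A"
    proof -
      have mem: "qten (f s powi k s) \<in> QZ.BC.span ?A" if s: "s \<in> S" for s
        unfolding qten_power_int [OF S(2) [OF s]]
        by (intro Sp.smult_closed rat_to_Qp_closed subsetD [OF QZ.BC.in_own_span [OF A(2)]] imageI s)
      have "T \<subseteq> S \<Longrightarrow> (\<Oplus>\<^bsub>V\<^esub>s\<in>T. qten (f s powi k s)) \<in> QZ.BC.span ?A" if "finite T" for T
        using that
      proof (induction T rule: finite_induct)
        case empty
        show ?case unfolding QZ.BC.M.finsum_empty by (rule Sp.zero_closed)
      next
        case (insert t T)
        have c: "(\<lambda>s. qten (f s powi k s)) \<in> T \<rightarrow> carrier V" "qten (f t powi k t) \<in> carrier V"
          using insert.prems fk qten_closed by auto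
        have T: "t \<in> S" "T \<subseteq> S" using insert.prems by auto
        show ?case
          unfolding QZ.BC.M.finsum_insert [OF insert.hyps c]
          by (rule Sp.m_closed [OF mem [OF T(1)] insert.IH [OF T(2)]])
      qed
      then show ?thesis using S(1) by blast
    qed
    finally have n: "rat_to_Qp p (of_int (int n)) \<odot>\<^bsub>V\<^esub> qten u \<in> QZ.BC.span ?A"
      using qten_power_int [OF u, of "int n"] by simp
    let ?q = "of_int (int n) :: rat"
    have inv: "rat_to_Qp p (inverse ?q) \<otimes>\<^bsub>Qp p\<^esub> rat_to_Qp p ?q = \<one>\<^bsub>Qp p\<^esub>"
      using nk(1) by (intro rat_to_Qp_inverse) simp
    have "rat_to_Qp p (inverse ?q) \<odot>\<^bsub>V\<^esub> (rat_to_Qp p ?q \<odot>\<^bsub>V\<^esub> qten u) = qten u"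
      unfolding Module.module.smult_assoc1 [OF QZ.module_BC rat_to_Qp_closed rat_to_Qp_closed qten_closed [OF u], symmetric] inv
      by (rule QZ.BC.smult_one [OF qten_closed [OF u]])
    then show ?thesis using Sp.smult_closed [OF rat_to_Qp_closed [of "inverse ?q"] n] by (simp only:)
  qed
  have minus: "x \<ominus>\<^bsub>V\<^esub> y \<in> QZ.BC.span ?A" if "x \<in> QZ.BC.span ?A" "y \<in> QZ.BC.span ?A" for x y
  proof -
    have y: "y \<in> carrier V" using Sp.subset that(2) by (rule subsetD)
    have eq: "\<ominus>\<^bsub>V\<^esub> y = (\<ominus>\<^bsub>Qp p\<^esub> \<one>\<^bsub>Qp p\<^esub>) \<odot>\<^bsub>V\<^esub> y"
      unfolding QZ.BC.smult_l_minus [OF QZ.S.one_closed y] QZ.BC.smult_one [OF y] ..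
    have "\<ominus>\<^bsub>V\<^esub> y \<in> QZ.BC.span ?A"
      unfolding eq by (intro Sp.smult_closed that QZ.S.a_inv_closed QZ.S.one_closed)
    then show ?thesis unfolding a_minus_def by (rule Sp.m_closed [OF that(1)])
  qed
  have zu: "QZ.pure \<one>\<^bsub>Qp p\<^esub> m \<in> QZ.BC.span ?A" if "m \<in> carrier ZE.BC" for m
    using that
  proof (induction rule: ZE.BC_induct)
    case (pure a u)
    have "a \<odot>\<^bsub>ZU\<^esub> zten u = ZE.pure a u"
      unfolding ZE.pure_one_smult [OF pure(1), of u] by (simp only: ZU_eq)
    with QZ.pure_one_balanced [OF zten_closed [OF pure(2)] pure(1)]
    have eq: "QZ.pure \<one>\<^bsub>Qp p\<^esub> (ZE.pure a u) = a \<odot>\<^bsub>V\<^esub> qten u" by (simp only: id_apply)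
    show ?case unfolding eq by (rule Sp.smult_closed [OF QZ.R_in_S [OF pure(1)] qten [OF pure(2)]])
  next
    case (diff x y)
    note d = diff(1,2) [folded ZU_eq]
    note ag = Module.module.axioms(2) [OF QZ.M.module_axioms]
    have xy: "x \<ominus>\<^bsub>ZU\<^esub> y \<in> carrier ZU" "(x \<ominus>\<^bsub>ZU\<^esub> y) \<oplus>\<^bsub>ZU\<^esub> y = x"
      by (rule abelian_group.minus_closed [OF ag d], rule abelian_group.minus_add_cancel [OF ag d])
    note c = QZ.pure_closed [OF QZ.S.one_closed]
    have "QZ.pure \<one>\<^bsub>Qp p\<^esub> x = QZ.pure \<one>\<^bsub>Qp p\<^esub> (x \<ominus>\<^bsub>ZU\<^esub> y) \<oplus>\<^bsub>V\<^esub> QZ.pure \<one>\<^bsub>Qp p\<^esub> y"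
      using QZ.pure_add_right [OF QZ.S.one_closed xy(1) d(2)] unfolding xy(2) .
    from QZ.BC.M.eq_minusI [OF this c [OF d(2)] c [OF xy(1)]]
    have eq: "QZ.pure \<one>\<^bsub>Qp p\<^esub> (x \<ominus>\<^bsub>ZU\<^esub> y) = QZ.pure \<one>\<^bsub>Qp p\<^esub> x \<ominus>\<^bsub>V\<^esub> QZ.pure \<one>\<^bsub>Qp p\<^esub> y" .
    have "x \<ominus>\<^bsub>ZE.BC\<^esub> y = x \<ominus>\<^bsub>ZU\<^esub> y" by (simp only: ZU_eq)
    then show ?case using minus [OF diff(3,4)] by (simp only: eq)
  qed
  have "carrier V \<subseteq> QZ.BC.span ?A"
  proof
    fix v assume "v \<in> carrier V"
    then show "v \<in> QZ.BC.span ?A"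
    proof (induction rule: QZ.BC_induct)
      case (pure s m)
      show ?case unfolding QZ.pure_one_smult [OF pure(1), of m] by (rule Sp.smult_closed [OF pure(1) zu [OF pure(2) [unfolded ZU_eq]]])
    next
      case (diff x y)
      then show ?case by (intro minus)
    qed
  qed
  then have "QZ.BC.span ?A = carrier V" using Sp.subset by blast
  then have "V.fin_dim" unfolding V.fin_dim_def using A by blast
  from V.fin_dim_subspace [OF this reg.kerT_is_subspace] show ?thesis unfolding LK_eq .
qed

lemma LK_finsum:
  assumes "finite A" "\<And>a. a \<in> A \<Longrightarrow> f a \<in> carrier LK"
  shows "(\<Oplus>\<^bsub>LK\<^esub>a\<in>A. f a) = (\<Oplus>\<^bsub>V\<^esub>a\<in>A. f a) \<and> (\<Oplus>\<^bsub>LK\<^esub>a\<in>A. f a) \<in> carrier LK"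
proof -
  interpret K: vectorspace "Qp p" LK by (rule vectorspace_LK)
  show ?thesis
    using assms
  proof (induction A rule: finite_induct)
    case empty
    show ?case unfolding K.M.finsum_empty QZ.BC.M.finsum_empty LK_ops(2) using K.M.zero_closed unfolding LK_ops(2) by simp
  next
    case (insert a A)
    have K: "f \<in> A \<rightarrow> carrier LK" "f a \<in> carrier LK" using insert.prems by auto
    then have V: "f \<in> A \<rightarrow> carrier V" "f a \<in> carrier V" using LK_carrier by auto
    have "(\<Oplus>\<^bsub>LK\<^esub>a\<in>A. f a) = (\<Oplus>\<^bsub>V\<^esub>a\<in>A. f a) \<and> (\<Oplus>\<^bsub>LK\<^esub>a\<in>A. f a) \<in> carrier LK"
      by (rule insert.IH) (rule insert.prems, erule insertI2)
    note IH = conjunct1 [OF this] conjunct2 [OF this]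
    show ?case
      unfolding K.M.finsum_insert [OF insert.hyps K] QZ.BC.M.finsum_insert [OF insert.hyps V]
      using K.M.a_closed [OF K(2) IH(2)] by (simp only: IH(1) LK_ops(1) simp_thms)
  qed
qed

end

lemma (in padic_subfield_pair) restrict_LK_hom:
  assumes "f \<in> module_hom (Qp p) A.V B.V" "\<And>v. v \<in> carrier A.LK \<Longrightarrow> f v \<in> carrier B.LK"
  shows "f \<in> module_hom (Qp p) A.LK B.LK"
  using assms unfolding module_hom_def A.LK_ops B.LK_ops by (auto simp: A.LK_carrier)

subsection \<open>The Galois action\<close>

locale galois_units = padic_subfield p L + L: rational_extension L B
  for p :: nat and L B :: "'a::field_char_0 set" +
  fixes G :: "('a \<Rightarrow> 'a) monoid"
  assumes group: "group G" and finite_G: "finite (carrier G)"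
    and act: "\<And>g. g \<in> carrier G \<Longrightarrow> padic_field_hom p L L g"
    and comp: "\<And>g h x. g \<in> carrier G \<Longrightarrow> h \<in> carrier G \<Longrightarrow> x \<in> L \<Longrightarrow> (g \<otimes>\<^bsub>G\<^esub> h) x = g (h x)"
begin

abbreviation "TG g \<equiv> unit_space_map p L L g"

lemmas TG_hom = padic_field_hom.unit_map_hom [OF act]
lemmas TG_qten = padic_field_hom.unit_map_qten [OF act]
lemmas act_E = padic_field_hom.sigma_E [OF act]

lemma TG_mult:
  assumes g: "g \<in> carrier G" and h: "h \<in> carrier G" and v: "v \<in> carrier V"
  shows "TG (g \<otimes>\<^bsub>G\<^esub> h) v = TG g (TG h v)"
proof (rule V_hom_eqI [OF QZ.module_BC _ _ _ v])
  interpret group G by (rule group)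
  have gh: "g \<otimes>\<^bsub>G\<^esub> h \<in> carrier G" using g h by simp
  show "TG (g \<otimes>\<^bsub>G\<^esub> h) \<in> module_hom (Qp p) V V" by (rule TG_hom [OF gh])
  show "(\<lambda>v. TG g (TG h v)) \<in> module_hom (Qp p) V V" by (rule module_hom_comp [OF TG_hom [OF h] TG_hom [OF g]])
  show "TG (g \<otimes>\<^bsub>G\<^esub> h) (qten u) = TG g (TG h (qten u))" if u: "u \<in> carrier E" for u
    unfolding TG_qten [OF gh u] TG_qten [OF h u] TG_qten [OF g act_E [OF h u]] comp [OF g h E_unit(1) [OF u]] ..
qed

lemma TG_LK: "g \<in> carrier G \<Longrightarrow> TG g \<in> module_hom (Qp p) LK LK"
  by (rule padic_subfield_pair.restrict_LK_hom [OF padic_subfield_pair.intro [OF padic_subfield_axioms padic_subfield_axioms]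
        TG_hom padic_field_hom.unit_map_LK [OF act]])

lemma finsum_hom:
  assumes "finite A" "\<And>a. a \<in> A \<Longrightarrow> f a \<in> module_hom (Qp p) V V"
  shows "(\<lambda>v. \<Oplus>\<^bsub>V\<^esub>a\<in>A. f a v) \<in> module_hom (Qp p) V V"
proof -
  have c: "\<And>v. v \<in> carrier V \<Longrightarrow> (\<lambda>a. f a v) \<in> A \<rightarrow> carrier V"
    using assms(2) module_hom_closed by blast
  show ?thesis
    unfolding module_hom_def
  proof (intro CollectI conjI allI impI Pi_I; (elim conjE)?)
    fix v assume v: "v \<in> carrier V"
    show "(\<Oplus>\<^bsub>V\<^esub>a\<in>A. f a v) \<in> carrier V" by (rule QZ.BC.M.finsum_closed [OF c [OF v]])
    fix q assume q: "q \<in> carrier (Qp p)"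
    show "(\<Oplus>\<^bsub>V\<^esub>a\<in>A. f a (q \<odot>\<^bsub>V\<^esub> v)) = q \<odot>\<^bsub>V\<^esub> (\<Oplus>\<^bsub>V\<^esub>a\<in>A. f a v)"
      unfolding QZ.BC.finsum_smult [OF q c [OF v]]
      using module_hom_smult [OF assms(2) q v] c [OF v] q by (intro QZ.BC.M.finsum_cong') auto
  next
    fix v w assume v: "v \<in> carrier V" and w: "w \<in> carrier V"
    show "(\<Oplus>\<^bsub>V\<^esub>a\<in>A. f a (v \<oplus>\<^bsub>V\<^esub> w)) = (\<Oplus>\<^bsub>V\<^esub>a\<in>A. f a v) \<oplus>\<^bsub>V\<^esub> (\<Oplus>\<^bsub>V\<^esub>a\<in>A. f a w)"
      unfolding QZ.BC.M.finsum_addf [OF c [OF v] c [OF w], symmetric]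
      using module_hom_add [OF assms(2) v w] c [OF v] c [OF w] by (intro QZ.BC.M.finsum_cong') auto
  qed
qed

section \<open>Fixed fields of subgroups and the norm\<close>

context
  fixes H assumes H: "subgroup H G"
begin

abbreviation "FH \<equiv> fixed_field L H"

lemma H_G: "h \<in> H \<Longrightarrow> h \<in> carrier G"
  using subgroup.subset [OF H] by auto

lemma finite_H: "finite H"
  using finite_subset [OF subgroup.subset [OF H] finite_G] .

lemma FH_sub: "FH \<subseteq> L"
  unfolding fixed_field_def by auto

lemma padic_subfield_FH: "padic_subfield p FH"
proof
  note s = padic_field_hom.sigma_zero [OF act [OF H_G]] padic_field_hom.sigma_one [OF act [OF H_G]]
    padic_field_hom.sigma_add [OF act [OF H_G]] padic_field_hom.sigma_mult [OF act [OF H_G]]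
    padic_field_hom.sigma_uminus [OF act [OF H_G]] padic_field_hom.sigma_inverse [OF act [OF H_G]]
  show "0 \<in> FH" "1 \<in> FH" using s(1,2) F_closed by (simp_all add: fixed_field_def)
  show "\<And>x y. x \<in> FH \<Longrightarrow> y \<in> FH \<Longrightarrow> x + y \<in> FH" "\<And>x y. x \<in> FH \<Longrightarrow> y \<in> FH \<Longrightarrow> x * y \<in> FH"
    "\<And>x. x \<in> FH \<Longrightarrow> - x \<in> FH" "\<And>x. x \<in> FH \<Longrightarrow> inverse x \<in> FH"
    by (auto simp: fixed_field_def s(3-6) F_closed)
qed

interpretation FH: padic_subfield p FH
  by (rule padic_subfield_FH)

interpretation inc: padic_field_hom p FH L "\<lambda>x. x"
  by (intro padic_field_hom.intro padic_subfield_pair.intro padic_field_hom_axioms.intro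
      padic_subfield_FH padic_subfield_axioms) (use FH_sub in auto)

interpretation nrm: padic_subfield_pair p L FH
  by (intro padic_subfield_pair.intro padic_subfield_FH padic_subfield_axioms)

lemma FH_E: "carrier FH.E = carrier E \<inter> FH"
  unfolding E_simps(1) FH.E_simps(1) using FH_sub by auto

definition "Nm u = (\<Prod>h\<in>H. h u)"

text \<open>Left translation by an element of \<open>H\<close> permutes the factors of the
  norm.\<close>

lemma Nm_E:
  assumes u: "u \<in> carrier E" shows "Nm u \<in> carrier FH.E"
proof -
  have hE: "\<And>h. h \<in> H \<Longrightarrow> h u \<in> carrier E" using act_E [OF H_G u] .
  have NE: "Nm u \<in> carrier E" unfolding Nm_def by (rule E_prod) (rule hE)
  have "g (Nm u) = Nm u" if g: "g \<in> H" for g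
  proof -
    interpret g: padic_field_hom p L L g by (rule act [OF H_G [OF g]])
    interpret G: Group.group G by (rule group)
    have prod: "g (\<Prod>h\<in>A. h u) = (\<Prod>h\<in>A. g (h u))" if "finite A" "A \<subseteq> H" for A
      using that
    proof (induction A rule: finite_induct)
      case (insert h A)
      then have "(\<Prod>h\<in>A. h u) \<in> L" "h u \<in> L" using E_unit(1) [OF E_prod [of A "\<lambda>h. h u"]] E_unit(1) [OF hE] hE by auto
      with insert show ?case by (simp add: g.sigma_mult)
    qed (simp add: g.sigma_one)
    have "g (Nm u) = (\<Prod>h\<in>H. (g \<otimes>\<^bsub>G\<^esub> h) u)"
      unfolding Nm_def prod [OF finite_H order_refl]
      by (intro prod.cong refl) (simp add: comp [OF H_G [OF g] H_G E_unit(1) [OF u]])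
    also have "\<dots> = Nm u"
      unfolding Nm_def
    proof (rule prod.reindex_bij_betw [of "\<lambda>h. g \<otimes>\<^bsub>G\<^esub> h" H H "\<lambda>h. h u"])
      have inj: "inj_on (\<lambda>h. g \<otimes>\<^bsub>G\<^esub> h) H"
        by (rule inj_onI) (use H_G g G.l_cancel in blast)
      moreover have "(\<lambda>h. g \<otimes>\<^bsub>G\<^esub> h) ` H \<subseteq> H" using subgroup.m_closed [OF H g] by auto
      ultimately show "bij_betw (\<lambda>h. g \<otimes>\<^bsub>G\<^esub> h) H H"
        unfolding bij_betw_def using endo_inj_surj [OF finite_H] by blast
    qed
    finally show ?thesis .
  qed
  then have "Nm u \<in> FH" unfolding fixed_field_def using E_unit(1) [OF NE] by simp
  with NE show ?thesis unfolding FH_E by simp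
qed

lemma Nm_mult: "u \<in> carrier E \<Longrightarrow> w \<in> carrier E \<Longrightarrow> Nm (u * w) = Nm u * Nm w"
  unfolding Nm_def prod.distrib [symmetric]
  using padic_field_hom.sigma_mult [OF act [OF H_G] E_unit(1) E_unit(1)] by (intro prod.cong refl) blast

lemma Nm_power_int:
  assumes u: "u \<in> carrier E" shows "Nm (u powi k) = Nm u powi k"
proof -
  have h: "h (u powi k) = h u powi k" if "h \<in> H" for h
    using module_hom_smult [OF padic_field_hom.sigma_hom [OF act [OF H_G [OF that]]] _ u, of k] by (simp add: E_simps(4))
  have pk: "(\<Prod>h\<in>A. h u powi k) = (\<Prod>h\<in>A. h u) powi k" for A :: "('a \<Rightarrow> 'a) set"
    by (induction A rule: infinite_finite_induct) (simp_all add: power_int_mult_distrib)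
  show ?thesis unfolding Nm_def pk [symmetric] by (rule prod.cong [OF refl h])
qed

lemma Nm_hom: "Nm \<in> module_hom int_ring E FH.E"
  unfolding module_hom_def
  using Nm_E Nm_mult Nm_power_int by (auto simp: E_simps(2,4) FH.E_simps(2,4))

lemma Nm_fixed: "u \<in> FH \<Longrightarrow> Nm u = u ^ card H"
proof -
  assume "u \<in> FH"
  then have "(\<Prod>h\<in>H. h u) = (\<Prod>h\<in>H. u)" unfolding fixed_field_def by (intro prod.cong) auto
  then show ?thesis unfolding Nm_def by simp
qed

abbreviation "incl \<equiv> unit_space_map p FH L (\<lambda>x. x)"
abbreviation "nm \<equiv> unit_space_map p L FH Nm"

lemmas nm_hom = nrm.unit_space_map_spec(1) [OF Nm_hom]
lemmas nm_qten = nrm.unit_space_map_spec(2) [OF Nm_hom]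

lemma incl_nm:
  assumes v: "v \<in> carrier V" shows "incl (nm v) = (\<Oplus>\<^bsub>V\<^esub>h\<in>H. TG h v)"
proof (rule V_hom_eqI [OF QZ.module_BC _ _ _ v])
  show "(\<lambda>v. incl (nm v)) \<in> module_hom (Qp p) V V" by (rule module_hom_comp [OF nm_hom inc.unit_map_hom])
  show "(\<lambda>v. \<Oplus>\<^bsub>V\<^esub>h\<in>H. TG h v) \<in> module_hom (Qp p) V V" by (rule finsum_hom [OF finite_H TG_hom [OF H_G]])
  fix u assume u: "u \<in> carrier E"
  have "incl (nm (qten u)) = qten (Nm u)" unfolding nm_qten [OF u] inc.unit_map_qten [OF Nm_E [OF u]] ..
  also have "\<dots> = (\<Oplus>\<^bsub>V\<^esub>h\<in>H. qten (h u))"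
    unfolding Nm_def by (rule qten_prod [OF finite_H act_E [OF H_G u]])
  also have "\<dots> = (\<Oplus>\<^bsub>V\<^esub>h\<in>H. TG h (qten u))"
    using qten_closed [OF act_E [OF H_G u]] TG_qten [OF H_G u] by (intro QZ.BC.M.finsum_cong') auto
  finally show "incl (nm (qten u)) = (\<Oplus>\<^bsub>V\<^esub>h\<in>H. TG h (qten u))" .
qed

lemma nm_incl:
  assumes v: "v \<in> carrier FH.V" shows "nm (incl v) = rat_to_Qp p (of_nat (card H)) \<odot>\<^bsub>FH.V\<^esub> v"
proof (rule FH.V_hom_eqI [OF FH.QZ.module_BC _ _ _ v])
  show "(\<lambda>v. nm (incl v)) \<in> module_hom (Qp p) FH.V FH.V" by (rule module_hom_comp [OF inc.unit_map_hom nm_hom])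
  let ?c = "rat_to_Qp p (of_nat (card H))"
  show "(\<lambda>v. ?c \<odot>\<^bsub>FH.V\<^esub> v) \<in> module_hom (Qp p) FH.V FH.V"
    unfolding module_hom_def
  proof (intro CollectI conjI allI impI Pi_I; (elim conjE)?)
    fix v q assume v: "v \<in> carrier FH.V" and q: "q \<in> carrier (Qp p)"
    show "?c \<odot>\<^bsub>FH.V\<^esub> (q \<odot>\<^bsub>FH.V\<^esub> v) = q \<odot>\<^bsub>FH.V\<^esub> (?c \<odot>\<^bsub>FH.V\<^esub> v)"
      unfolding FH.QZ.BC.smult_assoc1 [OF rat_to_Qp_closed q v, symmetric] FH.QZ.BC.smult_assoc1 [OF q rat_to_Qp_closed v, symmetric]
        QZ.S.m_comm [OF q rat_to_Qp_closed] ..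
  qed (simp_all add: FH.QZ.BC.smult_r_distr rat_to_Qp_closed)
  fix u assume u: "u \<in> carrier FH.E"
  then have uL: "u \<in> carrier E" "u \<in> FH" unfolding FH_E by simp_all
  have "nm (incl (FH.qten u)) = FH.qten (Nm u)" unfolding inc.unit_map_qten [OF u] nm_qten [OF uL(1)] ..
  also have "Nm u = u powi int (card H)" using Nm_fixed [OF uL(2)] by simp
  also have "FH.qten \<dots> = ?c \<odot>\<^bsub>FH.V\<^esub> FH.qten u" using FH.qten_power_int [OF u, of "int (card H)"] by simp
  finally show "nm (incl (FH.qten u)) = ?c \<odot>\<^bsub>FH.V\<^esub> FH.qten u" .
qed

lemma incl_LK: "incl \<in> module_hom (Qp p) FH.LK LK"
  by (rule inc.restrict_LK_hom [OF inc.unit_map_hom inc.unit_map_LK])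

lemma incl_nm_LK:
  assumes v: "v \<in> carrier LK" shows "incl (nm v) = (\<Oplus>\<^bsub>LK\<^esub>h\<in>H. TG h v)" "incl (nm v) \<in> carrier LK"
proof -
  have "TG h v \<in> carrier LK" if "h \<in> H" for h using padic_field_hom.unit_map_LK [OF act [OF H_G [OF that]] v] .
  then have fs: "(\<Oplus>\<^bsub>LK\<^esub>h\<in>H. TG h v) = (\<Oplus>\<^bsub>V\<^esub>h\<in>H. TG h v) \<and> (\<Oplus>\<^bsub>LK\<^esub>h\<in>H. TG h v) \<in> carrier LK"
    by (rule LK_finsum [OF finite_H])
  have vV: "v \<in> carrier V" using v LK_carrier by blast
  show "incl (nm v) = (\<Oplus>\<^bsub>LK\<^esub>h\<in>H. TG h v)"
    unfolding incl_nm [OF vV] conjunct1 [OF fs] ..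
  show "incl (nm v) \<in> carrier LK"
    unfolding incl_nm [OF vV] conjunct1 [OF fs, symmetric] by (rule conjunct2 [OF fs])
qed

text \<open>No local norm is constructed. The image of \<open>nm v\<close> in \<open>L\<close> is a
  sum of conjugates of \<open>v\<close>, each in the kernel because automorphisms preserve it, and
  \<open>LK_reflect\<close> takes this back to the fixed field, using that places extend.\<close>

lemma nm_LK: "nm \<in> module_hom (Qp p) LK FH.LK"
proof (rule nrm.restrict_LK_hom [OF nm_hom])
  fix v assume v: "v \<in> carrier LK"
  show "nm v \<in> carrier FH.LK"
  proof (rule inc.LK_reflect [OF _ _ incl_nm_LK(2) [OF v]])
    show "nm v \<in> carrier FH.V" using module_hom_closed [OF nm_hom] v by (auto simp: LK_carrier)
    fix w assume w: "w \<in> FH.P"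
    have span: "\<exists>c. (\<forall>b\<in>B. c b \<in> FH) \<and> x = (\<Sum>b\<in>B. c b * b)" if x: "x \<in> L" for x
    proof -
      obtain c where "x = (\<Sum>b\<in>B. of_rat (c b) * b)" using L.span_B [OF x] by blast
      then show ?thesis using inc.of_rat_F by (intro exI [of _ "\<lambda>b. of_rat (c b)"]) simp
    qed
    show "\<exists>w'\<in>P. inc.pb w' = w"
      unfolding inc.pb_def by (rule inc.place_extension [OF FH_sub L.finite_B L.B_L span w])
  qed
qed

text \<open>The norm of a fixed unit is its power with exponent \<open>card H\<close>. Taking norms
  of a relation in \<open>L\<close> thus expresses a power of \<open>u\<close> through the norms of
  the generators of \<open>L\<close>.\<close>

lemma fin_dim_FH:
  assumes S: "finite S" "S \<subseteq> carrier E" "\<And>u. u \<in> carrier E \<Longrightarrow> \<exists>n>0::nat. \<exists>k. u ^ n = (\<Prod>s\<in>S. s powi k s)"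
  shows "vectorspace.fin_dim (Qp p) FH.LK"
proof (rule FH.fin_dim_LK [OF S(1), of Nm])
  show "s \<in> S \<Longrightarrow> Nm s \<in> carrier FH.E" for s using S(2) Nm_E by auto
  fix u assume "u \<in> carrier FH.E"
  then have u: "u \<in> carrier E" "u \<in> FH" unfolding FH_E by simp_all
  obtain n :: nat and k where nk: "n > 0" "u ^ n = (\<Prod>s\<in>S. s powi k s)" using S(3) [OF u(1)] by blast
  have prod: "Nm (\<Prod>s\<in>T. s powi k s) = (\<Prod>s\<in>T. Nm s powi k s)" if "finite T" "T \<subseteq> S" for T
    using that
  proof (induction T rule: finite_induct)
    case empty
    show ?case using Nm_fixed [OF FH.F_closed(2)] by simp
  next
    case (insert t T)
    have t: "t \<in> carrier E" and T: "(\<Prod>s\<in>T. s powi k s) \<in> carrier E"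
      using insert.prems S(2) by (auto intro!: E_prod E_closed)
    show ?case using insert Nm_mult [OF E_closed(3) [OF t] T] Nm_power_int [OF t] by simp
  qed
  have "u ^ (card H * n) = Nm (u ^ n)"
    using Nm_power_int [OF u(1), of "int n"] Nm_fixed [OF u(2)] by (simp add: power_mult)
  also have "\<dots> = (\<Prod>s\<in>S. Nm s powi k s)" unfolding nk(2) by (rule prod [OF S(1) order_refl])
  finally have "u ^ (card H * n) = (\<Prod>s\<in>S. Nm s powi k s)" .
  moreover have "0 < card H * n"
    \<comment> \<open>A subgroup contains the identity, so the exponent is positive.\<close>
    using nk(1) finite_H subgroup.one_closed [OF H] by (auto simp: card_gt_0_iff)
  ultimately show "\<exists>n>0::nat. \<exists>k. u ^ n = (\<Prod>s\<in>S. Nm s powi k s)" by blast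
qed

end

theorem brauer_relation_leopoldt:
  assumes fin: "finite \<H>" and sub: "\<And>H. H \<in> \<H> \<Longrightarrow> subgroup H G"
    and brauer: "\<And>g. g \<in> carrier G \<Longrightarrow>
      (\<Sum>H\<in>\<H>. a H / of_nat (card H) * of_nat (card {x \<in> carrier G. inv\<^bsub>G\<^esub> x \<otimes>\<^bsub>G\<^esub> g \<otimes>\<^bsub>G\<^esub> x \<in> H})) = (0::rat)"
  shows "(\<Sum>H\<in>\<H>. a H * of_nat (leopoldt_defect (fixed_field L H) p)) = 0"
proof -
  have E_U: "carrier E = L.U" unfolding E_simps(1) L.U_def ..
  obtain S where S: "finite S" "S \<subseteq> carrier E" "\<And>u. u \<in> carrier E \<Longrightarrow> \<exists>n>0::nat. \<exists>k. u ^ n = (\<Prod>s\<in>S. s powi k s)"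
    using L.units_finite_rank unfolding E_U by blast
  show ?thesis
    unfolding leopoldt_defect_def
  proof (rule brauer_relation_dim [OF rational_embedding_Qp vectorspace_LK _ group finite_G TG_LK _ fin sub _ _ incl_LK nm_LK incl_nm_LK(1) _ brauer])
    show "vectorspace.fin_dim (Qp p) LK"
      by (rule fin_dim_LK [OF S(1), of "\<lambda>s. s"]) (use S in auto)
  next
    fix g h v assume "g \<in> carrier G" "h \<in> carrier G" "v \<in> carrier LK"
    then show "TG (g \<otimes>\<^bsub>G\<^esub> h) v = TG g (TG h v)" by (intro TG_mult) (simp_all add: LK_carrier)
  next
    fix H assume H: "H \<in> \<H>"
    interpret FH: padic_subfield p "fixed_field L H" by (rule padic_subfield_FH [OF sub [OF H]])
    show "vectorspace (Qp p) FH.LK" by (rule FH.vectorspace_LK)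
    show "vectorspace.fin_dim (Qp p) FH.LK" by (rule fin_dim_FH [OF sub [OF H] S])
    show "unit_space_map p L (fixed_field L H) (Nm H) (unit_space_map p (fixed_field L H) L (\<lambda>x. x) w) = rat_to_Qp p (of_nat (card H)) \<odot>\<^bsub>FH.LK\<^esub> w"
      if "w \<in> carrier FH.LK" for w
      unfolding FH.LK_ops by (rule nm_incl [OF sub [OF H]]) (use that FH.LK_carrier in blast)
  qed (assumption | rule sub)+
qed

end

subsection \<open>Number fields\<close>

lemma subfield_type_closed:
  fixes F :: "'a::field_char_0 set"
  assumes "subfield F ring_of_type_algebra"
  shows "0 \<in> F" "1 \<in> F" "\<And>x y. x \<in> F \<Longrightarrow> y \<in> F \<Longrightarrow> x + y \<in> F" "\<And>x y. x \<in> F \<Longrightarrow> y \<in> F \<Longrightarrow> x * y \<in> F"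
    "\<And>x. x \<in> F \<Longrightarrow> - x \<in> F" "\<And>x. x \<in> F \<Longrightarrow> inverse x \<in> F"
proof -
  let ?R = "ring_of_type_algebra :: 'a ring"
  interpret R: field ?R by (rule field_from_type_algebra)
  have ops: "\<zero>\<^bsub>?R\<^esub> = 0" "\<one>\<^bsub>?R\<^esub> = 1" "\<And>x y. x \<oplus>\<^bsub>?R\<^esub> y = x + y" "\<And>x y. x \<otimes>\<^bsub>?R\<^esub> y = x * y" "carrier ?R = UNIV"
    by (simp_all add: ring_of_type_algebra_def)
  note s = subringE [OF subfieldE(1) [OF assms], unfolded ops]
  show "0 \<in> F" "1 \<in> F" by (fact s(2), fact s(3))
  show "\<And>x y. x \<in> F \<Longrightarrow> y \<in> F \<Longrightarrow> x + y \<in> F" "\<And>x y. x \<in> F \<Longrightarrow> y \<in> F \<Longrightarrow> x * y \<in> F" by (fact s(7), fact s(6))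
  fix x assume x: "x \<in> F"
  have "x + (\<ominus>\<^bsub>?R\<^esub> x) = 0" using R.r_neg [of x] by (simp add: ops)
  then have "\<ominus>\<^bsub>?R\<^esub> x = - x" by (simp add: eq_neg_iff_add_eq_0 add.commute)
  then show "- x \<in> F" using s(5) [OF x] by simp
  show "inverse x \<in> F"
  proof (cases "x = 0")
    case False
    then have x': "x \<in> F - {\<zero>\<^bsub>?R\<^esub>}" using x by (simp add: ops)
    have "x * (inv\<^bsub>?R\<^esub> x) = 1" using R.subfield_m_inv(2) [OF assms x'] by (simp add: ops)
    then have "inverse x = inv\<^bsub>?R\<^esub> x" by (rule inverse_unique)
    then show ?thesis using R.subfield_m_inv(1) [OF assms x'] by simp
  qed (use \<open>0 \<in> F\<close> in simp)
qed

text \<open>Finite dimension is built by adjoining one line at a time. Following this induction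
  produces generators with explicit rational coefficients.\<close>

lemma finite_dimension_span:
  fixes E :: "'a::field_char_0 set"
  assumes "ring.finite_dimension ring_of_type_algebra \<rat> E"
  shows "\<exists>B. finite B \<and> B \<subseteq> E \<and> (\<forall>x\<in>E. \<exists>c. x = (\<Sum>b\<in>B. of_rat (c b) * b))"
proof -
  let ?R = "ring_of_type_algebra :: 'a ring"
  interpret R: field ?R by (rule field_from_type_algebra)
  have ops: "\<zero>\<^bsub>?R\<^esub> = 0" "\<And>x y. x \<oplus>\<^bsub>?R\<^esub> y = x + y" "\<And>x y. x \<otimes>\<^bsub>?R\<^esub> y = x * y"
    by (simp_all add: ring_of_type_algebra_def)
  have "0 \<in> E \<and> (\<exists>B. finite B \<and> B \<subseteq> E \<and> (\<forall>x\<in>E. \<exists>c. x = (\<Sum>b\<in>B. of_rat (c b) * b)))" if "R.dimension n \<rat> E" for n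
    using that
  proof (induction n "\<rat> :: 'a set" E rule: R.dimension.induct)
    case zero_dim
    show ?case unfolding ops by (intro conjI exI [of _ "{}"]) auto
  next
    case (Suc_dim v E n)
    then obtain B where B: "0 \<in> E" "finite B" "B \<subseteq> E" "\<forall>x\<in>E. \<exists>c. x = (\<Sum>b\<in>B. of_rat (c b) * b)" by blast
    have mem: "u \<in> R.line_extension \<rat> v E \<longleftrightarrow> (\<exists>k\<in>\<rat>. \<exists>w\<in>E. u = k * v + w)" for u
      unfolding R.line_extension_mem_iff ops ..
    have "w \<in> R.line_extension \<rat> v E" if "w \<in> E" for w
      unfolding mem by (rule bexI [of _ 0]) (use that in auto)
    moreover have "v \<in> R.line_extension \<rat> v E"
      unfolding mem by (rule bexI [of _ 1]) (use B(1) in auto)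
    moreover have "\<exists>c. x = (\<Sum>b\<in>insert v B. of_rat (c b) * b)" if x: "x \<in> R.line_extension \<rat> v E" for x
    proof -
      obtain k w where kw: "k \<in> \<rat>" "w \<in> E" "x = k * v + w" using x unfolding mem by blast
      obtain q where q: "k = of_rat q" using kw(1) by (rule Rats_cases)
      obtain c where c: "w = (\<Sum>b\<in>B. of_rat (c b) * b)" using B(4) kw(2) by blast
      \<comment> \<open>The new vector lies outside the old space, so its coefficient can be set
        without disturbing the others.\<close>
      have vB: "v \<notin> B" using B(3) Suc_dim(2) by auto
      have "(\<Sum>b\<in>B. of_rat ((c(v := q)) b) * b) = (\<Sum>b\<in>B. of_rat (c b) * b)"
        using vB by (intro sum.cong) auto
      then have "x = (\<Sum>b\<in>insert v B. of_rat ((c(v := q)) b) * b)"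
        unfolding sum.insert [OF B(2) vB] kw(3) q c by simp
      then show ?thesis by (intro exI [of _ "c(v := q)"])
    qed
    ultimately show ?case using B by (intro conjI exI [of _ "insert v B"]) auto
  qed
  then show ?thesis using assms by (elim R.finite_dimensionE') blast
qed

lemma number_field_rational_extension:
  assumes "number_field L"
  shows "\<exists>B. rational_extension L B"
proof -
  obtain B where "finite B" "B \<subseteq> L" "\<forall>x\<in>L. \<exists>c. x = (\<Sum>b\<in>B. of_rat (c b) * b)"
    using finite_dimension_span [of L] assms unfolding number_field_def by blast
  moreover have "subfield L ring_of_type_algebra" using assms unfolding number_field_def by simp
  ultimately show ?thesis
    by (intro exI [of _ B] rational_extension.intro) (assumption | rule subfield_type_closed | erule (1) bspec)+
qed

lemma galois_group_iff:
  "\<sigma> \<in> carrier (galois_group K L) \<longleftrightarrow> \<sigma> \<in> Bij L \<and> \<sigma> 1 = 1 \<and>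
    (\<forall>x\<in>L. \<forall>y\<in>L. \<sigma> (x * y) = \<sigma> x * \<sigma> y \<and> \<sigma> (x + y) = \<sigma> x + \<sigma> y) \<and> (\<forall>x\<in>K. \<sigma> x = x)"
proof -
  have "\<sigma> \<in> ring_iso (ring_on L) (ring_on L) \<longleftrightarrow> \<sigma> \<in> L \<rightarrow> L \<and> bij_betw \<sigma> L L \<and> \<sigma> 1 = 1 \<and>
    (\<forall>x\<in>L. \<forall>y\<in>L. \<sigma> (x * y) = \<sigma> x * \<sigma> y \<and> \<sigma> (x + y) = \<sigma> x + \<sigma> y)"
    unfolding ring_iso_def Ring.ring_hom_def by (auto simp: ring_of_type_algebra_def)
  then show ?thesis
    unfolding galois_group_def using Bij_imp_funcset [of \<sigma> L] by (auto simp: Bij_def)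
qed

lemma galois_group_mult:
  assumes "\<sigma> \<in> carrier (galois_group K L)" "\<tau> \<in> carrier (galois_group K L)"
  shows "\<sigma> \<otimes>\<^bsub>galois_group K L\<^esub> \<tau> = compose L \<sigma> \<tau>"
  using assms unfolding galois_group_iff by (simp add: galois_group_def BijGroup_def)

lemma group_galois_group:
  assumes L: "1 \<in> L" "\<And>x y. x \<in> L \<Longrightarrow> y \<in> L \<Longrightarrow> x + y \<in> L" "\<And>x y. x \<in> L \<Longrightarrow> y \<in> L \<Longrightarrow> x * y \<in> L" and K: "K \<subseteq> L"
  shows "group (galois_group K L)"
proof -
  let ?A = "carrier (galois_group K L)"
  interpret BG: Group.group "BijGroup L" by (rule group_BijGroup)
  have eq: "galois_group K L = (BijGroup L)\<lparr>carrier := ?A\<rparr>" unfolding galois_group_def by simp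
  have "subgroup ?A (BijGroup L)"
  proof (rule BG.subgroupI)
    show "?A \<subseteq> carrier (BijGroup L)" unfolding galois_group_iff subset_iff by (simp add: BijGroup_def)
    have "(\<lambda>x\<in>L. x) \<in> ?A"
      unfolding galois_group_iff using id_Bij L K by auto
    then show "?A \<noteq> {}" by blast
  next
    fix f assume f: "f \<in> ?A"
    then have fB: "f \<in> Bij L" unfolding galois_group_iff by simp
    define g where "g = (\<lambda>x\<in>L. inv_into L f x)"
    have inv: "inv\<^bsub>BijGroup L\<^esub> f = g" unfolding g_def by (rule inv_BijGroup [OF fB])
    have bij: "inj_on f L" "f ` L = L" using fB unfolding Bij_def bij_betw_def by auto
    have g: "g x \<in> L" "f (g x) = x" if "x \<in> L" for x
      unfolding g_def using that bij inv_into_into [of x f L] f_inv_into_f [of x f L] by simp_all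
    have uniq: "g x = y" if "y \<in> L" "f y = x" for x y
      unfolding g_def using that bij by auto
    note fh = f [unfolded galois_group_iff]
    have "g 1 = 1" by (rule uniq) (use L fh in simp_all)
    moreover have "g (x * y) = g x * g y" "g (x + y) = g x + g y" if "x \<in> L" "y \<in> L" for x y
      by (rule uniq; use L fh g that in simp)+
    moreover have "g x = x" if "x \<in> K" for x by (rule uniq) (use that K fh in auto)
    moreover have "g \<in> Bij L" unfolding g_def by (rule restrict_inv_into_Bij [OF fB])
    ultimately show "inv\<^bsub>BijGroup L\<^esub> f \<in> ?A" unfolding inv galois_group_iff by blast
  next
    fix f g assume fg: "f \<in> ?A" "g \<in> ?A"
    then have B: "f \<in> Bij L" "g \<in> Bij L" unfolding galois_group_iff by simp_all
    have gL: "g x \<in> L" if "x \<in> L" for x using Bij_imp_funcset [OF B(2)] that by auto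
    have "compose L f g \<in> ?A"
      unfolding galois_group_iff
      using fg [unfolded galois_group_iff] compose_Bij [OF B] L K gL by (auto simp: compose_eq)
    then show "f \<otimes>\<^bsub>BijGroup L\<^esub> g \<in> ?A" using B by (simp add: BijGroup_def)
  qed
  then show ?thesis by (subst eq) (rule subgroup.subgroup_is_group [OF _ BG.is_group])
qed

lemma galois_units_galois_group:
  assumes p: "Factorial_Ring.prime p" and B: "rational_extension L B" and K: "K \<subseteq> L"
  shows "galois_units p L B (galois_group K L)"
proof -
  interpret B: rational_extension L B by fact
  interpret padic_subfield p L
    by (intro padic_subfield.intro padic_prime.intro padic_subfield_axioms.intro p) (assumption | rule B.L)+
  have hom: "field_embedding L \<sigma>" "\<sigma> \<in> extensional L" "\<And>x. x \<in> L \<Longrightarrow> \<sigma> x \<in> L" if "\<sigma> \<in> carrier (galois_group K L)" for \<sigma>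
  proof -
    note s = that [unfolded galois_group_iff]
    show "\<sigma> \<in> extensional L" "\<And>x. x \<in> L \<Longrightarrow> \<sigma> x \<in> L"
      using s Bij_imp_extensional [of \<sigma> L] Bij_imp_funcset [of \<sigma> L] by auto
    show "field_embedding L \<sigma>" by unfold_locales (use s B.L in simp_all)
  qed
  show ?thesis
  proof (intro galois_units.intro galois_units_axioms.intro padic_subfield_axioms B)
    show "group (galois_group K L)" by (rule group_galois_group [OF B.L(2,3,4) K])
    show "finite (carrier (galois_group K L))"
      by (rule finite_subset [OF _ B.finite_homs]) (use hom in auto)
    show "padic_field_hom p L L \<sigma>" if "\<sigma> \<in> carrier (galois_group K L)" for \<sigma>
      using field_embedding.one [OF hom(1) [OF that]] field_embedding.add [OF hom(1) [OF that]]
        field_embedding.mult [OF hom(1) [OF that]] hom(3) [OF that]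
      by (intro padic_field_hom.intro padic_subfield_pair.intro padic_field_hom_axioms.intro padic_subfield_axioms) simp_all
    show "(\<sigma> \<otimes>\<^bsub>galois_group K L\<^esub> \<tau>) x = \<sigma> (\<tau> x)"
      if "\<sigma> \<in> carrier (galois_group K L)" "\<tau> \<in> carrier (galois_group K L)" "x \<in> L" for \<sigma> \<tau> x
      using that by (simp add: galois_group_mult compose_eq)
  qed
qed

theorem theorem5p20:
  fixes K L :: "'a::field_char_0 set"
    and \<H> :: "('a \<Rightarrow> 'a) set set"
    and a :: "('a \<Rightarrow> 'a) set \<Rightarrow> rat"
  assumes "number_field K"
    and "number_field L"
    and "finite_galois_extension K L"
    and "\<And>H. H \<in> \<H> \<Longrightarrow> subgroup H (galois_group K L)"
    and "\<And>g. g \<in> carrier (galois_group K L) \<Longrightarrow>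
           (\<Sum>H\<in>\<H>. of_rat (a H) * induced_character (galois_group K L) H trivial_character g) = 0"
  shows "\<forall>p::nat. Factorial_Ring.prime p \<longrightarrow>
           (\<Sum>H\<in>\<H>. a H * of_nat (leopoldt_defect (fixed_field L H) p)) = 0"
proof (intro allI impI)
  fix p :: nat assume p: "Factorial_Ring.prime p"
  let ?G = "galois_group K L"
  obtain B where B: "rational_extension L B" using number_field_rational_extension [OF assms(2)] by blast
  have "K \<subseteq> L" using assms(3) unfolding finite_galois_extension_def by simp
  interpret galois_units p L B ?G by (rule galois_units_galois_group [OF p B \<open>K \<subseteq> L\<close>])
  \<comment> \<open>A finite group has finitely many subgroups, so the sums in the relation are
    genuine finite sums.\<close>
  have "\<H> \<subseteq> Pow (carrier ?G)" using subgroup.subset [OF assms(4)] by blast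
  then have fin: "finite \<H>" by (rule finite_subset) (simp add: finite_G)
  show "(\<Sum>H\<in>\<H>. a H * of_nat (leopoldt_defect (fixed_field L H) p)) = 0"
  proof (rule brauer_relation_leopoldt [OF fin assms(4)])
    fix g assume g: "g \<in> carrier ?G"
    let ?n = "\<lambda>H. card {x \<in> carrier ?G. inv\<^bsub>?G\<^esub> x \<otimes>\<^bsub>?G\<^esub> g \<otimes>\<^bsub>?G\<^esub> x \<in> H}"
    \<comment> \<open>The induced trivial character at \<open>g\<close> is \<open>?n H\<close>
      divided by \<open>card H\<close>, a rational number. The complex relation therefore descends
      to the rationals by injectivity of \<open>of_rat\<close>.\<close>
    have "(of_rat (\<Sum>H\<in>\<H>. a H / of_nat (card H) * of_nat (?n H)) :: complex)
        = (\<Sum>H\<in>\<H>. of_rat (a H) * induced_character ?G H trivial_character g)"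
      unfolding of_rat_sum induced_character_def by (simp add: of_rat_mult of_rat_divide)
    also have "\<dots> = 0" by (rule assms(5) [OF g])
    finally show "(\<Sum>H\<in>\<H>. a H / of_nat (card H) * of_nat (?n H)) = 0" by simp
  qed
qed

end
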